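(* Let $a\in S^m_{\rho,\delta}$ for some $m<0$ and $0<\delta\le\rho<1$, and let $T_a$ be the associated pseudodifferential operator on $\mathbb{R}^n$. (i) Let $m=-n(1-\rho)$. Then $T_a$ is bounded on $L^p(w)$ for $w\in A_p$ and all $1<p<\infty$. (ii) Let $-n(1-\rho)<m\le-n(1-\rho)/2$. Then $T_a$ is bounded on $L^p(w)$ for $w\in A_{p/r_e}$ and all $r_e<p<\infty$, where $r_e:=-n(1-\rho)/m$. (iii) Let $-n(1-\rho)/2<m<0$. Then $T_a$ is bounded on $L^p(w)$ for $w\in A_{p/2}\cap RH_{(s_e/p)'}$ and all $2<p<s_e$, where $s_e:=\frac{2n(1-\rho)}{n(1-\rho)+2m}$.
   Context: Symbol classes: for $m\in\mathbb{R}$ and $0\le\delta,\rho\le1$, $S^m_{\rho,\delta}$ is the set of all $a\in C^\infty(\mathbb{R}^n\times\mathbb{R}^n)$ such that for all multi-indices $\nu,\sigma\in\mathbb{N}^n$ there is a constant $C_{\nu,\sigma}$ with $|\partial_x^\nu\partial_\xi^\sigma a(x,\xi)|\le C_{\nu,\sigma}(1+|\xi|)^{m-\rho|\sigma|+\delta|\nu|}$ for all $x,\xi$. The pseudodifferential operator is $T_af(x)=\int_{\mathbb{R}^n}e^{ix\cdot\xi}a(x,\xi)\widehat f(\xi)\,d\xi$, initially defined for Schwartz $f$, with $\widehat f$ the Fourier transform of $f$. A weight $w$ is a nonnegative locally integrable function on $\mathbb{R}^n$; $L^p(w)$ is the space with norm $(\int|f|^pw)^{1/p}$. For $1<p<\infty$,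 $p'$ is the conjugate exponent, $1/p+1/p'=1$. For $1<p<\infty$ the classes $A_p$ and $RH_p$ consist of all weights $w$ with, respectively, $$[w]_{A_p}=\sup_B\,\langle w\rangle_B\,\langle w^{1-p'}\rangle_B^{p-1}<\infty,\qquad [w]_{RH_p}=\sup_B\,\langle w\rangle_B^{-1}\Big(\frac1{|B|}\int_Bw^p\Big)^{1/p}<\infty,$$ where the suprema range over all balls $B\subset\mathbb{R}^n$ and $\langle w\rangle_B=|B|^{-1}\int_Bw$. *)

theory Defs
  imports "HOL-Analysis.Analysis"
begin

section \<open>Smooth functions and partial derivatives\<close>

definition partial :: "'a::real_normed_vector \<Rightarrow> ('a \<Rightarrow> 'b::real_normed_vector) \<Rightarrow> 'a \<Rightarrow> 'b"
  where "partial v f = (\<lambda>x. frechet_derivative f (at x) v)"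

primrec Ck :: "nat \<Rightarrow> ('a::euclidean_space \<Rightarrow> 'b::real_normed_vector) \<Rightarrow> bool" where
  "Ck 0 f \<longleftrightarrow> continuous_on UNIV f"
| "Ck (Suc k) f \<longleftrightarrow> f differentiable_on UNIV \<and> (\<forall>b\<in>Basis. Ck k (partial b f))"

definition smooth :: "('a::euclidean_space \<Rightarrow> 'b::real_normed_vector) \<Rightarrow> bool"
  where "smooth f \<longleftrightarrow> (\<forall>k. Ck k f)"

text \<open>Multi-indices are functions \<open>\<nu> :: 'n \<Rightarrow> nat\<close>. The derivative of multi-index \<open>\<nu>\<close> along the
  vectors \<open>e i\<close> applies \<open>partial (e i)\<close> exactly \<open>\<nu> i\<close> times for each \<open>i\<close>. The order, fixed here
  by choosing some list of indices with these multiplicities, is immaterial for smooth functions.\<close>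

definition multi_deriv ::
    "('n::finite \<Rightarrow> 'a::real_normed_vector) \<Rightarrow> ('n \<Rightarrow> nat) \<Rightarrow> ('a \<Rightarrow> 'b::real_normed_vector) \<Rightarrow> 'a \<Rightarrow> 'b"
  where "multi_deriv e \<nu> f = foldr (\<lambda>i. partial (e i)) (SOME is. \<forall>i. count_list is i = \<nu> i) f"

definition multi_order :: "('n::finite \<Rightarrow> nat) \<Rightarrow> nat"
  where "multi_order \<nu> = (\<Sum>i\<in>UNIV. \<nu> i)"

definition D_x :: "('n::finite \<Rightarrow> nat) \<Rightarrow> ((real^'n) \<times> (real^'n) \<Rightarrow> complex) \<Rightarrow> (real^'n) \<times> (real^'n) \<Rightarrow> complex"
  where "D_x = multi_deriv (\<lambda>i. (axis i 1, 0))"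

definition D_xi :: "('n::finite \<Rightarrow> nat) \<Rightarrow> ((real^'n) \<times> (real^'n) \<Rightarrow> complex) \<Rightarrow> (real^'n) \<times> (real^'n) \<Rightarrow> complex"
  where "D_xi = multi_deriv (\<lambda>i. (0, axis i 1))"

section \<open>Symbols, Schwartz functions and pseudodifferential operators\<close>

definition symbol_class :: "real \<Rightarrow> real \<Rightarrow> real \<Rightarrow> ((real^'n::finite) \<times> (real^'n) \<Rightarrow> complex) set"
  where "symbol_class m \<rho> \<delta> =
    {a. smooth a \<and>
        (\<forall>\<nu> \<sigma>. \<exists>C. \<forall>x \<xi>. norm (D_x \<nu> (D_xi \<sigma> a) (x, \<xi>)) \<le>
           C * (1 + norm \<xi>) powr (m - \<rho> * real (multi_order \<sigma>) + \<delta> * real (multi_order \<nu>)))}"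

definition schwartz :: "(real^'n::finite \<Rightarrow> complex) set"
  where "schwartz =
    {f. smooth f \<and>
        (\<forall>\<alpha> \<beta>. bounded (range (\<lambda>x. (\<Prod>i\<in>UNIV. (x $ i) ^ \<alpha> i) *\<^sub>R multi_deriv (\<lambda>i. axis i 1) \<beta> f x)))}"

text \<open>The factor \<open>(2\<pi>)\<^sup>-\<^sup>n\<close> is the normalization for which the operator with symbol 1 is the identity.\<close>

definition fourier :: "(real^'n::finite \<Rightarrow> complex) \<Rightarrow> real^'n \<Rightarrow> complex"
  where "fourier f \<xi> =
    of_real (1 / (2 * pi) ^ CARD('n)) * (LINT x|lborel. exp (- \<i> * of_real (x \<bullet> \<xi>)) * f x)"

definition pseudo_diff ::
    "((real^'n::finite) \<times> (real^'n) \<Rightarrow> complex) \<Rightarrow> (real^'n \<Rightarrow> complex) \<Rightarrow> real^'n \<Rightarrow> complex"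
  where "pseudo_diff a f x =
    (LINT \<xi>|lborel. exp (\<i> * of_real (x \<bullet> \<xi>)) * a (x, \<xi>) * fourier f \<xi>)"

section \<open>Weights\<close>

definition weight :: "(real^'n::finite \<Rightarrow> real) \<Rightarrow> bool"
  where "weight w \<longleftrightarrow> (\<forall>x. 0 \<le> w x) \<and> (\<forall>K. compact K \<longrightarrow> w absolutely_integrable_on K)"

text \<open>Powers with real exponent on \<open>[0, \<infinity>]\<close>. Unlike for \<open>powr\<close>, a negative power of 0 is \<open>\<infinity>\<close>, so
  that e.g. the Muckenhoupt constant detects zeros of the weight.\<close>

definition epowr :: "ennreal \<Rightarrow> real \<Rightarrow> ennreal"
  where "epowr x s =
    (if s = 0 then 1
     else if x = 0 then (if s > 0 then 0 else \<infinity>)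
     else if x = \<infinity> then (if s > 0 then \<infinity> else 0)
     else ennreal (enn2real x powr s))"

definition ball_avg :: "(real^'n::finite) set \<Rightarrow> (real^'n \<Rightarrow> ennreal) \<Rightarrow> ennreal"
  where "ball_avg B g = (\<integral>\<^sup>+x\<in>B. g x \<partial>lebesgue) / emeasure lebesgue B"

definition balls :: "(real^'n::finite) set set"
  where "balls = {ball c r | c r. r > 0}"

definition conj_exp :: "real \<Rightarrow> real"
  where "conj_exp p = p / (p - 1)"

text \<open>Arithmetic in the two characteristics is that of \<open>[0, \<infinity>]\<close>, with \<open>0 * \<infinity> = 0\<close>.\<close>

definition Ap_const :: "real \<Rightarrow> (real^'n::finite \<Rightarrow> real) \<Rightarrow> ennreal"
  where "Ap_const p w =
    (SUP B\<in>balls. ball_avg B (\<lambda>x. ennreal (w x)) *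
       epowr (ball_avg B (\<lambda>x. epowr (ennreal (w x)) (1 - conj_exp p))) (p - 1))"

definition RHp_const :: "real \<Rightarrow> (real^'n::finite \<Rightarrow> real) \<Rightarrow> ennreal"
  where "RHp_const p w =
    (SUP B\<in>balls. inverse (ball_avg B (\<lambda>x. ennreal (w x))) *
       epowr (ball_avg B (\<lambda>x. epowr (ennreal (w x)) p)) (1 / p))"

definition Ap :: "real \<Rightarrow> (real^'n::finite \<Rightarrow> real) set"
  where "Ap p = {w. weight w \<and> Ap_const p w < \<infinity>}"

definition RHp :: "real \<Rightarrow> (real^'n::finite \<Rightarrow> real) set"
  where "RHp p = {w. weight w \<and> RHp_const p w < \<infinity>}"

section \<open>Boundedness on weighted Lebesgue spaces\<close>

definition Lp_norm :: "real \<Rightarrow> (real^'n::finite \<Rightarrow> real) \<Rightarrow> (real^'n \<Rightarrow> complex) \<Rightarrow> ennreal"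
  where "Lp_norm p w f = epowr (\<integral>\<^sup>+x. ennreal (norm (f x) powr p * w x) \<partial>lebesgue) (1 / p)"

definition Lp_space :: "real \<Rightarrow> (real^'n::finite \<Rightarrow> real) \<Rightarrow> (real^'n \<Rightarrow> complex) set"
  where "Lp_space p w = {f \<in> borel_measurable lebesgue. Lp_norm p w f < \<infinity>}"

text \<open>An operator \<open>T\<close>, given on Schwartz functions, is bounded on \<open>L\<^sup>p(w)\<close> if it agrees on Schwartz
  functions with a bounded linear operator \<open>S\<close> on \<open>L\<^sup>p(w)\<close>. \<open>S\<close> acts on representatives, and
  linearity and agreement are up to equality almost everywhere for the measure \<open>w dx\<close>; that \<open>S\<close>
  respects this equality follows from linearity and the norm bound. In particular
  \<open>Lp_norm p w (T f) \<le> C * Lp_norm p w f\<close> for all Schwartz \<open>f\<close> with finite norm.\<close>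

definition bounded_on_Lp ::
    "real \<Rightarrow> (real^'n::finite \<Rightarrow> real) \<Rightarrow> ((real^'n \<Rightarrow> complex) \<Rightarrow> real^'n \<Rightarrow> complex) \<Rightarrow> bool"
  where "bounded_on_Lp p w T \<longleftrightarrow>
    (\<exists>S. (\<exists>C::real. \<forall>f\<in>Lp_space p w. S f \<in> Lp_space p w \<and> Lp_norm p w (S f) \<le> ennreal C * Lp_norm p w f) \<and>
         (\<forall>f\<in>Lp_space p w. \<forall>g\<in>Lp_space p w. \<forall>c d.
            AE x in density lebesgue (\<lambda>x. ennreal (w x)). S (\<lambda>y. c * f y + d * g y) x = c * S f x + d * S g x) \<and>
         (\<forall>f\<in>schwartz \<inter> Lp_space p w.
            AE x in density lebesgue (\<lambda>x. ennreal (w x)). S f x = T f x))"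

end

(*
  Split a = sum_j b_j dyadically in frequency. The kernel of the piece b_j lives at scale 2^(-j rho) and
  its L^2 norm is given by Plancherel's theorem, so Hoelder's inequality with exponent r in (1, 2] bounds
  the piece pointwise by r-averages of f over cubes, with constant 2^(j (m + n (1 - rho) / r)). Averages
  over cubes are bounded on L^(p/r)(w) for w in A_(p/r), uniformly in the scale, so that no maximal
  function is needed. Since A_(p/r_e) is open in the index, r can be taken slightly larger than r_e; this
  gives geometric decay in j, and hence (i) and (ii) if r_e < 2.

  If r_e = 2, and in (iii), take r = 2. The piece has norm 2^(j m) on L^2 (Calderon--Vaillancourt at a
  single scale), and norm 2^(j (m + n (1 - rho) / 2)) on L^q(w^s), where w^s is in A_(q/2) for some s a little
  larger than sigma = (s_e/p)' by the reverse Hoelder inequality (sigma = 1 if r_e = 2). Interpolation with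
  change of measure yields L^p(w) with an exponent that would be 0 for s = sigma and is therefore negative.
*)
theory Submission
  imports Defs "HOL-Probability.Probability"
begin

text \<open>Two scales govern the piece at frequency \<open>R = 2 ^ j\<close>. Its symbol lives at
  frequencies up to about \<open>R\<close>, and with \<open>l = R powr \<rho>\<close> each
  \<xi>-derivative gains \<open>1 / l\<close>, while each x-derivative costs at most
  \<open>l\<close> because \<delta> \<le> \<rho>. Kernel decay is measured by the polynomial
  \<open>growth\<close>, whose pure even powers correspond to \<xi>-derivatives in one variable at a
  time, so the estimates involve no mixed \<xi>-derivatives.

  The exponent r = 2 is a barrier: the L^(r') norm of a kernel is obtained from its L^2 and sup
  norms, which forces r' \<ge> 2. Below the barrier the critical loss is recovered by raising r. At
  the barrier and beyond, m + n (1 - \<rho>) / 2 \<ge> 0, the weighted bound alone does not decay,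
  and the negative order has to come from the unweighted L^2 bound.

  A weight in A_p either vanishes almost everywhere, a case treated separately, or has an everywhere
  positive Borel version, with which all estimates are made. The operator on L^p(w) is the series of
  the pieces. Each piece is a kernel integral that converges absolutely at almost every point, and
  on Schwartz functions the series converges pointwise to the symbol integral.\<close>

abbreviation L2sq :: "('a::euclidean_space \<Rightarrow> 'b::real_normed_vector) \<Rightarrow> ennreal"
  where "L2sq f \<equiv> \<integral>\<^sup>+x. ennreal ((norm (f x))\<^sup>2) \<partial>lborel"

abbreviation Lp_int :: "real \<Rightarrow> ('a::euclidean_space \<Rightarrow> real) \<Rightarrow> ('a \<Rightarrow> 'b::real_normed_vector) \<Rightarrow> ennreal"
  where "Lp_int p w f \<equiv> \<integral>\<^sup>+x. ennreal (norm (f x) powr p * w x) \<partial>lborel"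

abbreviation eLp_int :: "real \<Rightarrow> ('a::euclidean_space \<Rightarrow> real) \<Rightarrow> ('a \<Rightarrow> ennreal) \<Rightarrow> ennreal"
  where "eLp_int p w f \<equiv> \<integral>\<^sup>+x. epowr (f x) p * ennreal (w x) \<partial>lborel"

abbreviation mass :: "('a::euclidean_space \<Rightarrow> real) \<Rightarrow> 'a set \<Rightarrow> ennreal"
  where "mass w S \<equiv> \<integral>\<^sup>+x\<in>S. ennreal (w x) \<partial>lborel"

section \<open>Powers and integrals on the extended half-line\<close>

lemma epowr_ennreal: "0 \<le> x \<Longrightarrow> 0 < s \<Longrightarrow> epowr (ennreal x) s = ennreal (x powr s)"
  by (auto simp: epowr_def ennreal_eq_0_iff)

lemma epowr_0 [simp]: "0 < s \<Longrightarrow> epowr 0 s = 0"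
  by (simp add: epowr_def)

lemma epowr_top [simp]: "0 < s \<Longrightarrow> epowr top s = top"
  by (simp add: epowr_def)

lemma epowr_1 [simp]: "epowr x 1 = x"
  by (cases x) (auto simp: epowr_def ennreal_eq_0_iff)

lemma epowr_mono: assumes "x \<le> y" "0 < s" shows "epowr x s \<le> epowr y s"
proof (cases y)
  case (real b)
  then obtain a where "x = ennreal a" "0 \<le> a" "a \<le> b"
    using assms(1) by (cases x) (auto simp: top_unique)
  then show ?thesis using real assms(2) by (auto simp: epowr_ennreal intro!: ennreal_leI powr_mono2)
qed (use assms in auto)

text \<open>For a positive exponent the zero and infinite cases agree on both sides under the
  convention that 0 times infinity is 0, so the rule needs no condition on the factors.\<close>

lemma epowr_mult: assumes "0 < s" shows "epowr (x * y) s = epowr x s * epowr y s"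
proof (cases "x = 0 \<or> y = 0")
  case False
  show ?thesis
  proof (cases x)
    case (real a)
    show ?thesis
    proof (cases y)
      case (real b)
      then show ?thesis using assms \<open>x = ennreal a\<close> \<open>0 \<le> a\<close>
        by (simp add: epowr_ennreal ennreal_mult[symmetric] powr_mult)
    next
      case top
      with False assms \<open>x = ennreal a\<close> \<open>0 \<le> a\<close> show ?thesis
        by (simp add: epowr_ennreal ennreal_mult_top)
    qed
  next
    case top
    have "epowr y s \<noteq> 0" using False assms by (cases y) (auto simp: epowr_def ennreal_eq_0_iff)
    with top False assms show ?thesis
      by (simp add: ennreal_top_mult)
  qed
qed (use assms in auto)

lemma epowr_epowr: assumes "0 < s" "0 < t" shows "epowr (epowr x s) t = epowr x (s * t)"
proof (cases x)
  case (real a)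
  then show ?thesis using assms by (simp add: epowr_ennreal powr_powr)
next
  case top
  then show ?thesis using assms by (simp add: epowr_def)
qed

lemma epowr_eq_0_iff: "0 < s \<Longrightarrow> epowr x s = 0 \<longleftrightarrow> x = 0"
  by (cases x) (auto simp: epowr_def ennreal_eq_0_iff)

lemma epowr_less_top_iff: "0 < s \<Longrightarrow> epowr x s < \<infinity> \<longleftrightarrow> x < \<infinity>"
  by (cases x) (auto simp: epowr_def)

lemma epowr_measurable [measurable]: "(\<lambda>x. epowr x s) \<in> borel_measurable borel"
  unfolding epowr_def by measurable

lemma Young_ennreal:
  assumes "1 < p" "1 / p + 1 / q = 1"
  shows "x * y \<le> ennreal (1/p) * epowr x p + ennreal (1/q) * epowr y q"
proof -
  have q: "1 < q"
  proof -
    have "1 / q = 1 - 1/p" using assms(2) by simp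
    moreover have "0 < 1 - 1/p" "1 - 1/p < 1" using assms(1) by auto
    ultimately have "0 < 1/q" "1/q < 1" by auto
    then show ?thesis by (simp add: divide_less_eq split: if_splits)
  qed
  show ?thesis
  proof (cases "x = 0 \<or> y = 0")
    case False
    show ?thesis
    proof (cases x)
      case (real a)
      show ?thesis
      proof (cases y)
        case (real b)
        have "a * b \<le> a powr p / p + b powr q / q"
          using assms q \<open>0 \<le> a\<close> real by (intro Youngs_inequality) auto
        then show ?thesis using assms(1) q \<open>x = ennreal a\<close> \<open>0 \<le> a\<close> real
          by (simp add: epowr_ennreal ennreal_mult[symmetric] ennreal_plus[symmetric] del: ennreal_plus)
      qed (use q in \<open>auto simp: ennreal_mult_top epowr_def\<close>)
    qed (use assms in \<open>auto simp: ennreal_mult_top epowr_def\<close>)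
  qed auto
qed

text \<open>After division by their norms both factors are normalised, and integrating Young's
  inequality gives 1/p + 1/q = 1. Norms equal to 0 or infinity are split off beforehand, since they
  cannot be divided out.\<close>

lemma nn_integral_Holder:
  assumes p: "1 < p" and pq: "1 / p + 1 / q = 1"
    and [measurable]: "f \<in> borel_measurable M" "g \<in> borel_measurable M"
  shows "(\<integral>\<^sup>+x. f x * g x \<partial>M) \<le> epowr (\<integral>\<^sup>+x. epowr (f x) p \<partial>M) (1/p) * epowr (\<integral>\<^sup>+x. epowr (g x) q \<partial>M) (1/q)"
proof -
  have q: "1 < q"
  proof -
    have "1 / q = 1 - 1/p" using pq by simp
    moreover have "0 < 1 - 1/p" "1 - 1/p < 1" using p by auto
    ultimately have "0 < 1/q" "1/q < 1" by auto
    then show ?thesis by (simp add: divide_less_eq split: if_splits)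
  qed
  define F G where "F = (\<integral>\<^sup>+x. epowr (f x) p \<partial>M)" and "G = (\<integral>\<^sup>+x. epowr (g x) q \<partial>M)"
  consider "F = 0 \<or> G = 0" | "F \<noteq> 0" "G \<noteq> 0" "F = \<infinity> \<or> G = \<infinity>" | "F \<noteq> 0" "G \<noteq> 0" "F \<noteq> \<infinity>" "G \<noteq> \<infinity>" by blast
  then show ?thesis
  proof cases
    case 1
    have "AE x in M. f x * g x = 0"
    proof (cases "F = 0")
      case True
      then have "AE x in M. epowr (f x) p = 0" unfolding F_def by (subst (asm) nn_integral_0_iff_AE) auto
      then show ?thesis using p by (auto simp: epowr_eq_0_iff)
    next
      case False
      with 1 have "AE x in M. epowr (g x) q = 0" unfolding G_def by (subst (asm) nn_integral_0_iff_AE) auto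
      then show ?thesis using q by (auto simp: epowr_eq_0_iff)
    qed
    then have "(\<integral>\<^sup>+x. f x * g x \<partial>M) = 0" by (simp add: nn_integral_0_iff_AE)
    then show ?thesis by simp
  next
    case 2
    then have "epowr F (1/p) * epowr G (1/q) = \<infinity>"
      using p q by (auto simp: ennreal_mult_top ennreal_top_mult epowr_eq_0_iff)
    then show ?thesis unfolding F_def G_def by simp
  next
    case 3
    then obtain a b where ab: "F = ennreal a" "G = ennreal b" "0 < a" "0 < b"
      by (cases F; cases G) (auto simp: less_le)
    define c d where "c = a powr (1/p)" and "d = b powr (1/q)"
    have cd: "0 < c" "0 < d" using ab by (auto simp: c_def d_def)
    have "(\<integral>\<^sup>+x. (ennreal (1/c) * f x) * (ennreal (1/d) * g x) \<partial>M)
       \<le> (\<integral>\<^sup>+x. ennreal (1/p) * epowr (ennreal (1/c) * f x) p + ennreal (1/q) * epowr (ennreal (1/d) * g x) q \<partial>M)"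
      by (intro nn_integral_mono Young_ennreal p pq)
    also have "\<dots> = ennreal (1/p) * ennreal ((1/c) powr p) * F + ennreal (1/q) * ennreal ((1/d) powr q) * G"
      using p q cd unfolding F_def G_def
      by (simp add: epowr_mult epowr_ennreal nn_integral_add nn_integral_cmult mult.assoc)
    also have "\<dots> = 1"
    proof -
      have "(1/c) powr p = 1 / a" "(1/d) powr q = 1 / b"
        using p q ab by (simp_all add: c_def d_def powr_divide powr_powr)
      then show ?thesis using ab p q pq
        by (simp add: ennreal_mult[symmetric] ennreal_plus[symmetric] del: ennreal_plus)
    qed
    finally have *: "(\<integral>\<^sup>+x. (ennreal (1/c) * f x) * (ennreal (1/d) * g x) \<partial>M) \<le> 1" .
    have "(\<integral>\<^sup>+x. f x * g x \<partial>M) = (\<integral>\<^sup>+x. ennreal (c * d) * ((ennreal (1/c) * f x) * (ennreal (1/d) * g x)) \<partial>M)"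
    proof (intro nn_integral_cong)
      fix x
      have "ennreal (c*d) * ((ennreal (1/c) * f x) * (ennreal (1/d) * g x)) = ennreal (c*d) * ennreal (1/c) * ennreal (1/d) * (f x * g x)"
        by (simp add: ac_simps)
      also have "ennreal (c*d) * ennreal (1/c) * ennreal (1/d) = 1"
        using cd by (simp add: ennreal_mult[symmetric])
      finally show "f x * g x = ennreal (c*d) * ((ennreal (1/c) * f x) * (ennreal (1/d) * g x))" by simp
    qed
    also have "\<dots> = ennreal (c * d) * (\<integral>\<^sup>+x. (ennreal (1/c) * f x) * (ennreal (1/d) * g x) \<partial>M)"
      by (intro nn_integral_cmult) auto
    also have "\<dots> \<le> ennreal (c * d) * 1" by (intro mult_left_mono *) auto
    also have "\<dots> = epowr F (1/p) * epowr G (1/q)"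
      using ab p q cd by (simp add: epowr_ennreal c_def d_def ennreal_mult)
    finally show ?thesis unfolding F_def G_def .
  qed
qed

text \<open>The p-th power form of Hoelder's inequality puts the exponent p - 1 on the dual factor,
  exactly as in the Muckenhoupt characteristic.\<close>

lemma nn_integral_Holder_powr:
  assumes p: "1 < p" and [measurable]: "f \<in> borel_measurable M" "g \<in> borel_measurable M"
  shows "epowr (\<integral>\<^sup>+x. f x * g x \<partial>M) p
    \<le> (\<integral>\<^sup>+x. epowr (f x) p \<partial>M) * epowr (\<integral>\<^sup>+x. epowr (g x) (p / (p - 1)) \<partial>M) (p - 1)"
proof -
  define q where "q = p / (p - 1)"
  have q: "1/p + 1/q = 1" "0 < q" using p by (auto simp: q_def divide_simps)
  have "epowr (\<integral>\<^sup>+x. f x * g x \<partial>M) p \<le> epowr (epowr (\<integral>\<^sup>+x. epowr (f x) p \<partial>M) (1/p) * epowr (\<integral>\<^sup>+x. epowr (g x) q \<partial>M) (1/q)) p"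
    using p q by (intro epowr_mono nn_integral_Holder) auto
  also have "\<dots> = epowr (\<integral>\<^sup>+x. epowr (f x) p \<partial>M) (1/p*p) * epowr (\<integral>\<^sup>+x. epowr (g x) q \<partial>M) (1/q*p)"
    using p q by (simp add: epowr_mult epowr_epowr)
  also have "1/p*p = 1" using p by simp
  also have "1/q*p = p - 1" using p by (simp add: q_def)
  finally show ?thesis by (simp add: q_def)
qed

text \<open>Jensen's inequality for a finite measure on the naturals, obtained from Hoelder by
  splitting the weight \<open>c k\<close> into its powers 1/p and (p - 1)/p. It replaces Minkowski's
  inequality wherever a series is summed in L^p.\<close>

lemma epowr_suminf_le:
  fixes c :: "nat \<Rightarrow> real" and y :: "nat \<Rightarrow> ennreal"
  assumes p: "1 < p" and c: "\<And>k. 0 < c k" "summable c"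
  shows "epowr (\<Sum>k. ennreal (c k) * y k) p \<le> ennreal ((\<Sum>k. c k) powr (p - 1)) * (\<Sum>k. ennreal (c k) * epowr (y k) p)"
proof -
  define q where "q = p / (p - 1)"
  have q: "0 < q" using p by (simp add: q_def)
  have "ennreal (c k) = ennreal (c k powr (1/p)) * ennreal (c k powr ((p-1)/p))" for k
  proof -
    have "1/p + (p-1)/p = 1" using p by (simp add: field_simps)
    then show ?thesis using c(1)[of k] by (simp add: ennreal_mult[symmetric] powr_add[symmetric])
  qed
  then have "(\<Sum>k. ennreal (c k) * y k) = (\<Sum>k. (ennreal (c k powr (1/p)) * y k) * ennreal (c k powr ((p-1)/p)))"
    by (metis (no_types, lifting) mult.assoc mult.commute)
  also have "\<dots> = (\<integral>\<^sup>+k. (ennreal (c k powr (1/p)) * y k) * ennreal (c k powr ((p-1)/p)) \<partial>count_space UNIV)"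
    by (simp add: nn_integral_count_space_nat)
  finally have "epowr (\<Sum>k. ennreal (c k) * y k) p \<le>
     (\<integral>\<^sup>+k. epowr (ennreal (c k powr (1/p)) * y k) p \<partial>count_space UNIV) *
     epowr (\<integral>\<^sup>+k. epowr (ennreal (c k powr ((p-1)/p))) (p/(p-1)) \<partial>count_space UNIV) (p - 1)"
    using nn_integral_Holder_powr[OF p, of "\<lambda>k. ennreal (c k powr (1/p)) * y k" "count_space UNIV" "\<lambda>k. ennreal (c k powr ((p-1)/p))"]
    by simp
  also have "(\<integral>\<^sup>+k. epowr (ennreal (c k powr (1/p)) * y k) p \<partial>count_space UNIV) = (\<Sum>k. ennreal (c k) * epowr (y k) p)"
    using p c(1) by (simp add: nn_integral_count_space_nat epowr_mult epowr_ennreal powr_powr less_imp_le)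
  also have "(\<integral>\<^sup>+k. epowr (ennreal (c k powr ((p-1)/p))) (p/(p-1)) \<partial>count_space UNIV) = ennreal (\<Sum>k. c k)"
    using p c by (simp add: nn_integral_count_space_nat epowr_ennreal powr_powr less_imp_le suminf_ennreal2)
  also have "epowr (ennreal (\<Sum>k. c k)) (p - 1) = ennreal ((\<Sum>k. c k) powr (p - 1))"
    using p c by (intro epowr_ennreal suminf_nonneg) (auto simp: less_imp_le)
  finally show ?thesis by (simp add: mult.commute)
qed

lemma nn_integral_lborel_affine:
  fixes f :: "'a::euclidean_space \<Rightarrow> ennreal"
  assumes [measurable]: "f \<in> borel_measurable borel" and c: "c \<noteq> 0"
  shows "(\<integral>\<^sup>+x. f x \<partial>lborel) = ennreal (\<bar>c\<bar> ^ DIM('a)) * (\<integral>\<^sup>+x. f (t + c *\<^sub>R x) \<partial>lborel)"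
  by (subst lborel_affine[OF c, of t])
    (simp add: nn_integral_density nn_integral_distr nn_integral_cmult)

lemma nn_integral_lborel_translate:
  fixes f :: "'a::euclidean_space \<Rightarrow> ennreal"
  assumes [measurable]: "f \<in> borel_measurable borel"
  shows "(\<integral>\<^sup>+x. f (t + x) \<partial>lborel) = (\<integral>\<^sup>+x. f x \<partial>lborel)"
  using nn_integral_lborel_affine[OF assms, of 1 t] by simp

lemma nn_integral_lborel_reflect:
  fixes f :: "'a::euclidean_space \<Rightarrow> ennreal"
  assumes [measurable]: "f \<in> borel_measurable borel"
  shows "(\<integral>\<^sup>+x. f (t - x) \<partial>lborel) = (\<integral>\<^sup>+x. f x \<partial>lborel)"
  using nn_integral_lborel_affine[OF assms, of "-1" t] by simp

section \<open>Cubes and the polynomial decay function\<close>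

definition cube :: "real^'n::finite \<Rightarrow> real \<Rightarrow> (real^'n) set"
  where "cube x t = {y. \<forall>i. \<bar>y $ i - x $ i\<bar> \<le> t}"

lemma cube_eq_cbox: "cube x t = cbox (x - (\<chi> i. t)) (x + (\<chi> i. t))"
  by (auto simp: cube_def mem_box_cart abs_le_iff algebra_simps)

lemma cube_measurable [measurable]: "cube x t \<in> sets borel"
  by (simp add: cube_eq_cbox)

lemma compact_cube: "compact (cube x t)"
  by (simp add: cube_eq_cbox)

lemma emeasure_cube:
  fixes x :: "real^'n::finite"
  assumes "0 \<le> t" shows "emeasure lborel (cube x t) = ennreal ((2 * t) ^ CARD('n))"
proof -
  have *: "(x + (\<chi> i. t) - (x - (\<chi> i. t))) \<bullet> b = 2 * t" if "b \<in> Basis" for b :: "real^'n"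
    using that by (auto simp: Basis_vec_def inner_axis)
  have le: "(x - (\<chi> i. t)) \<bullet> b \<le> (x + (\<chi> i. t)) \<bullet> b" if "b \<in> Basis" for b :: "real^'n"
    using that assms by (auto simp: Basis_vec_def inner_axis)
  show ?thesis
    unfolding cube_eq_cbox
    by (subst emeasure_lborel_cbox, erule le) (subst prod.cong[OF refl *], assumption, simp)
qed

lemma mem_cube_commute: "y \<in> cube x t \<longleftrightarrow> x \<in> cube y t"
  by (auto simp: cube_def abs_minus_commute)

lemma mem_cube_scale: "0 < l \<Longrightarrow> l *\<^sub>R (x - y) \<in> cube 0 t \<longleftrightarrow> y \<in> cube x (t / l)"
  by (simp add: cube_def abs_mult right_diff_distrib[symmetric] pos_le_divide_eq abs_minus_commute mult.commute)

lemma cube_mono: "s \<le> t \<Longrightarrow> cube x s \<subseteq> cube x t"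
  unfolding cube_def by (auto intro: order_trans)

lemma cube_subset_add: "y \<in> cube x s \<Longrightarrow> cube y t \<subseteq> cube x (s + t)"
  unfolding cube_def by (auto simp: abs_le_iff) (smt (verit))+

text \<open>The exponent 2 n is even, so this is a positive polynomial, and it exceeds n, so the
  reciprocal is integrable. Multiplying a kernel by it amounts to applying to the symbol derivatives
  of order 2 n in single variables.\<close>

definition growth :: "real^'n::finite \<Rightarrow> real"
  where "growth v = 1 + (\<Sum>i\<in>UNIV. (v $ i) ^ (2 * CARD('n)))"

lemma growth_ge_1: "1 \<le> growth v"
  unfolding growth_def by (simp add: sum_nonneg power_mult)

lemma growth_pos: "0 < growth v"
  using growth_ge_1[of v] by linarith

lemma growth_ge_coord: "(v $ i) ^ (2 * CARD('n)) \<le> growth (v :: real^'n::finite)"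
proof -
  have "(v $ i) ^ (2 * CARD('n)) \<le> (\<Sum>i\<in>UNIV. (v $ i) ^ (2 * CARD('n)))"
    by (intro member_le_sum) (auto simp: power_mult)
  then show ?thesis by (simp add: growth_def)
qed

lemma growth_minus [simp]: "growth (- v) = growth v"
  by (simp add: growth_def power_mult)

lemma continuous_growth [continuous_intros]: "continuous_on S f \<Longrightarrow> continuous_on S (\<lambda>x. growth (f x))"
  unfolding growth_def by (intro continuous_intros)

lemma growth_measurable [measurable]: "growth \<in> borel_measurable borel"
  by (intro borel_measurable_continuous_onI continuous_intros)

text \<open>The value 4^(-n (k - 1)) is the bound for \<open>1 / growth\<close> outside the cube of
  half side 2^(k - 1), where some coordinate has 2 n-th power at least 4^(n (k - 1)). The type
  argument only carries the dimension.\<close>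

definition growth_coeff :: "'n::finite itself \<Rightarrow> nat \<Rightarrow> real"
  where "growth_coeff _ k = 4 ^ CARD('n) * (1 / 4 ^ CARD('n)) ^ k"

text \<open>The least k whose cube contains v works: v lies outside the preceding cube, so a single
  large coordinate already makes \<open>growth\<close> large. For k = 0 the trivial bound by 1
  suffices.\<close>

lemma inverse_growth_le_ex:
  fixes v :: "real^'n::finite"
  shows "\<exists>k. v \<in> cube 0 (2 ^ k) \<and> 1 / growth v \<le> growth_coeff TYPE('n) k"
proof -
  define n where "n = CARD('n)"
  have ex: "\<exists>k. v \<in> cube 0 (2 ^ k)"
  proof -
    obtain k :: nat where "norm v \<le> 2 ^ k" using real_arch_pow[of 2 "norm v"] by (auto intro: less_imp_le)
    then have "v \<in> cube 0 (2 ^ k)"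
      unfolding cube_def using component_le_norm_cart[of v] by (auto intro: order_trans)
    then show ?thesis ..
  qed
  define k where "k = (LEAST k. v \<in> cube 0 (2 ^ k))"
  have k: "v \<in> cube 0 (2 ^ k)" unfolding k_def using ex by (rule LeastI_ex)
  show ?thesis
  proof (cases k)
    case 0
    have "1 / growth v \<le> 1" using growth_ge_1[of v] by simp
    also have "\<dots> \<le> growth_coeff TYPE('n) 0" by (simp add: growth_coeff_def)
    finally show ?thesis using k 0 by (intro exI[of _ 0]) simp
  next
    case (Suc j)
    then have "v \<notin> cube 0 (2 ^ j)" unfolding k_def using not_less_Least[of j "\<lambda>k. v \<in> cube 0 (2 ^ k)"] by auto
    then obtain i where i: "2 ^ j < \<bar>v $ i\<bar>" by (auto simp: cube_def not_le)
    have "(2 ^ j) ^ (2 * n) \<le> \<bar>v $ i\<bar> ^ (2 * n)" using i by (intro power_mono) auto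
    also have "\<dots> \<le> growth v" using growth_ge_coord[of v i] by (simp add: n_def power_even_abs)
    finally have "1 / growth v \<le> 1 / (2 ^ j) ^ (2 * n)" by (intro divide_left_mono) (auto simp: growth_pos)
    also have "\<dots> = growth_coeff TYPE('n) k"
      by (simp add: growth_coeff_def Suc n_def[symmetric] power_mult[symmetric] power_divide[symmetric] flip: power_mult_distrib)
        (simp add: power_mult power_divide mult.commute[of j])
    finally show ?thesis using k by auto
  qed
qed

lemma growth_coeff_pos: "0 < growth_coeff TYPE('n::finite) k"
  by (simp add: growth_coeff_def)

text \<open>This majorant by a positive combination of cube indicators reduces averages against
  \<open>1 / growth\<close> to plain averages over cubes.\<close>

lemma inverse_growth_le:
  fixes v :: "real^'n::finite"
  shows "ennreal (1 / growth v) \<le> (\<Sum>k. ennreal (growth_coeff TYPE('n) k) * indicator (cube 0 (2 ^ k)) v)"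
proof -
  obtain k where k: "v \<in> cube 0 (2 ^ k)" "1 / growth v \<le> growth_coeff TYPE('n) k"
    using inverse_growth_le_ex by blast
  have "ennreal (1 / growth v) \<le> (\<Sum>k\<in>{k}. ennreal (growth_coeff TYPE('n) k) * indicator (cube 0 (2 ^ k)) v)"
    using k by (simp add: ennreal_leI del: sum_mult_indicator)
  also have "\<dots> \<le> (\<Sum>k. ennreal (growth_coeff TYPE('n) k) * indicator (cube 0 (2 ^ k)) v)"
    by (intro sum_le_suminf) auto
  finally show ?thesis .
qed

text \<open>Volumes growing like 2^(n k) against coefficients decaying like 4^(-n k) leave a
  geometric sequence of ratio 2^(-n).\<close>

lemma growth_coeff_volume:
  "growth_coeff TYPE('n::finite) k * (2 * 2 ^ k) ^ CARD('n) = 8 ^ CARD('n) * (1 / 2 ^ CARD('n)) ^ k"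
proof -
  have "(2 * 2 ^ k :: real) ^ CARD('n) = 2 ^ CARD('n) * (2 ^ CARD('n)) ^ k"
    by (simp add: power_mult_distrib power_mult[symmetric] mult.commute)
  moreover have "(1 / 4 ^ CARD('n)) ^ k * (2 ^ CARD('n)) ^ k = (1 / 2 ^ CARD('n) :: real) ^ k"
    proof -
    have "1 / 4 ^ CARD('n) * 2 ^ CARD('n) = (1 / 2 ^ CARD('n) :: real)"
    proof -
      have "(4::real) ^ CARD('n) = 2 ^ CARD('n) * 2 ^ CARD('n)"
        by (subst power_mult_distrib[symmetric]) simp
      then show ?thesis by simp
    qed
    moreover have "(1 / 4 ^ CARD('n)) ^ k * (2 ^ CARD('n)) ^ k = (1 / 4 ^ CARD('n) * 2 ^ CARD('n) :: real) ^ k"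
      by (rule power_mult_distrib[symmetric])
    ultimately show ?thesis by simp
  qed
  moreover have "(4::real) ^ CARD('n) * 2 ^ CARD('n) = 8 ^ CARD('n)"
    by (subst power_mult_distrib[symmetric]) simp
  moreover have "a * b * (c * d) = (a * c) * (b * d)" for a b c d :: real by (simp only: mult_ac)
  ultimately show ?thesis unfolding growth_coeff_def by (simp only:)
qed

lemma summable_growth_coeff_volume:
  "summable (\<lambda>k. growth_coeff TYPE('n::finite) k * (2 * 2 ^ k) ^ CARD('n))"
  unfolding growth_coeff_volume by (intro summable_mult summable_geometric) simp

definition growth_mass :: "'n::finite itself \<Rightarrow> real"
  where "growth_mass _ = (\<Sum>k. growth_coeff TYPE('n) k * (2 * 2 ^ k) ^ CARD('n))"

lemma growth_mass_pos: "0 < growth_mass TYPE('n::finite)"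
  unfolding growth_mass_def by (intro suminf_pos summable_growth_coeff_volume) (simp add: growth_coeff_pos)

lemma nn_integral_inverse_growth:
  "(\<integral>\<^sup>+v. ennreal (1 / growth (v :: real^'n::finite)) \<partial>lborel) \<le> ennreal (growth_mass TYPE('n))"
proof -
  have "(\<integral>\<^sup>+v. ennreal (1 / growth (v :: real^'n)) \<partial>lborel)
      \<le> (\<integral>\<^sup>+v. (\<Sum>k. ennreal (growth_coeff TYPE('n) k) * indicator (cube 0 (2 ^ k)) v) \<partial>(lborel :: (real^'n) measure))"
    by (intro nn_integral_mono inverse_growth_le)
  also have "\<dots> = (\<Sum>k. ennreal (growth_coeff TYPE('n) k) * emeasure lborel (cube (0 :: real^'n) (2 ^ k)))"
    by (subst nn_integral_suminf) (auto simp: nn_integral_cmult)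
  also have "\<dots> = (\<Sum>k. ennreal (growth_coeff TYPE('n) k * (2 * 2 ^ k) ^ CARD('n)))"
    by (simp add: emeasure_cube ennreal_mult growth_coeff_pos less_imp_le)
  also have "\<dots> = ennreal (growth_mass TYPE('n))"
    unfolding growth_mass_def
    by (intro suminf_ennreal2 summable_growth_coeff_volume) (simp add: growth_coeff_pos less_imp_le)
  finally show ?thesis .
qed

lemma nn_integral_inverse_growth_scaled:
  fixes x :: "real^'n::finite"
  assumes "0 < l"
  shows "(\<integral>\<^sup>+y. ennreal (1 / growth (l *\<^sub>R (x - y))) \<partial>lborel) \<le> ennreal (growth_mass TYPE('n) / l ^ CARD('n))"
proof -
  have "(\<integral>\<^sup>+y. ennreal (1 / growth (l *\<^sub>R (x - y))) \<partial>lborel)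
     = ennreal (\<bar>1/l\<bar> ^ DIM(real^'n)) * (\<integral>\<^sup>+y. ennreal (1 / growth (l *\<^sub>R (x - (x + (1/l) *\<^sub>R y)))) \<partial>lborel)"
    using assms by (intro nn_integral_lborel_affine) auto
  also have "(\<lambda>y. ennreal (1 / growth (l *\<^sub>R (x - (x + (1/l) *\<^sub>R y))))) = (\<lambda>y. ennreal (1 / growth y))"
    using assms by (intro ext) simp
  also have "ennreal (\<bar>1/l\<bar> ^ DIM(real^'n)) * (\<integral>\<^sup>+y. ennreal (1 / growth (y :: real^'n)) \<partial>lborel)
      \<le> ennreal (\<bar>1/l\<bar> ^ DIM(real^'n)) * ennreal (growth_mass TYPE('n))"
    by (intro mult_left_mono nn_integral_inverse_growth) auto
  also have "\<dots> = ennreal (growth_mass TYPE('n) / l ^ CARD('n))"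
    using assms growth_mass_pos[where 'n='n]
    by (simp add: ennreal_mult[symmetric] power_divide)
  finally show ?thesis .
qed

section \<open>The reverse Hoelder inequality\<close>

text \<open>Half-open in every coordinate, so that dyadic subcubes partition their parent exactly
  and not only up to null sets.\<close>

definition hcube :: "real^'n::finite \<Rightarrow> real \<Rightarrow> (real^'n) set"
  where "hcube c s = {y. \<forall>i. c $ i \<le> y $ i \<and> y $ i < c $ i + s}"

lemma hcube_subset_cbox: "hcube c s \<subseteq> cbox c (c + (\<chi> i. s))"
  and box_subset_hcube: "box c (c + (\<chi> i. s)) \<subseteq> hcube c s"
  unfolding hcube_def by (auto simp: mem_box_cart less_imp_le)

lemma hcube_measurable [measurable]: "hcube c s \<in> sets borel"
proof -
  have "hcube c s = (\<Inter>i. {y. c $ i \<le> y $ i} \<inter> {y. y $ i < c $ i + s})"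
    by (auto simp: hcube_def)
  moreover have "{y. c $ i \<le> y $ i} \<in> sets borel" "{y. y $ i < c $ i + s} \<in> sets borel" for i
    by (auto intro!: borel_closed borel_open closed_Collect_le open_Collect_less continuous_intros)
  ultimately show ?thesis by (auto intro!: sets.finite_INT)
qed

lemma emeasure_hcube:
  fixes c :: "real^'n::finite"
  assumes "0 \<le> s" shows "emeasure lborel (hcube c s) = ennreal (s ^ CARD('n))"
proof -
  have *: "(c + (\<chi> i. s) - c) \<bullet> b = s" if "b \<in> Basis" for b :: "real^'n"
    using that by (auto simp: Basis_vec_def inner_axis)
  have le: "c \<bullet> b \<le> (c + (\<chi> i. s)) \<bullet> b" if "b \<in> Basis" for b :: "real^'n"
    using that assms by (auto simp: Basis_vec_def inner_axis)
  have 1: "emeasure lborel (cbox c (c + (\<chi> i. s))) = ennreal (s ^ CARD('n))"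
    by (subst emeasure_lborel_cbox, erule le) (subst prod.cong[OF refl *], assumption, simp)
  have 2: "emeasure lborel (box c (c + (\<chi> i. s))) = ennreal (s ^ CARD('n))"
    by (subst emeasure_lborel_box, erule le) (subst prod.cong[OF refl *], assumption, simp)
  show ?thesis
    using emeasure_mono[OF hcube_subset_cbox[of c s], of lborel]
      emeasure_mono[OF box_subset_hcube[of c s], of lborel]
    by (simp add: 1 2 antisym)
qed

text \<open>The dyadic subcube of level k containing x, in the grid of side l with corner a.
  Describing it by equality of floors instead of by its corner makes it an equivalence class, so
  that equality and nesting of cells become statements about floors.\<close>

definition cell :: "real^'n::finite \<Rightarrow> real \<Rightarrow> nat \<Rightarrow> real^'n \<Rightarrow> (real^'n) set"
  where "cell a l k x = {y. \<forall>i. \<lfloor>(y $ i - a $ i) * 2 ^ k / l\<rfloor> = \<lfloor>(x $ i - a $ i) * 2 ^ k / l\<rfloor>}"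

lemma mem_cell_self [simp]: "x \<in> cell a l k x"
  by (simp add: cell_def)

lemma cell_eq: "y \<in> cell a l k x \<Longrightarrow> cell a l k y = cell a l k x"
  by (simp add: cell_def)

text \<open>A floor is the integer half of the floor of the doubled argument, so agreement at the
  finer level determines the coarser one.\<close>

lemma cell_Suc_subset: "cell a l (Suc k) x \<subseteq> cell a l k x"
proof
  fix y assume y: "y \<in> cell a l (Suc k) x"
  have half: "\<lfloor>u\<rfloor> = \<lfloor>2 * u\<rfloor> div 2" for u :: real by linarith
  have "\<lfloor>(y $ i - a $ i) * 2 ^ k / l\<rfloor> = \<lfloor>(x $ i - a $ i) * 2 ^ k / l\<rfloor>" for i
  proof -
    have "\<lfloor>2 * ((y $ i - a $ i) * 2 ^ k / l)\<rfloor> = \<lfloor>2 * ((x $ i - a $ i) * 2 ^ k / l)\<rfloor>"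
      using y by (simp add: cell_def mult_ac)
    then show ?thesis by (subst (1 2) half) simp
  qed
  then show "y \<in> cell a l k x" by (simp add: cell_def)
qed

lemma cell_antimono: "j \<le> k \<Longrightarrow> cell a l k x \<subseteq> cell a l j x"
  by (induction rule: dec_induct) (use cell_Suc_subset in blast)+

lemma cell_eq_hcube:
  assumes "0 < l"
  shows "cell a l k x = hcube (\<chi> i. a $ i + of_int \<lfloor>(x $ i - a $ i) * 2 ^ k / l\<rfloor> * (l / 2 ^ k)) (l / 2 ^ k)"
proof -
  define d where "d = l / 2 ^ k"
  have d: "0 < d" "u * 2 ^ k / l = u / d" for u using assms by (auto simp: d_def)
  have "\<lfloor>u / d\<rfloor> = z \<longleftrightarrow> of_int z * d \<le> u \<and> u < of_int z * d + d" for u :: real and z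
    using d by (simp add: floor_eq_iff pos_le_divide_eq pos_divide_less_eq distrib_right)
  then have "\<lfloor>(y $ i - a $ i) / d\<rfloor> = z \<longleftrightarrow> a $ i + of_int z * d \<le> y $ i \<and> y $ i < a $ i + of_int z * d + d" for y i z
    by (simp add: algebra_simps)
  then show ?thesis unfolding cell_def hcube_def d_def[symmetric] d(2) by simp
qed

lemma cell_measurable [measurable]: "0 < l \<Longrightarrow> cell a l k x \<in> sets borel"
  by (simp add: cell_eq_hcube)

lemma emeasure_cell:
  "0 < l \<Longrightarrow> emeasure lborel (cell (a :: real^'n::finite) l k x) = ennreal ((l / 2 ^ k) ^ CARD('n))"
  by (simp only: cell_eq_hcube) (intro emeasure_hcube, simp)

lemma emeasure_cell_parent:
  fixes a :: "real^'n::finite"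
  assumes "0 < l"
  shows "emeasure lborel (cell a l k x) = ennreal (2 ^ CARD('n)) * emeasure lborel (cell a l (Suc k) x)"
  using assms by (simp add: emeasure_cell ennreal_mult[symmetric] power_mult_distrib[symmetric] del: power_mult_distrib)

lemma cell_dist:
  assumes "0 < l" "y \<in> cell a l k x" shows "\<bar>y $ i - x $ i\<bar> \<le> l / 2 ^ k"
proof -
  have "y \<in> cell a l k x" "x \<in> cell a l k x" using assms by auto
  then show ?thesis unfolding cell_eq_hcube[OF assms(1)] hcube_def
    by (auto dest!: spec[of _ i] simp: abs_le_iff)
qed

lemma ex_cell_subset_open:
  fixes x :: "real^'n::finite"
  assumes "0 < l" "open U" "x \<in> U" shows "\<exists>k. cell a l k x \<subseteq> U"
proof -
  obtain e where e: "0 < e" "\<And>y. dist y x < e \<Longrightarrow> y \<in> U" using assms by (auto simp: open_dist)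
  have "(\<lambda>k. real CARD('n) * (l * (1/2) ^ k)) \<longlonglongrightarrow> real CARD('n) * (l * 0)"
    by (intro tendsto_intros LIMSEQ_realpow_zero) auto
  then have "\<forall>\<^sub>F k in sequentially. real CARD('n) * (l * (1/2) ^ k) < e" using e by (intro order_tendstoD(2)) auto
  then obtain k where k: "real CARD('n) * (l * (1/2) ^ k) < e"
    using eventually_happens'[OF sequentially_bot] by blast
  have "cell a l k x \<subseteq> U"
  proof
    fix y assume y: "y \<in> cell a l k x"
    have "dist y x = norm (y - x)" by (simp add: dist_norm)
    also have "\<dots> \<le> (\<Sum>i\<in>UNIV. \<bar>(y - x) $ i\<bar>)" by (rule norm_le_l1_cart)
    also have "\<dots> \<le> (\<Sum>i\<in>(UNIV::'n set). l / 2 ^ k)" using cell_dist[OF assms(1) y] by (intro sum_mono) simp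
    also have "\<dots> < e" using k by (simp add: power_divide)
    finally show "y \<in> U" by (rule e)
  qed
  then show ?thesis ..
qed

text \<open>The maximal cells with property \<open>P\<close> among all levels from 0 on, that is,
  the stopping family of a Calderon--Zygmund decomposition. The property is left arbitrary because
  it serves both for large averages and for inclusion in an open set.\<close>

definition stop_cells :: "real^'n::finite \<Rightarrow> real \<Rightarrow> ((real^'n) set \<Rightarrow> bool) \<Rightarrow> (real^'n) set set"
  where "stop_cells a l P = {C. \<exists>k x. C = cell a l k x \<and> P C \<and> (\<forall>j<k. \<not> P (cell a l j x))}"

lemma countable_stop_cells: "countable (stop_cells (a :: real^'n::finite) l P)"
proof -
  define g where "g = (\<lambda>(k, z :: int^'n). {y :: real^'n. \<forall>i. \<lfloor>(y $ i - a $ i) * 2 ^ (k::nat) / l\<rfloor> = z $ i})"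
  have "cell a l k x = g (k, \<chi> i. \<lfloor>(x $ i - a $ i) * 2 ^ k / l\<rfloor>)" for k x
    by (simp add: cell_def g_def)
  then have "stop_cells a l P \<subseteq> range g" unfolding stop_cells_def by blast
  then show ?thesis by (rule countable_subset) simp
qed

lemma Union_stop_cells: "\<Union>(stop_cells a l P) = {x. \<exists>k. P (cell a l k x)}"
proof (intro equalityI subsetI)
  fix x assume "x \<in> {x. \<exists>k. P (cell a l k x)}"
  then obtain k where "P (cell a l k x)" "\<forall>j<k. \<not> P (cell a l j x)"
    using exists_least_iff[of "\<lambda>k. P (cell a l k x)"] by auto
  then have "cell a l k x \<in> stop_cells a l P" by (auto simp: stop_cells_def)
  then show "x \<in> \<Union>(stop_cells a l P)" using mem_cell_self by blast
next
  fix x assume "x \<in> \<Union>(stop_cells a l P)"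
  then obtain k y where "x \<in> cell a l k y" "P (cell a l k y)" by (auto simp: stop_cells_def)
  then show "x \<in> {x. \<exists>k. P (cell a l k x)}" using cell_eq by (metis mem_Collect_eq)
qed

text \<open>All points of a cell share its ancestors, so a stopping cell can be recentred at any of
  its points.\<close>

lemma stop_cells_at:
  assumes "C \<in> stop_cells a l P" "z \<in> C"
  obtains k where "C = cell a l k z" "P C" "\<And>j. j < k \<Longrightarrow> \<not> P (cell a l j z)"
proof -
  obtain k x where k: "C = cell a l k x" "P C" "\<forall>j<k. \<not> P (cell a l j x)"
    using assms by (auto simp: stop_cells_def)
  have "cell a l j z = cell a l j x" if "j \<le> k" for j
    using assms k cell_antimono[OF that, of a l x] by (intro cell_eq) auto
  then show ?thesis using k that[of k] by auto
qed

text \<open>Recentred at a common point, two stopping cells have the same level, namely the first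
  level at which \<open>P\<close> holds there.\<close>

lemma disjoint_stop_cells: "disjoint (stop_cells a l P)"
proof (intro pairwiseI)
  fix C D assume CD: "C \<in> stop_cells a l P" "D \<in> stop_cells a l P" "C \<noteq> D"
  show "disjnt C D"
  proof (rule ccontr)
    assume "\<not> disjnt C D"
    then obtain z where z: "z \<in> C" "z \<in> D" by (auto simp: disjnt_def)
    obtain j where j: "C = cell a l j z" "P C" "\<And>i. i < j \<Longrightarrow> \<not> P (cell a l i z)" using stop_cells_at[OF CD(1) z(1)] by metis
    obtain k where k: "D = cell a l k z" "P D" "\<And>i. i < k \<Longrightarrow> \<not> P (cell a l i z)" using stop_cells_at[OF CD(2) z(2)] by metis
    have "j = k" using j k by (metis nat_neq_iff)
    then show False using j k CD by simp
  qed
qed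

lemma stop_cells_measurable: "0 < l \<Longrightarrow> C \<in> stop_cells a l P \<Longrightarrow> C \<in> sets borel"
  by (auto simp: stop_cells_def)

lemma emeasure_Union_disjoint:
  assumes "countable F" "disjoint F" "\<And>C. C \<in> F \<Longrightarrow> C \<in> sets M"
  shows "emeasure M (\<Union>F) = (\<integral>\<^sup>+C. emeasure M C \<partial>count_space F)"
  using emeasure_UN_countable[of F "\<lambda>C. C" M] assms
  by (auto simp: disjoint_family_on_def disjoint_def)

text \<open>A bound on the average over each stopping cell adds up over the union, because the cells
  are disjoint and countable.\<close>

lemma stop_cells_emeasure_ge:
  assumes l: "0 < l" and F: "F \<subseteq> stop_cells a l P" and sets: "sets M = sets borel"
    and P: "\<And>C. C \<in> F \<Longrightarrow> ennreal t * emeasure lborel C \<le> emeasure M C"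
  shows "ennreal t * emeasure lborel (\<Union>F) \<le> emeasure M (\<Union>F)"
proof -
  have *: "countable F" "disjoint F" "\<And>C. C \<in> F \<Longrightarrow> C \<in> sets borel"
    using F countable_stop_cells[of a l P] disjoint_stop_cells[of a l P] stop_cells_measurable[OF l, of _ a P]
    by (auto intro: countable_subset simp: pairwise_def)
  have "ennreal t * emeasure lborel (\<Union>F) = (\<integral>\<^sup>+C. ennreal t * emeasure lborel C \<partial>count_space F)"
    using * by (simp add: emeasure_Union_disjoint nn_integral_cmult)
  also have "\<dots> \<le> (\<integral>\<^sup>+C. emeasure M C \<partial>count_space F)" by (intro nn_integral_mono P) simp
  also have "\<dots> = emeasure M (\<Union>F)" using * sets by (subst emeasure_Union_disjoint) auto
  finally show ?thesis .
qed

lemma stop_cells_emeasure_le: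
  assumes l: "0 < l" and F: "F \<subseteq> stop_cells a l P" and sets: "sets M = sets borel"
    and P: "\<And>C. C \<in> F \<Longrightarrow> emeasure M C \<le> ennreal t * emeasure lborel C"
  shows "emeasure M (\<Union>F) \<le> ennreal t * emeasure lborel (\<Union>F)"
proof -
  have *: "countable F" "disjoint F" "\<And>C. C \<in> F \<Longrightarrow> C \<in> sets borel"
    using F countable_stop_cells[of a l P] disjoint_stop_cells[of a l P] stop_cells_measurable[OF l, of _ a P]
    by (auto intro: countable_subset simp: pairwise_def)
  have "emeasure M (\<Union>F) = (\<integral>\<^sup>+C. emeasure M C \<partial>count_space F)"
    using * sets by (subst emeasure_Union_disjoint) auto
  also have "\<dots> \<le> (\<integral>\<^sup>+C. ennreal t * emeasure lborel C \<partial>count_space F)" by (intro nn_integral_mono P) simp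
  also have "\<dots> = ennreal t * emeasure lborel (\<Union>F)"
    using * by (simp add: emeasure_Union_disjoint nn_integral_cmult)
  finally show ?thesis .
qed

text \<open>One-sided dyadic Lebesgue differentiation. Outer regularity replaces the usual maximal function
  argument.\<close>

lemma AE_le_of_cell_averages_le:
  fixes w :: "real^'n::finite \<Rightarrow> real" and a :: "real^'n"
  assumes [measurable]: "w \<in> borel_measurable borel" and w: "\<And>x. 0 \<le> w x" and l: "0 < l" and t: "0 \<le> t"
    and [measurable]: "A \<in> sets borel" and fin: "emeasure lborel A < \<infinity>"
    and A: "\<And>x k. x \<in> A \<Longrightarrow> emeasure (density lborel w) (cell a l k x) \<le> ennreal t * emeasure lborel (cell a l k x)"
  shows "AE x in lborel. x \<in> A \<longrightarrow> w x \<le> t"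
proof -
  define W where "W = density lborel (\<lambda>x. ennreal (w x))"
  have [simp]: "sets W = sets borel" by (simp add: W_def)
  define E where "E = (\<lambda>m::nat. {x \<in> A. t + 1 / (real m + 1) < w x})"
  have Em [measurable]: "E m \<in> sets borel" for m
    unfolding E_def by measurable
  have "emeasure lborel (E m) = 0" for m
  proof -
    define d where "d = 1 / (real m + 1)"
    have d: "0 < d" by (simp add: d_def)
    have finE: "emeasure lborel (E m) < \<infinity>"
      using emeasure_mono[of "E m" A lborel] fin by (auto simp: E_def)
    have ge: "ennreal (t + d) * emeasure lborel (E m) \<le> emeasure W (E m)"
    proof -
      have "ennreal (t + d) * emeasure lborel (E m) = (\<integral>\<^sup>+x. ennreal (t + d) * indicator (E m) x \<partial>lborel)"
        by (simp add: nn_integral_cmult)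
      also have "\<dots> \<le> (\<integral>\<^sup>+x. ennreal (w x) * indicator (E m) x \<partial>lborel)"
        by (intro nn_integral_mono) (auto simp: E_def d_def indicator_def intro!: ennreal_leI)
      finally show ?thesis by (simp add: W_def emeasure_density)
    qed
    have "ennreal (t + d) * emeasure lborel (E m) \<le> ennreal t * (emeasure lborel (E m) + ennreal e)" if e: "0 < e" for e
    proof -
      obtain U where U: "open U" "E m \<subseteq> U" "emeasure lborel (U - E m) < e"
        using outer_regular_lborel[OF Em[of m], of e] e by auto
      \<comment> \<open>Covering cells must meet \<open>E m\<close>: such a cell contains a point of
        \<open>A\<close>, so its average is controlled by hypothesis even where it leaves
        \<open>A\<close>.\<close>
      define P where "P = (\<lambda>C. C \<subseteq> U \<and> C \<inter> E m \<noteq> {})"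
      have P: "emeasure W C \<le> ennreal t * emeasure lborel C" if "C \<in> stop_cells a l P" for C
      proof -
        obtain k x where kx: "C = cell a l k x" "P C" using \<open>C \<in> _\<close> by (auto simp: stop_cells_def)
        then obtain y where "y \<in> C" "y \<in> A" by (auto simp: P_def E_def)
        then show ?thesis using A[of y k] kx cell_eq[of y a l k x] by (simp add: W_def)
      qed
      have sub: "E m \<subseteq> \<Union>(stop_cells a l P)"
        unfolding Union_stop_cells P_def using ex_cell_subset_open[OF l U(1)] U(2) mem_cell_self by blast
      have sub2: "\<Union>(stop_cells a l P) \<subseteq> U" by (auto simp: stop_cells_def P_def)
      have meas: "\<Union>(stop_cells a l P) \<in> sets borel"
        using countable_stop_cells stop_cells_measurable[OF l] by (intro sets.countable_Union) auto
      have "emeasure W (E m) \<le> emeasure W (\<Union>(stop_cells a l P))" using sub meas by (intro emeasure_mono) auto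
      also have "\<dots> \<le> ennreal t * emeasure lborel (\<Union>(stop_cells a l P))"
        by (intro stop_cells_emeasure_le[OF l subset_refl]) (auto simp: P)
      also have "\<dots> \<le> ennreal t * emeasure lborel U" using sub2 U(1) by (intro mult_left_mono emeasure_mono) auto
      also have "emeasure lborel U = emeasure lborel (E m) + emeasure lborel (U - E m)"
        using U by (subst plus_emeasure) (auto intro!: arg_cong[where f="emeasure lborel"])
      also have "ennreal t * \<dots> \<le> ennreal t * (emeasure lborel (E m) + ennreal e)"
        using U by (intro mult_left_mono add_left_mono) auto
      finally show ?thesis using ge by (rule order_trans[rotated])
    qed
    moreover obtain r where r: "emeasure lborel (E m) = ennreal r" "0 \<le> r" using finE by (cases "emeasure lborel (E m)") auto
    ultimately have "(t + d) * r \<le> t * (r + e)" if "0 < e" for e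
      using that t d by (force simp: ennreal_mult[symmetric] ennreal_plus[symmetric] simp del: ennreal_plus)
    then have *: "d * r \<le> t * e" if "0 < e" for e using that by (simp add: algebra_simps)
    have "d * r \<le> 0"
    proof (rule field_le_epsilon)
      fix e :: real assume "0 < e"
      \<comment> \<open>Dividing by t + 1 instead of t keeps the choice legitimate for t =
        0.\<close>
      have "d * r \<le> t * (e / (t + 1))" using \<open>0 < e\<close> t by (intro *) simp
      also have "\<dots> \<le> e" using t \<open>0 < e\<close> by (simp add: divide_simps)
      finally show "d * r \<le> 0 + e" by simp
    qed
    then have "r = 0" using d r(2) by (simp add: mult_le_0_iff)
    then show ?thesis using r by simp
  qed
  then have "AE x in lborel. \<forall>m. x \<notin> E m"
    by (subst AE_all_countable) (auto intro!: AE_not_in simp: null_sets_def)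
  then show ?thesis
  proof (eventually_elim, intro impI)
    fix x assume x: "\<forall>m. x \<notin> E m" "x \<in> A"
    show "w x \<le> t"
    proof (rule ccontr)
      assume "\<not> w x \<le> t"
      then obtain m :: nat where "1 / (real m + 1) < w x - t"
        using reals_Archimedean[of "w x - t"] by (auto simp: inverse_eq_divide add.commute)
      then have "t + 1 / (real m + 1) < w x" by linarith
      then have "x \<in> E m" using x by (simp add: E_def)
      then show False using x by simp
    qed
  qed
qed

text \<open>Calderon--Zygmund decompositions are made at the heights \<open>T ^ j * M\<close>, where
  \<open>M\<close> is the average of w over the cube. Each generation fills at most half of every
  cell of the preceding one, so by \<open>small\<close> its w-mass decays like b^j. Summing w^e over
  the layers between consecutive heights gives a geometric series of ratio
  \<open>T powr e * b\<close>, which is why e has to be small.\<close>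

lemma reverse_Holder_hcube:
  fixes w :: "real^'n::finite \<Rightarrow> real" and c :: "real^'n"
  assumes w_meas [measurable]: "w \<in> borel_measurable borel" and w: "\<And>x. 0 \<le> w x" and s: "0 < s"
    and M: "emeasure (density lborel w) (hcube c s) = ennreal (M * s ^ CARD('n))" "0 < M"
    and b: "0 \<le> b" "b < 1"
    and small: "\<And>a l E. \<lbrakk>0 < l; E \<in> sets borel; E \<subseteq> hcube a l; 2 * emeasure lborel E \<le> emeasure lborel (hcube a l)\<rbrakk>
       \<Longrightarrow> emeasure (density lborel w) E \<le> ennreal b * emeasure (density lborel w) (hcube a l)"
    and e: "0 < e" and be: "(2 * 2 ^ CARD('n)) powr e * b < 1"
  shows "mass (\<lambda>x. w x powr (1 + e)) (hcube c s)
    \<le> ennreal ((1 + (2 * 2 ^ CARD('n)) powr e / (1 - (2 * 2 ^ CARD('n)) powr e * b)) * s ^ CARD('n) * M powr (1 + e))"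
proof -
  define W where "W = density lborel (\<lambda>x. ennreal (w x))"
  have [simp]: "sets W = sets borel" "space W = UNIV" by (simp_all add: W_def)
  \<comment> \<open>The factor 2^n pays for comparing a cell with its parent; the other factor 2
    makes the next generation fill at most half of the cell.\<close>
  define T where "T = (2 * 2 ^ CARD('n) :: real)"
  have T: "1 < T" unfolding T_def using one_le_power[of "2::real" "CARD('n)"] by linarith
  define Q where "Q = hcube c s"
  have Q_cell: "Q = cell c s 0 c" by (simp add: Q_def cell_eq_hcube[OF s])
  have QW: "emeasure W Q = ennreal (M * s ^ CARD('n))" using M by (simp add: Q_def W_def)
  define lam where "lam = (\<lambda>j::nat. T ^ j * M)"
  have lam_pos: "0 < lam j" for j using T M by (simp add: lam_def)
  have lam_Suc: "lam (Suc j) = T * lam j" for j by (simp add: lam_def)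
  \<comment> \<open>The grid covers the whole space; the inclusion in \<open>Q\<close> restricts the
    selection to the cube under consideration.\<close>
  define P where "P = (\<lambda>j C. C \<subseteq> Q \<and> ennreal (lam j) * emeasure lborel C < emeasure W C)"
  define Om where "Om = (\<lambda>j. \<Union>(stop_cells c s (P j)))"
  have Om_meas [measurable]: "Om j \<in> sets borel" for j
    unfolding Om_def using countable_stop_cells stop_cells_measurable[OF s] by (intro sets.countable_Union) auto
  have Om_Q: "Om j \<subseteq> Q" for j by (auto simp: Om_def stop_cells_def P_def)
  have cellQ: "cell c s k x \<subseteq> Q" if "x \<in> Q" for k x
    using cell_antimono[of 0 k c s x] cell_eq[of x c s 0 c] that Q_cell by auto
  have P_Suc: "P j C" if "P (Suc j) C" for j C
  proof -
    have "lam j \<le> lam (Suc j)" using T lam_pos[of j] by (simp add: lam_Suc)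
    then have "ennreal (lam j) * emeasure lborel C \<le> ennreal (lam (Suc j)) * emeasure lborel C"
      by (intro mult_right_mono ennreal_leI) auto
    then show ?thesis using that by (auto simp: P_def)
  qed
  have decay: "emeasure W (Om (Suc j)) \<le> ennreal b * emeasure W (Om j)" for j
  proof -
    define F where "F = stop_cells c s (P j)"
    have F: "countable F" "disjoint F" "\<And>C. C \<in> F \<Longrightarrow> C \<in> sets borel"
      using countable_stop_cells disjoint_stop_cells stop_cells_measurable[OF s] by (auto simp: F_def)
    have sub: "Om (Suc j) \<subseteq> Om j"
      unfolding Om_def Union_stop_cells using P_Suc by blast
    have step: "emeasure W (C \<inter> Om (Suc j)) \<le> ennreal b * emeasure W C" if C: "C \<in> F" for C
    proof -
      obtain k x where kx: "C = cell c s k x" "P j C" "\<forall>i<k. \<not> P j (cell c s i x)"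
        using C by (auto simp: F_def stop_cells_def)
      have xQ: "x \<in> Q" using kx by (auto simp: P_def)
      \<comment> \<open>The cube \<open>Q\<close> itself is never selected, as its average
        \<open>M\<close> does not exceed the height. Every selected cell therefore has a parent that
        was rejected, which bounds its average from above.\<close>
      have "k \<noteq> 0"
      proof
        assume "k = 0"
        then have CQ: "C = Q" using kx xQ cell_eq[of x c s 0 c] Q_cell by auto
        have "emeasure lborel Q = ennreal (s ^ CARD('n))" unfolding Q_def using s by (intro emeasure_hcube) simp
        then have "ennreal (lam j * s ^ CARD('n)) < ennreal (M * s ^ CARD('n))"
          using kx(2) lam_pos[of j] s unfolding CQ P_def QW by (simp add: ennreal_mult)
        then have "lam j < M" using lam_pos[of j] M s by (simp add: ennreal_less_iff)
        moreover have "M \<le> lam j" using T M by (simp add: lam_def)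
        ultimately show False by simp
      qed
      then obtain k' where k': "k = Suc k'" by (cases k) auto
      have "\<not> P j (cell c s k' x)" using kx k' by simp
      then have "emeasure W (cell c s k' x) \<le> ennreal (lam j) * emeasure lborel (cell c s k' x)"
        using cellQ[OF xQ] by (auto simp: P_def not_less)
      then have WC: "emeasure W C \<le> ennreal (lam j) * (ennreal (2 ^ CARD('n)) * emeasure lborel C)"
        using emeasure_mono[OF cell_Suc_subset[of c s k' x], of W] s
        unfolding kx(1) k' emeasure_cell_parent[OF s, of c k'] by simp
      define G where "G = {D \<in> stop_cells c s (P (Suc j)). D \<subseteq> C}"
      have cov: "C \<inter> Om (Suc j) \<subseteq> \<Union>G"
      proof
        fix z assume z: "z \<in> C \<inter> Om (Suc j)"
        then obtain D where D: "D \<in> stop_cells c s (P (Suc j))" "z \<in> D" by (auto simp: Om_def)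
        obtain d where d: "D = cell c s d z" "P (Suc j) D" using stop_cells_at[OF D] by metis
        obtain k0 where k0: "C = cell c s k0 z" "\<And>i. i < k0 \<Longrightarrow> \<not> P j (cell c s i z)"
          using stop_cells_at[of C c s "P j" z] C z by (auto simp: F_def)
        have "k0 \<le> d" using k0(2)[of d] P_Suc d by (auto simp: not_less[symmetric])
        then have "D \<subseteq> C" unfolding d(1) k0(1) by (rule cell_antimono)
        then show "z \<in> \<Union>G" using D by (auto simp: G_def)
      qed
      have GC: "\<Union>G \<subseteq> C" by (auto simp: G_def)
      have G_meas [measurable]: "\<Union>G \<in> sets borel"
        using countable_stop_cells[of c s "P (Suc j)"] stop_cells_measurable[OF s]
        by (intro sets.countable_Union) (auto simp: G_def intro: countable_subset)
      have C_meas [measurable]: "C \<in> sets borel" using F C by auto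
      have "ennreal (lam (Suc j)) * emeasure lborel (\<Union>G) \<le> emeasure W (\<Union>G)"
        by (intro stop_cells_emeasure_ge[OF s, of _ c "P (Suc j)"])
          (auto simp: G_def stop_cells_def P_def less_imp_le)
      also have "\<dots> \<le> emeasure W C" using GC by (intro emeasure_mono) auto
      also note WC
      finally have 1: "ennreal (lam (Suc j)) * emeasure lborel (\<Union>G) \<le> ennreal (lam j) * (ennreal (2 ^ CARD('n)) * emeasure lborel C)" .
      have 2: "ennreal (lam (Suc j)) = ennreal (lam j * 2 ^ CARD('n)) * 2"
        using lam_pos[of j] by (simp add: lam_Suc T_def ennreal_mult[symmetric] ennreal_numeral[symmetric] del: ennreal_numeral)
      have 3: "ennreal (lam j) * (ennreal (2 ^ CARD('n)) * emeasure lborel C) = ennreal (lam j * 2 ^ CARD('n)) * emeasure lborel C"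
        using lam_pos[of j] by (simp add: ennreal_mult mult.assoc less_imp_le)
      \<comment> \<open>After cancelling \<open>lam j\<close> times 2^n, the spare factor 2 in T
        shows that the selected subcells fill at most half of \<open>C\<close>.\<close>
      have "ennreal (lam j * 2 ^ CARD('n)) * (2 * emeasure lborel (\<Union>G)) \<le> ennreal (lam j * 2 ^ CARD('n)) * emeasure lborel C"
        using 1 unfolding 2 3 by (simp add: mult.assoc)
      then have "2 * emeasure lborel (\<Union>G) \<le> emeasure lborel C"
        using lam_pos[of j] by (subst (asm) ennreal_mult_le_mult_iff) (auto simp: ennreal_eq_0_iff not_le)
      then have "emeasure W (\<Union>G) \<le> ennreal b * emeasure W C"
        using GC s unfolding W_def kx(1) cell_eq_hcube[OF s] by (intro small) (auto simp: G_meas)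
      moreover have "emeasure W (C \<inter> Om (Suc j)) \<le> emeasure W (\<Union>G)" using cov by (intro emeasure_mono) auto
      ultimately show ?thesis by (rule order_trans[rotated])
    qed
    have "Om (Suc j) = (\<Union>C\<in>F. C \<inter> Om (Suc j))" using sub by (auto simp: Om_def F_def)
    then have "emeasure W (Om (Suc j)) = emeasure W (\<Union>C\<in>F. C \<inter> Om (Suc j))" by simp
    also have "\<dots> = (\<integral>\<^sup>+C. emeasure W (C \<inter> Om (Suc j)) \<partial>count_space F)"
      using F by (intro emeasure_UN_countable) (auto simp: disjoint_family_on_def disjoint_def)
    also have "\<dots> \<le> (\<integral>\<^sup>+C. ennreal b * emeasure W C \<partial>count_space F)" by (intro nn_integral_mono step) simp
    also have "\<dots> = ennreal b * emeasure W (Om j)"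
      unfolding Om_def F_def[symmetric] using F by (simp add: emeasure_Union_disjoint nn_integral_cmult)
    finally show ?thesis .
  qed
  have geom: "emeasure W (Om j) \<le> ennreal (b ^ j * (M * s ^ CARD('n)))" for j
  proof (induction j)
    case 0
    show ?case using emeasure_mono[OF Om_Q, of W 0] by (simp add: QW[symmetric] Q_def)
  next
    case (Suc j)
    have "emeasure W (Om (Suc j)) \<le> ennreal b * ennreal (b ^ j * (M * s ^ CARD('n)))"
      using decay[of j] Suc by (meson mult_left_mono order_trans zero_le)
    then show ?case using b M s by (simp add: ennreal_mult[symmetric] mult_ac)
  qed
  \<comment> \<open>A point outside \<open>Om j\<close> lies in no cell of average above
    \<open>lam j\<close>, so dyadic differentiation bounds w there.\<close>
  have "AE x in lborel. \<forall>j. x \<in> Q - Om j \<longrightarrow> w x \<le> lam j"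
  proof (subst AE_all_countable, intro allI AE_le_of_cell_averages_le[OF w_meas w s])
    fix j
    show "0 \<le> lam j" using lam_pos[of j] by simp
    show "Q - Om j \<in> sets borel" by (simp add: Q_def)
    have "emeasure lborel (Q - Om j) \<le> emeasure lborel Q" by (intro emeasure_mono) (auto simp: Q_def)
    also have "\<dots> < \<infinity>" using emeasure_hcube[of s c] s unfolding Q_def by simp
    finally show "emeasure lborel (Q - Om j) < \<infinity>" .
    fix x k assume "x \<in> Q - Om j"
    then show "emeasure (density lborel (\<lambda>x. ennreal (w x))) (cell c s k x) \<le> ennreal (lam j) * emeasure lborel (cell c s k x)"
      using cellQ[of x k] unfolding Om_def Union_stop_cells by (auto simp: P_def not_less W_def)
  qed
  then have pt: "AE x in lborel. ennreal (w x powr (1 + e)) * indicator Q x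
     \<le> ennreal (w x) * (ennreal (M powr e) * indicator Q x + (\<Sum>j. ennreal (lam (Suc j) powr e) * indicator (Om j) x))"
  proof eventually_elim
    fix x assume x: "\<forall>j. x \<in> Q - Om j \<longrightarrow> w x \<le> lam j"
    show "ennreal (w x powr (1 + e)) * indicator Q x
     \<le> ennreal (w x) * (ennreal (M powr e) * indicator Q x + (\<Sum>j. ennreal (lam (Suc j) powr e) * indicator (Om j) x))"
    proof (cases "x \<in> Q \<and> w x \<noteq> 0")
      case True
      then have xQ: "x \<in> Q" and w0: "0 < w x" using w[of x] by auto
      have ex: "\<exists>j. w x \<le> lam j"
      proof -
        obtain j where "w x / M < T ^ j" using real_arch_pow[OF T] by blast
        then have "w x \<le> lam j" using M by (simp add: lam_def divide_less_eq)
        then show ?thesis ..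
      qed
      \<comment> \<open>The layer of x: w x is at most \<open>lam J\<close>, but exceeds the
        preceding height, so x belongs to the preceding stopping set if J > 0.\<close>
      define J where "J = (LEAST j. w x \<le> lam j)"
      have J: "w x \<le> lam J" unfolding J_def using ex by (rule LeastI_ex)
      have "ennreal (w x powr e) \<le> ennreal (M powr e) * indicator Q x + (\<Sum>j. ennreal (lam (Suc j) powr e) * indicator (Om j) x)"
      proof (cases J)
        case 0
        then have "w x powr e \<le> M powr e" using J w e by (intro powr_mono2) (auto simp: lam_def)
        then have "ennreal (w x powr e) \<le> ennreal (M powr e) * indicator Q x" using xQ by (simp add: ennreal_leI)
        then show ?thesis by (simp add: add_increasing2)
      next
        case (Suc j)
        have "\<not> w x \<le> lam j" unfolding J_def using not_less_Least[of j "\<lambda>j. w x \<le> lam j"] Suc J_def by simp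
        then have "x \<in> Om j" using x xQ by auto
        have "w x powr e \<le> lam (Suc j) powr e" using J Suc w e by (intro powr_mono2) auto
        then have "ennreal (w x powr e) \<le> (\<Sum>j\<in>{j}. ennreal (lam (Suc j) powr e) * indicator (Om j) x)"
          using \<open>x \<in> Om j\<close> by (simp add: ennreal_leI del: sum_mult_indicator)
        also have "\<dots> \<le> (\<Sum>j. ennreal (lam (Suc j) powr e) * indicator (Om j) x)" by (intro sum_le_suminf) auto
        finally show ?thesis by (simp add: add_increasing)
      qed
      then have "ennreal (w x) * ennreal (w x powr e) \<le> ennreal (w x) * (ennreal (M powr e) * indicator Q x + (\<Sum>j. ennreal (lam (Suc j) powr e) * indicator (Om j) x))"
        by (intro mult_left_mono) auto
      moreover have "ennreal (w x) * ennreal (w x powr e) = ennreal (w x powr (1 + e))"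
        using w0 by (simp add: ennreal_mult[symmetric] powr_add)
      ultimately show ?thesis using xQ by simp
    qed auto
  qed
  have Tb: "0 \<le> T powr e * b" "T powr e * b < 1" using b be by (simp_all add: T_def)
  have sm: "summable (\<lambda>j. T powr e * (T powr e * b) ^ j)"
    using Tb by (intro summable_mult summable_geometric) simp
  have tm: "lam (Suc j) powr e * (b ^ j * (M * s ^ CARD('n))) = M powr (1 + e) * s ^ CARD('n) * (T powr e * (T powr e * b) ^ j)" for j
  proof -
    have "lam (Suc j) powr e = (T powr e) ^ Suc j * M powr e"
    proof -
      have "(T ^ Suc j) powr e = (T powr real (Suc j)) powr e" using T by (subst powr_realpow) auto
      also have "\<dots> = (T powr e) powr real (Suc j)" by (simp only: powr_powr mult.commute)
      also have "\<dots> = (T powr e) ^ Suc j" using T by (intro powr_realpow) auto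
      finally show ?thesis using T M unfolding lam_def by (simp only: powr_mult)
    qed
    then show ?thesis using M by (simp add: powr_add power_mult_distrib mult_ac)
  qed
  have "mass (\<lambda>x. w x powr (1 + e)) Q
      \<le> (\<integral>\<^sup>+x. ennreal (w x) * (ennreal (M powr e) * indicator Q x + (\<Sum>j. ennreal (lam (Suc j) powr e) * indicator (Om j) x)) \<partial>lborel)"
    using pt by (intro nn_integral_mono_AE) auto
  also have "\<dots> = (\<integral>\<^sup>+x. ennreal (M powr e) * indicator Q x + (\<Sum>j. ennreal (lam (Suc j) powr e) * indicator (Om j) x) \<partial>W)"
    unfolding W_def by (subst nn_integral_density) (auto simp: Q_def)
  also have "\<dots> = ennreal (M powr e) * emeasure W Q + (\<Sum>j. ennreal (lam (Suc j) powr e) * emeasure W (Om j))"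
  proof -
    have "(\<integral>\<^sup>+x. (\<Sum>j. ennreal (lam (Suc j) powr e) * indicator (Om j) x) \<partial>W)
        = (\<Sum>j. \<integral>\<^sup>+x. ennreal (lam (Suc j) powr e) * indicator (Om j) x \<partial>W)"
      by (intro nn_integral_suminf) (simp add: W_def)
    moreover have "(\<integral>\<^sup>+x. ennreal (lam (Suc j) powr e) * indicator (Om j) x \<partial>W) = ennreal (lam (Suc j) powr e) * emeasure W (Om j)" for j
      by (intro nn_integral_cmult_indicator) (simp add: W_def)
    moreover have "(\<integral>\<^sup>+x. ennreal (M powr e) * indicator Q x \<partial>W) = ennreal (M powr e) * emeasure W Q"
      by (intro nn_integral_cmult_indicator) (simp add: W_def Q_def)
    ultimately show ?thesis
      by (subst nn_integral_add) (simp_all add: W_def Q_def)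
  qed
  also have "\<dots> \<le> ennreal (M powr e) * ennreal (M * s ^ CARD('n)) + (\<Sum>j. ennreal (lam (Suc j) powr e) * ennreal (b ^ j * (M * s ^ CARD('n))))"
    unfolding QW by (intro add_left_mono suminf_le mult_left_mono geom) auto
  also have "(\<Sum>j. ennreal (lam (Suc j) powr e) * ennreal (b ^ j * (M * s ^ CARD('n))))
      = (\<Sum>j. ennreal (M powr (1 + e) * s ^ CARD('n) * (T powr e * (T powr e * b) ^ j)))"
    using b M s by (simp only: tm[symmetric]) (simp add: ennreal_mult[symmetric])
  also have "\<dots> = ennreal (\<Sum>j. M powr (1 + e) * s ^ CARD('n) * (T powr e * (T powr e * b) ^ j))"
    using Tb M s b T by (intro suminf_ennreal2 summable_mult sm) auto
  also have "(\<Sum>j. M powr (1 + e) * s ^ CARD('n) * (T powr e * (T powr e * b) ^ j))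
      = M powr (1 + e) * s ^ CARD('n) * (T powr e * (1 / (1 - T powr e * b)))"
    using Tb sm by (subst suminf_mult) (auto simp: suminf_mult suminf_geometric summable_geometric)
  also have "ennreal (M powr e) * ennreal (M * s ^ CARD('n)) = ennreal (M powr (1 + e) * s ^ CARD('n))"
    using M s by (simp add: ennreal_mult[symmetric] powr_add mult_ac)
  also have "\<dots> + ennreal (M powr (1 + e) * s ^ CARD('n) * (T powr e * (1 / (1 - T powr e * b))))
      = ennreal ((1 + T powr e / (1 - T powr e * b)) * s ^ CARD('n) * M powr (1 + e))"
    using Tb M s by (subst ennreal_plus[symmetric]) (auto simp: algebra_simps)
  finally show ?thesis by (simp add: Q_def T_def)
qed

section \<open>Muckenhoupt weights on cubes\<close>

lemma epowr_one_left [simp]: "epowr 1 s = 1"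
  using epowr_ennreal[of 1 s] by (simp add: epowr_def)

lemma vec_nth_measurable [measurable]: "(\<lambda>x :: real^'n::finite. x $ i) \<in> borel_measurable borel"
  by (intro borel_measurable_continuous_onI continuous_intros)

lemma mem_cube_measurable [measurable]:
  assumes [measurable]: "f \<in> borel_measurable M" "g \<in> borel_measurable M"
  shows "Measurable.pred M (\<lambda>z. g z \<in> cube (f z :: real^'n::finite) t)"
  unfolding cube_def mem_Collect_eq by measurable

text \<open>Writing \<Phi> as \<open>\<Phi> * w powr (1 / P)\<close> times
  \<open>w powr (- 1 / P)\<close> makes the second factor integrate to the dual weight of index
  P.\<close>

lemma nn_integral_weighted_Holder:
  fixes w :: "real^'n::finite \<Rightarrow> real"
  assumes P: "1 < P" and [measurable]: "w \<in> borel_measurable borel" and w: "\<And>x. 0 < w x"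
    and [measurable]: "\<Phi> \<in> borel_measurable borel" "E \<in> sets borel"
  shows "epowr (\<integral>\<^sup>+y\<in>E. \<Phi> y \<partial>lborel) P
    \<le> (\<integral>\<^sup>+y\<in>E. epowr (\<Phi> y) P * ennreal (w y) \<partial>lborel) *
       epowr (mass (\<lambda>y. w y powr (- 1 / (P - 1))) E) (P - 1)"
proof -
  have "\<Phi> y * indicator E y = (\<Phi> y * ennreal (w y powr (1 / P)) * indicator E y) * (ennreal (w y powr (- 1 / P)) * indicator E y)" for y
  proof -
    have "ennreal (w y powr (1 / P)) * ennreal (w y powr (- 1 / P)) = 1"
      using w[of y] by (simp add: ennreal_mult[symmetric] powr_add[symmetric] del: powr_minus)
    then show ?thesis by (cases "y \<in> E") (simp_all add: mult.assoc)
  qed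
  then have "(\<integral>\<^sup>+y\<in>E. \<Phi> y \<partial>lborel) = (\<integral>\<^sup>+y. (\<Phi> y * ennreal (w y powr (1 / P)) * indicator E y) * (ennreal (w y powr (- 1 / P)) * indicator E y) \<partial>lborel)"
    by simp
  also have "epowr \<dots> P \<le> (\<integral>\<^sup>+y. epowr (\<Phi> y * ennreal (w y powr (1 / P)) * indicator E y) P \<partial>lborel) *
     epowr (\<integral>\<^sup>+y. epowr (ennreal (w y powr (- 1 / P)) * indicator E y) (P / (P - 1)) \<partial>lborel) (P - 1)"
    by (intro nn_integral_Holder_powr P) auto
  also have "(\<lambda>y. epowr (\<Phi> y * ennreal (w y powr (1 / P)) * indicator E y) P) = (\<lambda>y. epowr (\<Phi> y) P * ennreal (w y) * indicator E y)"
    using P w by (auto simp: fun_eq_iff epowr_mult epowr_ennreal powr_powr less_imp_le split: split_indicator)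
  also have "(\<lambda>y. epowr (ennreal (w y powr (- 1 / P)) * indicator E y) (P / (P - 1))) = (\<lambda>y. ennreal (w y powr (- 1 / (P - 1))) * indicator E y)"
    using P by (auto simp: fun_eq_iff epowr_ennreal powr_powr split: split_indicator)
  finally show ?thesis .
qed

text \<open>Real upper bounds a and b replace the two masses, which keeps the characteristic in real
  arithmetic and makes the condition stable under passing to smaller sets. The parameter v stands
  for the volume up to a dimensional factor.\<close>

abbreviation Ap_on :: "real \<Rightarrow> real \<Rightarrow> ('a::euclidean_space \<Rightarrow> real) \<Rightarrow> 'a set \<Rightarrow> real \<Rightarrow> bool"
  where "Ap_on P K w S v \<equiv> \<exists>a b. 0 < a \<and> 0 < b \<and> mass w S \<le> ennreal a \<and>
    mass (\<lambda>y. w y powr (- 1 / (P - 1))) S \<le> ennreal b \<and> a * b powr (P - 1) \<le> K * v powr P"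

text \<open>Everywhere positivity gives real powers of negative exponent their intended meaning.
  Only the existence of a constant matters, so no characteristic is recorded.\<close>

definition cube_Ap :: "real \<Rightarrow> (real^'n::finite \<Rightarrow> real) \<Rightarrow> bool"
  where "cube_Ap P w \<longleftrightarrow> w \<in> borel_measurable borel \<and> (\<forall>x. 0 < w x) \<and>
    (\<exists>K>0. \<forall>x t. 0 < t \<longrightarrow> (Ap_on P K w (cube x t) (t ^ CARD('n))))"

lemma set_nn_integral_mono_set:
  "A \<subseteq> B \<Longrightarrow> (\<integral>\<^sup>+x\<in>A. f x \<partial>M) \<le> (\<integral>\<^sup>+x\<in>B. f x \<partial>M)"
  by (intro nn_integral_mono) (auto split: split_indicator)

lemma emeasure_density_set: "f \<in> borel_measurable borel \<Longrightarrow> A \<in> sets borel \<Longrightarrow>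
   emeasure (density lborel f) A = (\<integral>\<^sup>+x\<in>A. f x \<partial>lborel)"
  by (simp add: emeasure_density)

text \<open>Hoelder's inequality is applied to the constant 1 on the complement of E, which fills at
  least half of the cube. The A_P condition then shows that the complement carries at least the
  share 1 / K' of the mass, so that E carries at most the rest.\<close>

lemma cube_Ap_absolutely_continuous:
  fixes w :: "real^'n::finite \<Rightarrow> real"
  assumes P: "1 < P" and "cube_Ap P w"
  obtains b where "0 \<le> b" "b < 1"
    "\<And>a l E. \<lbrakk>0 < l; E \<in> sets borel; E \<subseteq> hcube a l; 2 * emeasure lborel E \<le> emeasure lborel (hcube a l)\<rbrakk>
       \<Longrightarrow> emeasure (density lborel w) E \<le> ennreal b * emeasure (density lborel w) (hcube a l)"
proof -
  obtain K where [measurable]: "w \<in> borel_measurable borel" and w: "\<And>x. 0 < w x" and K: "0 < K"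
    and AB: "\<And>x t. 0 < t \<Longrightarrow> Ap_on P K w (cube x t) (t ^ CARD('n))"
    using assms(2) unfolding cube_Ap_def by blast
  define W where "W = density lborel (\<lambda>x. ennreal (w x))"
  have [simp]: "sets W = sets borel" by (simp add: W_def)
  \<comment> \<open>The denominator is the power P of half the volume of a cube of side 2 t, in
    units of t^n; the maximum with 1 ensures that 1 - 1 / K' is nonnegative.\<close>
  define K' where "K' = max 1 (K / (2 ^ CARD('n) / 2) powr P)"
  have K': "1 \<le> K'" "K \<le> K' * (2 ^ CARD('n) / 2) powr P"
  proof -
    have "0 < (2 ^ CARD('n) / 2 :: real) powr P" by simp
    moreover have "K / (2 ^ CARD('n) / 2) powr P \<le> K'" by (simp add: K'_def)
    ultimately show "K \<le> K' * (2 ^ CARD('n) / 2) powr P" by (simp add: pos_divide_le_eq)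
  qed (simp add: K'_def)
  show ?thesis
  proof (rule that[of "1 - 1 / K'"])
    show "0 \<le> 1 - 1 / K'" "1 - 1 / K' < 1" using K' by auto
    fix a :: "real^'n" and l E
    assume l: "0 < (l::real)" and [measurable]: "E \<in> sets borel" and E: "E \<subseteq> hcube a l"
      and small: "2 * emeasure lborel E \<le> emeasure lborel (hcube a l)"
    define t where "t = l / 2"
    have t: "0 < t" "l = 2 * t" using l by (auto simp: t_def)
    define x where "x = (\<chi> i. a $ i + t)"
    have sub: "hcube a l \<subseteq> cube x t" unfolding hcube_def cube_def x_def t(2) by (auto simp: abs_le_iff) (smt (verit))+
    obtain A B where AB: "0 < A" "0 < B" "mass w (cube x t) \<le> ennreal A"
       "mass (\<lambda>y. w y powr (- 1 / (P - 1))) (cube x t) \<le> ennreal B"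
       "A * B powr (P - 1) \<le> K * (t ^ CARD('n)) powr P" using AB[OF t(1), of x] by blast
    define D where "D = hcube a l - E"
    have [measurable]: "D \<in> sets borel" by (simp add: D_def)
    have hc: "emeasure lborel (hcube a l) = ennreal (l ^ CARD('n))" using l by (intro emeasure_hcube) simp
    have finE: "emeasure lborel E \<noteq> \<infinity>" using emeasure_mono[OF E, of lborel] by (auto simp: hc top_unique)
    have "emeasure lborel D = emeasure lborel (hcube a l) - emeasure lborel E"
      unfolding D_def using finE E by (intro emeasure_Diff) auto
    moreover obtain e where "emeasure lborel E = ennreal e" "0 \<le> e" using finE by (cases "emeasure lborel E") auto
    ultimately have "emeasure lborel D \<ge> ennreal (l ^ CARD('n) / 2)"
      using small l unfolding hc
      by (auto simp: ennreal_minus ennreal_mult[symmetric] ennreal_numeral[symmetric] simp del: ennreal_numeral intro!: ennreal_leI)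
    then have "epowr (ennreal (l ^ CARD('n) / 2)) P \<le> epowr (\<integral>\<^sup>+y\<in>D. 1 \<partial>lborel) P"
      using P by (intro epowr_mono) auto
    also have "\<dots> \<le> (\<integral>\<^sup>+y\<in>D. epowr 1 P * ennreal (w y) \<partial>lborel) *
       epowr (mass (\<lambda>y. w y powr (- 1 / (P - 1))) D) (P - 1)"
      by (intro nn_integral_weighted_Holder P w) auto
    also have "\<dots> \<le> emeasure W D * epowr (ennreal B) (P - 1)"
    proof (intro mult_mono epowr_mono)
      show "(\<integral>\<^sup>+y\<in>D. epowr 1 P * ennreal (w y) \<partial>lborel) \<le> emeasure W D"
        using P epowr_ennreal[of 1 P] by (simp add: W_def emeasure_density_set)
      show "mass (\<lambda>y. w y powr (- 1 / (P - 1))) D \<le> ennreal B"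
        using sub by (intro order_trans[OF set_nn_integral_mono_set AB(4)]) (auto simp: D_def)
    qed (use P in auto)
    also have "\<dots> = emeasure W D * ennreal (B powr (P - 1))" using P AB by (simp add: epowr_ennreal)
    finally have "ennreal ((l ^ CARD('n) / 2) powr P) \<le> emeasure W D * ennreal (B powr (P - 1))"
      using P l by (simp add: epowr_ennreal)
    then have "ennreal (K * (t ^ CARD('n)) powr P) \<le> ennreal K' * (emeasure W D * ennreal (B powr (P - 1)))"
    proof -
      assume *: "ennreal ((l ^ CARD('n) / 2) powr P) \<le> emeasure W D * ennreal (B powr (P - 1))"
      have "(l ^ CARD('n) / 2) powr P = (2 ^ CARD('n) / 2) powr P * (t ^ CARD('n)) powr P"
        using t by (simp add: power_mult_distrib powr_mult powr_divide)
      then have "K * (t ^ CARD('n)) powr P \<le> K' * (l ^ CARD('n) / 2) powr P"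
        using mult_right_mono[OF K'(2), of "(t ^ CARD('n)) powr P"] by (simp add: mult_ac)
      then have "ennreal (K * (t ^ CARD('n)) powr P) \<le> ennreal K' * ennreal ((l ^ CARD('n) / 2) powr P)"
        using K' by (simp add: ennreal_mult[symmetric] ennreal_leI)
      also have "\<dots> \<le> ennreal K' * (emeasure W D * ennreal (B powr (P - 1)))" by (intro mult_left_mono *) auto
      finally show ?thesis .
    qed
    then have "ennreal (A * B powr (P - 1)) \<le> ennreal K' * (emeasure W D * ennreal (B powr (P - 1)))"
      using ennreal_leI[OF AB(5)] by (rule order_trans[rotated])
    then have "ennreal (B powr (P - 1)) * ennreal A \<le> ennreal (B powr (P - 1)) * (ennreal K' * emeasure W D)"
      using AB by (simp add: ennreal_mult mult_ac)
    then have AD: "ennreal A \<le> ennreal K' * emeasure W D"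
      using AB by (subst (asm) ennreal_mult_le_mult_iff) (auto simp: ennreal_eq_0_iff not_le)
    have hcA: "emeasure W (hcube a l) \<le> ennreal A"
      using order_trans[OF set_nn_integral_mono_set[OF sub] AB(3)] by (simp add: W_def emeasure_density_set)
    have add: "emeasure W (hcube a l) = emeasure W E + emeasure W D"
      unfolding D_def using E by (subst plus_emeasure) (auto intro!: arg_cong[where f="emeasure W"])
    obtain h where h: "emeasure W (hcube a l) = ennreal h" "0 \<le> h" using hcA by (cases "emeasure W (hcube a l)") (auto simp: top_unique)
    obtain u v where uv: "emeasure W E = ennreal u" "0 \<le> u" "emeasure W D = ennreal v" "0 \<le> v"
      using add h by (cases "emeasure W E"; cases "emeasure W D") auto
    have huv: "h = u + v" using add h uv by (simp add: ennreal_plus[symmetric] del: ennreal_plus)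
    have "h \<le> K' * v" using order_trans[OF hcA AD] h uv K' by (simp add: ennreal_mult[symmetric])
    then have "h / K' \<le> v" using K' by (simp add: divide_le_eq mult.commute)
    then have "u \<le> (1 - 1 / K') * h" using huv by (simp add: algebra_simps)
    then show "emeasure (density lborel w) E \<le> ennreal (1 - 1 / K') * emeasure (density lborel w) (hcube a l)"
      using h uv K' by (simp add: W_def[symmetric] ennreal_mult[symmetric] ennreal_leI)
  qed
qed

text \<open>The eccentric double cube accommodates a half-open cube with corner x - t and side 4 t,
  to which the dyadic argument applies: it contains the closed cube of half side t and stays inside
  the closed cube of half side 2 t.\<close>

lemma cube_Ap_reverse_Holder:
  fixes w :: "real^'n::finite \<Rightarrow> real"
  assumes P: "1 < P" and Ap: "cube_Ap P w"
  obtains e0 where "0 < e0" "\<And>e. 0 < e \<Longrightarrow> e \<le> e0 \<Longrightarrow>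
    \<exists>C>0. \<forall>x t a. 0 < t \<longrightarrow> 0 < a \<longrightarrow> mass w (cube (x + (\<chi> i. t)) (2 * t)) \<le> ennreal a \<longrightarrow>
      mass (\<lambda>y. w y powr (1 + e)) (cube x t) \<le> ennreal (C * t ^ CARD('n) * (a / t ^ CARD('n)) powr (1 + e))"
proof -
  have [measurable]: "w \<in> borel_measurable borel" and w: "\<And>x. 0 < w x"
    using Ap by (auto simp: cube_Ap_def)
  obtain b where b: "0 \<le> b" "b < 1" and small:
    "\<And>a l E. \<lbrakk>0 < l; E \<in> sets borel; E \<subseteq> hcube a l; 2 * emeasure lborel E \<le> emeasure lborel (hcube a l)\<rbrakk>
       \<Longrightarrow> emeasure (density lborel w) E \<le> ennreal b * emeasure (density lborel w) (hcube a l)"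
    using cube_Ap_absolutely_continuous[OF P Ap] by metis
  define T where "T = (2 * 2 ^ CARD('n) :: real)"
  have T: "1 < T" unfolding T_def using one_le_power[of "2::real" "CARD('n)"] by linarith
  obtain e0 where e0: "0 < e0" "T powr e0 * b < 1"
  proof (cases "b = 0")
    case True
    then show ?thesis using that[of 1] by simp
  next
    case False
    \<comment> \<open>With this exponent \<open>T powr e0\<close> equals 2 / (1 + b), and 2 b / (1 +
      b) < 1.\<close>
    define e0 where "e0 = ln (2 / (1 + b)) / ln T"
    have "1 < 2 / (1 + b)" using b by (simp add: divide_simps)
    then have "0 < e0" using T unfolding e0_def by (intro divide_pos_pos ln_gt_zero)
    moreover have "T powr e0 = 2 / (1 + b)" using T b by (simp add: e0_def powr_def)
    moreover have "2 / (1 + b) * b < 1" using b by (simp add: divide_simps)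
    ultimately show ?thesis using that by metis
  qed
  show ?thesis
  proof (rule that[OF e0(1)])
    fix e :: real assume e: "0 < e" "e \<le> e0"
    have "T powr e * b \<le> T powr e0 * b" using e T b by (intro mult_right_mono powr_mono) auto
    then have be: "T powr e * b < 1" using e0 by simp
    define C where "C = (1 + T powr e / (1 - T powr e * b)) * 4 ^ CARD('n)"
    have C: "0 < C" using be T unfolding C_def by (intro mult_pos_pos add_pos_nonneg) auto
    have "mass (\<lambda>y. w y powr (1 + e)) (cube x t) \<le> ennreal (C * t ^ CARD('n) * (a / t ^ CARD('n)) powr (1 + e))"
      if t: "0 < t" and a: "0 < a" "mass w (cube (x + (\<chi> i. t)) (2 * t)) \<le> ennreal a" for x t a
    proof -
      define c where "c = x - (\<chi> i. t)"
      have 1: "cube x t \<subseteq> hcube c (4 * t)"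
      proof
        fix y assume "y \<in> cube x t"
        then have "\<bar>y $ i - x $ i\<bar> \<le> t" for i by (simp add: cube_def)
        then have "x $ i - t \<le> y $ i \<and> y $ i < x $ i - t + 4 * t" for i
          using t by (simp add: abs_le_iff) (smt (verit))
        then show "y \<in> hcube c (4 * t)" by (simp add: hcube_def c_def)
      qed
      have 2: "hcube c (4 * t) \<subseteq> cube (x + (\<chi> i. t)) (2 * t)"
      proof
        fix y assume "y \<in> hcube c (4 * t)"
        then have "x $ i - t \<le> y $ i \<and> y $ i < x $ i - t + 4 * t" for i by (simp add: hcube_def c_def)
        then have "\<bar>y $ i - (x $ i + t)\<bar> \<le> 2 * t" for i
          by (simp add: abs_le_iff) (smt (verit))
        then show "y \<in> cube (x + (\<chi> i. t)) (2 * t)" by (simp add: cube_def)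
      qed
      define s where "s = 4 * t"
      have s: "0 < s" using t by (simp add: s_def)
      have le: "emeasure (density lborel w) (hcube c s) \<le> ennreal a"
        using order_trans[OF set_nn_integral_mono_set[OF 2] a(2)] by (simp add: emeasure_density_set s_def)
      \<comment> \<open>The stopping argument starts from a positive average; positivity of w on a
        set of positive measure provides it.\<close>
      have ne: "emeasure (density lborel w) (hcube c s) \<noteq> 0"
      proof
        assume "emeasure (density lborel w) (hcube c s) = 0"
        then have "AE y in lborel. ennreal (w y) = 0 \<or> y \<notin> hcube c s"
          by (simp add: emeasure_density nn_integral_0_iff_AE indicator_eq_0_iff)
        then have "AE y in lborel. y \<notin> hcube c s"
          by eventually_elim (use w in \<open>auto simp: ennreal_eq_0_iff not_le[symmetric]\<close>)
        then have "emeasure lborel (hcube c s) = 0" by (subst (asm) AE_iff_measurable[of "hcube c s"]) auto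
        then show False using s zero_less_power[OF s, of "CARD('n)"] by (subst (asm) emeasure_hcube) (auto simp: ennreal_eq_0_iff)
      qed
      obtain m where m: "emeasure (density lborel w) (hcube c s) = ennreal m" "0 < m" "m \<le> a"
        using le ne a(1) by (cases "emeasure (density lborel w) (hcube c s)") (auto simp: top_unique less_le)
      define M where "M = m / s ^ CARD('n)"
      have M: "emeasure (density lborel w) (hcube c s) = ennreal (M * s ^ CARD('n))" "0 < M"
        using m s by (auto simp: M_def)
      have "mass (\<lambda>y. w y powr (1 + e)) (cube x t) \<le> mass (\<lambda>y. w y powr (1 + e)) (hcube c s)"
        unfolding s_def by (intro set_nn_integral_mono_set 1)
      also have "\<dots> \<le> ennreal ((1 + T powr e / (1 - T powr e * b)) * s ^ CARD('n) * M powr (1 + e))"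
        unfolding T_def using be[unfolded T_def] w
        by (intro reverse_Holder_hcube M b e s small) (auto simp: less_imp_le)
      also have "\<dots> \<le> ennreal (C * t ^ CARD('n) * (a / t ^ CARD('n)) powr (1 + e))"
      proof (rule ennreal_leI)
        have "t ^ CARD('n) \<le> s ^ CARD('n)" using t by (intro power_mono) (auto simp: s_def)
        then have "M \<le> a / t ^ CARD('n)" unfolding M_def using m t by (intro frac_le) auto
        then have "M powr (1 + e) \<le> (a / t ^ CARD('n)) powr (1 + e)" using M e by (intro powr_mono2) auto
        then have "(1 + T powr e / (1 - T powr e * b)) * s ^ CARD('n) * M powr (1 + e) \<le> (1 + T powr e / (1 - T powr e * b)) * s ^ CARD('n) * (a / t ^ CARD('n)) powr (1 + e)"
          using be s T by (intro mult_left_mono) auto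
        then show "(1 + T powr e / (1 - T powr e * b)) * s ^ CARD('n) * M powr (1 + e) \<le> C * t ^ CARD('n) * (a / t ^ CARD('n)) powr (1 + e)"
          by (simp add: C_def s_def power_mult_distrib mult_ac)
      qed
      finally show ?thesis .
    qed
    then show "\<exists>C>0. \<forall>x t a. 0 < t \<longrightarrow> 0 < a \<longrightarrow> mass w (cube (x + (\<chi> i. t)) (2 * t)) \<le> ennreal a \<longrightarrow>
      mass (\<lambda>y. w y powr (1 + e)) (cube x t) \<le> ennreal (C * t ^ CARD('n) * (a / t ^ CARD('n)) powr (1 + e))"
      using C by blast
  qed
qed

text \<open>The conjugate index satisfies (P - 1) (P' - 1) = 1, so raising the condition to the
  power 1 / (P - 1) exchanges the two masses and dualising twice returns w.\<close>

lemma cube_Ap_dual: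
  fixes w :: "real^'n::finite \<Rightarrow> real"
  assumes P: "1 < P" and Ap: "cube_Ap P w"
  shows "cube_Ap (P / (P - 1)) (\<lambda>x. w x powr (- 1 / (P - 1)))"
proof -
  obtain K where [measurable]: "w \<in> borel_measurable borel" and w: "\<And>x. 0 < w x" and K: "0 < K"
    and AB: "\<And>x t. 0 < t \<Longrightarrow> Ap_on P K w (cube x t) (t ^ CARD('n))"
    using Ap unfolding cube_Ap_def by blast
  have P1: "P / (P - 1) - 1 = 1 / (P - 1)" using P by (simp add: field_simps)
  have ww: "(w y powr (- 1 / (P - 1))) powr (- 1 / (P / (P - 1) - 1)) = w y" for y
  proof -
    have "- 1 / (P - 1) * (- 1 / (1 / (P - 1))) = 1" using P by (simp add: divide_simps)
    then show ?thesis using w[of y] unfolding P1 powr_powr by (simp only: powr_one)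
  qed
  have "Ap_on (P / (P - 1)) (K powr (1 / (P - 1))) (\<lambda>y. w y powr (- 1 / (P - 1))) (cube x t) (t ^ CARD('n))" if t: "0 < t" for x t
  proof -
    obtain a b where ab: "0 < a" "0 < b"
       "mass w (cube x t) \<le> ennreal a"
       "mass (\<lambda>y. w y powr (- 1 / (P - 1))) (cube x t) \<le> ennreal b"
       "a * b powr (P - 1) \<le> K * (t ^ CARD('n)) powr P" using AB[OF t, of x] by blast
    have "b * a powr (1 / (P - 1)) = (a * b powr (P - 1)) powr (1 / (P - 1))"
      using ab P by (simp add: powr_mult powr_powr)
    also have "\<dots> \<le> (K * (t ^ CARD('n)) powr P) powr (1 / (P - 1))"
      using ab P by (intro powr_mono2) auto
    also have "\<dots> = K powr (1 / (P - 1)) * (t ^ CARD('n)) powr (P / (P - 1))"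
      using K P by (simp add: powr_mult powr_powr)
    finally have "b * a powr (P / (P - 1) - 1) \<le> K powr (1 / (P - 1)) * (t ^ CARD('n)) powr (P / (P - 1))"
      unfolding P1 .
    then show ?thesis using ab unfolding ww by blast
  qed
  moreover have "(\<lambda>x. w x powr (- 1 / (P - 1))) \<in> borel_measurable borel" by measurable
  moreover have "0 < w x powr (- 1 / (P - 1))" for x using w[of x] by simp
  moreover have "0 < K powr (1 / (P - 1))" using K by simp
  ultimately show ?thesis unfolding cube_Ap_def by blast
qed

text \<open>Openness of \<open>A\<^sub>P\<close>: the reverse Hoelder inequality is applied to the weight itself and then, in
  \<open>cube_Ap_open\<close>, to its dual weight.\<close>

lemma cube_Ap_powr:
  fixes w :: "real^'n::finite \<Rightarrow> real"
  assumes P: "1 < P" and Ap: "cube_Ap P w"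
  obtains e0 where "0 < e0" "\<And>e. 0 < e \<Longrightarrow> e \<le> e0 \<Longrightarrow> cube_Ap ((P - 1) * (1 + e) + 1) (\<lambda>x. w x powr (1 + e))"
proof -
  obtain K where [measurable]: "w \<in> borel_measurable borel" and w: "\<And>x. 0 < w x" and K: "0 < K"
    and AB: "\<And>x t. 0 < t \<Longrightarrow> Ap_on P K w (cube x t) (t ^ CARD('n))"
    using Ap unfolding cube_Ap_def by blast
  obtain e0 where e0: "0 < e0" and RH: "\<And>e. 0 < e \<Longrightarrow> e \<le> e0 \<Longrightarrow>
    \<exists>C>0. \<forall>x t a. 0 < t \<longrightarrow> 0 < a \<longrightarrow> mass w (cube (x + (\<chi> i. t)) (2 * t)) \<le> ennreal a \<longrightarrow>
      mass (\<lambda>y. w y powr (1 + e)) (cube x t) \<le> ennreal (C * t ^ CARD('n) * (a / t ^ CARD('n)) powr (1 + e))"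
    using cube_Ap_reverse_Holder[OF P Ap] by blast
  show ?thesis
  proof (rule that[OF e0])
    fix e :: real assume e: "0 < e" "e \<le> e0"
    \<comment> \<open>This index makes the dual weight of \<open>w powr (1 + e)\<close> coincide
      with that of w at index P, so that the reverse Hoelder inequality is needed for one mass
      only.\<close>
    define Q where "Q = (P - 1) * (1 + e) + 1"
    have Q1: "Q - 1 = (P - 1) * (1 + e)" by (simp add: Q_def)
    obtain C where C: "0 < C" "\<And>x t a. 0 < t \<Longrightarrow> 0 < a \<Longrightarrow> mass w (cube (x + (\<chi> i. t)) (2 * t)) \<le> ennreal a \<Longrightarrow>
      mass (\<lambda>y. w y powr (1 + e)) (cube x t) \<le> ennreal (C * t ^ CARD('n) * (a / t ^ CARD('n)) powr (1 + e))"
      using RH[OF e] by blast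
    have ww: "(w y powr (1 + e)) powr (- 1 / (Q - 1)) = w y powr (- 1 / (P - 1))" for y
      using P e unfolding Q1 by (simp add: powr_powr)
    define K' where "K' = C * (K * (2 ^ CARD('n)) powr P) powr (1 + e)"
    have "Ap_on Q K' (\<lambda>y. w y powr (1 + e)) (cube x t) (t ^ CARD('n))" if t: "0 < t" for x t
    proof -
      obtain a b where ab: "0 < a" "0 < b"
         "mass w (cube (x + (\<chi> i. t)) (2 * t)) \<le> ennreal a"
         "mass (\<lambda>y. w y powr (- 1 / (P - 1))) (cube (x + (\<chi> i. t)) (2 * t)) \<le> ennreal b"
         "a * b powr (P - 1) \<le> K * ((2 * t) ^ CARD('n)) powr P" using AB[of "2 * t" "x + (\<chi> i. t)"] t by auto
      have sub: "cube x t \<subseteq> cube (x + (\<chi> i. t)) (2 * t)"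
      proof
        fix y assume "y \<in> cube x t"
        then have "\<bar>y $ i - x $ i\<bar> \<le> t" for i by (simp add: cube_def)
        then have "\<bar>y $ i - (x $ i + t)\<bar> \<le> 2 * t" for i by (simp add: abs_le_iff) (smt (verit))
        then show "y \<in> cube (x + (\<chi> i. t)) (2 * t)" by (simp add: cube_def)
      qed
      define T where "T = t ^ CARD('n)"
      have T: "0 < T" using t by (simp add: T_def)
      have "C * T * (a / T) powr (1 + e) * b powr (Q - 1) = C * T * (1 / T) powr (1 + e) * (a * b powr (P - 1)) powr (1 + e)"
        unfolding Q1 using ab T by (simp add: powr_mult powr_divide powr_powr)
      also have "\<dots> \<le> C * T * (1 / T) powr (1 + e) * (K * ((2 * t) ^ CARD('n)) powr P) powr (1 + e)"
        using ab C T e by (intro mult_left_mono powr_mono2) auto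
      also have "\<dots> = K' * (T * (1 / T) powr (1 + e) * T powr (P * (1 + e)))"
        using K T t by (simp add: K'_def T_def power_mult_distrib powr_mult powr_powr mult_ac)
      also have "T * (1 / T) powr (1 + e) * T powr (P * (1 + e)) = T powr (1 - (1 + e) + P * (1 + e))"
        using T by (simp add: powr_add powr_diff powr_divide)
      also have "1 - (1 + e) + P * (1 + e) = Q" by (simp add: Q_def algebra_simps)
      finally have "C * T * (a / T) powr (1 + e) * b powr (Q - 1) \<le> K' * T powr Q" .
      moreover have "mass (\<lambda>y. w y powr (1 + e)) (cube x t) \<le> ennreal (C * T * (a / T) powr (1 + e))"
        unfolding T_def by (intro C t ab)
      moreover have "mass (\<lambda>y. (w y powr (1 + e)) powr (- 1 / (Q - 1))) (cube x t) \<le> ennreal b"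
        unfolding ww by (intro order_trans[OF set_nn_integral_mono_set[OF sub] ab(4)])
      moreover have "0 < C * T * (a / T) powr (1 + e)" using C T ab by simp
      ultimately show ?thesis using ab(2) unfolding T_def by blast
    qed
    moreover have "(\<lambda>x. w x powr (1 + e)) \<in> borel_measurable borel" by measurable
    moreover have "0 < w x powr (1 + e)" for x using w[of x] by simp
    moreover have "0 < K'" using C K by (simp add: K'_def)
    ultimately show "cube_Ap ((P - 1) * (1 + e) + 1) (\<lambda>x. w x powr (1 + e))"
      unfolding cube_Ap_def Q_def[symmetric] by blast
  qed
qed

lemma cube_Ap_open:
  fixes w :: "real^'n::finite \<Rightarrow> real"
  assumes P: "1 < P" and Ap: "cube_Ap P w"
  obtains P0 where "1 < P0" "P0 < P" "\<And>Q. P0 \<le> Q \<Longrightarrow> Q < P \<Longrightarrow> cube_Ap Q w"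
proof -
  define P' where "P' = P / (P - 1)"
  have P': "1 < P'" using P by (simp add: P'_def)
  have P1: "P' - 1 = 1 / (P - 1)" using P by (simp add: P'_def field_simps)
  have w: "\<And>x. 0 < w x" using Ap by (auto simp: cube_Ap_def)
  obtain e0 where e0: "0 < e0" and pw: "\<And>e. 0 < e \<Longrightarrow> e \<le> e0 \<Longrightarrow>
     cube_Ap ((P' - 1) * (1 + e) + 1) (\<lambda>x. (w x powr (- 1 / (P - 1))) powr (1 + e))"
    using cube_Ap_powr[OF P' cube_Ap_dual[OF P Ap, folded P'_def]] by blast
  \<comment> \<open>The index that corresponds to the largest admissible exponent e0 in the
    substitution below.\<close>
  define P0 where "P0 = 1 + (P - 1) / (1 + e0)"
  show ?thesis
  proof (rule that[of P0])
    show "1 < P0" using P e0 by (simp add: P0_def)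
    have "(P - 1) / (1 + e0) < (P - 1) / 1" using P e0 by (intro divide_strict_left_mono) auto
    then show "P0 < P" by (simp add: P0_def)
    fix Q assume Q: "P0 \<le> Q" "Q < P"
    have Q1: "1 < Q" using Q \<open>1 < P0\<close> by simp
    \<comment> \<open>For this e the power 1 + e of the dual weight at index P is the dual weight at
      index Q. Membership of that power is then dualised back to w.\<close>
    define e where "e = (P - 1) / (Q - 1) - 1"
    have "0 < e" using Q Q1 by (simp add: e_def)
    moreover have "e \<le> e0"
    proof -
      have "(P - 1) / (1 + e0) \<le> Q - 1" using Q by (simp add: P0_def)
      then have "P - 1 \<le> (Q - 1) * (1 + e0)" using e0 by (simp add: pos_divide_le_eq)
      then have "(P - 1) / (Q - 1) \<le> 1 + e0" using Q1 by (simp add: pos_divide_le_eq mult.commute)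
      then show ?thesis by (simp add: e_def)
    qed
    ultimately have *: "cube_Ap ((P' - 1) * (1 + e) + 1) (\<lambda>x. (w x powr (- 1 / (P - 1))) powr (1 + e))" by (rule pw)
    have 1: "1 + e = (P - 1) / (Q - 1)" by (simp add: e_def)
    have 2: "(P' - 1) * (1 + e) + 1 = Q / (Q - 1)" unfolding 1 P1 using P Q1 by (simp add: field_simps)
    have 3: "(\<lambda>x. (w x powr (- 1 / (P - 1))) powr (1 + e)) = (\<lambda>x. w x powr (- 1 / (Q - 1)))"
      unfolding 1 using P by (simp add: powr_powr)
    have 4: "1 < Q / (Q - 1)" using Q1 by simp
    have 5: "Q / (Q - 1) - 1 = 1 / (Q - 1)" using Q1 by (simp add: field_simps)
    have 6: "Q / (Q - 1) / (Q / (Q - 1) - 1) = Q" unfolding 5 using Q1 by simp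
    have 7: "(\<lambda>x. (w x powr (- 1 / (Q - 1))) powr (- 1 / (Q / (Q - 1) - 1))) = w"
    proof -
      have h: "- 1 / (Q - 1) * (- 1 / (1 / (Q - 1))) = 1" using Q1 by (simp add: divide_simps)
      show ?thesis unfolding 5 powr_powr h using w by (simp add: less_imp_le)
    qed
    show "cube_Ap Q w" using cube_Ap_dual[OF 4 *[unfolded 2 3]] unfolding 6 7 .
  qed
qed

text \<open>At a fixed scale Fubini's theorem replaces the maximal function. The pointwise Hoelder
  bound contains the dual mass near x; by A_P on a doubled cube it is at most a constant divided by
  the w-mass of the cube around y. Integrating over x against w produces that very mass, which
  cancels.\<close>

lemma cube_average_bounded:
  fixes w :: "real^'n::finite \<Rightarrow> real"
  assumes P: "1 < P" and Ap: "cube_Ap P w"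
  obtains C where "0 < C" "\<And>t \<Phi>. 0 < t \<Longrightarrow> \<Phi> \<in> borel_measurable borel \<Longrightarrow>
    eLp_int P w (\<lambda>x. \<integral>\<^sup>+y\<in>cube x t. \<Phi> y \<partial>lborel)
      \<le> ennreal (C * (t ^ CARD('n)) powr P) * eLp_int P w \<Phi>"
proof -
  obtain K where w_meas [measurable]: "w \<in> borel_measurable borel" and w: "\<And>x. 0 < w x" and K: "0 < K"
    and AB: "\<And>x t. 0 < t \<Longrightarrow> Ap_on P K w (cube x t) (t ^ CARD('n))"
    using Ap unfolding cube_Ap_def by blast
  show ?thesis
  proof (rule that[of "K * (2 ^ CARD('n)) powr P"])
    show "0 < K * (2 ^ CARD('n)) powr P" using K by simp
    fix t :: real and \<Phi> :: "real^'n \<Rightarrow> ennreal" assume t: "0 < t" and [measurable]: "\<Phi> \<in> borel_measurable borel"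
    \<comment> \<open>The normalising mass around y; the integration over x reproduces it exactly
      because membership in a cube is symmetric.\<close>
    define V where "V = (\<lambda>y. \<integral>\<^sup>+x. ennreal (w x) * indicator (cube y t) x \<partial>lborel)"
    have [measurable]: "V \<in> borel_measurable borel" unfolding V_def by measurable
    have V0: "V y \<noteq> 0" for y
    proof
      assume "V y = 0"
      then have "AE x in lborel. ennreal (w x) = 0 \<or> x \<notin> cube y t"
        unfolding V_def by (simp add: nn_integral_0_iff_AE indicator_eq_0_iff)
      then have "AE x in lborel. x \<notin> cube y t"
        by eventually_elim (use w in \<open>auto simp: ennreal_eq_0_iff not_le[symmetric]\<close>)
      then have "emeasure lborel (cube y t) = 0" by (subst (asm) AE_iff_measurable[of "cube y t"]) auto
      then have "(2 * t) ^ CARD('n) \<le> 0" using t by (subst (asm) emeasure_cube) (simp_all add: ennreal_eq_0_iff del: power_mult_distrib)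
      moreover have "0 < (2 * t) ^ CARD('n)" using t by (intro zero_less_power) simp
      ultimately show False by linarith
    qed
    have Vtop: "V y \<noteq> \<infinity>" for y
      using AB[OF t, of y] unfolding V_def by (auto simp: top_unique)
    define D where "D = K * ((2 * t) ^ CARD('n)) powr P"
    have D: "0 \<le> D" using K by (simp add: D_def)
    have pt: "epowr (\<integral>\<^sup>+y\<in>cube x t. \<Phi> y \<partial>lborel) P
       \<le> (\<integral>\<^sup>+y. ennreal D * (epowr (\<Phi> y) P * ennreal (w y) * indicator (cube x t) y / V y) \<partial>lborel)" for x
    proof -
      obtain a b where ab: "0 < a" "0 < b"
         "mass w (cube x (2 * t)) \<le> ennreal a"
         "mass (\<lambda>y. w y powr (- 1 / (P - 1))) (cube x (2 * t)) \<le> ennreal b"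
         "a * b powr (P - 1) \<le> D" using AB[of "2 * t" x] t by (auto simp: D_def)
      have "epowr (\<integral>\<^sup>+y\<in>cube x t. \<Phi> y \<partial>lborel) P
        \<le> (\<integral>\<^sup>+y\<in>cube x t. epowr (\<Phi> y) P * ennreal (w y) \<partial>lborel) *
           epowr (mass (\<lambda>y. w y powr (- 1 / (P - 1))) (cube x t)) (P - 1)"
        by (intro nn_integral_weighted_Holder P w) auto
      also have "\<dots> \<le> (\<integral>\<^sup>+y\<in>cube x t. epowr (\<Phi> y) P * ennreal (w y) \<partial>lborel) * epowr (ennreal b) (P - 1)"
        using P t cube_mono[of t "2 * t" x]
        by (intro mult_left_mono epowr_mono order_trans[OF set_nn_integral_mono_set ab(4)]) auto
      also have "\<dots> = (\<integral>\<^sup>+y. epowr (\<Phi> y) P * ennreal (w y) * indicator (cube x t) y * ennreal (b powr (P - 1)) \<partial>lborel)"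
        using ab P by (simp add: epowr_ennreal nn_integral_multc)
      also have "\<dots> \<le> (\<integral>\<^sup>+y. ennreal D * (epowr (\<Phi> y) P * ennreal (w y) * indicator (cube x t) y / V y) \<partial>lborel)"
      proof (intro nn_integral_mono)
        fix y
        show "epowr (\<Phi> y) P * ennreal (w y) * indicator (cube x t) y * ennreal (b powr (P - 1))
          \<le> ennreal D * (epowr (\<Phi> y) P * ennreal (w y) * indicator (cube x t) y / V y)"
        proof (cases "y \<in> cube x t")
          case True
          \<comment> \<open>The cube around y lies in the double cube around x, so the A_P condition
            on the latter couples the mass around y with the dual mass around x.\<close>
          have "cube y t \<subseteq> cube x (2 * t)" using cube_subset_add[OF True, of t] by simp
          then have "V y \<le> ennreal a"
            unfolding V_def by (intro order_trans[OF set_nn_integral_mono_set ab(3)])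
          moreover obtain v where v: "V y = ennreal v" "0 < v" using V0[of y] Vtop[of y] by (cases "V y") (auto simp: less_le)
          ultimately have "v \<le> a" using ab by simp
          then have "v * b powr (P - 1) \<le> D" using ab(5) ab(2) by (meson mult_right_mono order_trans powr_ge_zero)
          then have "b powr (P - 1) \<le> D / v" using v by (simp add: pos_le_divide_eq mult.commute)
          then have "ennreal (b powr (P - 1)) \<le> ennreal D / V y"
            using v D by (simp add: divide_ennreal ennreal_leI)
          then have "epowr (\<Phi> y) P * ennreal (w y) * ennreal (b powr (P - 1)) \<le> epowr (\<Phi> y) P * ennreal (w y) * (ennreal D / V y)"
            by (intro mult_left_mono) auto
          then show ?thesis using True by (simp add: ennreal_times_divide mult_ac)
        qed simp
      qed
      finally show ?thesis .
    qed
    have "eLp_int P w (\<lambda>x. \<integral>\<^sup>+y\<in>cube x t. \<Phi> y \<partial>lborel)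
      \<le> (\<integral>\<^sup>+x. (\<integral>\<^sup>+y. ennreal D * (epowr (\<Phi> y) P * ennreal (w y) * indicator (cube x t) y / V y) \<partial>lborel) * ennreal (w x) \<partial>lborel)"
      by (intro nn_integral_mono mult_right_mono pt) auto
    also have "\<dots> = (\<integral>\<^sup>+x. (\<integral>\<^sup>+y. ennreal D * (epowr (\<Phi> y) P * ennreal (w y) * indicator (cube x t) y / V y) * ennreal (w x) \<partial>lborel) \<partial>lborel)"
      by (intro nn_integral_cong nn_integral_multc[symmetric]) measurable
    also have "\<dots> = (\<integral>\<^sup>+y. (\<integral>\<^sup>+x. ennreal D * (epowr (\<Phi> y) P * ennreal (w y) * indicator (cube x t) y / V y) * ennreal (w x) \<partial>lborel) \<partial>lborel)"
      by (intro lborel_pair.Fubini'[symmetric]) measurable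
    also have "\<dots> = (\<integral>\<^sup>+y. ennreal D * (epowr (\<Phi> y) P * ennreal (w y)) \<partial>lborel)"
    proof (intro nn_integral_cong)
      fix y
      have "(\<integral>\<^sup>+x. ennreal D * (epowr (\<Phi> y) P * ennreal (w y) * indicator (cube x t) y / V y) * ennreal (w x) \<partial>lborel)
        = (\<integral>\<^sup>+x. ennreal D * (epowr (\<Phi> y) P * ennreal (w y)) / V y * (ennreal (w x) * indicator (cube y t) x) \<partial>lborel)"
        by (intro nn_integral_cong) (auto simp: ennreal_times_divide mult_ac indicator_def mem_cube_commute)
      also have "\<dots> = ennreal D * (epowr (\<Phi> y) P * ennreal (w y)) / V y * V y"
        unfolding V_def by (intro nn_integral_cmult) measurable
      also have "\<dots> = ennreal D * (epowr (\<Phi> y) P * ennreal (w y))"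
        using V0[of y] Vtop[of y] by (simp add: ennreal_divide_times ennreal_times_divide[symmetric] ennreal_divide_self mult.assoc top.not_eq_extremum)
      finally show "(\<integral>\<^sup>+x. ennreal D * (epowr (\<Phi> y) P * ennreal (w y) * indicator (cube x t) y / V y) * ennreal (w x) \<partial>lborel)
        = ennreal D * (epowr (\<Phi> y) P * ennreal (w y))" .
    qed
    also have "\<dots> = ennreal D * eLp_int P w \<Phi>" by (intro nn_integral_cmult) measurable
    also have "D = K * (2 ^ CARD('n)) powr P * (t ^ CARD('n)) powr P"
      using t by (simp add: D_def power_mult_distrib powr_mult)
    finally show "eLp_int P w (\<lambda>x. \<integral>\<^sup>+y\<in>cube x t. \<Phi> y \<partial>lborel)
      \<le> ennreal (K * (2 ^ CARD('n)) powr P * (t ^ CARD('n)) powr P) * eLp_int P w \<Phi>" .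
  qed
qed

text \<open>The majorant of \<open>1 / growth\<close> turns the operator into a series of averages
  over cubes of half side 2^k / l. Cube averages are bounded uniformly in the scale and the
  coefficients times volumes are summable, so the dependence on l is that of the volume
  alone.\<close>

lemma growth_average_bounded:
  fixes w :: "real^'n::finite \<Rightarrow> real"
  assumes P: "1 < P" and Ap: "cube_Ap P w"
  obtains C where "0 < C" "\<And>l \<Phi>. 0 < l \<Longrightarrow> \<Phi> \<in> borel_measurable borel \<Longrightarrow>
    eLp_int P w (\<lambda>x. \<integral>\<^sup>+y. ennreal (1 / growth (l *\<^sub>R (x - y))) * \<Phi> y \<partial>lborel)
      \<le> ennreal (C * (1 / l ^ CARD('n)) powr P) * eLp_int P w \<Phi>"
proof -
  have [measurable]: "w \<in> borel_measurable borel" and w: "\<And>x. 0 < w x" using Ap by (auto simp: cube_Ap_def)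
  obtain C where C: "0 < C" "\<And>t \<Phi>. 0 < t \<Longrightarrow> \<Phi> \<in> borel_measurable borel \<Longrightarrow>
    eLp_int P w (\<lambda>x. \<integral>\<^sup>+y\<in>cube x t. \<Phi> y \<partial>lborel)
      \<le> ennreal (C * (t ^ CARD('n)) powr P) * eLp_int P w \<Phi>"
    using cube_average_bounded[OF P Ap] by blast
  define c where "c = growth_coeff TYPE('n)"
  define d where "d = (\<lambda>k. c k * (2 * 2 ^ k) ^ CARD('n))"
  have c: "0 < c k" for k by (simp add: c_def growth_coeff_pos)
  have d: "0 < d k" for k using c by (simp add: d_def)
  have sd: "summable d" unfolding d_def c_def by (rule summable_growth_coeff_volume)
  define D where "D = (\<Sum>k. d k)"
  have D: "0 < D" unfolding D_def by (intro suminf_pos sd d)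
  show ?thesis
  proof (rule that[of "D powr (P - 1) * (D * C)"])
    show "0 < D powr (P - 1) * (D * C)" using D C by simp
    fix l :: real and \<Phi> :: "real^'n \<Rightarrow> ennreal" assume l: "0 < l" and [measurable]: "\<Phi> \<in> borel_measurable borel"
    define I where "I = eLp_int P w \<Phi>"
    define Y where "Y = (\<lambda>k x. \<integral>\<^sup>+y\<in>cube x (2 ^ k / l). \<Phi> y \<partial>lborel)"
    have [measurable]: "Y k \<in> borel_measurable borel" for k unfolding Y_def by measurable
    \<comment> \<open>Dividing by the volume moves it into the coefficient, so Jensen's inequality
      runs with the summable weights \<open>d\<close> and with normalised averages.\<close>
    define r where "r = (\<lambda>k. 1 / (2 * 2 ^ k :: real) ^ CARD('n))"
    have r: "0 < r k" "c k = d k * r k" for k by (auto simp: r_def d_def)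
    have pt: "(\<integral>\<^sup>+y. ennreal (1 / growth (l *\<^sub>R (x - y))) * \<Phi> y \<partial>lborel) \<le> (\<Sum>k. ennreal (d k) * (ennreal (r k) * Y k x))" for x
    proof -
      have "(\<integral>\<^sup>+y. ennreal (1 / growth (l *\<^sub>R (x - y))) * \<Phi> y \<partial>lborel)
        \<le> (\<integral>\<^sup>+y. (\<Sum>k. ennreal (c k) * (\<Phi> y * indicator (cube x (2 ^ k / l)) y)) \<partial>lborel)"
      proof (intro nn_integral_mono)
        fix y
        have "ennreal (1 / growth (l *\<^sub>R (x - y))) * \<Phi> y \<le> (\<Sum>k. ennreal (c k) * indicator (cube 0 (2 ^ k)) (l *\<^sub>R (x - y))) * \<Phi> y"
          unfolding c_def by (intro mult_right_mono inverse_growth_le) auto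
        also have "\<dots> = (\<Sum>k. ennreal (c k) * indicator (cube 0 (2 ^ k)) (l *\<^sub>R (x - y)) * \<Phi> y)" by (rule ennreal_suminf_multc[symmetric])
        also have "\<dots> = (\<Sum>k. ennreal (c k) * (\<Phi> y * indicator (cube x (2 ^ k / l)) y))"
          by (simp add: indicator_def mem_cube_scale[OF l] mult_ac)
        finally show "ennreal (1 / growth (l *\<^sub>R (x - y))) * \<Phi> y \<le> (\<Sum>k. ennreal (c k) * (\<Phi> y * indicator (cube x (2 ^ k / l)) y))" .
      qed
      also have "\<dots> = (\<Sum>k. \<integral>\<^sup>+y. ennreal (c k) * (\<Phi> y * indicator (cube x (2 ^ k / l)) y) \<partial>lborel)"
        by (intro nn_integral_suminf) measurable
      also have "\<dots> = (\<Sum>k. ennreal (c k) * Y k x)"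
        unfolding Y_def by (intro suminf_cong nn_integral_cmult) measurable
      also have "\<dots> = (\<Sum>k. ennreal (d k) * (ennreal (r k) * Y k x))"
        using d r(1) unfolding r(2) by (simp add: ennreal_mult less_imp_le mult.assoc)
      finally show ?thesis .
    qed
    have "eLp_int P w (\<lambda>x. \<integral>\<^sup>+y. ennreal (1 / growth (l *\<^sub>R (x - y))) * \<Phi> y \<partial>lborel)
      \<le> eLp_int P w (\<lambda>x. \<Sum>k. ennreal (d k) * (ennreal (r k) * Y k x))"
      using P by (intro nn_integral_mono mult_right_mono epowr_mono pt) auto
    also have "\<dots> \<le> (\<integral>\<^sup>+x. ennreal (D powr (P - 1)) * (\<Sum>k. ennreal (d k) * epowr (ennreal (r k) * Y k x) P) * ennreal (w x) \<partial>lborel)"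
      unfolding D_def by (intro nn_integral_mono mult_right_mono epowr_suminf_le P d sd) auto
    also have "\<dots> = (\<integral>\<^sup>+x. ennreal (D powr (P - 1)) * (\<Sum>k. ennreal (d k * r k powr P) * (epowr (Y k x) P * ennreal (w x))) \<partial>lborel)"
    proof (intro nn_integral_cong)
      fix x
      have "ennreal (d k) * epowr (ennreal (r k) * Y k x) P = ennreal (d k * r k powr P) * epowr (Y k x) P" for k
        using P d[of k] r(1)[of k] by (simp add: epowr_mult epowr_ennreal ennreal_mult less_imp_le mult.assoc)
      then have "(\<Sum>k. ennreal (d k) * epowr (ennreal (r k) * Y k x) P) * ennreal (w x) = (\<Sum>k. ennreal (d k * r k powr P) * (epowr (Y k x) P * ennreal (w x)))"
        by (simp add: ennreal_suminf_multc[symmetric] mult.assoc)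
      then show "ennreal (D powr (P - 1)) * (\<Sum>k. ennreal (d k) * epowr (ennreal (r k) * Y k x) P) * ennreal (w x)
        = ennreal (D powr (P - 1)) * (\<Sum>k. ennreal (d k * r k powr P) * (epowr (Y k x) P * ennreal (w x)))" by (simp add: mult.assoc)
    qed
    also have "\<dots> = ennreal (D powr (P - 1)) * (\<integral>\<^sup>+x. (\<Sum>k. ennreal (d k * r k powr P) * (epowr (Y k x) P * ennreal (w x))) \<partial>lborel)"
      by (intro nn_integral_cmult) measurable
    also have "\<dots> = ennreal (D powr (P - 1)) * (\<Sum>k. \<integral>\<^sup>+x. ennreal (d k * r k powr P) * (epowr (Y k x) P * ennreal (w x)) \<partial>lborel)"
      by (intro arg_cong2[where f="(*)"] refl nn_integral_suminf) measurable
    also have "\<dots> = ennreal (D powr (P - 1)) * (\<Sum>k. ennreal (d k * r k powr P) * eLp_int P w (Y k))"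
      by (intro arg_cong2[where f="(*)"] refl suminf_cong nn_integral_cmult) measurable
    also have "\<dots> \<le> ennreal (D powr (P - 1)) * (\<Sum>k. ennreal (d k * r k powr P) * (ennreal (C * ((2 ^ k / l) ^ CARD('n)) powr P) * I))"
      unfolding Y_def I_def using l by (intro mult_left_mono suminf_le C) auto
    also have "\<dots> \<le> ennreal (D powr (P - 1)) * (\<Sum>k. ennreal (d k) * (ennreal (C * (1 / l ^ CARD('n)) powr P) * I))"
    proof (intro mult_left_mono suminf_le)
      fix k
      have "r k powr P * ((2 ^ k / l) ^ CARD('n)) powr P = (r k * (2 ^ k / l) ^ CARD('n)) powr P"
        by (simp add: powr_mult)
      also have "\<dots> \<le> (1 / l ^ CARD('n)) powr P"
      proof (intro powr_mono2)
        have "(1/2::real) ^ CARD('n) \<le> 1" by (intro power_le_one) auto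
        then show "r k * (2 ^ k / l) ^ CARD('n) \<le> 1 / l ^ CARD('n)"
          using l by (simp add: r_def power_mult_distrib power_divide divide_simps)
      qed (use P r(1)[of k] l in auto)
      finally have "d k * r k powr P * (C * ((2 ^ k / l) ^ CARD('n)) powr P) \<le> d k * (C * (1 / l ^ CARD('n)) powr P)"
        using d[of k] C(1) by (simp add: mult.assoc mult.left_commute[of _ C])
      then have "ennreal (d k * r k powr P) * ennreal (C * ((2 ^ k / l) ^ CARD('n)) powr P) \<le> ennreal (d k) * ennreal (C * (1 / l ^ CARD('n)) powr P)"
        using d[of k] C(1) by (simp add: ennreal_mult[symmetric] less_imp_le ennreal_leI)
      then have "ennreal (d k * r k powr P) * ennreal (C * ((2 ^ k / l) ^ CARD('n)) powr P) * I \<le> ennreal (d k) * ennreal (C * (1 / l ^ CARD('n)) powr P) * I"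
        by (rule mult_right_mono) auto
      then show "ennreal (d k * r k powr P) * (ennreal (C * ((2 ^ k / l) ^ CARD('n)) powr P) * I) \<le> ennreal (d k) * (ennreal (C * (1 / l ^ CARD('n)) powr P) * I)"
        by (simp add: mult.assoc)
    qed auto
    also have "(\<Sum>k. ennreal (d k) * (ennreal (C * (1 / l ^ CARD('n)) powr P) * I)) = ennreal D * (ennreal (C * (1 / l ^ CARD('n)) powr P) * I)"
      using sd d by (simp add: ennreal_suminf_multc suminf_ennreal2 less_imp_le D_def)
    also have "ennreal (D powr (P - 1)) * \<dots> = ennreal (D powr (P - 1) * (D * C) * (1 / l ^ CARD('n)) powr P) * I"
      using D C by (simp add: ennreal_mult less_imp_le mult.assoc)
    finally show "eLp_int P w (\<lambda>x. \<integral>\<^sup>+y. ennreal (1 / growth (l *\<^sub>R (x - y))) * \<Phi> y \<partial>lborel)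
      \<le> ennreal (D powr (P - 1) * (D * C) * (1 / l ^ CARD('n)) powr P) * eLp_int P w \<Phi>"
      unfolding I_def .
  qed
qed

section \<open>From balls to cubes\<close>

lemma pred_ball [measurable]:
  "Measurable.pred borel (\<lambda>x :: 'a::euclidean_space. x \<in> ball c r)"
  "Measurable.pred lebesgue (\<lambda>x :: 'a::euclidean_space. x \<in> ball c r)"
  by (simp_all only: pred_def Collect_mem_eq) simp_all

lemma weight_measurable:
  assumes "weight (w :: real^'n::finite \<Rightarrow> real)"
  shows "w \<in> borel_measurable lebesgue"
proof (rule borel_measurable_LIMSEQ_real)
  show "(\<lambda>x. indicator (cball 0 (real k)) x * w x) \<in> borel_measurable lebesgue" for k
  proof -
    have "set_integrable lebesgue (cball 0 (real k)) w"
      using assms by (auto simp: weight_def)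
    then show ?thesis by (auto simp: set_integrable_def dest: borel_measurable_integrable)
  qed
  show "(\<lambda>k. indicator (cball 0 (real k)) x * w x) \<longlonglongrightarrow> w x" for x
  proof (rule tendsto_eventually)
    obtain N :: nat where "norm x \<le> real N" using real_arch_simple by blast
    then show "\<forall>\<^sub>F k in sequentially. indicator (cball 0 (real k)) x * w x = w x"
      by (intro eventually_sequentiallyI[of N]) (auto simp: indicator_def)
  qed
qed

text \<open>The bridge from the Lebesgue integrals of the definitions to the Borel measure used in
  all estimates, where product measurability and Fubini's theorem are available.\<close>

lemma nn_integral_lebesgue_version:
  assumes [measurable]: "f \<in> borel_measurable borel" and "AE x in lebesgue. g x = f x"
  shows "(\<integral>\<^sup>+x. g x \<partial>lebesgue) = (\<integral>\<^sup>+x. f x \<partial>lborel)"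
proof -
  have "(\<integral>\<^sup>+x. g x \<partial>lebesgue) = (\<integral>\<^sup>+x. f x \<partial>lebesgue)" using assms(2) by (rule nn_integral_cong_AE)
  then show ?thesis by (simp add: nn_integral_completion)
qed

lemma set_nn_integral_pos:
  fixes f :: "real^'n::finite \<Rightarrow> real"
  assumes [measurable]: "f \<in> borel_measurable borel" and f: "\<And>x. 0 < f x" and r: "0 < r"
  shows "mass f (ball c r) \<noteq> 0"
proof
  assume "mass f (ball c r) = 0"
  then have "AE x in lborel. ennreal (f x) = 0 \<or> x \<notin> ball c r"
    by (simp add: nn_integral_0_iff_AE indicator_eq_0_iff del: mem_ball)
  then have "AE x in lborel. x \<notin> ball c r"
    by eventually_elim (use f in \<open>auto simp: ennreal_eq_0_iff not_le[symmetric]\<close>)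
  then have "emeasure lborel (ball c r) = 0" by (subst (asm) AE_iff_measurable[of "ball c r"]) auto
  moreover have "0 < unit_ball_vol (real CARD('n)) * r ^ CARD('n)" using r by simp
  ultimately show False using r by (simp add: emeasure_ball ennreal_eq_0_iff)
qed

text \<open>Since a negative power of 0 is infinite, finiteness of the characteristic forces w to be
  positive almost everywhere on each ball with positive mass. A weight that does not vanish almost
  everywhere has positive mass on all large balls, and these exhaust the space. Hence both masses of
  the version are finite and positive on every ball.\<close>

lemma Ap_version:
  fixes w :: "real^'n::finite \<Rightarrow> real"
  assumes P: "1 < P" and w: "w \<in> Ap P" and nz: "\<not> (AE x in lebesgue. w x = 0)"
  obtains w' K where "w' \<in> borel_measurable borel" "\<And>x. 0 < w' x" "AE x in lebesgue. w x = w' x" "0 < K"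
    "\<And>x r. 0 < r \<Longrightarrow> \<exists>a b. 0 < a \<and> 0 < b \<and> mass w' (ball x r) = ennreal a \<and>
      mass (\<lambda>y. w' y powr (- 1 / (P - 1))) (ball x r) = ennreal b \<and>
      a * b powr (P - 1) \<le> K * (r ^ CARD('n)) powr P"
proof -
  define n where "n = CARD('n)"
  define s where "s = 1 / (P - 1)"
  have s: "0 < s" "1 - conj_exp P = - s" using P by (auto simp: s_def conj_exp_def field_simps)
  have ww: "weight w" and fin: "Ap_const P w < \<infinity>" using w by (auto simp: Ap_def)
  have w0: "0 \<le> w x" for x using ww by (simp add: weight_def)
  have wm [measurable]: "w \<in> borel_measurable lebesgue" by (rule weight_measurable[OF ww])
  define A where "A = (\<lambda>B. \<integral>\<^sup>+x\<in>B. ennreal (w x) \<partial>lebesgue)"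
  define S where "S = (\<lambda>B. \<integral>\<^sup>+x\<in>B. epowr (ennreal (w x)) (- s) \<partial>lebesgue)"
  define V where "V = (\<lambda>r. unit_ball_vol (real n) * r ^ n)"
  have V: "0 < V r" "emeasure lebesgue (ball x r) = ennreal (V r)" if "0 < r" for r and x :: "real^'n"
    using that by (auto simp: V_def n_def emeasure_ball)
  obtain K where K: "Ap_const P w = ennreal K" "0 \<le> K" using fin by (cases "Ap_const P w") auto
  have bound: "A (ball x r) / ennreal (V r) * epowr (S (ball x r) / ennreal (V r)) (P - 1) \<le> ennreal K" if r: "0 < r" for x r
  proof -
    have "ball x r \<in> balls" using r by (auto simp: balls_def)
    then have "ball_avg (ball x r) (\<lambda>x. ennreal (w x)) * epowr (ball_avg (ball x r) (\<lambda>x. epowr (ennreal (w x)) (1 - conj_exp P))) (P - 1) \<le> Ap_const P w"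
      unfolding Ap_const_def by (rule SUP_upper)
    then show ?thesis unfolding ball_avg_def V(2)[OF r] s(2) K(1) A_def S_def .
  qed
  have Ainf: "A (ball x r) < \<infinity>" for x r
  proof -
    have "set_integrable lebesgue (cball x r) w" using ww by (auto simp: weight_def)
    then have "(\<integral>\<^sup>+y. norm (indicator (cball x r) y *\<^sub>R w y) \<partial>lebesgue) < \<infinity>"
      by (simp add: set_integrable_def integrable_iff_bounded)
    moreover have "A (ball x r) \<le> (\<integral>\<^sup>+y. norm (indicator (cball x r) y *\<^sub>R w y) \<partial>lebesgue)"
      unfolding A_def using w0 by (intro nn_integral_mono) (auto simp: indicator_def)
    ultimately show ?thesis by (rule le_less_trans[rotated])
  qed
  obtain R :: nat where R: "A (ball 0 (real R)) \<noteq> 0"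
  proof (rule ccontr)
    assume "\<not> thesis"
    then have "A (ball 0 (real R)) = 0" for R :: nat using that by blast
    then have "AE x in lebesgue. x \<in> ball 0 (real R) \<longrightarrow> w x = 0" for R :: nat
    proof -
      have "(\<lambda>x. ennreal (w x) * indicator (ball 0 (real R)) x) \<in> borel_measurable lebesgue" by measurable
      then have "AE x in lebesgue. ennreal (w x) * indicator (ball 0 (real R)) x = 0"
        using \<open>A (ball 0 (real R)) = 0\<close> unfolding A_def by (simp add: nn_integral_0_iff_AE)
      then show ?thesis by eventually_elim (use w0 in \<open>auto simp: indicator_def ennreal_eq_0_iff antisym\<close>)
    qed
    then have "AE x in lebesgue. \<forall>R::nat. x \<in> ball 0 (real R) \<longrightarrow> w x = 0" by (subst AE_all_countable) blast
    then have "AE x in lebesgue. w x = 0"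
    proof eventually_elim
      fix x assume *: "\<forall>R::nat. x \<in> ball 0 (real R) \<longrightarrow> w x = 0"
      obtain R :: nat where "norm x < real R" using reals_Archimedean2 by blast
      then have "x \<in> ball 0 (real R)" by simp
      then show "w x = 0" using * by blast
    qed
    then show False using nz by simp
  qed
  \<comment> \<open>An infinite dual average times a nonzero average would be infinite, against the
    finite characteristic.\<close>
  have Sfin: "S (ball x r) < \<infinity>" if "0 < r" "A (ball x r) \<noteq> 0" for x r
  proof (rule ccontr)
    assume "\<not> S (ball x r) < \<infinity>"
    then have "S (ball x r) = \<infinity>" by (cases "S (ball x r)") auto
    then have "epowr (S (ball x r) / ennreal (V r)) (P - 1) = \<infinity>"
      using P by (simp add: ennreal_top_divide)
    moreover have "A (ball x r) / ennreal (V r) \<noteq> 0" using that V[of r] by (simp add: ennreal_divide_eq_0_iff)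
    ultimately show False using bound[OF that(1), of x] by (simp add: ennreal_mult_top top_unique)
  qed
  have big: "A (ball 0 (real k)) \<noteq> 0" if "R \<le> k" for k :: nat
  proof -
    have "A (ball 0 (real R)) \<le> A (ball 0 (real k))"
      unfolding A_def using that by (intro set_nn_integral_mono_set) auto
    then show ?thesis using R by auto
  qed
  have sm: "(\<lambda>x. epowr (ennreal (w x)) (- s)) \<in> borel_measurable lebesgue"
    by (rule measurable_compose[OF _ epowr_measurable]) simp
  have pos: "AE x in lebesgue. 0 < w x"
  proof -
    have "AE x in lebesgue. x \<in> ball 0 (real (R + Suc k)) \<longrightarrow> 0 < w x" for k
    proof -
      have fin: "(\<integral>\<^sup>+x. epowr (ennreal (w x)) (- s) * indicator (ball 0 (real (R + Suc k))) x \<partial>lebesgue) \<noteq> \<infinity>"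
        using Sfin[of "real (R + Suc k)" 0] big[of "R + Suc k"] unfolding S_def by auto
      have "(\<lambda>x. epowr (ennreal (w x)) (- s) * indicator (ball 0 (real (R + Suc k))) x) \<in> borel_measurable lebesgue"
        using sm by measurable
      from nn_integral_noteq_infinite[OF this fin]
      show ?thesis
      proof eventually_elim
        fix x assume "epowr (ennreal (w x)) (- s) * indicator (ball 0 (real (R + Suc k))) x \<noteq> \<infinity>"
        then show "x \<in> ball 0 (real (R + Suc k)) \<longrightarrow> 0 < w x"
          using w0[of x] s(1) by (cases "w x = 0") (auto simp: epowr_def)
      qed
    qed
    then have "AE x in lebesgue. \<forall>k. x \<in> ball 0 (real (R + Suc k)) \<longrightarrow> 0 < w x" by (subst AE_all_countable) blast
    then show ?thesis
    proof eventually_elim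
      fix x assume *: "\<forall>k. x \<in> ball 0 (real (R + Suc k)) \<longrightarrow> 0 < w x"
      obtain k :: nat where "norm x < real k" using reals_Archimedean2 by blast
      then have "x \<in> ball 0 (real (R + Suc k))" by simp
      then show "0 < w x" using * by blast
    qed
  qed
  obtain w1 where w1 [measurable]: "w1 \<in> borel_measurable lborel" and "AE x in lborel. w x = w1 x"
    using completion_ex_borel_measurable_real[OF wm] by blast
  then have ae1: "AE x in lebesgue. w x = w1 x" by (simp add: AE_completion_iff AE_completion)
  \<comment> \<open>The value 1 is arbitrary; it is taken on a null set only.\<close>
  define w' where "w' = (\<lambda>x. if 0 < w1 x then w1 x else 1)"
  have w'm [measurable]: "w' \<in> borel_measurable borel"
    using w1 unfolding w'_def by simp
  have w'pos: "0 < w' x" for x by (simp add: w'_def)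
  have ae: "AE x in lebesgue. w x = w' x"
    using ae1 pos by eventually_elim (simp add: w'_def)
  have A': "A (ball x r) = mass w' (ball x r)" for x r
    unfolding A_def using ae by (intro nn_integral_lebesgue_version) (measurable, auto elim: eventually_mono)
  have S': "S (ball x r) = mass (\<lambda>y. w' y powr (- 1 / (P - 1))) (ball x r)" for x r
    unfolding S_def
  proof (rule nn_integral_lebesgue_version)
    show "AE y in lebesgue. epowr (ennreal (w y)) (- s) * indicator (ball x r) y = ennreal (w' y powr (- 1 / (P - 1))) * indicator (ball x r) y"
      using ae
    proof eventually_elim
      fix y assume y: "w y = w' y"
      have "epowr (ennreal (w y)) (- s) = ennreal (w' y powr (- s))"
        using w'pos[of y] s(1) unfolding y by (simp add: epowr_def ennreal_eq_0_iff)
      then show "epowr (ennreal (w y)) (- s) * indicator (ball x r) y = ennreal (w' y powr (- 1 / (P - 1))) * indicator (ball x r) y"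
        by (simp add: s_def)
    qed
  qed measurable
  show ?thesis
  proof (rule that[OF w'm w'pos ae])
    define K' where "K' = (K + 1) * (unit_ball_vol (real n)) powr P"
    have "unit_ball_vol (real n) \<noteq> 0" using unit_ball_vol_pos[of "real n"] by linarith
    then show "0 < K'" using K unfolding K'_def by (intro mult_pos_pos) auto
    fix x r assume r: "0 < (r::real)"
    have A0: "A (ball x r) \<noteq> 0" unfolding A' by (intro set_nn_integral_pos r w'pos) simp
    have S0: "S (ball x r) \<noteq> 0" unfolding S' by (intro set_nn_integral_pos r) (auto simp: w'pos less_imp_neq[THEN not_sym])
    obtain a where a: "A (ball x r) = ennreal a" "0 < a" using Ainf[of x r] A0 by (cases "A (ball x r)") (auto simp: less_le)
    obtain b where b: "S (ball x r) = ennreal b" "0 < b" using Sfin[OF r A0] S0 by (cases "S (ball x r)") (auto simp: less_le)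
    have "a / V r * (b / V r) powr (P - 1) \<le> K"
      using bound[OF r, of x] a b V(1)[OF r] P K(2)
      by (simp add: divide_ennreal epowr_ennreal ennreal_mult[symmetric])
    then have "a * b powr (P - 1) \<le> K * (V r * V r powr (P - 1))"
      using V(1)[OF r] by (simp add: powr_divide field_simps)
    also have "V r * V r powr (P - 1) = V r powr P" using V(1)[OF r] by (simp add: powr_diff)
    also have "K * V r powr P \<le> K' * (r ^ CARD('n)) powr P"
      using r by (simp add: K'_def V_def n_def powr_mult mult.assoc mult_right_mono)
    finally show "\<exists>a b. 0 < a \<and> 0 < b \<and> mass w' (ball x r) = ennreal a \<and>
      mass (\<lambda>y. w' y powr (- 1 / (P - 1))) (ball x r) = ennreal b \<and>
      a * b powr (P - 1) \<le> K' * (r ^ CARD('n)) powr P"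
      using a b unfolding A' S' by blast
  qed
qed

lemma cube_subset_ball:
  assumes "0 < t" shows "cube (x :: real^'n::finite) t \<subseteq> ball x (t * (real CARD('n) + 1))"
proof
  fix y assume y: "y \<in> cube x t"
  have "dist x y = norm (y - x)" by (simp add: dist_norm norm_minus_commute)
  also have "\<dots> \<le> (\<Sum>i\<in>UNIV. \<bar>(y - x) $ i\<bar>)" by (rule norm_le_l1_cart)
  also have "\<dots> \<le> (\<Sum>i\<in>(UNIV::'n set). t)" using y by (intro sum_mono) (simp add: cube_def)
  also have "\<dots> < t * (real CARD('n) + 1)" using assms by (simp add: algebra_simps)
  finally show "y \<in> ball x (t * (real CARD('n) + 1))" by simp
qed

text \<open>A cube lies in a concentric ball of comparable volume, so the passage costs a
  dimensional factor.\<close>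

lemma Ap_imp_cube_Ap:
  fixes w :: "real^'n::finite \<Rightarrow> real"
  assumes P: "1 < P" and w: "w \<in> Ap P" and nz: "\<not> (AE x in lebesgue. w x = 0)"
  obtains w' where "AE x in lebesgue. w x = w' x" "cube_Ap P w'"
proof -
  obtain w' K where w' [measurable]: "w' \<in> borel_measurable borel" and pos: "\<And>x. 0 < w' x" and ae: "AE x in lebesgue. w x = w' x" and K: "0 < K"
    and AB: "\<And>x r. 0 < r \<Longrightarrow> \<exists>a b. 0 < a \<and> 0 < b \<and> mass w' (ball x r) = ennreal a \<and>
      mass (\<lambda>y. w' y powr (- 1 / (P - 1))) (ball x r) = ennreal b \<and>
      a * b powr (P - 1) \<le> K * (r ^ CARD('n)) powr P"
    using Ap_version[OF assms] by blast
  have "Ap_on P (K * ((real CARD('n) + 1) ^ CARD('n)) powr P) w' (cube x t) (t ^ CARD('n))" if t: "0 < t" for x t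
  proof -
    define r where "r = t * (real CARD('n) + 1)"
    have r: "0 < r" "cube x t \<subseteq> ball x r" using t cube_subset_ball[OF t] by (auto simp: r_def)
    obtain a b where ab: "0 < a" "0 < b" "mass w' (ball x r) = ennreal a"
      "mass (\<lambda>y. w' y powr (- 1 / (P - 1))) (ball x r) = ennreal b"
      "a * b powr (P - 1) \<le> K * (r ^ CARD('n)) powr P" using AB[OF r(1), of x] by blast
    have "a * b powr (P - 1) \<le> K * ((real CARD('n) + 1) ^ CARD('n)) powr P * (t ^ CARD('n)) powr P"
      using ab(5) t by (simp add: r_def power_mult_distrib powr_mult mult_ac)
    then show ?thesis using ab(1,2) unfolding ab(3,4)[symmetric]
      by (intro exI[of _ a] exI[of _ b] conjI) (auto simp: ab(3,4)[symmetric] intro!: set_nn_integral_mono_set r(2))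
  qed
  moreover have "0 < K * ((real CARD('n) + 1) ^ CARD('n)) powr P" using K by simp
  ultimately have "cube_Ap P w'" unfolding cube_Ap_def using w' pos by blast
  then show ?thesis using that ae by blast
qed

text \<open>The Johnson--Neugebauer correspondence: at index \<sigma> (P - 1) + 1 the weight
  w^\<sigma> has the same dual weight as w at index P, and the reverse Hoelder condition bounds the
  mass of w^\<sigma> by that of w.\<close>

lemma Ap_RHp_imp_cube_Ap:
  fixes w :: "real^'n::finite \<Rightarrow> real"
  assumes P: "1 < P" and \<sigma>: "1 < \<sigma>" and w: "w \<in> Ap P" and RH: "w \<in> RHp \<sigma>" and nz: "\<not> (AE x in lebesgue. w x = 0)"
  obtains w' where "AE x in lebesgue. w x = w' x" "\<And>x. 0 < w' x" "w' \<in> borel_measurable borel"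
    "cube_Ap (\<sigma> * (P - 1) + 1) (\<lambda>x. w' x powr \<sigma>)"
proof -
  obtain w' K where w' [measurable]: "w' \<in> borel_measurable borel" and pos: "\<And>x. 0 < w' x" and ae: "AE x in lebesgue. w x = w' x" and K: "0 < K"
    and AB: "\<And>x r. 0 < r \<Longrightarrow> \<exists>a b. 0 < a \<and> 0 < b \<and> mass w' (ball x r) = ennreal a \<and>
      mass (\<lambda>y. w' y powr (- 1 / (P - 1))) (ball x r) = ennreal b \<and>
      a * b powr (P - 1) \<le> K * (r ^ CARD('n)) powr P"
    using Ap_version[OF P w nz] by blast
  define n where "n = CARD('n)"
  define Q where "Q = \<sigma> * (P - 1) + 1"
  have Q1: "Q - 1 = \<sigma> * (P - 1)" by (simp add: Q_def)
  have ww: "(w' y powr \<sigma>) powr (- 1 / (Q - 1)) = w' y powr (- 1 / (P - 1))" for y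
    unfolding Q1 powr_powr using \<sigma> by simp
  define V where "V = (\<lambda>r. unit_ball_vol (real n) * r ^ n)"
  have V: "0 < V r" "emeasure lebesgue (ball x r) = ennreal (V r)" if "0 < r" for r and x :: "real^'n"
    using that by (auto simp: V_def n_def emeasure_ball)
  have fin: "RHp_const \<sigma> w < \<infinity>" using RH by (auto simp: RHp_def)
  obtain L where L: "RHp_const \<sigma> w = ennreal L" "0 \<le> L" using fin by (cases "RHp_const \<sigma> w") auto
  have Lb: "mass (\<lambda>y. w' y powr \<sigma>) (ball x r) \<le> ennreal (V r * ((L + 1) * (a / V r)) powr \<sigma>)"
    if r: "0 < r" and a: "mass w' (ball x r) = ennreal a" "0 < a" for x r a
  proof -
    have "ball x r \<in> balls" using r by (auto simp: balls_def)
    then have *: "inverse (ball_avg (ball x r) (\<lambda>x. ennreal (w x))) * epowr (ball_avg (ball x r) (\<lambda>x. epowr (ennreal (w x)) \<sigma>)) (1 / \<sigma>) \<le> ennreal L"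
      unfolding L(1)[symmetric] RHp_const_def by (rule SUP_upper)
    have 1: "(\<integral>\<^sup>+y\<in>ball x r. ennreal (w y) \<partial>lebesgue) = ennreal a"
      unfolding a(1)[symmetric] using ae by (intro nn_integral_lebesgue_version) (measurable, auto elim: eventually_mono)
    have 2: "(\<integral>\<^sup>+y\<in>ball x r. epowr (ennreal (w y)) \<sigma> \<partial>lebesgue) = mass (\<lambda>y. w' y powr \<sigma>) (ball x r)"
    proof (rule nn_integral_lebesgue_version)
      show "AE y in lebesgue. epowr (ennreal (w y)) \<sigma> * indicator (ball x r) y = ennreal (w' y powr \<sigma>) * indicator (ball x r) y"
        using ae by eventually_elim (use \<sigma> pos in \<open>simp add: epowr_ennreal less_imp_le\<close>)
    qed measurable
    define I where "I = mass (\<lambda>y. w' y powr \<sigma>) (ball x r)"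
    have *: "inverse (ennreal (a / V r)) * epowr (I / ennreal (V r)) (1 / \<sigma>) \<le> ennreal L"
      using * V(1)[OF r] a(2) unfolding ball_avg_def V(2)[OF r] 1 2 I_def[symmetric] by (simp add: divide_ennreal)
    have inv: "inverse (ennreal (a / V r)) = ennreal (V r / a)"
      using V(1)[OF r] a(2) by (simp add: inverse_ennreal)
    have Ifin: "I \<noteq> \<infinity>"
    proof
      assume "I = \<infinity>"
      then have "epowr (I / ennreal (V r)) (1 / \<sigma>) = \<infinity>" using \<sigma> by (simp add: ennreal_top_divide)
      moreover have "ennreal (V r / a) \<noteq> 0" using V(1)[OF r] a(2) by simp
      ultimately show False using * unfolding inv by (simp add: ennreal_mult_top top_unique)
    qed
    then obtain i where i: "I = ennreal i" "0 \<le> i" by (cases I) auto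
    have "V r / a * (i / V r) powr (1 / \<sigma>) \<le> L"
      using * V(1)[OF r] a(2) \<sigma> i L(2) unfolding inv i(1)
      by (simp add: divide_ennreal epowr_ennreal ennreal_mult[symmetric])
    then have "(i / V r) powr (1 / \<sigma>) \<le> L * (a / V r)" using V(1)[OF r] a(2) by (simp add: field_simps)
    also have "\<dots> \<le> (L + 1) * (a / V r)" using V(1)[OF r] a(2) by (intro mult_right_mono) auto
    finally have "((i / V r) powr (1 / \<sigma>)) powr \<sigma> \<le> ((L + 1) * (a / V r)) powr \<sigma>" using \<sigma> by (intro powr_mono2) auto
    then have "i / V r \<le> ((L + 1) * (a / V r)) powr \<sigma>" using \<sigma> i V(1)[OF r] by (simp add: powr_powr)
    then have "i \<le> V r * ((L + 1) * (a / V r)) powr \<sigma>" using V(1)[OF r] by (simp add: pos_divide_le_eq mult.commute)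
    then show ?thesis using i by (simp add: I_def[symmetric] ennreal_leI)
  qed
  define r where "r = (\<lambda>t::real. t * (real n + 1))"
  define K' where "K' = ((L + 1) powr \<sigma> * K powr \<sigma> * (unit_ball_vol (real n)) powr (1 - \<sigma>)) * ((real n + 1) ^ n) powr Q"
  have "Ap_on Q K' (\<lambda>y. w' y powr \<sigma>) (cube x t) (t ^ CARD('n))" if t: "0 < t" for x t
  proof -
    have r: "0 < r t" "cube x t \<subseteq> ball x (r t)" using t cube_subset_ball[OF t] by (auto simp: r_def n_def)
    obtain a b where ab: "0 < a" "0 < b" "mass w' (ball x (r t)) = ennreal a"
      "mass (\<lambda>y. w' y powr (- 1 / (P - 1))) (ball x (r t)) = ennreal b"
      "a * b powr (P - 1) \<le> K * (r t ^ CARD('n)) powr P" using AB[OF r(1), of x] by blast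
    define a' where "a' = V (r t) * ((L + 1) * (a / V (r t))) powr \<sigma>"
    have a': "0 < a'" using V(1)[OF r(1)] ab L by (simp add: a'_def)
    have "a' * b powr (Q - 1) = V (r t) powr (1 - \<sigma>) * (L + 1) powr \<sigma> * (a * b powr (P - 1)) powr \<sigma>"
    proof -
      have 1: "b powr (Q - 1) = (b powr (P - 1)) powr \<sigma>" by (simp only: Q1 powr_powr mult.commute)
      have 2: "v * (l * (a / v)) powr \<sigma> * B powr \<sigma> = v powr (1 - \<sigma>) * l powr \<sigma> * (a * B) powr \<sigma>"
        if "0 < v" "0 < l" "0 < B" for v l B :: real
        using that ab(1) by (simp add: powr_mult powr_divide powr_diff)
      show ?thesis unfolding a'_def 1 using V(1)[OF r(1)] ab(2) L by (intro 2) auto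
    qed
    also have "\<dots> \<le> V (r t) powr (1 - \<sigma>) * (L + 1) powr \<sigma> * (K * (r t ^ n) powr P) powr \<sigma>"
      using ab \<sigma> unfolding n_def by (intro mult_left_mono powr_mono2) auto
    also have "\<dots> = ((L + 1) powr \<sigma> * K powr \<sigma> * (unit_ball_vol (real n)) powr (1 - \<sigma>)) * ((r t ^ n) powr (1 - \<sigma>) * (r t ^ n) powr (P * \<sigma>))"
      using r(1) K unfolding V_def by (simp add: powr_mult powr_powr mult_ac)
    also have "(r t ^ n) powr (1 - \<sigma>) * (r t ^ n) powr (P * \<sigma>) = (r t ^ n) powr Q"
      by (simp add: powr_add[symmetric] Q_def algebra_simps)
    also have "(r t ^ n) powr Q = ((real n + 1) ^ n) powr Q * (t ^ n) powr Q"
      using t by (simp add: r_def power_mult_distrib powr_mult mult.commute)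
    finally have "a' * b powr (Q - 1) \<le> K' * (t ^ n) powr Q" by (simp add: K'_def)
    moreover have "mass (\<lambda>y. w' y powr \<sigma>) (cube x t) \<le> ennreal a'"
      unfolding a'_def by (intro order_trans[OF set_nn_integral_mono_set[OF r(2)] Lb] r ab)
    moreover have "mass (\<lambda>y. (w' y powr \<sigma>) powr (- 1 / (Q - 1))) (cube x t) \<le> ennreal b"
      unfolding ww ab(4)[symmetric] by (intro set_nn_integral_mono_set r(2))
    ultimately show ?thesis using a' ab(2) unfolding n_def by blast
  qed
  moreover have "unit_ball_vol (real n) \<noteq> 0" using unit_ball_vol_pos[of "real n"] by linarith
  then have "0 < K'" using K L unfolding K'_def by (intro mult_pos_pos) auto
  moreover have "(\<lambda>x. w' x powr \<sigma>) \<in> borel_measurable borel" by measurable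
  moreover have "0 < w' x powr \<sigma>" for x using pos[of x] by simp
  ultimately have "cube_Ap Q (\<lambda>x. w' x powr \<sigma>)" unfolding cube_Ap_def by blast
  then show ?thesis using that ae pos w' unfolding Q_def by blast
qed

section \<open>The Fourier transform\<close>

lemma cnj_measurable [measurable]: "cnj \<in> borel_measurable borel"
  by (intro borel_measurable_continuous_onI continuous_intros)

text \<open>Domination by a product of integrable functions gives integrability on the product
  space; the oscillatory integrals below are interchanged in this form.\<close>

lemma Fubini_swap_bound:
  fixes f :: "'a::euclidean_space \<Rightarrow> 'b::euclidean_space \<Rightarrow> complex"
  assumes f [measurable]: "(\<lambda>(x, y). f x y) \<in> borel_measurable (lborel \<Otimes>\<^sub>M lborel)"
    and A: "integrable lborel A" and B: "integrable lborel B"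
    and le: "\<And>x y. norm (f x y) \<le> A x * (B y :: real)"
  shows "(LINT x|lborel. LINT y|lborel. f x y) = (LINT y|lborel. LINT x|lborel. f x y)"
proof -
  have [measurable]: "A \<in> borel_measurable borel" "B \<in> borel_measurable borel"
    using A B by (auto dest: borel_measurable_integrable)
  have "integrable (lborel \<Otimes>\<^sub>M lborel) (\<lambda>(x, y). f x y)"
  proof (rule integrableI_bounded[OF f])
    have "(\<integral>\<^sup>+z. norm (case z of (x, y) \<Rightarrow> f x y) \<partial>(lborel \<Otimes>\<^sub>M lborel)) = (\<integral>\<^sup>+x. \<integral>\<^sup>+y. norm (f x y) \<partial>lborel \<partial>lborel)"
      by (subst lborel.nn_integral_fst[symmetric]) auto
    also have "\<dots> \<le> (\<integral>\<^sup>+x. \<integral>\<^sup>+y. ennreal (norm (A x)) * ennreal (norm (B y)) \<partial>lborel \<partial>lborel)"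
    proof (intro nn_integral_mono)
      fix x y
      have "norm (f x y) \<le> norm (A x) * norm (B y)"
        using le[of x y] norm_ge_zero[of "f x y"] by (metis abs_mult abs_of_nonneg order_trans real_norm_def)
      then show "ennreal (norm (f x y)) \<le> ennreal (norm (A x)) * ennreal (norm (B y))"
        by (simp add: ennreal_mult[symmetric] ennreal_leI del: real_norm_def)
    qed
    also have "\<dots> = (\<integral>\<^sup>+x. norm (A x) \<partial>lborel) * (\<integral>\<^sup>+y. norm (B y) \<partial>lborel)"
      by (subst nn_integral_cmult, measurable, subst nn_integral_multc, measurable)
    also have "\<dots> < \<infinity>" using A B by (auto simp: integrable_iff_bounded ennreal_mult_less_top)
    finally show "(\<integral>\<^sup>+z. norm (case z of (x, y) \<Rightarrow> f x y) \<partial>(lborel \<Otimes>\<^sub>M lborel)) < \<infinity>" .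
  qed
  from lborel_pair.Fubini_integral[OF this] show ?thesis by simp
qed

lemma integrable_exp_imaginary_mult:
  assumes "integrable lborel h"
  shows "integrable lborel (\<lambda>\<xi>. iexp (x \<bullet> \<xi>) * (h \<xi> :: complex))"
proof -
  have [measurable]: "h \<in> borel_measurable borel" using assms by (auto dest: borel_measurable_integrable)
  show ?thesis using assms by (rule Bochner_Integration.integrable_bound) (auto simp: norm_mult)
qed

text \<open>Positive sign and no normalising factor: applied to a symbol in \<xi> it yields the
  convolution kernel of the operator, up to (2 pi)^n.\<close>

definition FT :: "('a::euclidean_space \<Rightarrow> complex) \<Rightarrow> 'a \<Rightarrow> complex"
  where "FT h x = (LINT \<xi>|lborel. iexp (x \<bullet> \<xi>) * h \<xi>)"

lemma FT_measurable [measurable]: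
  assumes [measurable]: "h \<in> borel_measurable borel" shows "FT h \<in> borel_measurable borel"
  unfolding FT_def by measurable

lemma norm_FT_le: "norm (FT h x) \<le> (LINT \<xi>|lborel. norm (h \<xi>))"
  unfolding FT_def by (rule order_trans[OF integral_norm_bound]) (simp add: norm_mult)

definition gauss :: "real \<Rightarrow> 'a::euclidean_space \<Rightarrow> real"
  where "gauss e x = exp (- (e\<^sup>2 * (norm x)\<^sup>2) / 2)"

lemma gauss_nonneg [simp]: "0 \<le> gauss e x"
  by (simp add: gauss_def)

lemma gauss_measurable [measurable]: "gauss e \<in> borel_measurable borel"
  unfolding gauss_def by measurable

text \<open>The transform of the standard Gaussian is the characteristic function of the standard
  normal distribution; a dilation gives the general width.\<close>

lemma FT_gauss_real:
  fixes t e :: real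
  assumes e: "0 < e"
  shows "integrable lborel (\<lambda>s. iexp (t * s) * of_real (gauss e s))" (is ?I)
    and "(LINT s|lborel. iexp (t * s) * of_real (gauss e s)) = of_real (sqrt (2 * pi) / e * gauss (1 / e) t)" (is ?E)
proof -
  have 1: "has_bochner_integral lborel (\<lambda>s. iexp (u * s) * of_real (gauss 1 s)) (of_real (sqrt (2 * pi) * gauss 1 u))" for u :: real
  proof -
    have *: "of_real (sqrt (2 * pi)) * (of_real (std_normal_density s) * iexp (u * s)) = iexp (u * s) * of_real (gauss 1 s)" for s
      by (simp add: std_normal_density_def gauss_def)
    have "integrable lborel (\<lambda>s. std_normal_density s)"
      using integrable_normal_density[of 1 0] by simp
    then have "integrable lborel (\<lambda>s. complex_of_real (std_normal_density s))" by (rule integrable_of_real)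
    from integrable_exp_imaginary_mult[OF this, of u]
    have int: "integrable lborel (\<lambda>s. of_real (std_normal_density s) * iexp (u * s))"
      by (simp add: mult.commute)
    have "(LINT s|lborel. of_real (std_normal_density s) * iexp (u * s)) = char std_normal_distribution u"
      unfolding char_def by (subst integral_density) (auto simp: scaleR_conv_of_real)
    also have "\<dots> = of_real (gauss 1 u)"
      by (simp add: char_std_normal_distribution gauss_def)
    finally have "has_bochner_integral lborel (\<lambda>s. of_real (std_normal_density s) * iexp (u * s)) (of_real (gauss 1 u))"
      using int by (simp add: has_bochner_integral_iff)
    then have "has_bochner_integral lborel (\<lambda>s. of_real (sqrt (2 * pi)) * (of_real (std_normal_density s) * iexp (u * s))) (of_real (sqrt (2 * pi)) * complex_of_real (gauss 1 u))"
      by (intro has_bochner_integral_mult_right)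
    then show ?thesis unfolding * by simp
  qed
  define f where "f = (\<lambda>s. iexp ((t / e) * s) * complex_of_real (gauss 1 s))"
  have f: "integrable lborel f" "(LINT s|lborel. f s) = of_real (sqrt (2 * pi) * gauss 1 (t / e))"
    using 1[of "t / e"] unfolding f_def by (auto simp: has_bochner_integral_iff)
  have fe: "f (0 + e * s) = iexp (t * s) * of_real (gauss e s)" for s
    using e by (simp add: f_def gauss_def power_mult_distrib)
  show ?I using lborel_integrable_real_affine[OF f(1), of e 0] e by (simp only: fe)
  have "of_real (sqrt (2 * pi) * gauss 1 (t / e)) = \<bar>e\<bar> *\<^sub>R (LINT s|lborel. f (0 + e * s))"
    unfolding f(2)[symmetric] using e by (intro lborel_integral_real_affine) simp
  then show ?E unfolding fe using e
    by (simp add: scaleR_conv_of_real gauss_def power_divide field_simps)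
qed

lemma FT_gauss:
  fixes u :: "'a::euclidean_space"
  assumes e: "0 < e"
  shows "integrable lborel (\<lambda>x :: 'a. iexp (u \<bullet> x) * of_real (gauss e x))" (is ?I)
    and "(LINT x|lborel. iexp (u \<bullet> x) * of_real (gauss e x)) = of_real ((sqrt (2 * pi) / e) ^ DIM('a) * gauss (1 / e) u)" (is ?E)
proof -
  interpret product_sigma_finite "\<lambda>_::'a. lborel :: real measure" ..
  have gprod: "of_real (gauss d x) = (\<Prod>b\<in>Basis. complex_of_real (gauss d (x \<bullet> b)))" for d and x :: 'a
  proof -
    have "gauss d x = exp (\<Sum>b\<in>Basis. - (d\<^sup>2 * (x \<bullet> b)\<^sup>2) / 2)"
      unfolding gauss_def power2_norm_eq_inner euclidean_inner[of x x]
      by (simp add: sum_negf sum_divide_distrib sum_distrib_left power2_eq_square)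
    also have "\<dots> = (\<Prod>b\<in>Basis. gauss d (x \<bullet> b))"
      by (simp add: exp_sum gauss_def)
    finally show ?thesis by simp
  qed
  have eprod: "iexp (u \<bullet> x) = (\<Prod>b\<in>Basis. iexp ((u \<bullet> b) * (x \<bullet> b)))" for x
    by (simp add: euclidean_inner[of u x] sum_distrib_left exp_sum[symmetric])
  define F where "F = (\<lambda>b s. iexp ((u \<bullet> b) * s) * complex_of_real (gauss e s))"
  have F: "iexp (u \<bullet> x) * of_real (gauss e x) = (\<Prod>b\<in>Basis. F b (x \<bullet> b))" for x
    unfolding eprod gprod F_def by (simp add: prod.distrib)
  have Fi: "integrable lborel (F b)" and Fe: "(LINT s|lborel. F b s) = of_real (sqrt (2 * pi) / e * gauss (1 / e) (u \<bullet> b))" for b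
    unfolding F_def by (rule FT_gauss_real[OF e])+
  define T where "T = (\<lambda>f. \<Sum>b\<in>Basis. f b *\<^sub>R b :: 'a)"
  have T [measurable]: "T \<in> measurable (\<Pi>\<^sub>M b\<in>Basis. lborel) borel" unfolding T_def by measurable
  have lb: "lborel = distr (\<Pi>\<^sub>M b\<in>Basis. lborel) borel T" unfolding T_def by (rule lborel_eq)
  have Tb: "T f \<bullet> b = f b" if "b \<in> Basis" for f b
    using that unfolding T_def by (simp add: inner_sum_left inner_Basis if_distrib cong: if_cong)
  have Fm: "F b \<in> borel_measurable borel" for b unfolding F_def by measurable
  have pm: "(\<lambda>x. \<Prod>b\<in>Basis. F b (x \<bullet> b)) \<in> borel_measurable borel"
    using Fm by measurable
  have FT': "(\<Prod>b\<in>Basis. F b (T f \<bullet> b)) = (\<Prod>b\<in>Basis. F b (f b))" for f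
    by (intro prod.cong) (auto simp: Tb)
  show ?I
    unfolding F by (subst lb, subst integrable_distr_eq[OF T pm])
      (simp only: FT', intro product_integrable_prod, auto simp: Fi)
  have "(LINT x|lborel. (\<Prod>b\<in>Basis. F b (x \<bullet> b))) = integral\<^sup>L (\<Pi>\<^sub>M b\<in>Basis. lborel) (\<lambda>f. \<Prod>b\<in>Basis. F b (f b))"
    by (subst lb, subst integral_distr[OF T pm]) (simp only: FT')
  also have "\<dots> = (\<Prod>b\<in>Basis. (LINT s|lborel. F b s))" by (intro product_integral_prod) (auto simp: Fi)
  also have "\<dots> = of_real ((sqrt (2 * pi) / e) ^ DIM('a) * gauss (1 / e) u)"
    unfolding Fe of_real_mult prod.distrib of_real_power gprod by simp
  finally show ?E unfolding F .
qed

lemma integrable_gauss: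
  assumes "0 < e" shows "integrable lborel (gauss e :: 'a::euclidean_space \<Rightarrow> real)"
  using FT_gauss(1)[OF assms, of "0 :: 'a"] by (simp add: complex_of_real_integrable_eq)

lemma nn_integral_gauss:
  assumes e: "0 < e"
  shows "(\<integral>\<^sup>+x. ennreal (gauss e (x :: 'a::euclidean_space)) \<partial>lborel) = ennreal ((sqrt (2 * pi) / e) ^ DIM('a))"
proof -
  have "complex_of_real (LINT x|lborel. gauss e (x :: 'a)) = of_real ((sqrt (2 * pi) / e) ^ DIM('a))"
    using FT_gauss(2)[OF e, of "0 :: 'a"] by (simp add: gauss_def)
  then have "(LINT x|lborel. gauss e (x :: 'a)) = (sqrt (2 * pi) / e) ^ DIM('a)"
    unfolding of_real_eq_iff .
  then show ?thesis
    using integrable_gauss[OF e, where 'a='a] by (subst nn_integral_eq_integral) simp_all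
qed

text \<open>The Gaussian makes all integrals absolutely convergent for h that is merely integrable.
  Expanding the square turns the left side into a double integral of h against its conjugate with a
  Gaussian kernel of total mass (2 pi)^n, and Schur's test bounds it.\<close>

lemma Plancherel_gauss:
  fixes h :: "'a::euclidean_space \<Rightarrow> complex"
  assumes h: "integrable lborel h" and e: "0 < e"
  shows "(\<integral>\<^sup>+x. ennreal ((norm (FT h x))\<^sup>2 * gauss e x) \<partial>lborel) \<le> ennreal ((2 * pi) ^ DIM('a)) * L2sq h"
proof -
  have hm [measurable]: "h \<in> borel_measurable borel" using h by (auto dest: borel_measurable_integrable)
  define L where "L = (LINT \<xi>|lborel. norm (h \<xi>))"
  have L: "norm (FT h x) \<le> L" for x unfolding L_def by (rule norm_FT_le)
  have L0: "0 \<le> L" unfolding L_def by simp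
  define c where "c = (sqrt (2 * pi) / e) ^ DIM('a)"
  have c: "0 < c" using e by (simp add: c_def)
  \<comment> \<open>The transform of the Gaussian factor. Its total mass does not depend on e, which
    makes the bound uniform.\<close>
  define G where "G = (\<lambda>v :: 'a. c * gauss (1 / e) v)"
  have G: "0 \<le> G v" for v using c by (simp add: G_def gauss_def)
  have [measurable]: "G \<in> borel_measurable borel" unfolding G_def by measurable
  have Gint: "(\<integral>\<^sup>+v. ennreal (G v) \<partial>lborel) = ennreal ((2 * pi) ^ DIM('a))"
  proof -
    have "(\<integral>\<^sup>+v. ennreal (G v) \<partial>lborel) = ennreal c * (\<integral>\<^sup>+v. ennreal (gauss (1 / e) (v :: 'a)) \<partial>lborel)"
      using c unfolding G_def by (subst nn_integral_cmult[symmetric]) (auto simp: ennreal_mult gauss_def)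
    also have "\<dots> = ennreal (c * (sqrt (2 * pi) / (1 / e)) ^ DIM('a))"
      using e c by (subst nn_integral_gauss) (auto simp: ennreal_mult)
    also have "c * (sqrt (2 * pi) / (1 / e)) ^ DIM('a) = (2 * pi) ^ DIM('a)"
      unfolding c_def power_mult_distrib[symmetric] using e by simp
    finally show ?thesis .
  qed
  have ig: "integrable lborel (\<lambda>x :: 'a. L * gauss e x)" using integrable_gauss[OF e, where 'a='a] by simp
  have ig1: "integrable lborel (\<lambda>x :: 'a. gauss e x)" using integrable_gauss[OF e, where 'a='a] by simp
  have inh: "integrable lborel (\<lambda>x. norm (h x))" using h by simp
  have inner: "(LINT x|lborel. FT h x * of_real (gauss e x) * exp (- (\<i> * of_real (x \<bullet> \<eta>)))) = (LINT \<xi>|lborel. h \<xi> * of_real (G (\<xi> - \<eta>)))" for \<eta>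
  proof -
    have "(LINT x|lborel. FT h x * of_real (gauss e x) * exp (- (\<i> * of_real (x \<bullet> \<eta>))))
      = (LINT x|lborel. LINT \<xi>|lborel. iexp (x \<bullet> \<xi>) * h \<xi> * (of_real (gauss e x) * exp (- (\<i> * of_real (x \<bullet> \<eta>)))))"
    proof (rule Bochner_Integration.integral_cong[OF refl])
      fix x
      have "FT h x * (of_real (gauss e x) * exp (- (\<i> * of_real (x \<bullet> \<eta>))))
        = (LINT \<xi>|lborel. iexp (x \<bullet> \<xi>) * h \<xi> * (of_real (gauss e x) * exp (- (\<i> * of_real (x \<bullet> \<eta>)))))"
        unfolding FT_def by (rule integral_mult_left_zero[symmetric])
      then show "FT h x * of_real (gauss e x) * exp (- (\<i> * of_real (x \<bullet> \<eta>)))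
        = (LINT \<xi>|lborel. iexp (x \<bullet> \<xi>) * h \<xi> * (of_real (gauss e x) * exp (- (\<i> * of_real (x \<bullet> \<eta>)))))"
        by (simp only: mult.assoc)
    qed
    also have "\<dots> = (LINT \<xi>|lborel. LINT x|lborel. iexp (x \<bullet> \<xi>) * h \<xi> * (of_real (gauss e x) * exp (- (\<i> * of_real (x \<bullet> \<eta>)))))"
    proof (rule Fubini_swap_bound[OF _ ig1 inh])
      fix x \<xi>
      show "norm (iexp (x \<bullet> \<xi>) * h \<xi> * (of_real (gauss e x) * exp (- (\<i> * of_real (x \<bullet> \<eta>))))) \<le> gauss e x * norm (h \<xi>)"
        by (simp add: norm_mult gauss_def)
    qed measurable
    also have "\<dots> = (LINT \<xi>|lborel. h \<xi> * of_real (G (\<xi> - \<eta>)))"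
    proof (rule Bochner_Integration.integral_cong[OF refl])
      fix \<xi>
      have "iexp (x \<bullet> \<xi>) * h \<xi> * (of_real (gauss e x) * exp (- (\<i> * of_real (x \<bullet> \<eta>)))) = h \<xi> * (iexp ((\<xi> - \<eta>) \<bullet> x) * of_real (gauss e x))" for x
      proof -
        have "\<i> * of_real ((\<xi> - \<eta>) \<bullet> x) = \<i> * of_real (x \<bullet> \<xi>) + - (\<i> * of_real (x \<bullet> \<eta>))"
          by (simp add: inner_diff_left inner_commute algebra_simps)
        then show ?thesis by (simp only: exp_add mult_ac)
      qed
      then have "(LINT x|lborel. iexp (x \<bullet> \<xi>) * h \<xi> * (of_real (gauss e x) * exp (- (\<i> * of_real (x \<bullet> \<eta>)))))
        = h \<xi> * (LINT x|lborel. iexp ((\<xi> - \<eta>) \<bullet> x) * of_real (gauss e x))"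
        by (simp only: integral_mult_right_zero)
      then show "(LINT x|lborel. iexp (x \<bullet> \<xi>) * h \<xi> * (of_real (gauss e x) * exp (- (\<i> * of_real (x \<bullet> \<eta>))))) = h \<xi> * of_real (G (\<xi> - \<eta>))"
        unfolding FT_gauss(2)[OF e] G_def c_def .
    qed
    finally show ?thesis .
  qed
  define I where "I = (LINT x|lborel. FT h x * of_real (gauss e x) * cnj (FT h x))"
  have sq: "FT h x * of_real (gauss e x) * cnj (FT h x) = of_real ((norm (FT h x))\<^sup>2 * gauss e x)" for x
    by (simp add: complex_norm_square[symmetric] mult.commute mult.left_commute del: of_real_power)
  have isq: "integrable lborel (\<lambda>x. (norm (FT h x))\<^sup>2 * gauss e x)"
  proof (rule Bochner_Integration.integrable_bound)
    show "integrable lborel (\<lambda>x :: 'a. L\<^sup>2 * gauss e x)" using ig1 by simp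
    show "AE x in lborel. norm ((norm (FT h x))\<^sup>2 * gauss e x) \<le> norm (L\<^sup>2 * gauss e x)"
      using L L0 by (auto simp: gauss_def abs_mult intro!: mult_right_mono power_mono)
  qed measurable
  have "I = (LINT x|lborel. FT h x * of_real (gauss e x) * (LINT \<eta>|lborel. exp (- (\<i> * of_real (x \<bullet> \<eta>))) * cnj (h \<eta>)))"
  proof -
    have "cnj (FT h x) = (LINT \<eta>|lborel. exp (- (\<i> * of_real (x \<bullet> \<eta>))) * cnj (h \<eta>))" for x
      unfolding FT_def by (subst Bochner_Integration.integral_cnj[symmetric]) (simp add: exp_cnj)
    then show ?thesis unfolding I_def by simp
  qed
  also have "\<dots> = (LINT x|lborel. LINT \<eta>|lborel. FT h x * of_real (gauss e x) * (exp (- (\<i> * of_real (x \<bullet> \<eta>))) * cnj (h \<eta>)))"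
    by simp
  also have "\<dots> = (LINT \<eta>|lborel. LINT x|lborel. FT h x * of_real (gauss e x) * (exp (- (\<i> * of_real (x \<bullet> \<eta>))) * cnj (h \<eta>)))"
  proof (rule Fubini_swap_bound[OF _ ig inh])
    fix x \<eta>
    show "norm (FT h x * of_real (gauss e x) * (exp (- (\<i> * of_real (x \<bullet> \<eta>))) * cnj (h \<eta>))) \<le> L * gauss e x * norm (h \<eta>)"
      using L[of x] by (simp add: norm_mult gauss_def mult_right_mono)
  qed measurable
  also have "\<dots> = (LINT \<eta>|lborel. cnj (h \<eta>) * (LINT \<xi>|lborel. h \<xi> * of_real (G (\<xi> - \<eta>))))"
    unfolding inner[symmetric] by (simp add: mult_ac)
  finally have I: "I = (LINT \<eta>|lborel. cnj (h \<eta>) * (LINT \<xi>|lborel. h \<xi> * of_real (G (\<xi> - \<eta>))))" .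
  have nb: "ennreal (norm (LINT x|lborel. f x)) \<le> (\<integral>\<^sup>+x. norm (f x) \<partial>lborel)" for f :: "'a \<Rightarrow> complex"
    by (cases "integrable lborel f") (auto simp: not_integrable_integral_eq intro: integral_norm_bound_ennreal)
  have "(\<integral>\<^sup>+x. ennreal ((norm (FT h x))\<^sup>2 * gauss e x) \<partial>lborel) = ennreal (LINT x|lborel. (norm (FT h x))\<^sup>2 * gauss e x)"
    using isq by (intro nn_integral_eq_integral) (auto simp: gauss_def)
  also have "(LINT x|lborel. (norm (FT h x))\<^sup>2 * gauss e x) = norm I"
  proof -
    have "I = of_real (LINT x|lborel. (norm (FT h x))\<^sup>2 * gauss e x)"
      unfolding I_def sq using isq by (rule integral_of_real)
    moreover have "0 \<le> (LINT x|lborel. (norm (FT h x))\<^sup>2 * gauss e x)" by (simp add: gauss_def)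
    ultimately show ?thesis by simp
  qed
  also have "ennreal (norm I) \<le> (\<integral>\<^sup>+\<eta>. norm (cnj (h \<eta>) * (LINT \<xi>|lborel. h \<xi> * of_real (G (\<xi> - \<eta>)))) \<partial>lborel)"
    unfolding I by (rule nb)
  also have "\<dots> \<le> (\<integral>\<^sup>+\<eta>. (\<integral>\<^sup>+\<xi>. ennreal (norm (h \<eta>) * (norm (h \<xi>) * G (\<xi> - \<eta>))) \<partial>lborel) \<partial>lborel)"
  proof (intro nn_integral_mono)
    fix \<eta>
    have "ennreal (norm (cnj (h \<eta>) * (LINT \<xi>|lborel. h \<xi> * of_real (G (\<xi> - \<eta>))))) = ennreal (norm (h \<eta>)) * ennreal (norm (LINT \<xi>|lborel. h \<xi> * of_real (G (\<xi> - \<eta>))))"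
      by (simp add: norm_mult ennreal_mult)
    also have "\<dots> \<le> ennreal (norm (h \<eta>)) * (\<integral>\<^sup>+\<xi>. norm (h \<xi> * of_real (G (\<xi> - \<eta>))) \<partial>lborel)"
      by (intro mult_left_mono nb) simp
    also have "\<dots> = (\<integral>\<^sup>+\<xi>. ennreal (norm (h \<eta>) * (norm (h \<xi>) * G (\<xi> - \<eta>))) \<partial>lborel)"
      using G by (subst nn_integral_cmult[symmetric]) (auto simp: norm_mult ennreal_mult)
    finally show "ennreal (norm (cnj (h \<eta>) * (LINT \<xi>|lborel. h \<xi> * of_real (G (\<xi> - \<eta>))))) \<le> (\<integral>\<^sup>+\<xi>. ennreal (norm (h \<eta>) * (norm (h \<xi>) * G (\<xi> - \<eta>))) \<partial>lborel)" .
  qed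
  \<comment> \<open>Schur's test: after the arithmetic-geometric inequality each term depends on h
    at one point only, and the other variable integrates out to the mass of
    \<open>G\<close>.\<close>
  also have "\<dots> \<le> (\<integral>\<^sup>+\<eta>. (\<integral>\<^sup>+\<xi>. ennreal ((norm (h \<eta>))\<^sup>2 / 2) * ennreal (G (\<xi> - \<eta>)) + ennreal ((norm (h \<xi>))\<^sup>2 / 2) * ennreal (G (\<xi> - \<eta>)) \<partial>lborel) \<partial>lborel)"
  proof (intro nn_integral_mono)
    fix \<eta> \<xi>
    have "norm (h \<eta>) * norm (h \<xi>) \<le> (norm (h \<eta>))\<^sup>2 / 2 + (norm (h \<xi>))\<^sup>2 / 2"
      using sum_squares_bound[of "norm (h \<eta>)" "norm (h \<xi>)"] by simp
    then have "norm (h \<eta>) * norm (h \<xi>) * G (\<xi> - \<eta>) \<le> ((norm (h \<eta>))\<^sup>2 / 2 + (norm (h \<xi>))\<^sup>2 / 2) * G (\<xi> - \<eta>)"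
      using G by (intro mult_right_mono)
    then show "ennreal (norm (h \<eta>) * (norm (h \<xi>) * G (\<xi> - \<eta>))) \<le> ennreal ((norm (h \<eta>))\<^sup>2 / 2) * ennreal (G (\<xi> - \<eta>)) + ennreal ((norm (h \<xi>))\<^sup>2 / 2) * ennreal (G (\<xi> - \<eta>))"
      using G[of "\<xi> - \<eta>"] by (simp add: ennreal_mult[symmetric] ennreal_plus[symmetric] distrib_right mult.assoc ennreal_leI del: ennreal_plus)
  qed
  also have "\<dots> = (\<integral>\<^sup>+\<eta>. (\<integral>\<^sup>+\<xi>. ennreal ((norm (h \<eta>))\<^sup>2 / 2) * ennreal (G (\<xi> - \<eta>)) \<partial>lborel) \<partial>lborel)
      + (\<integral>\<^sup>+\<eta>. (\<integral>\<^sup>+\<xi>. ennreal ((norm (h \<xi>))\<^sup>2 / 2) * ennreal (G (\<xi> - \<eta>)) \<partial>lborel) \<partial>lborel)"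
    by (subst nn_integral_add, measurable, subst nn_integral_add, measurable)
  also have "(\<integral>\<^sup>+\<eta>. (\<integral>\<^sup>+\<xi>. ennreal ((norm (h \<xi>))\<^sup>2 / 2) * ennreal (G (\<xi> - \<eta>)) \<partial>lborel) \<partial>lborel)
      = (\<integral>\<^sup>+\<xi>. (\<integral>\<^sup>+\<eta>. ennreal ((norm (h \<xi>))\<^sup>2 / 2) * ennreal (G (\<xi> - \<eta>)) \<partial>lborel) \<partial>lborel)"
    by (rule lborel_pair.Fubini') measurable
  also have "\<dots> = (\<integral>\<^sup>+\<xi>. ennreal ((norm (h \<xi>))\<^sup>2 / 2) * ennreal ((2 * pi) ^ DIM('a)) \<partial>lborel)"
  proof (intro nn_integral_cong)
    fix \<xi>
    have "(\<integral>\<^sup>+\<eta>. ennreal (G (\<xi> - \<eta>)) \<partial>lborel) = ennreal ((2 * pi) ^ DIM('a))"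
      using nn_integral_lborel_reflect[of "\<lambda>v. ennreal (G v)" \<xi>] by (simp add: Gint)
    then show "(\<integral>\<^sup>+\<eta>. ennreal ((norm (h \<xi>))\<^sup>2 / 2) * ennreal (G (\<xi> - \<eta>)) \<partial>lborel) = ennreal ((norm (h \<xi>))\<^sup>2 / 2) * ennreal ((2 * pi) ^ DIM('a))"
      by (subst nn_integral_cmult) auto
  qed
  also have "(\<integral>\<^sup>+\<eta>. (\<integral>\<^sup>+\<xi>. ennreal ((norm (h \<eta>))\<^sup>2 / 2) * ennreal (G (\<xi> - \<eta>)) \<partial>lborel) \<partial>lborel)
    = (\<integral>\<^sup>+\<xi>. ennreal ((norm (h \<xi>))\<^sup>2 / 2) * ennreal ((2 * pi) ^ DIM('a)) \<partial>lborel)"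
  proof (intro nn_integral_cong)
    fix \<eta>
    have "(\<integral>\<^sup>+\<xi>. ennreal (G (\<xi> - \<eta>)) \<partial>lborel) = ennreal ((2 * pi) ^ DIM('a))"
      using nn_integral_lborel_translate[of "\<lambda>v. ennreal (G v)" "- \<eta>"] by (simp add: Gint)
    then show "(\<integral>\<^sup>+\<xi>. ennreal ((norm (h \<eta>))\<^sup>2 / 2) * ennreal (G (\<xi> - \<eta>)) \<partial>lborel) = ennreal ((norm (h \<eta>))\<^sup>2 / 2) * ennreal ((2 * pi) ^ DIM('a))"
      by (subst nn_integral_cmult) auto
  qed
  also have "(\<integral>\<^sup>+\<xi>. ennreal ((norm (h \<xi>))\<^sup>2 / 2) * ennreal ((2 * pi) ^ DIM('a)) \<partial>lborel) + (\<integral>\<^sup>+\<xi>. ennreal ((norm (h \<xi>))\<^sup>2 / 2) * ennreal ((2 * pi) ^ DIM('a)) \<partial>lborel)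
    = (\<integral>\<^sup>+\<xi>. ennreal ((2 * pi) ^ DIM('a)) * ennreal ((norm (h \<xi>))\<^sup>2) \<partial>lborel)"
  proof -
    have half: "ennreal (a / 2) * D + ennreal (a / 2) * D = D * ennreal a" if "0 \<le> a" for a D
    proof -
      have "ennreal (a / 2) * D + ennreal (a / 2) * D = (ennreal (a / 2) + ennreal (a / 2)) * D" by (simp only: distrib_right)
      also have "ennreal (a / 2) + ennreal (a / 2) = ennreal a" using that by (subst ennreal_plus[symmetric]) auto
      finally show ?thesis by (simp only: mult.commute)
    qed
    show ?thesis
      by (subst nn_integral_add[symmetric], measurable, intro nn_integral_cong half) simp
  qed
  also have "\<dots> = ennreal ((2 * pi) ^ DIM('a)) * L2sq h"
    by (intro nn_integral_cmult) measurable
  finally show ?thesis .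
qed

text \<open>Fatou's lemma along Gaussians tending to 1. The inequality is all that the kernel and
  multiplier estimates require.\<close>

lemma Plancherel_le:
  fixes h :: "'a::euclidean_space \<Rightarrow> complex"
  assumes h: "integrable lborel h"
  shows "L2sq (FT h) \<le> ennreal ((2 * pi) ^ DIM('a)) * L2sq h"
proof -
  have hm [measurable]: "h \<in> borel_measurable borel" using h by (auto dest: borel_measurable_integrable)
  define R where "R = ennreal ((2 * pi) ^ DIM('a)) * L2sq h"
  define g where "g = (\<lambda>k x. ennreal ((norm (FT h x))\<^sup>2 * gauss (1 / real (Suc k)) x))"
  have lim: "(\<lambda>k. g k x) \<longlonglongrightarrow> ennreal ((norm (FT h x))\<^sup>2)" for x
  proof -
    have "(\<lambda>k. (norm (FT h x))\<^sup>2 * exp (- ((1 / real (Suc k))\<^sup>2 * (norm x)\<^sup>2) / 2)) \<longlonglongrightarrow> (norm (FT h x))\<^sup>2 * exp (- (0\<^sup>2 * (norm x)\<^sup>2) / 2)"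
      by (intro tendsto_intros LIMSEQ_Suc lim_1_over_n) auto
    then show ?thesis unfolding g_def gauss_def by (intro tendsto_ennrealI) simp
  qed
  have "L2sq (FT h) = (\<integral>\<^sup>+x. liminf (\<lambda>k. g k x) \<partial>lborel)"
    using lim by (intro nn_integral_cong) (metis lim_imp_Liminf sequentially_bot)
  also have "\<dots> \<le> liminf (\<lambda>k. \<integral>\<^sup>+x. g k x \<partial>lborel)"
    by (intro nn_integral_liminf) (auto simp: g_def)
  also have "\<dots> \<le> liminf (\<lambda>k. R)"
    unfolding g_def R_def by (intro Liminf_mono always_eventually allI Plancherel_gauss h) simp
  also have "\<dots> = R" by (simp add: Liminf_const)
  finally show ?thesis unfolding R_def .
qed

text \<open>Gives one integrable envelope for all difference quotients with steps of length at most
  1.\<close>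

lemma growth_shift:
  fixes x :: "real^'n::finite"
  assumes t: "\<bar>t\<bar> \<le> 1"
  shows "growth x \<le> (1 + 4 ^ CARD('n) * (1 + real CARD('n))) * growth (x + t *\<^sub>R axis i 1)"
proof -
  define y where "y = x + t *\<^sub>R axis i 1"
  define N where "N = 2 * CARD('n)"
  have even: "a ^ N = \<bar>a\<bar> ^ N" for a :: real by (simp add: N_def power_mult)
  have "(x $ l) ^ N \<le> 4 ^ CARD('n) * ((y $ l) ^ N + 1)" for l
  proof -
    have "\<bar>x $ l\<bar> \<le> \<bar>y $ l\<bar> + 1"
      using t by (simp add: y_def axis_def) (cases "l = i"; simp)
    also have "\<dots> \<le> 2 * max \<bar>y $ l\<bar> 1" by simp
    finally have "\<bar>x $ l\<bar> ^ N \<le> (2 * max \<bar>y $ l\<bar> 1) ^ N" by (intro power_mono) auto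
    also have "\<dots> = 4 ^ CARD('n) * max \<bar>y $ l\<bar> 1 ^ N" by (simp add: power_mult_distrib N_def power_mult)
    also have "max \<bar>y $ l\<bar> 1 ^ N \<le> \<bar>y $ l\<bar> ^ N + 1" by (simp add: max_def)
    finally show ?thesis by (simp add: even[symmetric])
  qed
  then have "(\<Sum>l\<in>UNIV. (x $ l) ^ N) \<le> (\<Sum>l\<in>(UNIV::'n set). 4 ^ CARD('n) * ((y $ l) ^ N + 1))" by (intro sum_mono)
  also have "\<dots> = 4 ^ CARD('n) * ((\<Sum>l\<in>UNIV. (y $ l) ^ N) + real CARD('n))"
    by (simp add: sum_distrib_left[symmetric] sum.distrib)
  also have "\<dots> = 4 ^ CARD('n) * (growth y - 1 + real CARD('n))" by (simp add: growth_def N_def)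
  finally have "growth x \<le> 1 + 4 ^ CARD('n) * (growth y - 1 + real CARD('n))" by (simp add: growth_def N_def)
  also have "\<dots> \<le> growth y + 4 ^ CARD('n) * (growth y * (1 + real CARD('n)))"
  proof -
    have "growth y - 1 + real CARD('n) \<le> growth y * (1 + real CARD('n))"
    proof -
      have "1 * real CARD('n) \<le> growth y * real CARD('n)" using growth_ge_1[of y] by (intro mult_right_mono) auto
      then show ?thesis by (simp only: distrib_left mult_1_left mult_1_right)
    qed
    then show ?thesis using growth_ge_1[of y] by (intro add_mono mult_left_mono) auto
  qed
  also have "\<dots> = (1 + 4 ^ CARD('n) * (1 + real CARD('n))) * growth y" by (simp add: algebra_simps)
  finally show ?thesis by (simp add: y_def)
qed

section \<open>Integration by parts for functions with polynomial decay\<close>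

lemma integrable_inverse_growth: "integrable lborel (\<lambda>x :: real^'n::finite. 1 / growth x)"
proof (rule integrableI_bounded)
  have "(\<integral>\<^sup>+x. ennreal (norm (1 / growth (x :: real^'n))) \<partial>lborel) = (\<integral>\<^sup>+x. ennreal (1 / growth (x :: real^'n)) \<partial>lborel)"
    by (intro nn_integral_cong) (simp add: abs_of_pos[OF growth_pos])
  also have "\<dots> < \<infinity>" using nn_integral_inverse_growth[where 'n='n] by (auto simp: le_less_trans)
  finally show "(\<integral>\<^sup>+x. ennreal (norm (1 / growth (x :: real^'n))) \<partial>lborel) < \<infinity>" .
qed measurable

lemma integrable_growth_bound:
  fixes f :: "real^'n::finite \<Rightarrow> complex"
  assumes [measurable]: "f \<in> borel_measurable borel" and f: "\<And>x. norm (f x) \<le> C / growth x"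
  shows "integrable lborel f"
proof (rule Bochner_Integration.integrable_bound)
  show "integrable lborel (\<lambda>x :: real^'n. C * (1 / growth x))" by (intro integrable_mult_right integrable_inverse_growth)
  show "AE x in lborel. norm (f x) \<le> norm (C * (1 / growth x))"
  proof (rule AE_I2)
    fix x
    have "norm (f x) \<le> C * (1 / growth x)" using f[of x] by simp
    then show "norm (f x) \<le> norm (C * (1 / growth x))" by (simp only: real_norm_def)
  qed
qed measurable

lemma integral_lborel_translate:
  fixes f :: "'a::euclidean_space \<Rightarrow> complex"
  assumes [measurable]: "f \<in> borel_measurable borel"
  shows "(LINT x|lborel. f (x + c)) = (LINT x|lborel. f x)"
proof -
  have "(LINT x|lborel. f x) = (LINT x|distr lborel borel ((+) c). f x)" by (simp add: lborel_distr_plus)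
  also have "\<dots> = (LINT x|lborel. f (c + x))" by (rule integral_distr) auto
  finally show ?thesis by (simp add: add.commute)
qed

text \<open>By translation invariance the integral of a difference quotient vanishes.\<close>

lemma integral_derivative_eq_0:
  fixes F F' :: "real^'n::finite \<Rightarrow> complex"
  assumes cont: "continuous_on UNIV F" "continuous_on UNIV F'"
    and bd: "\<And>x. norm (F x) \<le> C / growth x" "\<And>x. norm (F' x) \<le> C / growth x"
    and der: "\<And>x t. ((\<lambda>t. F (x + t *\<^sub>R axis i 1)) has_vector_derivative F' (x + t *\<^sub>R axis i 1)) (at t)"
  shows "(LINT x|lborel. F' x) = 0"
proof -
  have [measurable]: "F \<in> borel_measurable borel" "F' \<in> borel_measurable borel"
    using cont by (auto intro: borel_measurable_continuous_onI)
  define M where "M = 1 + 4 ^ CARD('n) * (1 + real CARD('n))"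
  define e where "e = (axis i 1 :: real^'n)"
  define t where "t = (\<lambda>k. 1 / real (Suc k))"
  have t: "0 < t k" "t k \<le> 1" for k by (auto simp: t_def)
  have C: "0 \<le> C"
  proof -
    have "0 \<le> C / growth (0 :: real^'n)" by (rule order_trans[OF norm_ge_zero bd(1)])
    then show ?thesis using growth_pos[of "0 :: real^'n"] by (simp add: zero_le_divide_iff)
  qed
  have env: "norm (F' (x + s *\<^sub>R e)) \<le> C * M * (1 / growth x)" if "\<bar>s\<bar> \<le> 1" for x s
  proof -
    have "norm (F' (x + s *\<^sub>R e)) \<le> C / growth (x + s *\<^sub>R e)" by (rule bd)
    also have "\<dots> \<le> C * M * (1 / growth x)"
    proof -
      have "growth x \<le> M * growth (x + s *\<^sub>R e)" unfolding M_def e_def by (rule growth_shift[OF that])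
      then have "1 / growth (x + s *\<^sub>R e) \<le> M / growth x" using growth_pos[of x] growth_pos[of "x + s *\<^sub>R e"] by (simp add: divide_simps)
      from mult_left_mono[OF this C] show ?thesis by simp
    qed
    finally show ?thesis .
  qed
  define D where "D = (\<lambda>k x. (1 / t k) *\<^sub>R (F (x + t k *\<^sub>R e) - F x))"
  have intF: "integrable lborel F" by (rule integrable_growth_bound[OF _ bd(1)]) simp
  have "(LINT x|lborel. F (x + c)) = (LINT x|lborel. F x)" for c by (rule integral_lborel_translate) simp
  moreover have "integrable lborel (\<lambda>x. F (x + c))" for c
  proof -
    have "integrable (distr lborel borel ((+) c)) F" using intF by (simp add: lborel_distr_plus)
    then show ?thesis by (subst (asm) integrable_distr_eq) (auto simp: add.commute)
  qed
  ultimately have D0: "(LINT x|lborel. D k x) = 0" for k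
    unfolding D_def using intF by (simp add: Bochner_Integration.integral_diff)
  have "(\<lambda>k. LINT x|lborel. D k x) \<longlonglongrightarrow> (LINT x|lborel. F' x)"
  proof (rule integral_dominated_convergence[where w="\<lambda>x. C * M * (1 / growth x)"])
    show "integrable lborel (\<lambda>x :: real^'n. C * M * (1 / growth x))" by (intro integrable_mult_right integrable_inverse_growth)
    show "AE x in lborel. (\<lambda>k. D k x) \<longlonglongrightarrow> F' x"
    proof (rule AE_I2)
      fix x
      have "((\<lambda>s. F (x + s *\<^sub>R e)) has_vector_derivative F' x) (at 0)" using der[of x 0] by (simp add: e_def)
      then have "((\<lambda>s. (1 / s) *\<^sub>R (F (x + s *\<^sub>R e) - F x)) \<longlongrightarrow> F' x) (at 0)"
      proof -
        assume "((\<lambda>s. F (x + s *\<^sub>R e)) has_vector_derivative F' x) (at 0)"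
        then have "((\<lambda>h. norm (F (x + h *\<^sub>R e) - F x - h *\<^sub>R F' x) / norm h) \<longlongrightarrow> 0) (at 0)"
          by (simp add: has_vector_derivative_def has_derivative_at)
        moreover have "\<forall>\<^sub>F h in at 0. norm (F (x + h *\<^sub>R e) - F x - h *\<^sub>R F' x) / norm h = norm ((1 / h) *\<^sub>R (F (x + h *\<^sub>R e) - F x) - F' x)"
          unfolding eventually_at_filter
        proof (rule always_eventually, intro allI impI)
          fix h :: real assume h: "h \<noteq> 0"
          have "(1 / h) *\<^sub>R (F (x + h *\<^sub>R e) - F x) - F' x = (1 / h) *\<^sub>R (F (x + h *\<^sub>R e) - F x - h *\<^sub>R F' x)"
            using h by (simp add: scaleR_diff_right)
          then show "norm (F (x + h *\<^sub>R e) - F x - h *\<^sub>R F' x) / norm h = norm ((1 / h) *\<^sub>R (F (x + h *\<^sub>R e) - F x) - F' x)"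
            by (simp only: norm_scaleR) simp
        qed
        ultimately have "((\<lambda>h. norm ((1 / h) *\<^sub>R (F (x + h *\<^sub>R e) - F x) - F' x)) \<longlongrightarrow> 0) (at 0)"
          by (rule Lim_transform_eventually)
        then show ?thesis by (simp only: tendsto_norm_zero_iff LIM_zero_iff)
      qed
      moreover have "filterlim t (at 0) sequentially"
        unfolding t_def by (intro filterlim_atI LIMSEQ_Suc lim_1_over_n) auto
      ultimately show "(\<lambda>k. D k x) \<longlonglongrightarrow> F' x" unfolding D_def by (rule filterlim_compose)
    qed
    fix k
    show "AE x in lborel. norm (D k x) \<le> C * M * (1 / growth x)"
    proof (rule AE_I2)
      fix x
      \<comment> \<open>The difference quotient is a mean of F' over a segment of length at most 1,
        so it inherits the shifted envelope of F'.\<close>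
      have "((\<lambda>s. F' (x + s *\<^sub>R e)) has_integral (F (x + t k *\<^sub>R e) - F (x + 0 *\<^sub>R e))) {0..t k}"
        using t[of k] der unfolding e_def
        by (intro fundamental_theorem_of_calculus) (auto intro: has_vector_derivative_at_within)
      then have "norm (F (x + t k *\<^sub>R e) - F (x + 0 *\<^sub>R e)) \<le> C * M * (1 / growth x) * measure lborel (cbox 0 (t k))"
        using t[of k] C growth_pos[of x] by (intro has_integral_bound[where f="\<lambda>s. F' (x + s *\<^sub>R e)"] env) (auto simp: M_def)
      then show "norm (D k x) \<le> C * M * (1 / growth x)"
        using t[of k] growth_pos[of x] by (simp add: D_def divide_simps mult_ac)
    qed
  qed (auto simp: D_def)
  then show ?thesis unfolding D0 by (simp add: LIMSEQ_const_iff)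
qed

text \<open>Integration by parts in the form that the derivative of the exponential times F has
  integral 0.\<close>

lemma FT_derivative:
  fixes F F' :: "real^'n::finite \<Rightarrow> complex"
  assumes cont: "continuous_on UNIV F" "continuous_on UNIV F'"
    and bd: "\<And>x. norm (F x) \<le> C / growth x" "\<And>x. norm (F' x) \<le> C / growth x"
    and der: "\<And>x t. ((\<lambda>t. F (x + t *\<^sub>R axis i 1)) has_vector_derivative F' (x + t *\<^sub>R axis i 1)) (at t)"
  shows "FT F' u = - \<i> * of_real (u $ i) * FT F u"
proof -
  have [measurable]: "F \<in> borel_measurable borel" "F' \<in> borel_measurable borel"
    using cont by (auto intro: borel_measurable_continuous_onI)
  define E where "E = (\<lambda>\<xi>. iexp (u \<bullet> \<xi>))"
  have nE: "norm (E \<xi>) = 1" for \<xi> by (simp add: E_def)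
  have contE: "continuous_on UNIV E" unfolding E_def by (intro continuous_intros)
  have C: "0 \<le> C / growth x" for x :: "real^'n" by (rule order_trans[OF norm_ge_zero bd(1)])
  define G' where "G' = (\<lambda>\<xi>. (\<i> * of_real (u $ i)) * (E \<xi> * F \<xi>) + E \<xi> * F' \<xi>)"
  have "(LINT \<xi>|lborel. G' \<xi>) = 0"
  proof (rule integral_derivative_eq_0[where F="\<lambda>\<xi>. E \<xi> * F \<xi>" and C="(\<bar>u $ i\<bar> + 1) * C" and i=i])
    show "continuous_on UNIV (\<lambda>\<xi>. E \<xi> * F \<xi>)" "continuous_on UNIV G'"
      unfolding G'_def by (intro continuous_intros cont contE)+
    fix x t
    have "norm (F x) \<le> C / growth x" by (rule bd)
    also have "\<dots> \<le> (\<bar>u $ i\<bar> + 1) * (C / growth x)" using mult_right_mono[OF _ C[of x], of 1 "\<bar>u $ i\<bar> + 1"] by simp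
    finally show "norm (E x * F x) \<le> (\<bar>u $ i\<bar> + 1) * C / growth x" by (simp add: norm_mult nE)
    have "norm (G' x) \<le> \<bar>u $ i\<bar> * norm (F x) + norm (F' x)"
      unfolding G'_def by (rule order_trans[OF norm_triangle_ineq]) (simp add: norm_mult nE)
    also have "\<dots> \<le> \<bar>u $ i\<bar> * (C / growth x) + C / growth x" by (intro add_mono mult_left_mono bd) auto
    also have "\<dots> = (\<bar>u $ i\<bar> + 1) * C / growth x" by (simp add: distrib_right add_divide_distrib)
    finally show "norm (G' x) \<le> (\<bar>u $ i\<bar> + 1) * C / growth x" .
    have dE: "((\<lambda>t. E (x + t *\<^sub>R axis i 1)) has_vector_derivative (\<i> * of_real (u $ i)) * E (x + t *\<^sub>R axis i 1)) (at t)"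
    proof -
      have *: "u \<bullet> (x + t *\<^sub>R axis i 1) = u \<bullet> x + t * (u $ i)" for t
        by (simp add: inner_add_right inner_axis)
      have "((\<lambda>t. iexp (u \<bullet> x + t * (u $ i))) has_vector_derivative (\<i> * of_real (u $ i)) * iexp (u \<bullet> x + t * (u $ i))) (at t)"
      proof -
        have "((\<lambda>z. exp (\<i> * (of_real (u \<bullet> x) + z * of_real (u $ i)))) has_field_derivative (\<i> * of_real (u $ i)) * exp (\<i> * (of_real (u \<bullet> x) + of_real t * of_real (u $ i)))) (at (of_real t))"
          by (auto intro!: derivative_eq_intros)
        from has_vector_derivative_real_field[OF this, of UNIV] show ?thesis by simp
      qed
      then show ?thesis unfolding E_def * .
    qed
    show "((\<lambda>t. E (x + t *\<^sub>R axis i 1) * F (x + t *\<^sub>R axis i 1)) has_vector_derivative G' (x + t *\<^sub>R axis i 1)) (at t)"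
      using has_vector_derivative_mult[OF dE der[of x t]] by (simp add: G'_def algebra_simps)
  qed
  moreover have "integrable lborel (\<lambda>\<xi>. E \<xi> * F \<xi>)" "integrable lborel (\<lambda>\<xi>. E \<xi> * F' \<xi>)"
    unfolding E_def by (intro integrable_exp_imaginary_mult integrable_growth_bound[OF _ bd(1)] integrable_growth_bound[OF _ bd(2)]; simp)+
  ultimately have "(\<i> * of_real (u $ i)) * FT F u + FT F' u = 0"
    unfolding G'_def FT_def E_def by (subst (asm) Bochner_Integration.integral_add) auto
  then show ?thesis by (simp add: add_eq_0_iff2)
qed

lemma FT_derivative_chain:
  fixes F :: "nat \<Rightarrow> real^'n::finite \<Rightarrow> complex"
  assumes cont: "\<And>k. k \<le> N \<Longrightarrow> continuous_on UNIV (F k)"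
    and bd: "\<And>k. k \<le> N \<Longrightarrow> \<exists>C. \<forall>x. norm (F k x) \<le> C / growth x"
    and der: "\<And>k x t. k < N \<Longrightarrow> ((\<lambda>t. F k (x + t *\<^sub>R axis i 1)) has_vector_derivative F (Suc k) (x + t *\<^sub>R axis i 1)) (at t)"
    and "k \<le> N"
  shows "FT (F k) u = (- \<i> * of_real (u $ i)) ^ k * FT (F 0) u"
  using \<open>k \<le> N\<close>
proof (induction k)
  case (Suc k)
  obtain C1 where C1: "\<And>x. norm (F k x) \<le> C1 / growth x" using bd[of k] Suc.prems by auto
  obtain C2 where C2: "\<And>x. norm (F (Suc k) x) \<le> C2 / growth x" using bd[of "Suc k"] Suc.prems by auto
  have "FT (F (Suc k)) u = - \<i> * of_real (u $ i) * FT (F k) u"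
  proof (rule FT_derivative[where C="max C1 C2"])
    fix x
    show "norm (F k x) \<le> max C1 C2 / growth x" "norm (F (Suc k) x) \<le> max C1 C2 / growth x"
      using growth_pos[of x] by (auto intro!: order_trans[OF C1] order_trans[OF C2] divide_right_mono)
    show "continuous_on UNIV (F k)" "continuous_on UNIV (F (Suc k))" using Suc.prems by (auto intro: cont)
    show "((\<lambda>t. F k (x + t *\<^sub>R axis i 1)) has_vector_derivative F (Suc k) (x + t *\<^sub>R axis i 1)) (at t)" for t
      using Suc.prems by (intro der) auto
  qed
  also have "FT (F k) u = (- \<i> * of_real (u $ i)) ^ k * FT (F 0) u" using Suc.prems by (intro Suc.IH) simp
  finally show ?case by (simp only: power_Suc mult.assoc)
qed simp

section \<open>Kernels of frequency pieces\<close>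

text \<open>The exponent r / (r - 1) - 2 is r' - 2: this power of the sup bound, times the L^2
  bound, controls the L^(r') norm. Factors depending on the amplitude and the frequency are kept
  apart.\<close>

definition kernel_const :: "'n::finite itself \<Rightarrow> real \<Rightarrow> real"
  where "kernel_const _ r = (((real CARD('n) + 1) * 4 ^ CARD('n)) powr (r / (r - 1) - 2) *
     ((real CARD('n) + 1)\<^sup>2 * (2 * pi) ^ CARD('n) * 4 ^ CARD('n))) powr (r - 1)"

text \<open>A symbol localised to frequencies of size \<open>R\<close>: \<open>D L i k\<close> stands for the derivative of the
  symbol along the coordinates in the list \<open>L\<close> in \<open>x\<close> and of order \<open>k\<close> in \<open>\<xi>\<^sub>i\<close>.\<close>

locale amplitude =
  fixes D :: "'n::finite list \<Rightarrow> 'n \<Rightarrow> nat \<Rightarrow> real^'n \<Rightarrow> real^'n \<Rightarrow> complex" and A R l :: real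
    and b :: "real^'n \<Rightarrow> real^'n \<Rightarrow> complex"
  assumes A: "0 < A" and R: "1 \<le> R" and l: "0 < l"
    and cont: "continuous_on UNIV (\<lambda>(x, \<xi>). D L i k x \<xi>)"
    and supp: "\<xi> \<notin> cube 0 (2 * R) \<Longrightarrow> D L i k x \<xi> = 0"
    and bound: "length L \<le> CARD('n) \<Longrightarrow> k \<le> 2 * CARD('n) \<Longrightarrow> norm (D L i k x \<xi>) \<le> A * l ^ length L / l ^ k"
    and base: "D [] i 0 = b"
    and deriv_\<xi>: "k < 2 * CARD('n) \<Longrightarrow>
      ((\<lambda>t. D [] i k x (\<xi> + t *\<^sub>R axis i 1)) has_vector_derivative D [] i (Suc k) x (\<xi> + t *\<^sub>R axis i 1)) (at t)"
    and deriv_x: "((\<lambda>t. D L i k (x + t *\<^sub>R axis j 1) \<xi>) has_vector_derivative D (j # L) i k (x + t *\<^sub>R axis j 1) \<xi>) (at t)"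
begin

lemma D_measurable_pair [measurable]: "(\<lambda>z. D L i k (fst z) (snd z)) \<in> borel_measurable borel"
  using cont[of L i k] by (intro borel_measurable_continuous_onI) (simp add: case_prod_unfold)

lemma D_measurable [measurable]:
  assumes [measurable]: "f \<in> borel_measurable M" "g \<in> borel_measurable M"
  shows "(\<lambda>z. D L i k (f z) (g z)) \<in> borel_measurable M"
proof -
  have "(\<lambda>z. D L i k (fst (f z, g z)) (snd (f z, g z))) \<in> borel_measurable M"
    by (rule measurable_compose[OF _ D_measurable_pair]) (simp add: borel_prod[symmetric])
  then show ?thesis by simp
qed

lemma cont_\<xi>: "continuous_on UNIV (D L i k x)"
  using continuous_on_compose2[OF cont[of L i k] continuous_on_Pair[OF continuous_on_const continuous_on_id, of UNIV x]]
  by simp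

lemma norm_D_le:
  assumes "length L \<le> CARD('n)" "k \<le> 2 * CARD('n)"
  shows "ennreal (norm (D L i k x \<xi>)) \<le> ennreal (A * l ^ length L / l ^ k) * indicator (cube 0 (2 * R)) \<xi>"
  using bound[OF assms, of i x \<xi>] supp[of \<xi> L i k x] by (auto simp: indicator_def intro: ennreal_leI)

text \<open>Compact support in \<xi> makes any decay available; this one is the hypothesis of the
  integration by parts.\<close>

lemma D_growth_bound:
  assumes "k \<le> 2 * CARD('n)"
  shows "\<exists>C. \<forall>\<xi>. norm (D [] i k x \<xi>) \<le> C / growth \<xi>"
proof -
  have "bounded (growth ` cube (0 :: real^'n) (2 * R))"
    by (intro compact_imp_bounded compact_continuous_image compact_cube continuous_intros)
  then obtain B where "\<And>\<xi> :: real^'n. \<xi> \<in> cube 0 (2 * R) \<Longrightarrow> norm (growth \<xi>) \<le> B" unfolding bounded_iff by blast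
  then have B: "growth \<xi> \<le> B" if "\<xi> \<in> cube 0 (2 * R)" for \<xi> :: "real^'n"
    using that abs_le_D1 unfolding real_norm_def by blast
  have "norm (D [] i k x \<xi>) \<le> (A / l ^ k * B) / growth \<xi>" for \<xi>
  proof (cases "\<xi> \<in> cube 0 (2 * R)")
    case True
    have "norm (D [] i k x \<xi>) * growth \<xi> \<le> A / l ^ k * B"
      using bound[OF _ assms, of "[]" i x \<xi>] B[OF True] growth_pos[of \<xi>] A l by (intro mult_mono) auto
    then show ?thesis by (subst pos_le_divide_eq[OF growth_pos])
  next
    case False
    have "0 \<le> B" using B[of 0] R growth_pos[of "0 :: real^'n"] by (auto simp: cube_def)
    then show ?thesis using False supp A l growth_pos[of \<xi>] by (simp add: less_imp_le)
  qed
  then show ?thesis by blast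
qed

lemma integrable_D:
  assumes "k \<le> 2 * CARD('n)" shows "integrable lborel (D [] i k x)"
proof -
  obtain C where "\<And>\<xi>. norm (D [] i k x \<xi>) \<le> C / growth \<xi>" using D_growth_bound[OF assms] by blast
  then show ?thesis by (intro integrable_growth_bound[of _ C]) auto
qed

lemma FT_D:
  assumes "k \<le> 2 * CARD('n)"
  shows "FT (D [] i k x) u = (- \<i> * of_real (u $ i)) ^ k * FT (b x) u"
  using FT_derivative_chain[of "2 * CARD('n)" "\<lambda>k. D [] i k x" i k u] assms deriv_\<xi> D_growth_bound cont_\<xi>
  by (simp add: base)

lemma norm_FT_D:
  assumes "k \<le> 2 * CARD('n)"
  shows "norm (FT (D [] i k x) u) = \<bar>u $ i\<bar> ^ k * norm (FT (b x) u)"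
  unfolding FT_D[OF assms] by (simp add: norm_mult norm_power)

lemma norm_FT_D_le:
  assumes k: "k \<le> 2 * CARD('n)"
  shows "norm (FT (D [] i k x) u) \<le> A * (4 * R) ^ CARD('n) / l ^ k"
proof -
  have "ennreal (norm (FT (D [] i k x) u)) \<le> ennreal (LINT \<xi>|lborel. norm (D [] i k x \<xi>))"
    by (intro ennreal_leI norm_FT_le)
  also have "\<dots> = (\<integral>\<^sup>+\<xi>. ennreal (norm (D [] i k x \<xi>)) \<partial>lborel)"
    by (intro nn_integral_eq_integral[symmetric] integrable_norm integrable_D k) auto
  also have "\<dots> \<le> (\<integral>\<^sup>+\<xi>. ennreal (A * l ^ length ([] :: 'n list) / l ^ k) * indicator (cube 0 (2 * R)) \<xi> \<partial>(lborel :: (real^'n) measure))"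
    by (intro nn_integral_mono norm_D_le k) simp
  also have "\<dots> = ennreal (A * (4 * R) ^ CARD('n) / l ^ k)"
    using A R l by (simp add: nn_integral_cmult_indicator emeasure_cube ennreal_mult[symmetric])
  finally show ?thesis using A R l by (simp add: ennreal_le_iff)
qed

text \<open>Plancherel's theorem, the pointwise bound of the symbol, and the volume (4 R)^n of its
  support.\<close>

lemma nn_integral_FT_D_le:
  assumes k: "k \<le> 2 * CARD('n)"
  shows "L2sq (FT (D [] i k x)) \<le> ennreal ((2 * pi) ^ CARD('n) * (4 * R) ^ CARD('n) * (A / l ^ k)\<^sup>2)"
proof -
  have "L2sq (FT (D [] i k x)) \<le> ennreal ((2 * pi) ^ DIM(real^'n)) * L2sq (\<lambda>\<xi>. D [] i k x \<xi>)"
    by (rule Plancherel_le[OF integrable_D[OF k]])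
  also have "\<dots> \<le> ennreal ((2 * pi) ^ DIM(real^'n)) * (\<integral>\<^sup>+\<xi>. ennreal ((A / l ^ k)\<^sup>2) * indicator (cube 0 (2 * R)) \<xi> \<partial>(lborel :: (real^'n) measure))"
  proof (intro mult_left_mono nn_integral_mono)
    fix \<xi> :: "real^'n"
    show "ennreal ((norm (D [] i k x \<xi>))\<^sup>2) \<le> ennreal ((A / l ^ k)\<^sup>2) * indicator (cube 0 (2 * R)) \<xi>"
      using bound[OF _ k, of "[]" i x \<xi>] supp[of \<xi> "[]" i k x] by (auto simp: indicator_def intro!: ennreal_leI power_mono)
  qed simp
  also have "\<dots> = ennreal ((2 * pi) ^ CARD('n) * (4 * R) ^ CARD('n) * (A / l ^ k)\<^sup>2)"
  proof -
    have "(\<integral>\<^sup>+\<xi>. ennreal ((A / l ^ k)\<^sup>2) * indicator (cube 0 (2 * R)) \<xi> \<partial>(lborel :: (real^'n) measure)) = ennreal ((A / l ^ k)\<^sup>2) * ennreal ((4 * R) ^ CARD('n))"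
      using R by (subst nn_integral_cmult_indicator) (simp_all add: emeasure_cube)
    then show ?thesis using R by (simp add: ennreal_mult mult_ac)
  qed
  finally show ?thesis .
qed

text \<open>The kernel with its decay at the natural scale 1 / l divided out. It obeys the same sup
  and L^2 bounds as the kernel, up to dimensional constants.\<close>

definition Kg :: "real^'n \<Rightarrow> real^'n \<Rightarrow> real"
  where "Kg x u = norm (FT (b x) u) * growth (l *\<^sub>R u)"

lemma FT_b_measurable [measurable]:
  assumes [measurable]: "f \<in> borel_measurable M" "g \<in> borel_measurable M"
  shows "(\<lambda>z. FT (b (f z)) (g z)) \<in> borel_measurable M"
  unfolding FT_def base[of undefined, symmetric] by measurable

lemma Kg_measurable [measurable]:
  assumes [measurable]: "f \<in> borel_measurable M" "g \<in> borel_measurable M"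
  shows "(\<lambda>z. Kg (f z) (g z)) \<in> borel_measurable M"
  unfolding Kg_def by measurable

lemma Kg_nonneg: "0 \<le> Kg x u"
  using growth_pos[of "l *\<^sub>R u"] by (simp add: Kg_def)

lemma Kg_eq: "Kg x u = norm (FT (b x) u) + (\<Sum>i\<in>UNIV. l ^ (2 * CARD('n)) * norm (FT (D [] i (2 * CARD('n)) x) u))"
proof -
  have "(u $ i) ^ (2 * CARD('n)) = \<bar>u $ i\<bar> ^ (2 * CARD('n))" for i by (simp add: power_mult)
  then show ?thesis
    unfolding Kg_def growth_def by (simp add: norm_FT_D distrib_left sum_distrib_left power_mult_distrib mult_ac)
qed

lemma norm_FT_b_le: "norm (FT (b x) u) \<le> A * (4 * R) ^ CARD('n)"
  using norm_FT_D_le[of 0 undefined x u] by (simp add: base)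

lemma Kg_le: "Kg x u \<le> (real CARD('n) + 1) * (A * (4 * R) ^ CARD('n))"
proof -
  have "(\<Sum>i\<in>UNIV. l ^ (2 * CARD('n)) * norm (FT (D [] i (2 * CARD('n)) x) u)) \<le> (\<Sum>i\<in>(UNIV::'n set). A * (4 * R) ^ CARD('n))"
  proof (intro sum_mono)
    fix i
    have "l ^ (2 * CARD('n)) * norm (FT (D [] i (2 * CARD('n)) x) u) \<le> l ^ (2 * CARD('n)) * (A * (4 * R) ^ CARD('n) / l ^ (2 * CARD('n)))"
      using l by (intro mult_left_mono norm_FT_D_le) auto
    then show "l ^ (2 * CARD('n)) * norm (FT (D [] i (2 * CARD('n)) x) u) \<le> A * (4 * R) ^ CARD('n)" using l by simp
  qed
  then show ?thesis unfolding Kg_eq using norm_FT_b_le[of x u] by (simp add: distrib_right)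
qed

lemma nn_integral_Kg_le:
  "(\<integral>\<^sup>+u. ennreal ((Kg x u)\<^sup>2) \<partial>lborel) \<le> ennreal ((real CARD('n) + 1)\<^sup>2 * ((2 * pi) ^ CARD('n) * (4 * R) ^ CARD('n) * A\<^sup>2))"
proof -
  define N where "N = 2 * CARD('n)"
  define B where "B = (2 * pi) ^ CARD('n) * (4 * R) ^ CARD('n)"
  have B: "0 \<le> B" using R by (simp add: B_def)
  define n where "n = real CARD('n) + 1"
  have n: "0 \<le> n" by (simp add: n_def)
  have "(Kg x u)\<^sup>2 \<le> n * ((norm (FT (b x) u))\<^sup>2 + (\<Sum>i\<in>UNIV. (l ^ N)\<^sup>2 * (norm (FT (D [] i N x) u))\<^sup>2))" for u
  proof -
    \<comment> \<open>The option type indexes the n + 1 summands of \<open>Kg\<close>, so that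
      Cauchy--Schwarz applies to a single sum.\<close>
    define z where "z = (\<lambda>j. case j of None \<Rightarrow> norm (FT (b x) u) | Some i \<Rightarrow> l ^ N * norm (FT (D [] i N x) u))"
    have s: "(\<Sum>j\<in>UNIV. f j) = f None + (\<Sum>i\<in>UNIV. f (Some i))" for f :: "'n option \<Rightarrow> real"
      by (simp add: UNIV_option_conv sum.reindex)
    have "Kg x u = (\<Sum>j\<in>UNIV. 1 * z j)" unfolding s by (simp add: Kg_eq z_def N_def)
    also have "\<dots>\<^sup>2 \<le> (\<Sum>j\<in>(UNIV :: 'n option set). 1\<^sup>2) * (\<Sum>j\<in>UNIV. (z j)\<^sup>2)" by (rule Cauchy_Schwarz_ineq_sum)
    also have "(\<Sum>j\<in>(UNIV :: 'n option set). 1\<^sup>2) = n" by (simp add: n_def card_UNIV_option)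
    also have "(\<Sum>j\<in>UNIV. (z j)\<^sup>2) = (norm (FT (b x) u))\<^sup>2 + (\<Sum>i\<in>UNIV. (l ^ N)\<^sup>2 * (norm (FT (D [] i N x) u))\<^sup>2)"
      unfolding s by (simp add: z_def power_mult_distrib)
    finally show ?thesis .
  qed
  then have "(\<integral>\<^sup>+u. ennreal ((Kg x u)\<^sup>2) \<partial>lborel)
    \<le> (\<integral>\<^sup>+u. ennreal n * (ennreal ((norm (FT (b x) u))\<^sup>2) + (\<Sum>i\<in>UNIV. ennreal ((l ^ N)\<^sup>2) * ennreal ((norm (FT (D [] i N x) u))\<^sup>2))) \<partial>lborel)"
    using n by (intro nn_integral_mono)
      (simp add: ennreal_mult[symmetric] sum_ennreal ennreal_plus[symmetric] sum_nonneg ennreal_leI del: ennreal_plus)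
  also have "\<dots> = ennreal n * (L2sq (FT (b x)) + (\<Sum>i\<in>UNIV. ennreal ((l ^ N)\<^sup>2) * L2sq (FT (D [] i N x))))"
    by (subst nn_integral_cmult, measurable, subst nn_integral_add, measurable, subst nn_integral_sum, measurable)
      (simp add: nn_integral_cmult)
  also have "\<dots> \<le> ennreal n * (ennreal (B * A\<^sup>2) + (\<Sum>i\<in>(UNIV :: 'n set). ennreal ((l ^ N)\<^sup>2) * ennreal (B * (A / l ^ N)\<^sup>2)))"
    using nn_integral_FT_D_le[of 0 undefined x] nn_integral_FT_D_le[of N _ x]
    by (intro mult_left_mono add_mono sum_mono) (auto simp: base B_def N_def)
  also have "(\<Sum>i\<in>(UNIV :: 'n set). ennreal ((l ^ N)\<^sup>2) * ennreal (B * (A / l ^ N)\<^sup>2)) = ennreal (real CARD('n) * (B * A\<^sup>2))"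
    using l B A by (simp add: ennreal_mult[symmetric] power_divide ennreal_of_nat_eq_real_of_nat)
  also have "ennreal n * (ennreal (B * A\<^sup>2) + ennreal (real CARD('n) * (B * A\<^sup>2))) = ennreal (n\<^sup>2 * (B * A\<^sup>2))"
    using n B by (simp add: ennreal_plus[symmetric] ennreal_mult[symmetric] del: ennreal_plus)
      (simp add: n_def power2_eq_square algebra_simps)
  finally show ?thesis by (simp add: n_def B_def)
qed

text \<open>Hoelder's inequality together with the pointwise and the \<open>L\<^sup>2\<close> bound of the kernel; the latter
  two give the \<open>L\<^bsup>r'\<^esup>\<close> bound because \<open>r' \<ge> 2\<close>.\<close>

lemma kernel_average_bound:
  fixes f :: "real^'n \<Rightarrow> ennreal"
  assumes r: "1 < r" "r \<le> 2" and [measurable]: "f \<in> borel_measurable borel"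
  shows "epowr (\<integral>\<^sup>+y. ennreal (norm (FT (b x) (x - y))) * f y \<partial>lborel) r
    \<le> ennreal (kernel_const TYPE('n) r * (A powr r * R ^ CARD('n))) *
       (\<integral>\<^sup>+y. ennreal (1 / growth (l *\<^sub>R (x - y))) * epowr (f y) r \<partial>lborel)"
proof -
  define r' where "r' = r / (r - 1)"
  have r': "2 \<le> r'" using r by (simp add: r'_def pos_le_divide_eq)
  define n where "n = CARD('n)"
  define S where "S = (real n + 1) * (A * (4 * R) ^ n)"
  have S: "0 < S" using A R by (simp add: S_def)
  define B where "B = (real n + 1)\<^sup>2 * ((2 * pi) ^ n * (4 * R) ^ n * A\<^sup>2)"
  have B: "0 \<le> B" using R by (simp add: B_def)
  define g where "g = (\<lambda>y. growth (l *\<^sub>R (x - y)))"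
  have g: "1 \<le> g y" "0 < g y" for y unfolding g_def by (rule growth_ge_1, rule growth_pos)
  have [measurable]: "g \<in> borel_measurable borel" unfolding g_def by measurable
  have "(\<integral>\<^sup>+y. ennreal (norm (FT (b x) (x - y))) * f y \<partial>lborel) = (\<integral>\<^sup>+y. (ennreal (1 / g y) * f y) * ennreal (Kg x (x - y)) \<partial>lborel)"
  proof (intro nn_integral_cong)
    fix y
    have "ennreal (norm (FT (b x) (x - y))) = ennreal (1 / g y) * ennreal (Kg x (x - y))"
      using g[of y] by (simp add: Kg_def g_def ennreal_mult[symmetric])
    then show "ennreal (norm (FT (b x) (x - y))) * f y = (ennreal (1 / g y) * f y) * ennreal (Kg x (x - y))"
      by (simp add: mult_ac)
  qed
  also have "epowr \<dots> r \<le> (\<integral>\<^sup>+y. epowr (ennreal (1 / g y) * f y) r \<partial>lborel) * epowr (\<integral>\<^sup>+y. epowr (ennreal (Kg x (x - y))) (r / (r - 1)) \<partial>lborel) (r - 1)"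
    by (intro nn_integral_Holder_powr r) measurable
  also have "\<dots> \<le> (\<integral>\<^sup>+y. ennreal (1 / g y) * epowr (f y) r \<partial>lborel) * epowr (ennreal (S powr (r' - 2) * B)) (r - 1)"
  proof (intro mult_mono nn_integral_mono epowr_mono)
    fix y
    \<comment> \<open>As g is at least 1, the power r of the decay can be given up to a single
      power, which is what the averaging lemma handles.\<close>
    have "(1 / g y) powr r \<le> 1 / g y"
      using g[of y] r powr_mono'[of 1 r "1 / g y"] by simp
    then have "ennreal ((1 / g y) powr r) * epowr (f y) r \<le> ennreal (1 / g y) * epowr (f y) r"
      by (intro mult_right_mono ennreal_leI) auto
    then show "epowr (ennreal (1 / g y) * f y) r \<le> ennreal (1 / g y) * epowr (f y) r"
      using r g[of y] by (simp add: epowr_mult epowr_ennreal)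
  next
    have "(\<integral>\<^sup>+y. epowr (ennreal (Kg x (x - y))) (r / (r - 1)) \<partial>lborel) = (\<integral>\<^sup>+y. ennreal (Kg x (x - y) powr r') \<partial>lborel)"
      using r' by (intro nn_integral_cong) (simp add: epowr_ennreal Kg_nonneg r'_def[symmetric])
    also have "\<dots> = (\<integral>\<^sup>+y. ennreal (Kg x y powr r') \<partial>lborel)"
      by (rule nn_integral_lborel_reflect) measurable
    also have "\<dots> \<le> (\<integral>\<^sup>+y. ennreal (S powr (r' - 2)) * ennreal ((Kg x y)\<^sup>2) \<partial>lborel)"
    proof (intro nn_integral_mono)
      fix y
      have "Kg x y powr r' \<le> S powr (r' - 2) * (Kg x y)\<^sup>2"
      proof (cases "Kg x y = 0")
        case False
        then have pos: "0 < Kg x y" using Kg_nonneg[of x y] by simp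
        have "Kg x y powr r' = Kg x y powr (r' - 2) * (Kg x y)\<^sup>2"
          using powr_add[of "Kg x y" "r' - 2" 2] pos by (simp add: powr_numeral)
        also have "\<dots> \<le> S powr (r' - 2) * (Kg x y)\<^sup>2"
          using Kg_le[of x y] r' pos by (intro mult_right_mono powr_mono2) (auto simp: S_def n_def)
        finally show ?thesis .
      qed simp
      then show "ennreal (Kg x y powr r') \<le> ennreal (S powr (r' - 2)) * ennreal ((Kg x y)\<^sup>2)"
        by (simp add: ennreal_mult[symmetric] ennreal_leI)
    qed
    also have "\<dots> = ennreal (S powr (r' - 2)) * (\<integral>\<^sup>+y. ennreal ((Kg x y)\<^sup>2) \<partial>lborel)" by (intro nn_integral_cmult) measurable
    also have "\<dots> \<le> ennreal (S powr (r' - 2)) * ennreal B"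
      unfolding B_def n_def by (intro mult_left_mono nn_integral_Kg_le) simp
    also have "\<dots> = ennreal (S powr (r' - 2) * B)" using B by (simp add: ennreal_mult)
    finally show "(\<integral>\<^sup>+y. epowr (ennreal (Kg x (x - y))) (r / (r - 1)) \<partial>lborel) \<le> ennreal (S powr (r' - 2) * B)" .
  qed (use r in auto)
  also have "epowr (ennreal (S powr (r' - 2) * B)) (r - 1) = ennreal ((S powr (r' - 2) * B) powr (r - 1))"
    using r B by (intro epowr_ennreal) auto
  also have "(S powr (r' - 2) * B) powr (r - 1) = kernel_const TYPE('n) r * (A powr r * R ^ n)"
  proof -
    \<comment> \<open>Separates dimensional constants from A and R^n. The identities r' (r - 1) = r
      and (r' - 1) (r - 1) = 1 leave A^r times a single factor R^n.\<close>
    define c where "c = (real n + 1) * 4 ^ n"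
    define d where "d = (real n + 1)\<^sup>2 * (2 * pi) ^ n * 4 ^ n"
    define Q where "Q = R ^ n"
    have Q: "0 < Q" using R by (simp add: Q_def)
    have 1: "S = c * (A * Q)" "B = d * (A\<^sup>2 * Q)"
      by (simp_all add: S_def B_def c_def d_def Q_def power_mult_distrib mult_ac)
    have cd: "0 < c" "0 < d" by (simp_all add: c_def d_def)
    have "S powr (r' - 2) * B = (c powr (r' - 2) * d) * (A powr r' * Q powr (r' - 1))"
      unfolding 1 using A Q cd by (simp add: powr_mult powr_diff powr_numeral power2_eq_square mult_ac)
    then have "(S powr (r' - 2) * B) powr (r - 1) = (c powr (r' - 2) * d) powr (r - 1) * (A powr (r' * (r - 1)) * Q powr ((r' - 1) * (r - 1)))"
      using A Q cd by (simp add: powr_mult powr_powr)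
    also have "r' * (r - 1) = r" using r by (simp add: r'_def)
    also have "(r' - 1) * (r - 1) = 1" using r by (simp add: r'_def field_simps)
    finally show ?thesis using Q by (simp add: kernel_const_def c_def d_def Q_def n_def r'_def)
  qed
  finally show ?thesis unfolding g_def n_def by (simp add: mult.commute)
qed

end

text \<open>The power r of the output is dominated by an average of the power r of the input, and
  averages are bounded at index p / r. Of the factor (R / l)^n, the part R^n comes from the L^(r')
  norm of the kernel and l^(-n) from the volume of the averaging cube.\<close>

lemma weighted_kernel_bound:
  fixes w :: "real^'n::finite \<Rightarrow> real"
  assumes r: "1 < r" "r \<le> 2" and p: "r < p" and Ap: "cube_Ap (p / r) w"
  obtains C where "0 < C" "\<And>D A R l b f. amplitude D A R l b \<Longrightarrow> f \<in> borel_measurable borel \<Longrightarrow>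
    eLp_int p w (\<lambda>x. \<integral>\<^sup>+y. ennreal (norm (FT (b x) (x - y))) * f y \<partial>lborel)
      \<le> ennreal (C * (A powr r * (R / l) ^ CARD('n)) powr (p / r)) * eLp_int p w f"
proof -
  have P: "1 < p / r" using r p by simp
  have [measurable]: "w \<in> borel_measurable borel" using Ap by (auto simp: cube_Ap_def)
  obtain C0 where C0: "0 < C0" "\<And>l \<Phi>. 0 < l \<Longrightarrow> \<Phi> \<in> borel_measurable borel \<Longrightarrow>
    (\<integral>\<^sup>+x. epowr (\<integral>\<^sup>+y. ennreal (1 / growth (l *\<^sub>R (x - y))) * \<Phi> y \<partial>lborel) (p / r) * ennreal (w x) \<partial>lborel)
      \<le> ennreal (C0 * (1 / l ^ CARD('n)) powr (p / r)) * (\<integral>\<^sup>+y. epowr (\<Phi> y) (p / r) * ennreal (w y) \<partial>lborel)"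
    using growth_average_bounded[OF P Ap] by blast
  define c where "c = kernel_const TYPE('n) r"
  have c: "0 \<le> c" unfolding c_def kernel_const_def by simp
  show ?thesis
  proof (rule that[of "(c powr (p / r) + 1) * C0"])
    show "0 < (c powr (p / r) + 1) * C0" using C0 by (simp add: add_nonneg_pos)
    fix D :: "'n list \<Rightarrow> 'n \<Rightarrow> nat \<Rightarrow> real^'n \<Rightarrow> real^'n \<Rightarrow> complex" and A R l b and f :: "real^'n \<Rightarrow> ennreal"
    assume amp: "amplitude D A R l b" and [measurable]: "f \<in> borel_measurable borel"
    interpret amplitude D A R l b by fact
    define Q where "Q = A powr r * R ^ CARD('n)"
    have Q: "0 \<le> Q" using R by (simp add: Q_def)
    have "eLp_int p w (\<lambda>x. \<integral>\<^sup>+y. ennreal (norm (FT (b x) (x - y))) * f y \<partial>lborel)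
      = (\<integral>\<^sup>+x. epowr (epowr (\<integral>\<^sup>+y. ennreal (norm (FT (b x) (x - y))) * f y \<partial>lborel) r) (p / r) * ennreal (w x) \<partial>lborel)"
      using r p P by (simp add: epowr_epowr)
    also have "\<dots> \<le> (\<integral>\<^sup>+x. epowr (ennreal (c * Q) * (\<integral>\<^sup>+y. ennreal (1 / growth (l *\<^sub>R (x - y))) * epowr (f y) r \<partial>lborel)) (p / r) * ennreal (w x) \<partial>lborel)"
      unfolding c_def Q_def using P by (intro nn_integral_mono mult_right_mono epowr_mono kernel_average_bound r) auto
    also have "\<dots> = (\<integral>\<^sup>+x. ennreal ((c * Q) powr (p / r)) * (epowr (\<integral>\<^sup>+y. ennreal (1 / growth (l *\<^sub>R (x - y))) * epowr (f y) r \<partial>lborel) (p / r) * ennreal (w x)) \<partial>lborel)"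
      using P c Q by (simp add: epowr_mult epowr_ennreal mult.assoc)
    also have "\<dots> = ennreal ((c * Q) powr (p / r)) * (\<integral>\<^sup>+x. epowr (\<integral>\<^sup>+y. ennreal (1 / growth (l *\<^sub>R (x - y))) * epowr (f y) r \<partial>lborel) (p / r) * ennreal (w x) \<partial>lborel)"
      by (intro nn_integral_cmult) measurable
    also have "\<dots> \<le> ennreal ((c * Q) powr (p / r)) * (ennreal (C0 * (1 / l ^ CARD('n)) powr (p / r)) * (\<integral>\<^sup>+y. epowr (epowr (f y) r) (p / r) * ennreal (w y) \<partial>lborel))"
      using l by (intro mult_left_mono C0) auto
    also have "\<dots> = ennreal ((c * Q) powr (p / r) * (C0 * (1 / l ^ CARD('n)) powr (p / r))) * eLp_int p w f"
      using r p P C0 by (simp add: epowr_epowr ennreal_mult mult.assoc)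
    also have "\<dots> \<le> ennreal ((c powr (p / r) + 1) * C0 * (A powr r * (R / l) ^ CARD('n)) powr (p / r)) * eLp_int p w f"
    proof (intro mult_right_mono ennreal_leI)
      have "Q * (1 / l ^ CARD('n)) = A powr r * (R / l) ^ CARD('n)" by (simp add: Q_def power_divide)
      then have "(c * Q) powr (p / r) * (C0 * (1 / l ^ CARD('n)) powr (p / r)) = c powr (p / r) * C0 * (A powr r * (R / l) ^ CARD('n)) powr (p / r)"
        using c Q l by (metis (no_types, lifting) mult.assoc mult.left_commute powr_mult)
      also have "\<dots> \<le> (c powr (p / r) + 1) * C0 * (A powr r * (R / l) ^ CARD('n)) powr (p / r)"
        using C0 by (intro mult_right_mono) auto
      finally show "(c * Q) powr (p / r) * (C0 * (1 / l ^ CARD('n)) powr (p / r)) \<le> (c powr (p / r) + 1) * C0 * (A powr r * (R / l) ^ CARD('n)) powr (p / r)" .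
    qed simp
    finally show "eLp_int p w (\<lambda>x. \<integral>\<^sup>+y. ennreal (norm (FT (b x) (x - y))) * f y \<partial>lborel)
      \<le> ennreal ((c powr (p / r) + 1) * C0 * (A powr r * (R / l) ^ CARD('n)) powr (p / r)) * eLp_int p w f" .
  qed
qed

section \<open>The unweighted estimate\<close>

lemma vec_lambda_measurable [measurable]:
  fixes f :: "'n::finite \<Rightarrow> 'a \<Rightarrow> real"
  assumes [measurable]: "\<And>i. f i \<in> borel_measurable M"
  shows "(\<lambda>x. (\<chi> i. f i x)) \<in> borel_measurable M"
proof -
  have "(\<chi> i. f i x) = (\<Sum>i\<in>UNIV. f i x *\<^sub>R axis i 1)" for x
    by (simp add: vec_eq_iff axis_def if_distrib cong: if_cong)
  then show ?thesis by simp
qed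

definition upd :: "real^'n::finite \<Rightarrow> 'n \<Rightarrow> real \<Rightarrow> real^'n"
  where "upd z i s = (\<chi> j. if j = i then s else z $ j)"

definition mix :: "'n::finite set \<Rightarrow> real^'n \<Rightarrow> real^'n \<Rightarrow> real^'n"
  where "mix J x z = (\<chi> j. if j \<in> J then x $ j else z $ j)"

lemma mix_empty [simp]: "mix {} x z = z"
  and mix_UNIV [simp]: "mix UNIV x z = x"
  and mix_insert: "mix (insert i J) x z = upd (mix J x z) i (x $ i)"
  and upd_mix: "i \<notin> J \<Longrightarrow> upd (mix J x z) i s = mix J x (upd z i s)"
  by (auto simp: mix_def upd_def vec_eq_iff)

lemma upd_eq_add: "upd z i s = upd z i 0 + s *\<^sub>R axis i 1"
  by (simp add: upd_def vec_eq_iff axis_def)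

lemma upd_measurable [measurable]:
  assumes [measurable]: "f \<in> borel_measurable M" "g \<in> borel_measurable M"
  shows "(\<lambda>x. upd (f x) i (g x) :: real^'n::finite) \<in> borel_measurable M"
  unfolding upd_def by measurable

lemma mix_measurable [measurable]:
  assumes [measurable]: "f \<in> borel_measurable M" "g \<in> borel_measurable M"
  shows "(\<lambda>x. mix J (f x) (g x) :: real^'n::finite) \<in> borel_measurable M"
  unfolding mix_def by measurable

text \<open>The value at s0 is compared with the value at every other point and the comparison is
  averaged over the interval; Cauchy--Schwarz controls the increments. The fundamental theorem is
  assumed in the integrated form \<open>diff\<close>, because that form is what Fubini's theorem
  yields for oscillatory integrals.\<close>

lemma one_dim_Sobolev:
  fixes \<phi> \<phi>' :: "real \<Rightarrow> complex"
  assumes [measurable]: "\<phi> \<in> borel_measurable borel" "\<phi>' \<in> borel_measurable borel" and e: "0 < e"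
    and diff: "\<And>s s0. s \<in> {c - e..c + e} \<Longrightarrow> s0 \<in> {c - e..c + e} \<Longrightarrow>
      ennreal (norm (\<phi> s0 - \<phi> s)) \<le> mass (\<lambda>t. norm (\<phi>' t)) ({c - e..c + e})"
    and s0: "s0 \<in> {c - e..c + e}"
  shows "ennreal ((norm (\<phi> s0))\<^sup>2) \<le> ennreal (1 / e) * mass (\<lambda>t. (norm (\<phi> t))\<^sup>2) ({c - e..c + e})
     + ennreal (4 * e) * mass (\<lambda>t. (norm (\<phi>' t))\<^sup>2) ({c - e..c + e})"
proof -
  define I where "I = {c - e..c + e}"
  have [measurable]: "I \<in> sets borel" by (simp add: I_def)
  have I: "emeasure lborel I = ennreal (2 * e)" using e by (simp add: I_def)
  define J where "J = mass (\<lambda>t. norm (\<phi>' t)) I"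
  define J2 where "J2 = mass (\<lambda>t. (norm (\<phi>' t))\<^sup>2) I"
  have epow2: "epowr (ennreal a) 2 = ennreal (a\<^sup>2)" if "0 \<le> a" for a
    using that by (simp add: epowr_ennreal powr_numeral)
  have J: "epowr J 2 \<le> ennreal (2 * e) * J2"
  proof -
    have "epowr J 2 = epowr (\<integral>\<^sup>+t. (ennreal (norm (\<phi>' t)) * indicator I t) * indicator I t \<partial>lborel) 2"
      unfolding J_def by (intro arg_cong2[where f=epowr] nn_integral_cong) (auto simp: indicator_def)
    also have "\<dots> \<le> (\<integral>\<^sup>+t. epowr (ennreal (norm (\<phi>' t)) * indicator I t) 2 \<partial>lborel) * epowr (\<integral>\<^sup>+t. epowr (indicator I t) (2 / (2 - 1)) \<partial>lborel) (2 - 1)"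
      by (intro nn_integral_Holder_powr) auto
    also have "(\<integral>\<^sup>+t. epowr (ennreal (norm (\<phi>' t)) * indicator I t) 2 \<partial>lborel) = J2"
      unfolding J2_def by (intro nn_integral_cong) (auto simp: indicator_def epow2)
    also have "(\<integral>\<^sup>+t. epowr (indicator I t) (2 / (2 - 1)) \<partial>lborel) = (\<integral>\<^sup>+t. indicator I t \<partial>lborel)"
      by (intro nn_integral_cong) (auto simp: indicator_def)
    finally show ?thesis by (simp add: I mult.commute)
  qed
  have "ennreal ((norm (\<phi> s0))\<^sup>2) \<le> 2 * ennreal ((norm (\<phi> s))\<^sup>2) + 2 * (ennreal (2 * e) * J2)" if s: "s \<in> I" for s
  proof -
    have "ennreal ((norm (\<phi> s0))\<^sup>2) \<le> ennreal (2 * (norm (\<phi> s))\<^sup>2 + 2 * (norm (\<phi> s0 - \<phi> s))\<^sup>2)"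
    proof (rule ennreal_leI)
      have "norm (\<phi> s0) \<le> norm (\<phi> s) + norm (\<phi> s0 - \<phi> s)" using norm_triangle_ineq[of "\<phi> s" "\<phi> s0 - \<phi> s"] by simp
      then have "(norm (\<phi> s0))\<^sup>2 \<le> (norm (\<phi> s) + norm (\<phi> s0 - \<phi> s))\<^sup>2" by (intro power_mono) auto
      also have "\<dots> \<le> 2 * (norm (\<phi> s))\<^sup>2 + 2 * (norm (\<phi> s0 - \<phi> s))\<^sup>2"
        using sum_squares_bound[of "norm (\<phi> s)" "norm (\<phi> s0 - \<phi> s)"] by (simp add: power2_sum)
      finally show "(norm (\<phi> s0))\<^sup>2 \<le> 2 * (norm (\<phi> s))\<^sup>2 + 2 * (norm (\<phi> s0 - \<phi> s))\<^sup>2" .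
    qed
    also have "\<dots> = 2 * ennreal ((norm (\<phi> s))\<^sup>2) + 2 * epowr (ennreal (norm (\<phi> s0 - \<phi> s))) 2"
      by (simp add: epow2 ennreal_mult ennreal_numeral)
    also have "\<dots> \<le> 2 * ennreal ((norm (\<phi> s))\<^sup>2) + 2 * epowr J 2"
      unfolding J_def I_def using s s0 by (intro add_left_mono mult_left_mono epowr_mono diff) (auto simp: I_def)
    also have "\<dots> \<le> 2 * ennreal ((norm (\<phi> s))\<^sup>2) + 2 * (ennreal (2 * e) * J2)"
      by (intro add_left_mono mult_left_mono J) auto
    finally show ?thesis .
  qed
  \<comment> \<open>Integrates the comparison over s; division by the length 2 e follows
    below.\<close>
  then have "mass (\<lambda>s. (norm (\<phi> s0))\<^sup>2) I \<le> (\<integral>\<^sup>+s\<in>I. 2 * ennreal ((norm (\<phi> s))\<^sup>2) + 2 * (ennreal (2 * e) * J2) \<partial>lborel)"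
    by (intro nn_integral_mono) (auto simp: indicator_def)
  also have "\<dots> = 2 * mass (\<lambda>s. (norm (\<phi> s))\<^sup>2) I + 2 * (ennreal (2 * e) * J2) * ennreal (2 * e)"
  proof -
    have "(\<integral>\<^sup>+s\<in>I. 2 * ennreal ((norm (\<phi> s))\<^sup>2) + 2 * (ennreal (2 * e) * J2) \<partial>lborel)
      = (\<integral>\<^sup>+s. 2 * (ennreal ((norm (\<phi> s))\<^sup>2) * indicator I s) + 2 * (ennreal (2 * e) * J2) * indicator I s \<partial>lborel)"
      by (intro nn_integral_cong) (auto simp: indicator_def)
    then show ?thesis by (simp add: nn_integral_add nn_integral_cmult I)
  qed
  finally have *: "ennreal ((norm (\<phi> s0))\<^sup>2) * ennreal (2 * e) \<le> 2 * mass (\<lambda>s. (norm (\<phi> s))\<^sup>2) I + 2 * (ennreal (2 * e) * J2) * ennreal (2 * e)"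
    by (simp add: nn_integral_cmult_indicator I)
  have half: "ennreal (1 / (2 * e)) * 2 = ennreal (1 / e)" and one: "ennreal (1 / (2 * e)) * ennreal (2 * e) = 1" and four: "2 * ennreal (2 * e) = ennreal (4 * e)"
    using e by (simp_all add: ennreal_mult[symmetric] ennreal_numeral[symmetric] del: ennreal_numeral)
  have "ennreal ((norm (\<phi> s0))\<^sup>2) = ennreal (1 / (2 * e)) * (ennreal ((norm (\<phi> s0))\<^sup>2) * ennreal (2 * e))"
    using one by (simp only: mult.left_commute[of "ennreal (1 / (2 * e))"] one mult_1_right)
  also have "\<dots> \<le> ennreal (1 / (2 * e)) * (2 * mass (\<lambda>s. (norm (\<phi> s))\<^sup>2) I + 2 * (ennreal (2 * e) * J2) * ennreal (2 * e))"
    by (intro mult_left_mono *) auto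
  also have "\<dots> = (ennreal (1 / (2 * e)) * 2) * mass (\<lambda>s. (norm (\<phi> s))\<^sup>2) I + (ennreal (1 / (2 * e)) * ennreal (2 * e)) * ((2 * ennreal (2 * e)) * J2)"
    by (simp only: distrib_left mult_ac)
  also have "\<dots> = ennreal (1 / e) * mass (\<lambda>s. (norm (\<phi> s))\<^sup>2) I + ennreal (4 * e) * J2"
    unfolding half one four by simp
  finally show ?thesis unfolding J2_def I_def .
qed

section \<open>Operators with frozen symbols\<close>

context amplitude
begin

text \<open>The factor (2 pi)^(-n) of the quantisation is left out and restored when the pieces are
  summed.\<close>

definition T :: "(real^'n \<Rightarrow> complex) \<Rightarrow> real^'n \<Rightarrow> complex"
  where "T f x = (LINT y|lborel. FT (b x) (x - y) * f y)"

text \<open>\<open>\<Phi> L i k g x z\<close> is the operator with symbol \<open>D L i k z\<close>, frozen at \<open>z\<close>, applied to \<open>g\<close>.\<close>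

definition \<Phi> :: "'n list \<Rightarrow> 'n \<Rightarrow> nat \<Rightarrow> (real^'n \<Rightarrow> complex) \<Rightarrow> real^'n \<Rightarrow> real^'n \<Rightarrow> complex"
  where "\<Phi> L i k g x z = FT (\<lambda>\<xi>. D L i k z \<xi> * FT g (- \<xi>)) x"

lemma \<Phi>_measurable [measurable]:
  assumes [measurable]: "g \<in> borel_measurable borel" "u \<in> borel_measurable M" "v \<in> borel_measurable M"
  shows "(\<lambda>w. \<Phi> L i k g (u w) (v w)) \<in> borel_measurable M"
  unfolding \<Phi>_def FT_def by measurable

text \<open>Covers derivatives of every order, whereas the quantitative \<open>bound\<close> stops
  at finite order; it secures absolute convergence and does not enter any constant.\<close>

lemma D_support_bounded: "\<exists>B\<ge>0. \<forall>\<xi>. norm (D L i k z \<xi>) \<le> B * indicator (cube 0 (2 * R)) \<xi>"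
proof -
  have "compact (D L i k z ` cube 0 (2 * R))"
    by (intro compact_continuous_image compact_cube continuous_on_subset[OF cont_\<xi>]) auto
  then obtain B where B: "\<And>\<xi>. \<xi> \<in> cube 0 (2 * R) \<Longrightarrow> norm (D L i k z \<xi>) \<le> B"
    by (metis bounded_iff compact_imp_bounded imageI)
  have "norm (D L i k z \<xi>) \<le> max B 0 * indicator (cube 0 (2 * R)) \<xi>" for \<xi>
    using B[of \<xi>] supp[of \<xi> L i k z] by (auto simp: indicator_def)
  then show ?thesis by (intro exI[of _ "max B 0"]) auto
qed

lemma integrable_indicator_cube: "integrable lborel (indicator (cube x t) :: real^'n \<Rightarrow> real)"
  by (intro integrable_real_indicator) (auto simp: cube_eq_cbox emeasure_lborel_cbox_eq)

lemma integrable_D_mult: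
  assumes g: "integrable lborel g"
  shows "integrable lborel (\<lambda>\<xi>. D L i k z \<xi> * FT g (- \<xi>))"
proof -
  have [measurable]: "g \<in> borel_measurable borel" using g by (auto dest: borel_measurable_integrable)
  obtain B where B: "0 \<le> B" "\<And>\<xi>. norm (D L i k z \<xi>) \<le> B * indicator (cube 0 (2 * R)) \<xi>"
    using D_support_bounded[of L i k z] by blast
  define G where "G = (LINT y|lborel. norm (g y))"
  show ?thesis
  proof (rule Bochner_Integration.integrable_bound)
    show "integrable lborel (\<lambda>\<xi> :: real^'n. (B * G) * indicator (cube 0 (2 * R)) \<xi>)"
      by (intro integrable_mult_right integrable_indicator_cube)
    show "AE \<xi> in lborel. norm (D L i k z \<xi> * FT g (- \<xi>)) \<le> norm ((B * G) * indicator (cube 0 (2 * R)) \<xi> :: real)"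
    proof (rule AE_I2)
      fix \<xi> :: "real^'n"
      have "norm (D L i k z \<xi> * FT g (- \<xi>)) \<le> (B * indicator (cube 0 (2 * R)) \<xi>) * G"
        unfolding norm_mult G_def using B by (intro mult_mono norm_FT_le) auto
      then show "norm (D L i k z \<xi> * FT g (- \<xi>)) \<le> norm ((B * G) * indicator (cube 0 (2 * R)) \<xi> :: real)"
        using B(1) by (auto simp: indicator_def split: if_splits)
    qed
  qed measurable
qed

text \<open>A frozen symbol is a Fourier multiplier, so two applications of Plancherel's inequality
  suffice; hence the square of (2 pi)^n.\<close>

lemma \<Phi>_L2:
  assumes g: "integrable lborel g" and L: "length L \<le> CARD('n)" and k: "k \<le> 2 * CARD('n)"
  shows "L2sq (\<lambda>x. \<Phi> L i k g x z)
    \<le> ennreal (((2 * pi) ^ CARD('n))\<^sup>2 * (A * l ^ length L / l ^ k)\<^sup>2) * L2sq g"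
proof -
  have [measurable]: "g \<in> borel_measurable borel" using g by (auto dest: borel_measurable_integrable)
  define a where "a = A * l ^ length L / l ^ k"
  define q where "q = (2 * pi) ^ CARD('n)"
  have q: "0 \<le> q" by (simp add: q_def)
  have "L2sq (\<lambda>x. \<Phi> L i k g x z)
    \<le> ennreal ((2 * pi) ^ DIM(real^'n)) * L2sq (\<lambda>\<xi>. D L i k z \<xi> * FT g (- \<xi>))"
    unfolding \<Phi>_def by (rule Plancherel_le[OF integrable_D_mult[OF g]])
  also have "\<dots> \<le> ennreal q * (\<integral>\<^sup>+\<xi>. ennreal (a\<^sup>2) * ennreal ((norm (FT g (- \<xi>)))\<^sup>2) \<partial>lborel)"
  proof -
    have "(norm (D L i k z \<xi> * FT g (- \<xi>)))\<^sup>2 \<le> a\<^sup>2 * (norm (FT g (- \<xi>)))\<^sup>2" for \<xi>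
      using bound[OF L k, of i z \<xi>] by (simp add: norm_mult power_mult_distrib a_def mult_right_mono power_mono)
    then show ?thesis by (auto simp: q_def ennreal_mult[symmetric] intro!: mult_left_mono nn_integral_mono ennreal_leI)
  qed
  also have "\<dots> = ennreal q * (ennreal (a\<^sup>2) * L2sq (\<lambda>\<xi>. FT g (- \<xi>)))"
    by (subst nn_integral_cmult) auto
  also have "L2sq (\<lambda>\<xi>. FT g (- \<xi>)) = L2sq (\<lambda>\<xi>. FT g \<xi>)"
    using nn_integral_lborel_reflect[of "\<lambda>\<xi>. ennreal ((norm (FT g \<xi>))\<^sup>2)" 0] by simp
  also have "ennreal q * (ennreal (a\<^sup>2) * L2sq (\<lambda>\<xi>. FT g \<xi>)) \<le> ennreal q * (ennreal (a\<^sup>2) * (ennreal ((2 * pi) ^ DIM(real^'n)) * L2sq g))"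
    by (intro mult_left_mono Plancherel_le g) auto
  also have "\<dots> = ennreal (q\<^sup>2 * a\<^sup>2) * L2sq g"
  proof -
    have "q\<^sup>2 * a\<^sup>2 = q * (a\<^sup>2 * q)" by (simp add: power2_eq_square)
    moreover have "(2 * pi) ^ DIM(real^'n) = q" by (simp add: q_def)
    ultimately show ?thesis using q by (simp only: ennreal_mult mult.assoc zero_le_power2 mult_nonneg_nonneg)
  qed
  finally show ?thesis by (simp add: q_def a_def)
qed

text \<open>The fundamental theorem for the symbol in one coordinate of z, carried through the
  frequency integral by Fubini's theorem. The domination comes from compactness of the segment times
  the frequency cube.\<close>

lemma \<Phi>_diff:
  assumes g: "integrable lborel g" and s: "s \<in> {c..d}" "s0 \<in> {c..d}"
  shows "ennreal (norm (\<Phi> L i k g x (upd z j s0) - \<Phi> L i k g x (upd z j s)))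
     \<le> mass (\<lambda>t. norm (\<Phi> (j # L) i k g x (upd z j t))) ({c..d})"
proof -
  have gm [measurable]: "g \<in> borel_measurable borel" using g by (auto dest: borel_measurable_integrable)
  have main: "ennreal (norm (\<Phi> L i k g x (upd z j s0) - \<Phi> L i k g x (upd z j s)))
     \<le> mass (\<lambda>t. norm (\<Phi> (j # L) i k g x (upd z j t))) ({s..s0})" if le: "s \<le> s0" for s s0
  proof -
    define E where "E = (\<lambda>\<xi>. iexp (x \<bullet> \<xi>))"
    have [measurable]: "E \<in> borel_measurable borel" unfolding E_def by measurable
    have nE: "norm (E \<xi>) = 1" for \<xi> by (simp add: E_def)
    define W where "W = (\<lambda>\<xi> t. E \<xi> * (indicator {s..s0} t *\<^sub>R D (j # L) i k (upd z j t) \<xi> * FT g (- \<xi>)))"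
    obtain u0 where ue: "\<And>t. upd z j t = u0 + t *\<^sub>R axis j 1" using upd_eq_add[of z j] by blast
    have cj: "continuous_on UNIV (\<lambda>t. D (j # L) i k (upd z j t) \<xi>)" for \<xi>
    proof -
      have c1: "continuous_on UNIV (\<lambda>t. (u0 + t *\<^sub>R axis j 1, \<xi>))" by (intro continuous_intros)
      have "continuous_on UNIV (\<lambda>t. case (u0 + t *\<^sub>R axis j 1, \<xi>) of (x, \<xi>) \<Rightarrow> D (j # L) i k x \<xi>)"
        by (rule continuous_on_compose2[OF cont c1]) simp
      then show ?thesis by (simp add: ue)
    qed
    have ftc: "(LINT t|lborel. indicator {s..s0} t *\<^sub>R D (j # L) i k (upd z j t) \<xi>) = D L i k (upd z j s0) \<xi> - D L i k (upd z j s) \<xi>" for \<xi>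
    proof (rule integral_FTC_atLeastAtMost[OF le])
      fix t
      have "((\<lambda>t. D L i k (upd z j t) \<xi>) has_vector_derivative D (j # L) i k (upd z j t) \<xi>) (at t)"
        unfolding ue by (rule deriv_x)
      then show "((\<lambda>t. D L i k (upd z j t) \<xi>) has_vector_derivative D (j # L) i k (upd z j t) \<xi>) (at t within {s..s0})"
        by (rule has_vector_derivative_at_within)
    qed (use cj continuous_on_subset in blast)
    have Phi: "\<Phi> L i k g x y = (LINT \<xi>|lborel. E \<xi> * (D L i k y \<xi> * FT g (- \<xi>)))" for L y
      unfolding \<Phi>_def FT_def[of _ x] E_def ..
    have intE: "integrable lborel (\<lambda>\<xi>. E \<xi> * (D L i k y \<xi> * FT g (- \<xi>)))" for L y
      unfolding E_def by (intro integrable_exp_imaginary_mult integrable_D_mult g)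
    have "\<Phi> L i k g x (upd z j s0) - \<Phi> L i k g x (upd z j s)
       = (LINT \<xi>|lborel. E \<xi> * (D L i k (upd z j s0) \<xi> * FT g (- \<xi>)) - E \<xi> * (D L i k (upd z j s) \<xi> * FT g (- \<xi>)))"
      unfolding Phi by (intro Bochner_Integration.integral_diff[symmetric] intE)
    also have "\<dots> = (LINT \<xi>|lborel. LINT t|lborel. W \<xi> t)"
    proof (intro Bochner_Integration.integral_cong refl)
      fix \<xi>
      have "(LINT t|lborel. W \<xi> t) = E \<xi> * ((LINT t|lborel. indicator {s..s0} t *\<^sub>R D (j # L) i k (upd z j t) \<xi>) * FT g (- \<xi>))"
        unfolding W_def by (simp only: integral_mult_right_zero integral_mult_left_zero)
      then show "E \<xi> * (D L i k (upd z j s0) \<xi> * FT g (- \<xi>)) - E \<xi> * (D L i k (upd z j s) \<xi> * FT g (- \<xi>)) = (LINT t|lborel. W \<xi> t)"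
        unfolding ftc by (simp add: algebra_simps)
    qed
    also have "\<dots> = (LINT t|lborel. LINT \<xi>|lborel. W \<xi> t)"
    proof -
      have "compact ((\<lambda>(t, \<xi>). D (j # L) i k (upd z j t) \<xi>) ` ({s..s0} \<times> cube 0 (2 * R)))"
      proof (intro compact_continuous_image compact_Times compact_cube compact_Icc)
        have c1: "continuous_on UNIV (\<lambda>p. (u0 + fst p *\<^sub>R axis j 1, snd p :: real^'n))" by (intro continuous_intros)
        have "continuous_on UNIV (\<lambda>p. case (u0 + fst p *\<^sub>R axis j 1, snd p) of (x, \<xi>) \<Rightarrow> D (j # L) i k x \<xi>)"
          by (rule continuous_on_compose2[OF cont c1]) simp
        from continuous_on_subset[OF this subset_UNIV]
        show "continuous_on ({s..s0} \<times> cube 0 (2 * R)) (\<lambda>(t, \<xi>). D (j # L) i k (upd z j t) \<xi>)"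
          by (simp add: ue case_prod_unfold)
      qed
      then obtain B where B: "\<And>t \<xi>. t \<in> {s..s0} \<Longrightarrow> \<xi> \<in> cube 0 (2 * R) \<Longrightarrow> norm (D (j # L) i k (upd z j t) \<xi>) \<le> B"
        by (force dest!: compact_imp_bounded simp: bounded_iff)
      define G where "G = (LINT y|lborel. norm (g y))"
      have G: "0 \<le> G" by (simp add: G_def)
      have Wle: "norm (W \<xi> t) \<le> (max B 0 * G * indicator (cube 0 (2 * R)) \<xi>) * indicator {s..s0} t" for \<xi> t
      proof (cases "t \<in> {s..s0} \<and> \<xi> \<in> cube 0 (2 * R)")
        case True
        then have "norm (D (j # L) i k (upd z j t) \<xi>) * norm (FT g (- \<xi>)) \<le> max B 0 * G"
          unfolding G_def using B[of t \<xi>] by (intro mult_mono norm_FT_le) auto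
        then show ?thesis using True by (simp add: W_def norm_mult nE)
      next
        case False
        then have "W \<xi> t = 0" using supp[of \<xi> "j # L" i k "upd z j t"] by (auto simp: W_def)
        then show ?thesis using G by simp
      qed
      show ?thesis
      proof (rule Fubini_swap_bound[OF _ _ _ Wle])
        show "(\<lambda>(\<xi>, t). W \<xi> t) \<in> borel_measurable (lborel \<Otimes>\<^sub>M lborel)" unfolding W_def by measurable
        show "integrable lborel (\<lambda>\<xi> :: real^'n. max B 0 * G * indicator (cube 0 (2 * R)) \<xi>)"
          by (intro integrable_mult_right integrable_indicator_cube)
        show "integrable lborel (indicator {s..s0} :: real \<Rightarrow> real)" using le by (intro integrable_real_indicator) auto
      qed
    qed
    also have "\<dots> = (LINT t|lborel. indicator {s..s0} t *\<^sub>R \<Phi> (j # L) i k g x (upd z j t))"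
    proof (intro Bochner_Integration.integral_cong refl)
      fix t
      have "W \<xi> t = indicator {s..s0} t *\<^sub>R (E \<xi> * (D (j # L) i k (upd z j t) \<xi> * FT g (- \<xi>)))" for \<xi>
        by (simp add: W_def)
      then show "(LINT \<xi>|lborel. W \<xi> t) = indicator {s..s0} t *\<^sub>R \<Phi> (j # L) i k g x (upd z j t)"
        unfolding Phi by simp
    qed
    finally have "\<Phi> L i k g x (upd z j s0) - \<Phi> L i k g x (upd z j s) = (LINT t|lborel. indicator {s..s0} t *\<^sub>R \<Phi> (j # L) i k g x (upd z j t))" .
    moreover have "ennreal (norm (LINT t|lborel. f t)) \<le> (\<integral>\<^sup>+t. norm (f t) \<partial>lborel)" for f :: "real \<Rightarrow> complex"
      by (cases "integrable lborel f") (auto simp: not_integrable_integral_eq intro: integral_norm_bound_ennreal)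
    ultimately have "ennreal (norm (\<Phi> L i k g x (upd z j s0) - \<Phi> L i k g x (upd z j s))) \<le> (\<integral>\<^sup>+t. norm (indicator {s..s0} t *\<^sub>R \<Phi> (j # L) i k g x (upd z j t)) \<partial>lborel)"
      by metis
    also have "\<dots> = mass (\<lambda>t. norm (\<Phi> (j # L) i k g x (upd z j t))) ({s..s0})"
      by (intro nn_integral_cong) (auto simp: indicator_def)
    finally show ?thesis .
  qed
  show ?thesis
  proof (cases "s \<le> s0")
    case True
    then show ?thesis using s by (intro order_trans[OF main set_nn_integral_mono_set]) auto
  next
    case False
    then have "s0 \<le> s" by simp
    from main[OF this] show ?thesis using s
      by (subst norm_minus_commute) (auto intro: order_trans[OF _ set_nn_integral_mono_set])
  qed
qed

text \<open>Induction over the unfrozen coordinates. Releasing one coordinate by the Sobolev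
  inequality on an interval of half length 1 / l costs either nothing or one x-derivative, whose
  size l is balanced by the interval. At most n derivatives accumulate, which is the range where the
  symbol bound is available.\<close>

lemma \<Phi>_freeze:
  assumes g: "integrable lborel g" and k: "k \<le> 2 * CARD('n)" and J: "finite J" "length L + card J \<le> CARD('n)"
  shows "mass (\<lambda>x. (norm (\<Phi> L i k g x (mix J x z)))\<^sup>2) (cube z0 (1 / l))
    \<le> ennreal (10 ^ card J * (l ^ length L)\<^sup>2 * (((2 * pi) ^ CARD('n))\<^sup>2 * (A / l ^ k)\<^sup>2)) * L2sq g"
  using J
proof (induction J arbitrary: L z rule: finite_induct)
  case empty
  have "mass (\<lambda>x. (norm (\<Phi> L i k g x z))\<^sup>2) (cube z0 (1 / l)) \<le> L2sq (\<lambda>x. \<Phi> L i k g x z)"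
    by (intro nn_integral_mono) (auto simp: indicator_def)
  also note \<Phi>_L2[OF g _ k, of L i z]
  finally show ?case using empty by (simp add: power_divide power_mult_distrib mult_ac)
next
  case (insert j J)
  have gm [measurable]: "g \<in> borel_measurable borel" using g by (auto dest: borel_measurable_integrable)
  define Q where "Q = cube z0 (1 / l)"
  have [measurable]: "Q \<in> sets borel" by (simp add: Q_def)
  define e where "e = 1 / l"
  have e: "0 < e" using l by (simp add: e_def)
  define I where "I = {z0 $ j - e..z0 $ j + e}"
  have [measurable]: "I \<in> sets borel" by (simp add: I_def)
  have I: "emeasure lborel I = ennreal (2 * e)" using e by (simp add: I_def)
  define B where "B = ((2 * pi) ^ CARD('n))\<^sup>2 * (A / l ^ k)\<^sup>2"
  have B: "0 \<le> B" by (simp add: B_def)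
  define G where "G = L2sq g"
  define H where "H = (\<lambda>L :: 'n list. ennreal (10 ^ card J * (l ^ length L)\<^sup>2 * B) * G)"
  have IH: "mass (\<lambda>x. (norm (\<Phi> L' i k g x (mix J x y)))\<^sup>2) Q \<le> H L'" if "length L' + card J \<le> CARD('n)" for L' y
    unfolding Q_def H_def B_def G_def using insert.IH[OF that] .
  have len: "length L + card J \<le> CARD('n)" "length (j # L) + card J \<le> CARD('n)"
    using insert by auto
  \<comment> \<open>For fixed t the coordinate j is frozen at t again, so after Fubini the induction
    hypothesis applies at the point \<open>upd z j t\<close>.\<close>
  have swap: "(\<integral>\<^sup>+x\<in>Q. mass (\<lambda>t. (norm (\<Phi> L' i k g x (upd (mix J x z) j t)))\<^sup>2) I \<partial>lborel) \<le> ennreal (2 * e) * H L'"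
    if L': "length L' + card J \<le> CARD('n)" for L'
  proof -
    have "(\<integral>\<^sup>+x\<in>Q. mass (\<lambda>t. (norm (\<Phi> L' i k g x (upd (mix J x z) j t)))\<^sup>2) I \<partial>lborel)
      = (\<integral>\<^sup>+x. (\<integral>\<^sup>+t. ennreal ((norm (\<Phi> L' i k g x (upd (mix J x z) j t)))\<^sup>2) * indicator I t * indicator Q x \<partial>lborel) \<partial>lborel)"
      by (intro nn_integral_cong nn_integral_multc[symmetric]) measurable
    also have "\<dots> = (\<integral>\<^sup>+t. (\<integral>\<^sup>+x. ennreal ((norm (\<Phi> L' i k g x (upd (mix J x z) j t)))\<^sup>2) * indicator I t * indicator Q x \<partial>lborel) \<partial>lborel)"
      by (rule lborel_pair.Fubini') measurable
    also have "\<dots> \<le> (\<integral>\<^sup>+t. H L' * indicator I t \<partial>lborel)"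
    proof (intro nn_integral_mono)
      fix t
      have "(\<integral>\<^sup>+x. ennreal ((norm (\<Phi> L' i k g x (upd (mix J x z) j t)))\<^sup>2) * indicator I t * indicator Q x \<partial>lborel)
        = mass (\<lambda>x. (norm (\<Phi> L' i k g x (mix J x (upd z j t))))\<^sup>2) Q * indicator I t"
        unfolding upd_mix[OF insert.hyps(2)] by (subst nn_integral_multc[symmetric]) (auto simp: mult_ac)
      also have "\<dots> \<le> H L' * indicator I t" by (intro mult_right_mono IH L') simp
      finally show "(\<integral>\<^sup>+x. ennreal ((norm (\<Phi> L' i k g x (upd (mix J x z) j t)))\<^sup>2) * indicator I t * indicator Q x \<partial>lborel) \<le> H L' * indicator I t" .
    qed
    also have "\<dots> = ennreal (2 * e) * H L'" by (simp add: nn_integral_cmult_indicator I mult.commute)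
    finally show ?thesis .
  qed
  have "mass (\<lambda>x. (norm (\<Phi> L i k g x (mix (insert j J) x z)))\<^sup>2) Q
    \<le> (\<integral>\<^sup>+x\<in>Q. ennreal (1 / e) * mass (\<lambda>t. (norm (\<Phi> L i k g x (upd (mix J x z) j t)))\<^sup>2) I
     + ennreal (4 * e) * mass (\<lambda>t. (norm (\<Phi> (j # L) i k g x (upd (mix J x z) j t)))\<^sup>2) I \<partial>lborel)"
  proof (intro nn_integral_mono)
    fix x
    show "ennreal ((norm (\<Phi> L i k g x (mix (insert j J) x z)))\<^sup>2) * indicator Q x
      \<le> (ennreal (1 / e) * mass (\<lambda>t. (norm (\<Phi> L i k g x (upd (mix J x z) j t)))\<^sup>2) I
     + ennreal (4 * e) * mass (\<lambda>t. (norm (\<Phi> (j # L) i k g x (upd (mix J x z) j t)))\<^sup>2) I) * indicator Q x"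
    proof (cases "x \<in> Q")
      case True
      then have "x $ j \<in> I" by (auto simp: Q_def cube_def I_def e_def abs_le_iff algebra_simps dest!: spec[of _ j])
      then have "ennreal ((norm (\<Phi> L i k g x (upd (mix J x z) j (x $ j))))\<^sup>2) \<le>
         ennreal (1 / e) * mass (\<lambda>t. (norm (\<Phi> L i k g x (upd (mix J x z) j t)))\<^sup>2) I
          + ennreal (4 * e) * mass (\<lambda>t. (norm (\<Phi> (j # L) i k g x (upd (mix J x z) j t)))\<^sup>2) I"
        unfolding I_def by (intro one_dim_Sobolev e \<Phi>_diff[OF g]) measurable
      then show ?thesis using True by (simp add: mix_insert)
    qed simp
  qed
  also have "\<dots> = ennreal (1 / e) * (\<integral>\<^sup>+x\<in>Q. mass (\<lambda>t. (norm (\<Phi> L i k g x (upd (mix J x z) j t)))\<^sup>2) I \<partial>lborel)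
     + ennreal (4 * e) * (\<integral>\<^sup>+x\<in>Q. mass (\<lambda>t. (norm (\<Phi> (j # L) i k g x (upd (mix J x z) j t)))\<^sup>2) I \<partial>lborel)"
    by (simp only: distrib_right, subst nn_integral_add, measurable, simp only: mult.assoc, subst nn_integral_cmult, measurable, subst nn_integral_cmult, measurable)
  also have "\<dots> \<le> ennreal (1 / e) * (ennreal (2 * e) * H L) + ennreal (4 * e) * (ennreal (2 * e) * H (j # L))"
    by (intro add_mono mult_left_mono swap len) auto
  also have "\<dots> = ennreal (10 ^ card (insert j J) * (l ^ length L)\<^sup>2 * B) * G"
  proof -
    define h where "h = 10 ^ card J * (l ^ length L)\<^sup>2 * B"
    have h: "0 \<le> h" using B by (simp add: h_def)
    have e1: "ennreal (1 / e) * (ennreal (2 * e) * H L) = ennreal (2 * h) * G"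
      using e h by (simp add: H_def h_def[symmetric] mult.assoc[symmetric] ennreal_mult[symmetric])
    have e2: "ennreal (4 * e) * (ennreal (2 * e) * H (j # L)) = ennreal (8 * h) * G"
    proof -
      \<comment> \<open>The derivative term contributes 4 e times 2 e times l^2, that is 8; the term
        without derivative contributes 2. This is the factor 10 per coordinate.\<close>
      have "4 * e * (2 * e * (10 ^ card J * (l ^ length (j # L))\<^sup>2 * B)) = 8 * h"
        using l by (simp add: h_def e_def power2_eq_square field_simps)
      moreover have "ennreal (4 * e) * (ennreal (2 * e) * H (j # L)) = ennreal (4 * e * (2 * e * (10 ^ card J * (l ^ length (j # L))\<^sup>2 * B))) * G"
        using e B l by (simp add: H_def mult.assoc[symmetric] ennreal_mult[symmetric])
      ultimately show ?thesis by simp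
    qed
    have "ennreal (2 * h) * G + ennreal (8 * h) * G = (ennreal (2 * h) + ennreal (8 * h)) * G" by (simp only: distrib_right)
    also have "ennreal (2 * h) + ennreal (8 * h) = ennreal (10 * h)" using h by (subst ennreal_plus[symmetric]) auto
    also have "10 * h = 10 ^ card (insert j J) * (l ^ length L)\<^sup>2 * B"
      using insert.hyps unfolding h_def by (simp only: card_insert_disjoint power_Suc mult.assoc if_False not_False_eq_True)
    finally show ?thesis unfolding e1 e2 .
  qed
  finally show ?case unfolding Q_def B_def G_def .
qed

end

section \<open>Localisation in x and summation over cubes\<close>

context amplitude
begin

lemma FT_b_L2: "L2sq (FT (b x)) < \<infinity>"
  using nn_integral_FT_D_le[of 0 undefined x] by (auto simp: base le_less_trans)

lemma T_integrable:
  assumes [measurable]: "f \<in> borel_measurable borel" and f: "L2sq f < \<infinity>"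
  shows "integrable lborel (\<lambda>y. FT (b x) (x - y) * f y)"
proof (rule integrableI_bounded)
  have "(\<integral>\<^sup>+y. ennreal (norm (FT (b x) (x - y) * f y)) \<partial>lborel)
    \<le> (\<integral>\<^sup>+y. ennreal ((norm (FT (b x) (x - y)))\<^sup>2) + ennreal ((norm (f y))\<^sup>2) \<partial>lborel)"
  proof (intro nn_integral_mono)
    fix y
    have "norm (FT (b x) (x - y)) * norm (f y) \<le> (norm (FT (b x) (x - y)))\<^sup>2 + (norm (f y))\<^sup>2"
      using sum_squares_bound[of "norm (FT (b x) (x - y))" "norm (f y)"]
        mult_nonneg_nonneg[OF norm_ge_zero norm_ge_zero, of "FT (b x) (x - y)" "f y"] by linarith
    then show "ennreal (norm (FT (b x) (x - y) * f y)) \<le> ennreal ((norm (FT (b x) (x - y)))\<^sup>2) + ennreal ((norm (f y))\<^sup>2)"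
      by (simp add: norm_mult ennreal_plus[symmetric] ennreal_leI del: ennreal_plus)
  qed
  also have "\<dots> = L2sq (\<lambda>y. FT (b x) (x - y)) + L2sq f"
    by (intro nn_integral_add) measurable
  also have "L2sq (\<lambda>y. FT (b x) (x - y)) = L2sq (FT (b x))"
    by (rule nn_integral_lborel_reflect) measurable
  finally show "(\<integral>\<^sup>+y. ennreal (norm (FT (b x) (x - y) * f y)) \<partial>lborel) < \<infinity>"
    using FT_b_L2[of x] f by (auto simp: le_less_trans)
qed measurable

lemma T_measurable [measurable]:
  assumes [measurable]: "f \<in> borel_measurable borel" shows "T f \<in> borel_measurable borel"
  unfolding T_def by measurable

lemma integrable_FT_D_mult:
  assumes g: "integrable lborel g" and k: "k \<le> 2 * CARD('n)"
  shows "integrable lborel (\<lambda>y. FT (D [] i k x) (x - y) * g y)"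
proof (rule Bochner_Integration.integrable_bound)
  have [measurable]: "g \<in> borel_measurable borel" using g by (auto dest: borel_measurable_integrable)
  show "integrable lborel (\<lambda>y. (A * (4 * R) ^ CARD('n) / l ^ k) * norm (g y))"
    using g by (intro integrable_mult_right integrable_norm)
  show "(\<lambda>y. FT (D [] i k x) (x - y) * g y) \<in> borel_measurable lborel" unfolding FT_def by measurable
  show "AE y in lborel. norm (FT (D [] i k x) (x - y) * g y) \<le> norm ((A * (4 * R) ^ CARD('n) / l ^ k) * norm (g y))"
  proof (rule AE_I2)
    fix y
    have "norm (FT (D [] i k x) (x - y) * g y) \<le> (A * (4 * R) ^ CARD('n) / l ^ k) * norm (g y)"
      unfolding norm_mult by (intro mult_right_mono norm_FT_D_le k) auto
    also have "\<dots> \<le> norm ((A * (4 * R) ^ CARD('n) / l ^ k) * norm (g y))" unfolding real_norm_def by (rule abs_ge_self)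
    finally show "norm (FT (D [] i k x) (x - y) * g y) \<le> norm ((A * (4 * R) ^ CARD('n) / l ^ k) * norm (g y))" .
  qed
qed

lemma integral_FT_D_mult:
  assumes g: "integrable lborel g" and k: "k \<le> 2 * CARD('n)"
  shows "(LINT y|lborel. FT (D [] i k x) (x - y) * g y) = \<Phi> [] i k g x x"
proof -
  have [measurable]: "g \<in> borel_measurable borel" using g by (auto dest: borel_measurable_integrable)
  define W where "W = (\<lambda>y \<xi>. iexp ((x - y) \<bullet> \<xi>) * D [] i k x \<xi> * g y)"
  have "(LINT y|lborel. FT (D [] i k x) (x - y) * g y) = (LINT y|lborel. LINT \<xi>|lborel. W y \<xi>)"
    unfolding W_def FT_def by (simp only: integral_mult_left_zero)
  also have "\<dots> = (LINT \<xi>|lborel. LINT y|lborel. W y \<xi>)"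
  proof (rule Fubini_swap_bound)
    show "(\<lambda>(y, \<xi>). W y \<xi>) \<in> borel_measurable (lborel \<Otimes>\<^sub>M lborel)" unfolding W_def by measurable
    show "integrable lborel (\<lambda>y. norm (g y))" "integrable lborel (\<lambda>\<xi>. norm (D [] i k x \<xi>))"
      using g integrable_D[OF k] by (auto intro: integrable_norm)
    show "norm (W y \<xi>) \<le> norm (g y) * norm (D [] i k x \<xi>)" for y \<xi>
      by (simp add: W_def norm_mult mult.commute)
  qed
  also have "\<dots> = \<Phi> [] i k g x x"
  proof -
    have "(LINT y|lborel. W y \<xi>) = iexp (x \<bullet> \<xi>) * (D [] i k x \<xi> * FT g (- \<xi>))" for \<xi>
    proof -
      have "W y \<xi> = iexp (x \<bullet> \<xi>) * D [] i k x \<xi> * (iexp (- \<xi> \<bullet> y) * g y)" for y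
      proof -
        have "\<i> * of_real ((x - y) \<bullet> \<xi>) = \<i> * of_real (x \<bullet> \<xi>) + \<i> * of_real (- \<xi> \<bullet> y)"
          by (simp add: inner_diff_left inner_commute algebra_simps)
        then show ?thesis unfolding W_def by (simp only: exp_add mult_ac)
      qed
      then show ?thesis unfolding FT_def by (simp only: integral_mult_right_zero mult.assoc)
    qed
    then show ?thesis unfolding \<Phi>_def FT_def[of _ x] by simp
  qed
  finally show ?thesis .
qed

text \<open>Dividing f by \<open>growth\<close> centred at z provides decay away from z. The
  compensating polynomial is expanded around x: powers of x - y act on the kernel as
  \<xi>-derivatives of the symbol, and powers of x - z are harmless for x near z.\<close>

lemma T_expand:
  fixes f :: "real^'n \<Rightarrow> complex" and z :: "real^'n"
  assumes f: "integrable lborel f"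
  defines "N \<equiv> 2 * CARD('n)"
  defines "g \<equiv> \<lambda>y. f y / of_real (growth (l *\<^sub>R (y - z)))"
  shows "integrable lborel g"
    and "T f x = \<Phi> [] j 0 g x x + (\<Sum>i\<in>UNIV. \<Sum>k\<le>N. of_nat (N choose k) * (of_real (- l) * \<i>) ^ k * of_real (l * (x $ i - z $ i)) ^ (N - k) * \<Phi> [] i k g x x)"
proof -
  have [measurable]: "f \<in> borel_measurable borel" using f by (auto dest: borel_measurable_integrable)
  show g: "integrable lborel g"
  proof (rule Bochner_Integration.integrable_bound[OF f])
    show "AE y in lborel. norm (g y) \<le> norm (f y)"
    proof (rule AE_I2)
      fix y
      have "norm (f y) / growth (l *\<^sub>R (y - z)) \<le> norm (f y) / 1"
        using growth_ge_1[of "l *\<^sub>R (y - z)"] by (intro divide_left_mono) auto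
      then show "norm (g y) \<le> norm (f y)"
        using growth_pos[of "l *\<^sub>R (y - z)"] by (simp add: g_def norm_divide)
    qed
  qed (simp add: g_def)
  define c where "c = (\<lambda>i k. of_nat (N choose k) * (of_real (- l) * \<i>) ^ k * complex_of_real (l * (x $ i - z $ i)) ^ (N - k))"
  have pt: "FT (b x) (x - y) * f y = FT (D [] j 0 x) (x - y) * g y + (\<Sum>i\<in>UNIV. \<Sum>k\<le>N. c i k * (FT (D [] i k x) (x - y) * g y))" for y
  proof -
    define F where "F = FT (b x) (x - y)"
    have co: "complex_of_real ((l * (y $ i - z $ i)) ^ N) * F = (\<Sum>k\<le>N. c i k * FT (D [] i k x) (x - y))" for i
    proof -
      \<comment> \<open>Binomial expansion of y - z = (x - z) - (x - y).\<close>
      have "complex_of_real ((l * (y $ i - z $ i)) ^ N) = (of_real (- l * (x $ i - y $ i)) + of_real (l * (x $ i - z $ i))) ^ N"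
        by (simp add: algebra_simps)
      also have "\<dots> = (\<Sum>k\<le>N. of_nat (N choose k) * of_real (- l * (x $ i - y $ i)) ^ k * of_real (l * (x $ i - z $ i)) ^ (N - k))"
        by (rule binomial_ring)
      finally have "complex_of_real ((l * (y $ i - z $ i)) ^ N) * F = (\<Sum>k\<le>N. of_nat (N choose k) * of_real (- l * (x $ i - y $ i)) ^ k * of_real (l * (x $ i - z $ i)) ^ (N - k) * F)"
        by (simp only: sum_distrib_right)
      also have "\<dots> = (\<Sum>k\<le>N. c i k * FT (D [] i k x) (x - y))"
      proof (intro sum.cong refl)
        fix k assume k: "k \<in> {..N}"
        have e1: "FT (D [] i k x) (x - y) = (- \<i> * of_real ((x - y) $ i)) ^ k * F"
          unfolding F_def using k by (intro FT_D) (simp add: N_def)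
        have e2: "(of_real (- l) * \<i>) ^ k * (- \<i> * of_real ((x - y) $ i)) ^ k = complex_of_real (- l * (x $ i - y $ i)) ^ k"
        proof -
          have "a * \<i> * (- \<i> * c) = a * c" for a c :: complex by (simp add: mult.assoc)
          then show ?thesis unfolding power_mult_distrib[symmetric] by simp
        qed
        show "of_nat (N choose k) * of_real (- l * (x $ i - y $ i)) ^ k * of_real (l * (x $ i - z $ i)) ^ (N - k) * F = c i k * FT (D [] i k x) (x - y)"
          unfolding c_def e1 e2[symmetric] by (simp only: mult_ac)
      qed
      finally show ?thesis .
    qed
    have "complex_of_real (growth (l *\<^sub>R (y - z))) * F = F + (\<Sum>i\<in>UNIV. complex_of_real ((l * (y $ i - z $ i)) ^ N) * F)"
      by (simp add: growth_def N_def distrib_right sum_distrib_right)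
    also have "\<dots> = F + (\<Sum>i\<in>UNIV. \<Sum>k\<le>N. c i k * FT (D [] i k x) (x - y))" by (simp only: co)
    finally have gF: "complex_of_real (growth (l *\<^sub>R (y - z))) * F = F + (\<Sum>i\<in>UNIV. \<Sum>k\<le>N. c i k * FT (D [] i k x) (x - y))" .
    have "complex_of_real (growth (l *\<^sub>R (y - z))) \<noteq> 0" using growth_pos[of "l *\<^sub>R (y - z)"] by simp
    then have "f y = complex_of_real (growth (l *\<^sub>R (y - z))) * g y" by (simp add: g_def)
    then have "F * f y = (complex_of_real (growth (l *\<^sub>R (y - z))) * F) * g y" by (simp only: mult_ac)
    also have "\<dots> = F * g y + (\<Sum>i\<in>UNIV. \<Sum>k\<le>N. c i k * (FT (D [] i k x) (x - y) * g y))"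
      unfolding gF by (simp only: distrib_right sum_distrib_right mult.assoc)
    finally show ?thesis by (simp add: F_def base)
  qed
  have int: "integrable lborel (\<lambda>y. FT (D [] i k x) (x - y) * g y)" if "k \<le> N" for i k
    using that by (intro integrable_FT_D_mult g) (simp add: N_def)
  have "T f x = (LINT y|lborel. FT (D [] j 0 x) (x - y) * g y + (\<Sum>i\<in>UNIV. \<Sum>k\<le>N. c i k * (FT (D [] i k x) (x - y) * g y)))"
    unfolding T_def by (simp only: pt)
  also have "\<dots> = (LINT y|lborel. FT (D [] j 0 x) (x - y) * g y) + (LINT y|lborel. (\<Sum>i\<in>UNIV. \<Sum>k\<le>N. c i k * (FT (D [] i k x) (x - y) * g y)))"
    by (intro Bochner_Integration.integral_add int Bochner_Integration.integrable_sum integrable_mult_right) auto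
  also have "(LINT y|lborel. (\<Sum>i\<in>UNIV. \<Sum>k\<le>N. c i k * (FT (D [] i k x) (x - y) * g y)))
     = (\<Sum>i\<in>UNIV. LINT y|lborel. (\<Sum>k\<le>N. c i k * (FT (D [] i k x) (x - y) * g y)))"
    by (intro Bochner_Integration.integral_sum Bochner_Integration.integrable_sum integrable_mult_right int) auto
  also have "\<dots> = (\<Sum>i\<in>UNIV. \<Sum>k\<le>N. LINT y|lborel. c i k * (FT (D [] i k x) (x - y) * g y))"
    by (intro sum.cong refl Bochner_Integration.integral_sum integrable_mult_right int) auto
  also have "\<dots> = (\<Sum>i\<in>UNIV. \<Sum>k\<le>N. c i k * \<Phi> [] i k g x x)"
    by (intro sum.cong refl) (simp add: integral_FT_D_mult[OF g] N_def)
  also have "(LINT y|lborel. FT (D [] j 0 x) (x - y) * g y) = \<Phi> [] j 0 g x x" by (intro integral_FT_D_mult g) simp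
  finally show "T f x = \<Phi> [] j 0 g x x + (\<Sum>i\<in>UNIV. \<Sum>k\<le>N. of_nat (N choose k) * (of_real (- l) * \<i>) ^ k * of_real (l * (x $ i - z $ i)) ^ (N - k) * \<Phi> [] i k g x x)"
    by (simp only: c_def)
qed

end

lemma ennreal_double_sum:
  fixes a :: "'a \<Rightarrow> 'b \<Rightarrow> real"
  assumes "\<And>i k. 0 \<le> a i k"
  shows "(\<Sum>i\<in>I. \<Sum>k\<in>K. ennreal (a i k)) = ennreal (\<Sum>i\<in>I. \<Sum>k\<in>K. a i k)"
  using assms by (simp add: sum_ennreal sum_nonneg)

text \<open>The last factor is the cost of unfreezing n coordinates and of two Plancherel bounds.
  The squared term is the sum of all binomial coefficients over all coordinates, which
  Cauchy--Schwarz and the final summation each contribute once.\<close>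

definition CV_const :: "'n::finite itself \<Rightarrow> real"
  where "CV_const _ = 2 * (1 + (real CARD('n) * 2 ^ (2 * CARD('n)))\<^sup>2) * (10 ^ CARD('n) * ((2 * pi) ^ CARD('n))\<^sup>2)"

context amplitude
begin

text \<open>On the cube of half side 1 / l the coefficients \<open>l * (x $ i - z $ i)\<close> are
  at most 1, and the powers l^k of the expansion cancel the gains l^(-k) of the differentiated
  symbols, so all terms have the same size. The decay on the right is inherited from the division of
  f by \<open>growth\<close>.\<close>

lemma T_local_L2:
  assumes f: "integrable lborel f"
  shows "mass (\<lambda>x. (norm (T f x))\<^sup>2) (cube z (1 / l))
    \<le> ennreal (CV_const TYPE('n) * A\<^sup>2) * (\<integral>\<^sup>+y. ennreal ((norm (f y))\<^sup>2) * ennreal (1 / growth (l *\<^sub>R (z - y))) \<partial>lborel)"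
proof -
  have [measurable]: "f \<in> borel_measurable borel" using f by (auto dest: borel_measurable_integrable)
  define N where "N = 2 * CARD('n)"
  define g where "g = (\<lambda>y. f y / of_real (growth (l *\<^sub>R (y - z))))"
  define i0 where "i0 = (undefined :: 'n)"
  define Q where "Q = cube z (1 / l)"
  have [measurable]: "Q \<in> sets borel" by (simp add: Q_def)
  have g: "integrable lborel g" unfolding g_def by (rule T_expand(1)[OF f])
  have [measurable]: "g \<in> borel_measurable borel" using g by (auto dest: borel_measurable_integrable)
  define B where "B = 10 ^ CARD('n) * ((2 * pi) ^ CARD('n))\<^sup>2"
  have B: "0 \<le> B" by (simp add: B_def)
  define G where "G = L2sq g"
  have \<Phi>Q: "mass (\<lambda>x. (norm (\<Phi> [] i k g x x))\<^sup>2) Q \<le> ennreal (B * (A / l ^ k)\<^sup>2) * G" if "k \<le> N" for i k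
    using \<Phi>_freeze[OF g, where k=k and J=UNIV and L="[]" and ?z0.0=z and i=i] that by (simp add: Q_def B_def G_def N_def mult_ac)
  define M where "M = real CARD('n) * 2 ^ N"
  have sumM: "(\<Sum>i\<in>(UNIV::'n set). \<Sum>k\<le>N. real (N choose k)) = M"
  proof -
    have "(\<Sum>k\<le>N. real (N choose k)) = 2 ^ N" using choose_row_sum[of N] by (metis of_nat_numeral of_nat_power of_nat_sum)
    then show ?thesis by (simp add: M_def)
  qed
  have pt: "(norm (T f x))\<^sup>2 \<le> 2 * (norm (\<Phi> [] i0 0 g x x))\<^sup>2 + 2 * (M * (\<Sum>i\<in>UNIV. \<Sum>k\<le>N. real (N choose k) * (l ^ k)\<^sup>2 * (norm (\<Phi> [] i k g x x))\<^sup>2))" if x: "x \<in> Q" for x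
  proof -
    define v where "v = (\<lambda>i k. l ^ k * norm (\<Phi> [] i k g x x))"
    have "norm (T f x) \<le> norm (\<Phi> [] i0 0 g x x) + (\<Sum>i\<in>UNIV. \<Sum>k\<le>N. real (N choose k) * v i k)"
    proof -
      have tm: "norm (of_nat (N choose k) * (of_real (- l) * \<i>) ^ k * complex_of_real (l * (x $ i - z $ i)) ^ (N - k) * \<Phi> [] i k g x x) \<le> real (N choose k) * v i k" for i k
      proof -
        have "\<bar>x $ i - z $ i\<bar> \<le> 1 / l" using x by (simp add: Q_def cube_def)
        then have "\<bar>l * (x $ i - z $ i)\<bar> \<le> 1" using l by (simp add: abs_mult pos_le_divide_eq mult.commute)
        then have "\<bar>l * (x $ i - z $ i)\<bar> ^ (N - k) \<le> 1" by (intro power_le_one) auto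
        then have "norm (complex_of_real (l * (x $ i - z $ i)) ^ (N - k)) \<le> 1" by (simp only: norm_power norm_of_real)
        moreover have "norm ((complex_of_real (- l) * \<i>) ^ k) = l ^ k" using l by (simp add: norm_power norm_mult)
        ultimately have "norm (of_nat (N choose k) * (of_real (- l) * \<i>) ^ k * complex_of_real (l * (x $ i - z $ i)) ^ (N - k) * \<Phi> [] i k g x x) \<le> real (N choose k) * l ^ k * 1 * norm (\<Phi> [] i k g x x)"
          unfolding norm_mult using l by (intro mult_mono) auto
        then show ?thesis by (simp add: v_def mult_ac)
      qed
      have "norm (T f x) \<le> norm (\<Phi> [] i0 0 g x x) + norm (\<Sum>i\<in>UNIV. \<Sum>k\<le>N. of_nat (N choose k) * (of_real (- l) * \<i>) ^ k * complex_of_real (l * (x $ i - z $ i)) ^ (N - k) * \<Phi> [] i k g x x)"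
        unfolding T_expand(2)[OF f, where x=x and j=i0 and z=z] g_def N_def by (rule norm_triangle_ineq)
      also have "\<dots> \<le> norm (\<Phi> [] i0 0 g x x) + (\<Sum>i\<in>UNIV. \<Sum>k\<le>N. real (N choose k) * v i k)"
        by (intro add_left_mono sum_norm_le order_trans[OF norm_sum] sum_mono tm)
      finally show ?thesis .
    qed
    then have "(norm (T f x))\<^sup>2 \<le> (norm (\<Phi> [] i0 0 g x x) + (\<Sum>i\<in>UNIV. \<Sum>k\<le>N. real (N choose k) * v i k))\<^sup>2"
      by (intro power_mono) auto
    also have "\<dots> \<le> 2 * (norm (\<Phi> [] i0 0 g x x))\<^sup>2 + 2 * (\<Sum>i\<in>UNIV. \<Sum>k\<le>N. real (N choose k) * v i k)\<^sup>2"
      using sum_squares_bound[of "norm (\<Phi> [] i0 0 g x x)" "\<Sum>i\<in>UNIV. \<Sum>k\<le>N. real (N choose k) * v i k"]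
      by (simp add: power2_sum)
    also have "(\<Sum>i\<in>UNIV. \<Sum>k\<le>N. real (N choose k) * v i k)\<^sup>2 \<le> M * (\<Sum>i\<in>UNIV. \<Sum>k\<le>N. real (N choose k) * (v i k)\<^sup>2)"
    proof -
      define S where "S = (UNIV :: 'n set) \<times> {..N}"
      \<comment> \<open>Weighted Cauchy--Schwarz: the binomial coefficients act as a measure of
        total mass \<open>M\<close>.\<close>
      define a where "a = (\<lambda>p :: 'n \<times> nat. sqrt (real (N choose snd p)))"
      have "(\<Sum>i\<in>UNIV. \<Sum>k\<le>N. real (N choose k) * v i k) = (\<Sum>p\<in>S. a p * (a p * v (fst p) (snd p)))"
        unfolding S_def a_def by (simp add: sum.cartesian_product case_prod_unfold mult.assoc[symmetric])
      also have "\<dots>\<^sup>2 \<le> (\<Sum>p\<in>S. (a p)\<^sup>2) * (\<Sum>p\<in>S. (a p * v (fst p) (snd p))\<^sup>2)" by (rule Cauchy_Schwarz_ineq_sum)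
      also have "(\<Sum>p\<in>S. (a p)\<^sup>2) = M"
      proof -
        have "(\<Sum>p\<in>S. (a p)\<^sup>2) = (\<Sum>p\<in>S. real (N choose snd p))" by (simp add: a_def)
        also have "\<dots> = M" unfolding S_def sumM[symmetric] by (simp only: sum.cartesian_product case_prod_unfold)
        finally show ?thesis .
      qed
      also have "(\<Sum>p\<in>S. (a p * v (fst p) (snd p))\<^sup>2) = (\<Sum>i\<in>UNIV. \<Sum>k\<le>N. real (N choose k) * (v i k)\<^sup>2)"
        unfolding S_def a_def by (simp add: sum.cartesian_product case_prod_unfold power_mult_distrib)
      finally show ?thesis .
    qed
    finally show ?thesis by (simp add: v_def power_mult_distrib mult.assoc)
  qed
  have "mass (\<lambda>x. (norm (T f x))\<^sup>2) Q
    \<le> (\<integral>\<^sup>+x. 2 * (ennreal ((norm (\<Phi> [] i0 0 g x x))\<^sup>2) * indicator Q x) + ennreal (2 * M) * (\<Sum>i\<in>UNIV. \<Sum>k\<le>N. ennreal (real (N choose k) * (l ^ k)\<^sup>2) * (ennreal ((norm (\<Phi> [] i k g x x))\<^sup>2) * indicator Q x)) \<partial>lborel)"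
  proof (intro nn_integral_mono)
    fix x
    show "ennreal ((norm (T f x))\<^sup>2) * indicator Q x \<le> 2 * (ennreal ((norm (\<Phi> [] i0 0 g x x))\<^sup>2) * indicator Q x) + ennreal (2 * M) * (\<Sum>i\<in>UNIV. \<Sum>k\<le>N. ennreal (real (N choose k) * (l ^ k)\<^sup>2) * (ennreal ((norm (\<Phi> [] i k g x x))\<^sup>2) * indicator Q x))"
    proof (cases "x \<in> Q")
      case True
      have M: "0 \<le> M" by (simp add: M_def)
      have "ennreal ((norm (T f x))\<^sup>2) \<le> ennreal (2 * (norm (\<Phi> [] i0 0 g x x))\<^sup>2 + 2 * (M * (\<Sum>i\<in>UNIV. \<Sum>k\<le>N. real (N choose k) * (l ^ k)\<^sup>2 * (norm (\<Phi> [] i k g x x))\<^sup>2)))"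
        by (intro ennreal_leI pt True)
      also have "\<dots> = 2 * ennreal ((norm (\<Phi> [] i0 0 g x x))\<^sup>2) + ennreal (2 * M) * ennreal (\<Sum>i\<in>UNIV. \<Sum>k\<le>N. real (N choose k) * (l ^ k)\<^sup>2 * (norm (\<Phi> [] i k g x x))\<^sup>2)"
      proof -
        have split: "ennreal (2 * u + 2 * (M * v)) = 2 * ennreal u + ennreal (2 * M) * ennreal v" if "0 \<le> u" "0 \<le> v" for u v
          using that M by (simp add: ennreal_mult[symmetric] ennreal_numeral[symmetric] mult.assoc del: ennreal_numeral)
        show ?thesis by (intro split sum_nonneg) simp_all
      qed
      also have "ennreal (\<Sum>i\<in>UNIV. \<Sum>k\<le>N. real (N choose k) * (l ^ k)\<^sup>2 * (norm (\<Phi> [] i k g x x))\<^sup>2) = (\<Sum>i\<in>UNIV. \<Sum>k\<le>N. ennreal (real (N choose k) * (l ^ k)\<^sup>2) * ennreal ((norm (\<Phi> [] i k g x x))\<^sup>2))"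
        by (subst ennreal_double_sum[symmetric]) (simp_all only: ennreal_mult' zero_le_power2 mult_nonneg_nonneg of_nat_0_le_iff)
      finally show ?thesis using True by simp
    qed simp
  qed
  also have "\<dots> = 2 * mass (\<lambda>x. (norm (\<Phi> [] i0 0 g x x))\<^sup>2) Q + ennreal (2 * M) * (\<Sum>i\<in>UNIV. \<Sum>k\<le>N. ennreal (real (N choose k) * (l ^ k)\<^sup>2) * mass (\<lambda>x. (norm (\<Phi> [] i k g x x))\<^sup>2) Q)"
    by (subst nn_integral_add, measurable, subst nn_integral_cmult, measurable, subst nn_integral_cmult, measurable, subst nn_integral_sum, measurable, subst nn_integral_sum, measurable, subst nn_integral_cmult, measurable)
  also have "\<dots> \<le> 2 * (ennreal (B * (A / l ^ 0)\<^sup>2) * G) + ennreal (2 * M) * (\<Sum>i\<in>(UNIV::'n set). \<Sum>k\<le>N. ennreal (real (N choose k) * (l ^ k)\<^sup>2) * (ennreal (B * (A / l ^ k)\<^sup>2) * G))"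
    by (intro add_mono mult_left_mono sum_mono \<Phi>Q) auto
  also have "\<dots> = ennreal (CV_const TYPE('n) * A\<^sup>2) * G"
  proof -
    have "ennreal (real (N choose k) * (l ^ k)\<^sup>2) * (ennreal (B * (A / l ^ k)\<^sup>2) * G) = ennreal (real (N choose k) * (B * A\<^sup>2)) * G" for k
    proof -
      have "real (N choose k) * (l ^ k)\<^sup>2 * (B * (A / l ^ k)\<^sup>2) = real (N choose k) * (B * A\<^sup>2)" using l by (simp add: power_divide)
      moreover have "ennreal u * (ennreal v * G) = ennreal (u * v) * G" if "0 \<le> u" "0 \<le> v" for u v
        using that by (simp add: ennreal_mult mult.assoc)
      then have "ennreal (real (N choose k) * (l ^ k)\<^sup>2) * (ennreal (B * (A / l ^ k)\<^sup>2) * G) = ennreal (real (N choose k) * (l ^ k)\<^sup>2 * (B * (A / l ^ k)\<^sup>2)) * G"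
        using B by simp
      ultimately show ?thesis by (simp only:)
    qed
    then have "(\<Sum>i\<in>(UNIV::'n set). \<Sum>k\<le>N. ennreal (real (N choose k) * (l ^ k)\<^sup>2) * (ennreal (B * (A / l ^ k)\<^sup>2) * G)) = (\<Sum>i\<in>(UNIV::'n set). \<Sum>k\<le>N. ennreal (real (N choose k) * (B * A\<^sup>2))) * G"
      by (simp only: sum_distrib_right)
    also have "(\<Sum>i\<in>(UNIV::'n set). \<Sum>k\<le>N. ennreal (real (N choose k) * (B * A\<^sup>2))) = ennreal (\<Sum>i\<in>(UNIV::'n set). \<Sum>k\<le>N. real (N choose k) * (B * A\<^sup>2))"
      using B by (intro ennreal_double_sum) simp
    also have "(\<Sum>i\<in>(UNIV::'n set). \<Sum>k\<le>N. real (N choose k) * (B * A\<^sup>2)) = M * (B * A\<^sup>2)"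
      unfolding sumM[symmetric] by (simp only: sum_distrib_right)
    finally have *: "(\<Sum>i\<in>(UNIV::'n set). \<Sum>k\<le>N. ennreal (real (N choose k) * (l ^ k)\<^sup>2) * (ennreal (B * (A / l ^ k)\<^sup>2) * G)) = ennreal (M * (B * A\<^sup>2)) * G" .
    have M: "0 \<le> M" by (simp add: M_def)
    have "2 * (ennreal (B * (A / l ^ 0)\<^sup>2) * G) = ennreal (2 * (B * A\<^sup>2)) * G"
      using B by (simp add: ennreal_mult mult.assoc)
    moreover have "ennreal (2 * M) * (ennreal (M * (B * A\<^sup>2)) * G) = ennreal (2 * M * (M * (B * A\<^sup>2))) * G"
      using B M by (simp only: ennreal_mult mult.assoc mult_nonneg_nonneg zero_le_numeral zero_le_power2)
    moreover have "ennreal (2 * (B * A\<^sup>2)) * G + ennreal (2 * M * (M * (B * A\<^sup>2))) * G = ennreal (2 * (B * A\<^sup>2) + 2 * M * (M * (B * A\<^sup>2))) * G"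
      using B M by (simp only: distrib_right[symmetric], subst ennreal_plus[symmetric]) auto
    moreover have "2 * (B * A\<^sup>2) + 2 * M * (M * (B * A\<^sup>2)) = CV_const TYPE('n) * A\<^sup>2"
      by (simp add: CV_const_def M_def N_def B_def power2_eq_square algebra_simps)
    ultimately show ?thesis unfolding * by simp
  qed
  also have "\<dots> \<le> ennreal (CV_const TYPE('n) * A\<^sup>2) * (\<integral>\<^sup>+y. ennreal ((norm (f y))\<^sup>2) * ennreal (1 / growth (l *\<^sub>R (z - y))) \<partial>lborel)"
    unfolding G_def
  proof (intro mult_left_mono nn_integral_mono)
    fix y
    define h where "h = growth (l *\<^sub>R (y - z))"
    have h: "1 \<le> h" "h = growth (l *\<^sub>R (z - y))"
      using growth_ge_1[of "l *\<^sub>R (y - z)"] growth_minus[of "l *\<^sub>R (y - z)"] by (auto simp: h_def scaleR_diff_right)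
    have "(norm (g y))\<^sup>2 = (norm (f y))\<^sup>2 / h\<^sup>2"
      using h by (simp add: g_def h_def[symmetric] norm_divide power_divide)
    also have "\<dots> \<le> (norm (f y))\<^sup>2 / h"
      using h(1) by (intro divide_left_mono) (auto simp: power2_eq_square)
    finally show "ennreal ((norm (g y))\<^sup>2) \<le> ennreal ((norm (f y))\<^sup>2) * ennreal (1 / growth (l *\<^sub>R (z - y)))"
      using h by (simp add: ennreal_mult[symmetric] ennreal_leI)
  qed simp
  finally show ?thesis unfolding Q_def .
qed

text \<open>The local bounds are integrated over all centres z instead of being summed over a
  tiling. Each x is counted with volume at least l^(-n), and the decay integrates to a multiple of
  l^(-n), so the scale cancels.\<close>

lemma T_L2_integrable:
  assumes f: "integrable lborel f"
  shows "L2sq (T f) \<le> ennreal (CV_const TYPE('n) * growth_mass TYPE('n) * A\<^sup>2) * L2sq f"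
proof -
  have [measurable]: "f \<in> borel_measurable borel" using f by (auto dest: borel_measurable_integrable)
  define c where "c = CV_const TYPE('n) * A\<^sup>2"
  have c: "0 \<le> c" by (simp add: c_def CV_const_def)
  define m where "m = growth_mass TYPE('n)"
  have m: "0 < m" unfolding m_def by (rule growth_mass_pos)
  define F where "F = L2sq f"
  define V where "V = (1 / l) ^ CARD('n)"
  have V: "0 < V" using l by (simp add: V_def)
  have "ennreal V * L2sq (T f) \<le> (\<integral>\<^sup>+x. ennreal ((norm (T f x))\<^sup>2) * (\<integral>\<^sup>+z. indicator (cube z (1 / l)) x \<partial>lborel) \<partial>lborel)"
  proof -
    have "ennreal V \<le> (\<integral>\<^sup>+z. indicator (cube z (1 / l)) x \<partial>lborel)" for x :: "real^'n"
    proof -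
      have "(\<integral>\<^sup>+z. indicator (cube z (1 / l)) x \<partial>lborel) = (\<integral>\<^sup>+z. indicator (cube x (1 / l)) z \<partial>lborel)"
        by (intro nn_integral_cong) (simp add: indicator_def mem_cube_commute)
      also have "\<dots> = ennreal ((2 * (1 / l)) ^ CARD('n))" using l by (simp add: emeasure_cube)
      finally show ?thesis using l by (simp add: V_def ennreal_leI power_mono divide_right_mono)
    qed
    then have "(\<integral>\<^sup>+x. ennreal ((norm (T f x))\<^sup>2) * ennreal V \<partial>lborel) \<le> (\<integral>\<^sup>+x. ennreal ((norm (T f x))\<^sup>2) * (\<integral>\<^sup>+z. indicator (cube z (1 / l)) x \<partial>lborel) \<partial>lborel)"
      by (intro nn_integral_mono mult_left_mono) auto
    then show ?thesis by (subst (asm) nn_integral_multc) (auto simp: mult.commute)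
  qed
  also have "\<dots> = (\<integral>\<^sup>+x. (\<integral>\<^sup>+z. ennreal ((norm (T f x))\<^sup>2) * indicator (cube z (1 / l)) x \<partial>lborel) \<partial>lborel)"
    by (intro nn_integral_cong nn_integral_cmult[symmetric]) measurable
  also have "\<dots> = (\<integral>\<^sup>+z. (\<integral>\<^sup>+x. ennreal ((norm (T f x))\<^sup>2) * indicator (cube z (1 / l)) x \<partial>lborel) \<partial>lborel)"
    by (rule lborel_pair.Fubini') measurable
  also have "\<dots> \<le> (\<integral>\<^sup>+z. ennreal c * (\<integral>\<^sup>+y. ennreal ((norm (f y))\<^sup>2) * ennreal (1 / growth (l *\<^sub>R (z - y))) \<partial>lborel) \<partial>lborel)"
    unfolding c_def by (intro nn_integral_mono T_local_L2 f)
  also have "\<dots> = ennreal c * (\<integral>\<^sup>+z. (\<integral>\<^sup>+y. ennreal ((norm (f y))\<^sup>2) * ennreal (1 / growth (l *\<^sub>R (z - y))) \<partial>lborel) \<partial>lborel)"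
    by (intro nn_integral_cmult) measurable
  also have "(\<integral>\<^sup>+z. (\<integral>\<^sup>+y. ennreal ((norm (f y))\<^sup>2) * ennreal (1 / growth (l *\<^sub>R (z - y))) \<partial>lborel) \<partial>lborel)
    = (\<integral>\<^sup>+y. (\<integral>\<^sup>+z. ennreal ((norm (f y))\<^sup>2) * ennreal (1 / growth (l *\<^sub>R (z - y))) \<partial>lborel) \<partial>lborel)"
    by (rule lborel_pair.Fubini') measurable
  also have "\<dots> \<le> (\<integral>\<^sup>+y. ennreal ((norm (f y))\<^sup>2) * ennreal (m * V) \<partial>lborel)"
  proof (intro nn_integral_mono)
    fix y
    have "(\<integral>\<^sup>+z. ennreal ((norm (f y))\<^sup>2) * ennreal (1 / growth (l *\<^sub>R (z - y))) \<partial>lborel) = ennreal ((norm (f y))\<^sup>2) * (\<integral>\<^sup>+z. ennreal (1 / growth (l *\<^sub>R (z - y))) \<partial>lborel)"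
      by (intro nn_integral_cmult) measurable
    also have "(\<integral>\<^sup>+z. ennreal (1 / growth (l *\<^sub>R (z - y))) \<partial>lborel) = (\<integral>\<^sup>+z. ennreal (1 / growth (l *\<^sub>R (y - z))) \<partial>lborel)"
    proof (intro nn_integral_cong arg_cong[where f="\<lambda>t. ennreal (1 / t)"])
      show "growth (l *\<^sub>R (z - y)) = growth (l *\<^sub>R (y - z))" for z
        using growth_minus[of "l *\<^sub>R (y - z)"] by (simp add: scaleR_diff_right)
    qed
    also have "\<dots> \<le> ennreal (m * V)"
      using nn_integral_inverse_growth_scaled[OF l, of y] by (simp add: m_def V_def power_divide)
    finally show "(\<integral>\<^sup>+z. ennreal ((norm (f y))\<^sup>2) * ennreal (1 / growth (l *\<^sub>R (z - y))) \<partial>lborel) \<le> ennreal ((norm (f y))\<^sup>2) * ennreal (m * V)"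
      by (simp add: mult_left_mono)
  qed
  also have "\<dots> = F * ennreal (m * V)" unfolding F_def by (intro nn_integral_multc) measurable
  finally have "ennreal V * L2sq (T f) \<le> ennreal c * (F * ennreal (m * V))"
    by (simp add: mult_left_mono)
  also have "\<dots> = ennreal V * (ennreal (c * m) * F)"
    using c m V by (simp add: ennreal_mult mult_ac)
  finally have "L2sq (T f) \<le> ennreal (c * m) * F"
    using V by (subst (asm) ennreal_mult_le_mult_iff) auto
  also have "c * m = CV_const TYPE('n) * growth_mass TYPE('n) * A\<^sup>2" by (simp add: c_def m_def mult_ac)
  finally show ?thesis unfolding F_def .
qed

text \<open>Calderon--Vaillancourt for one frequency piece: on a cube of side \<open>1 / l\<close> the symbol is frozen in
  \<open>x\<close> at the cost of Sobolev derivatives, and the decay of the kernel allows the cubes to be summed.\<close>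

lemma T_L2:
  assumes fm [measurable]: "f \<in> borel_measurable borel" and f: "L2sq f < \<infinity>"
  shows "L2sq (T f) \<le> ennreal (CV_const TYPE('n) * growth_mass TYPE('n) * A\<^sup>2) * L2sq f"
proof -
  define C where "C = ennreal (CV_const TYPE('n) * growth_mass TYPE('n) * A\<^sup>2) * L2sq f"
  \<comment> \<open>Truncations to cubes are integrable, since a square-integrable function is
    integrable on sets of finite measure; Fatou's lemma passes to the limit.\<close>
  define F where "F = (\<lambda>m::nat. \<lambda>y. indicator (cube (0 :: real^'n) (real m)) y *\<^sub>R f y)"
  have [measurable]: "F m \<in> borel_measurable borel" for m unfolding F_def by measurable
  have Fle: "norm (F m y) \<le> norm (f y)" for m y by (simp add: F_def indicator_def)
  have Fint: "integrable lborel (F m)" for m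
  proof (rule integrableI_bounded)
    have "(\<integral>\<^sup>+y. ennreal (norm (F m y)) \<partial>lborel) \<le> (\<integral>\<^sup>+y. indicator (cube 0 (real m)) y + ennreal ((norm (f y))\<^sup>2) \<partial>lborel)"
    proof (intro nn_integral_mono)
      fix y :: "real^'n"
      have "norm (f y) \<le> 1 + (norm (f y))\<^sup>2" using sum_squares_bound[of 1 "norm (f y)"] zero_le_power2[of "norm (f y)"] unfolding one_power2 by linarith
      then show "ennreal (norm (F m y)) \<le> indicator (cube 0 (real m)) y + ennreal ((norm (f y))\<^sup>2)"
        by (auto simp: F_def indicator_def ennreal_1[symmetric] ennreal_plus[symmetric] ennreal_leI simp del: ennreal_1 ennreal_plus)
    qed
    also have "\<dots> = (\<integral>\<^sup>+y. indicator (cube 0 (real m)) y \<partial>(lborel :: (real^'n) measure)) + L2sq f"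
      by (intro nn_integral_add) measurable
    also have "\<dots> < \<infinity>" using f by (simp add: emeasure_cube)
    finally show "(\<integral>\<^sup>+y. ennreal (norm (F m y)) \<partial>lborel) < \<infinity>" .
  qed measurable
  have lim: "(\<lambda>m. T (F m) x) \<longlonglongrightarrow> T f x" for x
    unfolding T_def
  proof (rule integral_dominated_convergence[where w="\<lambda>y. norm (FT (b x) (x - y) * f y)"])
    show "integrable lborel (\<lambda>y. norm (FT (b x) (x - y) * f y))" by (intro integrable_norm T_integrable fm f)
    show "AE y in lborel. (\<lambda>m. FT (b x) (x - y) * F m y) \<longlonglongrightarrow> FT (b x) (x - y) * f y"
    proof (rule AE_I2, rule tendsto_eventually)
      fix y :: "real^'n"
      obtain M :: nat where "norm y \<le> real M" using real_arch_simple by blast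
      then have "y \<in> cube 0 (real m)" if "M \<le> m" for m
      proof -
        have "\<bar>y $ i\<bar> \<le> real m" for i
          using component_le_norm_cart[of y i] \<open>norm y \<le> real M\<close> that by linarith
        then show ?thesis by (simp add: cube_def)
      qed
      then show "\<forall>\<^sub>F m in sequentially. FT (b x) (x - y) * F m y = FT (b x) (x - y) * f y"
        by (intro eventually_sequentiallyI[of M]) (simp add: F_def)
    qed
    show "AE y in lborel. norm (FT (b x) (x - y) * F m y) \<le> norm (FT (b x) (x - y) * f y)" for m
      by (simp add: norm_mult Fle mult_left_mono)
  qed measurable
  have "L2sq (T f) = (\<integral>\<^sup>+x. liminf (\<lambda>m. ennreal ((norm (T (F m) x))\<^sup>2)) \<partial>lborel)"
  proof (intro nn_integral_cong)
    fix x
    have "(\<lambda>m. ennreal ((norm (T (F m) x))\<^sup>2)) \<longlonglongrightarrow> ennreal ((norm (T f x))\<^sup>2)"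
      by (intro tendsto_ennrealI tendsto_intros lim)
    then show "ennreal ((norm (T f x))\<^sup>2) = liminf (\<lambda>m. ennreal ((norm (T (F m) x))\<^sup>2))"
      by (metis lim_imp_Liminf sequentially_bot)
  qed
  also have "\<dots> \<le> liminf (\<lambda>m. \<integral>\<^sup>+x. ennreal ((norm (T (F m) x))\<^sup>2) \<partial>lborel)"
    by (intro nn_integral_liminf) measurable
  also have "\<dots> \<le> liminf (\<lambda>m. C)"
  proof (intro Liminf_mono always_eventually allI)
    fix m
    have "L2sq (T (F m)) \<le> ennreal (CV_const TYPE('n) * growth_mass TYPE('n) * A\<^sup>2) * L2sq (F m)"
      by (rule T_L2_integrable[OF Fint])
    also have "\<dots> \<le> C" unfolding C_def by (intro mult_left_mono nn_integral_mono ennreal_leI power_mono Fle) auto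
    finally show "L2sq (T (F m)) \<le> C" .
  qed
  also have "\<dots> = C" by (simp add: Liminf_const)
  finally show ?thesis unfolding C_def .
qed

end

section \<open>Interpolation with change of measure\<close>

text \<open>The layer-cake formula, with an open interval to match strict level sets.\<close>

lemma has_integral_powr_Ioc:
  fixes s X :: real
  assumes s: "0 < s" and X: "0 \<le> X"
  shows "(\<integral>\<^sup>+t. ennreal (s * t powr (s - 1)) * indicator {0<..<X} t \<partial>lborel) = ennreal (X powr s)"
proof -
  define a where "a = (\<lambda>k::nat. X / (real k + 2))"
  have "((\<lambda>t. s * t powr (s - 1)) has_integral (X powr s - 0 powr s)) {0..X}"
  proof (rule fundamental_theorem_of_calculus_interior[OF X])
    show "continuous_on {0..X} (\<lambda>t. t powr s)" using s by (intro continuous_on_powr' continuous_intros) auto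
    fix t assume t: "t \<in> {0<..<X}"
    have "((\<lambda>t. t powr s) has_real_derivative s * t powr (s - 1)) (at t)"
      using t by (intro has_real_derivative_powr) auto
    then show "((\<lambda>t. t powr s) has_vector_derivative s * t powr (s - 1)) (at t)"
      by (simp add: has_real_derivative_iff_has_vector_derivative)
  qed
  then have "((\<lambda>t. s * t powr (s - 1)) has_integral X powr s) {0..X}" using s by simp
  then have "(\<integral>\<^sup>+t. ennreal (s * t powr (s - 1)) * indicator {0..X} t \<partial>lborel) = ennreal (X powr s)"
    using s by (intro nn_integral_has_integral_lebesgue') auto
  moreover have "(\<integral>\<^sup>+t. ennreal (s * t powr (s - 1)) * indicator {0..X} t \<partial>lborel) = (\<integral>\<^sup>+t. ennreal (s * t powr (s - 1)) * indicator {0<..<X} t \<partial>lborel)"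
  proof (rule nn_integral_cong_AE)
    have "AE t in lborel. t \<notin> {0, X}" by (intro AE_not_in finite_imp_null_set_lborel) simp
    then show "AE t in lborel. ennreal (s * t powr (s - 1)) * indicator {0..X} t = ennreal (s * t powr (s - 1)) * indicator {0<..<X} t"
      by eventually_elim (auto simp: indicator_def)
  qed
  ultimately show ?thesis by simp
qed

text \<open>The complementary layer-cake integral, over the truncation heights that leave the value
  in the small part of f.\<close>

lemma nn_integral_powr_tail:
  fixes s X :: real
  assumes s: "0 < s" and X: "0 < X"
  shows "(\<integral>\<^sup>+t. ennreal (s * t powr (- s - 1)) * indicator {X..} t \<partial>lborel) = ennreal (X powr (- s))"
proof -
  have "(\<integral>\<^sup>+t. ennreal (s * t powr (- s - 1)) * indicator {X..} t \<partial>lborel) = ennreal (0 - - (X powr (- s)))"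
  proof (rule nn_integral_FTC_atLeast)
    show "((\<lambda>t. - (t powr (- s))) has_real_derivative s * t powr (- s - 1)) (at t)" if "X \<le> t" for t
      using that X by (auto intro!: derivative_eq_intros)
    show "0 \<le> s * t powr (- s - 1)" for t using s by simp
    have "((\<lambda>t. - (t powr (- s))) \<longlongrightarrow> - 0) at_top"
      using s by (intro tendsto_minus tendsto_neg_powr filterlim_ident) simp
    then show "((\<lambda>t. - (t powr (- s))) \<longlongrightarrow> 0) at_top" by simp
  qed measurable
  then show ?thesis by simp
qed

text \<open>The exponent 2 - p makes the weight disappear at p = 2, so that a single h serves the
  unweighted endpoint and both weighted norms.\<close>

abbreviation SW_int :: "('a::euclidean_space \<Rightarrow> real) \<Rightarrow> real \<Rightarrow> ('a \<Rightarrow> 'b::real_normed_vector) \<Rightarrow> ennreal"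
  where "SW_int h p f \<equiv> \<integral>\<^sup>+x. ennreal (norm (f x) powr p * h x powr (2 - p)) \<partial>lborel"

text \<open>Stein--Weiss interpolation with change of measure between \<open>L\<^sup>2\<close> and \<open>L\<^sup>q\<close> with weight
  \<open>h\<^bsup>2-q\<^esup>\<close>. Dividing by \<open>h\<close> puts both spaces over the measure \<open>h\<^sup>2 dx\<close>, where this is
  Marcinkiewicz interpolation.\<close>

lemma interpolation:
  fixes h :: "real^'n::finite \<Rightarrow> real" and S :: "(real^'n \<Rightarrow> complex) \<Rightarrow> real^'n \<Rightarrow> complex"
  assumes p: "2 < p" "p < q" and hm [measurable]: "h \<in> borel_measurable borel" and h: "\<And>x. 0 < h x"
    and a: "0 < a" and b: "0 < b"
    and Sm [measurable]: "\<And>f. f \<in> borel_measurable borel \<Longrightarrow> S f \<in> borel_measurable borel"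
    and S2: "\<And>f. f \<in> borel_measurable borel \<Longrightarrow> L2sq f < \<infinity> \<Longrightarrow>
       L2sq (S f) \<le> ennreal a * L2sq f"
    and Sq: "\<And>f. f \<in> borel_measurable borel \<Longrightarrow> SW_int h q f < \<infinity> \<Longrightarrow>
       SW_int h q (\<lambda>x. S f x) \<le> ennreal b * SW_int h q f"
    and add: "\<And>f g. f \<in> borel_measurable borel \<Longrightarrow> g \<in> borel_measurable borel \<Longrightarrow>
       L2sq f < \<infinity> \<Longrightarrow> SW_int h q g < \<infinity> \<Longrightarrow>
       AE x in lborel. S (\<lambda>y. f y + g y) x = S f x + S g x"
    and fm [measurable]: "f \<in> borel_measurable borel" and fin: "SW_int h p f < \<infinity>"
  shows "SW_int h p (\<lambda>x. S f x)
    \<le> ennreal ((4 * p / (p - 2) + 2 powr q * p / (q - p)) * (a powr ((q - p) / (q - 2)) * b powr ((p - 2) / (q - 2)))) *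
      SW_int h p f"
proof -
  \<comment> \<open>Balances the endpoints: with it a c^(2 - p) and b c^(q - p) coincide, and the
    interpolated constant is a geometric mean of a and b.\<close>
  define c where "c = (a / b) powr (1 / (q - 2))"
  have c: "0 < c" using a b by (simp add: c_def)
  define X where "X = (\<lambda>x. norm (f x) / (c * h x))"
  have X0: "0 \<le> X x" for x using c h[of x] by (simp add: X_def less_imp_le)
  have [measurable]: "X \<in> borel_measurable borel" unfolding X_def by measurable
  have fX: "norm (f x) = X x * (c * h x)" for x using c h[of x] by (simp add: X_def)
  \<comment> \<open>Truncation relative to \<open>c * h\<close> at height t. As 2 < p < q, the large
    part lies in L^2 and the small part in the weighted L^q space.\<close>
  define F1 where "F1 = (\<lambda>t x. if t < X x then f x else 0)"
  define F2 where "F2 = (\<lambda>t x. if t < X x then 0 else f x)"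
  have [measurable]: "F1 t \<in> borel_measurable borel" "F2 t \<in> borel_measurable borel" for t
    unfolding F1_def F2_def by measurable
  have F12: "f = (\<lambda>x. F1 t x + F2 t x)" for t by (auto simp: F1_def F2_def)
  define Np where "Np = SW_int h p f"
  have pw: "norm (f x) powr p * h x powr (2 - p) = X x powr p * c powr p * (h x)\<^sup>2" for x
  proof -
    have "norm (f x) powr p * h x powr (2 - p) = X x powr p * c powr p * (h x powr p * h x powr (2 - p))"
      using X0[of x] c h[of x] by (simp add: fX powr_mult)
    also have "h x powr p * h x powr (2 - p) = (h x)\<^sup>2" using h[of x] by (simp add: powr_add[symmetric] powr_numeral)
    finally show ?thesis .
  qed
  have f2: "(norm (f x))\<^sup>2 = X x powr 2 * c powr 2 * (h x)\<^sup>2" for x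
    using X0[of x] c by (simp add: fX power_mult_distrib powr_numeral)
  have fq: "norm (f x) powr q * h x powr (2 - q) = X x powr q * c powr q * (h x)\<^sup>2" for x
  proof -
    have "norm (f x) powr q * h x powr (2 - q) = X x powr q * c powr q * (h x powr q * h x powr (2 - q))"
      using X0[of x] c h[of x] by (simp add: fX powr_mult)
    also have "h x powr q * h x powr (2 - q) = (h x)\<^sup>2" using h[of x] by (simp add: powr_add[symmetric] powr_numeral)
    finally show ?thesis .
  qed
  have F1fin: "L2sq (F1 t) < \<infinity>" if t: "0 < t" for t
  proof -
    have "L2sq (F1 t) \<le> (\<integral>\<^sup>+x. ennreal ((c * t) powr (2 - p)) * ennreal (norm (f x) powr p * h x powr (2 - p)) \<partial>lborel)"
    proof (intro nn_integral_mono)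
      fix x
      have "(norm (F1 t x))\<^sup>2 \<le> (c * t) powr (2 - p) * (norm (f x) powr p * h x powr (2 - p))"
      proof (cases "t < X x")
        case True
        have "X x powr 2 = X x powr p * X x powr (2 - p)" using True t by (simp add: powr_add[symmetric])
        also have "\<dots> \<le> X x powr p * t powr (2 - p)" using True t p by (intro mult_left_mono powr_mono2') auto
        finally have "X x powr 2 * (c powr 2 * (h x)\<^sup>2) \<le> X x powr p * t powr (2 - p) * (c powr 2 * (h x)\<^sup>2)"
          by (intro mult_right_mono) auto
        moreover have "c powr 2 = c powr p * c powr (2 - p)" using c by (simp add: powr_add[symmetric])
        ultimately show ?thesis using True c t unfolding F1_def pw by (simp add: f2 powr_mult mult_ac)
      qed (simp add: F1_def)
      then show "ennreal ((norm (F1 t x))\<^sup>2) \<le> ennreal ((c * t) powr (2 - p)) * ennreal (norm (f x) powr p * h x powr (2 - p))"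
        by (simp add: ennreal_mult[symmetric] ennreal_leI)
    qed
    also have "\<dots> = ennreal ((c * t) powr (2 - p)) * Np" unfolding Np_def by (intro nn_integral_cmult) measurable
    also have "\<dots> < \<infinity>" using fin by (simp add: Np_def ennreal_mult_less_top)
    finally show ?thesis .
  qed
  have F2fin: "SW_int h q (\<lambda>x. F2 t x) < \<infinity>" if t: "0 < t" for t
  proof -
    have "SW_int h q (\<lambda>x. F2 t x) \<le> (\<integral>\<^sup>+x. ennreal ((c * t) powr (q - p)) * ennreal (norm (f x) powr p * h x powr (2 - p)) \<partial>lborel)"
    proof (intro nn_integral_mono)
      fix x
      have "norm (F2 t x) powr q * h x powr (2 - q) \<le> (c * t) powr (q - p) * (norm (f x) powr p * h x powr (2 - p))"
      proof (cases "t < X x \<or> X x = 0")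
        case False
        then have X: "0 < X x" "X x \<le> t" using X0[of x] by auto
        have "X x powr q = X x powr p * X x powr (q - p)" by (simp add: powr_add[symmetric])
        also have "\<dots> \<le> X x powr p * t powr (q - p)" using X t p by (intro mult_left_mono powr_mono2) auto
        finally have "X x powr q * (c powr q * (h x)\<^sup>2) \<le> X x powr p * t powr (q - p) * (c powr q * (h x)\<^sup>2)"
          by (intro mult_right_mono) auto
        moreover have "c powr q = c powr p * c powr (q - p)" by (simp add: powr_add[symmetric])
        ultimately show ?thesis using False c t unfolding F2_def pw by (simp add: fq powr_mult mult_ac)
      next
        case True
        then have "F2 t x = 0" using fX[of x] by (auto simp: F2_def)
        then show ?thesis by simp
      qed
      then show "ennreal (norm (F2 t x) powr q * h x powr (2 - q)) \<le> ennreal ((c * t) powr (q - p)) * ennreal (norm (f x) powr p * h x powr (2 - p))"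
        by (simp add: ennreal_mult[symmetric] ennreal_leI)
    qed
    also have "\<dots> = ennreal ((c * t) powr (q - p)) * Np" unfolding Np_def by (intro nn_integral_cmult) measurable
    also have "\<dots> < \<infinity>" using fin by (simp add: Np_def ennreal_mult_less_top)
    finally show ?thesis .
  qed
  define Y where "Y = (\<lambda>x. norm (S f x) / h x)"
  have Y0: "0 \<le> Y x" for x using h[of x] by (simp add: Y_def less_imp_le)
  have [measurable]: "Y \<in> borel_measurable borel" unfolding Y_def by measurable
  define U1 where "U1 = (\<lambda>t. \<integral>\<^sup>+x. ennreal ((norm (F1 t x))\<^sup>2) \<partial>lborel)"
  define U2 where "U2 = (\<lambda>t. \<integral>\<^sup>+x. ennreal (norm (F2 t x) powr q * h x powr (2 - q)) \<partial>lborel)"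
  \<comment> \<open>Chebyshev's inequality turns the two endpoint bounds into a bound for the level
    set of S f, measured by h^2 dx.\<close>
  have level: "(\<integral>\<^sup>+x. ennreal ((h x)\<^sup>2) * indicator {0<..<Y x} t \<partial>lborel) \<le> ennreal (4 * a / t\<^sup>2) * U1 t + ennreal (2 powr q * b / t powr q) * U2 t"
    if t: "0 < t" for t
  proof -
    have "AE x in lborel. S (\<lambda>y. F1 t y + F2 t y) x = S (F1 t) x + S (F2 t) x"
      by (intro add F1fin F2fin t) measurable
    then have ae: "AE x in lborel. S f x = S (F1 t) x + S (F2 t) x" using F12[of t] by simp
    have "(\<integral>\<^sup>+x. ennreal ((h x)\<^sup>2) * indicator {0<..<Y x} t \<partial>lborel)
      \<le> (\<integral>\<^sup>+x. ennreal (4 / t\<^sup>2) * ennreal ((norm (S (F1 t) x))\<^sup>2) + ennreal (2 powr q / t powr q) * ennreal (norm (S (F2 t) x) powr q * h x powr (2 - q)) \<partial>lborel)"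
    proof (rule nn_integral_mono_AE)
      show "AE x in lborel. ennreal ((h x)\<^sup>2) * indicator {0<..<Y x} t \<le> ennreal (4 / t\<^sup>2) * ennreal ((norm (S (F1 t) x))\<^sup>2) + ennreal (2 powr q / t powr q) * ennreal (norm (S (F2 t) x) powr q * h x powr (2 - q))"
        using ae
      proof eventually_elim
        fix x assume eq: "S f x = S (F1 t) x + S (F2 t) x"
        show "ennreal ((h x)\<^sup>2) * indicator {0<..<Y x} t \<le> ennreal (4 / t\<^sup>2) * ennreal ((norm (S (F1 t) x))\<^sup>2) + ennreal (2 powr q / t powr q) * ennreal (norm (S (F2 t) x) powr q * h x powr (2 - q))"
        proof (cases "t < Y x")
          case True
          then have "t * h x < norm (S f x)" using h[of x] by (simp add: Y_def pos_less_divide_eq)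
          also have "\<dots> \<le> norm (S (F1 t) x) + norm (S (F2 t) x)" unfolding eq by (rule norm_triangle_ineq)
          \<comment> \<open>One of the two summands reaches half the height; this is the source of
            the factors 4 and \<open>2 powr q\<close>.\<close>
          finally have "t * h x / 2 \<le> norm (S (F1 t) x) \<or> t * h x / 2 \<le> norm (S (F2 t) x)" by linarith
          then show ?thesis
          proof
            assume *: "t * h x / 2 \<le> norm (S (F1 t) x)"
            have "(t * h x / 2)\<^sup>2 \<le> (norm (S (F1 t) x))\<^sup>2" using t h[of x] by (intro power_mono *) auto
            then have "(h x)\<^sup>2 \<le> 4 / t\<^sup>2 * (norm (S (F1 t) x))\<^sup>2" using t by (simp add: power_mult_distrib power_divide field_simps)
            then have "ennreal ((h x)\<^sup>2) \<le> ennreal (4 / t\<^sup>2) * ennreal ((norm (S (F1 t) x))\<^sup>2)"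
              using t by (simp add: ennreal_mult[symmetric] ennreal_leI)
            then show ?thesis using True t by (simp add: add_increasing2)
          next
            assume *: "t * h x / 2 \<le> norm (S (F2 t) x)"
            have "(t * h x / 2) powr q \<le> norm (S (F2 t) x) powr q" using t h[of x] p by (intro powr_mono2 *) auto
            then have "h x powr q * (t powr q / 2 powr q) \<le> norm (S (F2 t) x) powr q"
              using t h[of x] by (simp add: powr_mult powr_divide mult_ac)
            then have "h x powr q \<le> 2 powr q / t powr q * norm (S (F2 t) x) powr q"
              using t by (simp add: field_simps)
            then have "h x powr q * h x powr (2 - q) \<le> 2 powr q / t powr q * norm (S (F2 t) x) powr q * h x powr (2 - q)"
              by (rule mult_right_mono) simp
            moreover have "h x powr q * h x powr (2 - q) = (h x)\<^sup>2" using h[of x] by (simp add: powr_add[symmetric] powr_numeral)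
            ultimately have "ennreal ((h x)\<^sup>2) \<le> ennreal (2 powr q / t powr q) * ennreal (norm (S (F2 t) x) powr q * h x powr (2 - q))"
              by (simp add: ennreal_mult[symmetric] ennreal_leI mult.assoc)
            then show ?thesis using True t by (simp add: add_increasing)
          qed
        qed simp
      qed
    qed
    also have "\<dots> = ennreal (4 / t\<^sup>2) * L2sq (S (F1 t)) + ennreal (2 powr q / t powr q) * SW_int h q (\<lambda>x. S (F2 t) x)"
      by (subst nn_integral_add, measurable, subst nn_integral_cmult, measurable, subst nn_integral_cmult, measurable)
    also have "\<dots> \<le> ennreal (4 / t\<^sup>2) * (ennreal a * U1 t) + ennreal (2 powr q / t powr q) * (ennreal b * U2 t)"
      unfolding U1_def U2_def by (intro add_mono mult_left_mono S2 Sq F1fin F2fin t) auto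
    also have "\<dots> = ennreal (4 * a / t\<^sup>2) * U1 t + ennreal (2 powr q * b / t powr q) * U2 t"
      using a b t by (simp add: mult.assoc[symmetric] ennreal_mult[symmetric])
    finally show ?thesis .
  qed
  have "SW_int h p (\<lambda>x. S f x)
    = (\<integral>\<^sup>+x. (\<integral>\<^sup>+t. ennreal (p * t powr (p - 1)) * (ennreal ((h x)\<^sup>2) * indicator {0<..<Y x} t) \<partial>lborel) \<partial>lborel)"
  proof (intro nn_integral_cong)
    fix x
    have "norm (S f x) = Y x * h x" using h[of x] by (simp add: Y_def)
    then have "norm (S f x) powr p * h x powr (2 - p) = Y x powr p * (h x powr p * h x powr (2 - p))"
      using Y0[of x] h[of x] by (simp add: powr_mult)
    also have "h x powr p * h x powr (2 - p) = (h x)\<^sup>2" using h[of x] by (simp add: powr_add[symmetric] powr_numeral)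
    finally have "ennreal (norm (S f x) powr p * h x powr (2 - p)) = ennreal ((h x)\<^sup>2) * ennreal (Y x powr p)"
      by (simp add: ennreal_mult mult.commute)
    also have "ennreal (Y x powr p) = (\<integral>\<^sup>+t. ennreal (p * t powr (p - 1)) * indicator {0<..<Y x} t \<partial>lborel)"
      using p Y0[of x] by (intro has_integral_powr_Ioc[symmetric]) auto
    also have "ennreal ((h x)\<^sup>2) * \<dots> = (\<integral>\<^sup>+t. ennreal ((h x)\<^sup>2) * (ennreal (p * t powr (p - 1)) * indicator {0<..<Y x} t) \<partial>lborel)"
      by (intro nn_integral_cmult[symmetric]) measurable
    finally show "ennreal (norm (S f x) powr p * h x powr (2 - p)) = (\<integral>\<^sup>+t. ennreal (p * t powr (p - 1)) * (ennreal ((h x)\<^sup>2) * indicator {0<..<Y x} t) \<partial>lborel)"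
      by (simp add: mult_ac)
  qed
  also have "\<dots> = (\<integral>\<^sup>+t. (\<integral>\<^sup>+x. ennreal (p * t powr (p - 1)) * (ennreal ((h x)\<^sup>2) * indicator {0<..<Y x} t) \<partial>lborel) \<partial>lborel)"
    by (rule lborel_pair.Fubini') (unfold greaterThanLessThan_iff indicator_def, measurable)
  also have "\<dots> \<le> (\<integral>\<^sup>+t. (\<integral>\<^sup>+x. ennreal (4 * a) * (ennreal (p * t powr (p - 3)) * indicator {0<..<X x} t * ennreal ((norm (f x))\<^sup>2))
      + ennreal (2 powr q * b) * (ennreal (p * t powr (p - q - 1)) * (indicator {X x..} t * indicator {0<..} t) * ennreal (norm (f x) powr q * h x powr (2 - q))) \<partial>lborel) \<partial>lborel)"
  proof (rule nn_integral_mono)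
    fix t :: real
    show "(\<integral>\<^sup>+x. ennreal (p * t powr (p - 1)) * (ennreal ((h x)\<^sup>2) * indicator {0<..<Y x} t) \<partial>lborel)
      \<le> (\<integral>\<^sup>+x. ennreal (4 * a) * (ennreal (p * t powr (p - 3)) * indicator {0<..<X x} t * ennreal ((norm (f x))\<^sup>2))
      + ennreal (2 powr q * b) * (ennreal (p * t powr (p - q - 1)) * (indicator {X x..} t * indicator {0<..} t) * ennreal (norm (f x) powr q * h x powr (2 - q))) \<partial>lborel)"
    proof (cases "0 < t")
      case t: True
      have "(\<integral>\<^sup>+x. ennreal (p * t powr (p - 1)) * (ennreal ((h x)\<^sup>2) * indicator {0<..<Y x} t) \<partial>lborel)
        = ennreal (p * t powr (p - 1)) * (\<integral>\<^sup>+x. ennreal ((h x)\<^sup>2) * indicator {0<..<Y x} t \<partial>lborel)"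
        by (intro nn_integral_cmult) (unfold greaterThanLessThan_iff indicator_def, measurable)
      also have "\<dots> \<le> ennreal (p * t powr (p - 1)) * (ennreal (4 * a / t\<^sup>2) * U1 t + ennreal (2 powr q * b / t powr q) * U2 t)"
        by (intro mult_left_mono level t) simp
      also have "\<dots> = ennreal (4 * a) * (ennreal (p * t powr (p - 3)) * U1 t) + ennreal (2 powr q * b) * (ennreal (p * t powr (p - q - 1)) * U2 t)"
      proof -
        have 1: "p * t powr (p - 1) * (4 * a / t\<^sup>2) = 4 * a * (p * t powr (p - 3))"
        proof -
          have "t powr (p - 1) = t powr (p - 3) * t\<^sup>2" using t by (simp add: powr_numeral[symmetric] powr_add[symmetric] del: powr_numeral)
          then show ?thesis using t by simp
        qed
        have 2: "p * t powr (p - 1) * (2 powr q * b / t powr q) = 2 powr q * b * (p * t powr (p - q - 1))"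
        proof -
          have "t powr (p - 1) = t powr (p - q - 1) * t powr q" by (simp add: powr_add[symmetric])
          then show ?thesis using t by simp
        qed
        have "ennreal (p * t powr (p - 1)) * ennreal (4 * a / t\<^sup>2) = ennreal (4 * a) * ennreal (p * t powr (p - 3))"
          using 1 a p by (simp add: ennreal_mult[symmetric])
        moreover have "ennreal (p * t powr (p - 1)) * ennreal (2 powr q * b / t powr q) = ennreal (2 powr q * b) * ennreal (p * t powr (p - q - 1))"
          using 2 b p by (simp add: ennreal_mult[symmetric])
        ultimately show ?thesis by (simp only: distrib_left mult.assoc[symmetric])
      qed
      also have "\<dots> = (\<integral>\<^sup>+x. ennreal (4 * a) * (ennreal (p * t powr (p - 3)) * indicator {0<..<X x} t * ennreal ((norm (f x))\<^sup>2))
      + ennreal (2 powr q * b) * (ennreal (p * t powr (p - q - 1)) * (indicator {X x..} t * indicator {0<..} t) * ennreal (norm (f x) powr q * h x powr (2 - q))) \<partial>lborel)"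
      proof -
        have u1: "E * indicator {0<..<X x} t * ennreal ((norm (f x))\<^sup>2) = E * ennreal ((norm (F1 t x))\<^sup>2)" for E x
          using t by (auto simp: F1_def indicator_def)
        have u2: "E * (indicator {X x..} t * indicator {0<..} t) * ennreal (norm (f x) powr q * h x powr (2 - q)) = E * ennreal (norm (F2 t x) powr q * h x powr (2 - q))" for E x
          using t by (auto simp: F2_def indicator_def)
        show ?thesis unfolding u1 u2 U1_def U2_def
          by (subst nn_integral_add, measurable, subst nn_integral_cmult, measurable, subst nn_integral_cmult, measurable, subst nn_integral_cmult, measurable, subst nn_integral_cmult, measurable)
      qed
      finally show ?thesis .
    qed (simp add: indicator_def)
  qed
  also have "\<dots> = (\<integral>\<^sup>+x. (\<integral>\<^sup>+t. ennreal (4 * a) * (ennreal (p * t powr (p - 3)) * indicator {0<..<X x} t * ennreal ((norm (f x))\<^sup>2))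
      + ennreal (2 powr q * b) * (ennreal (p * t powr (p - q - 1)) * (indicator {X x..} t * indicator {0<..} t) * ennreal (norm (f x) powr q * h x powr (2 - q))) \<partial>lborel) \<partial>lborel)"
    by (rule lborel_pair.Fubini') (unfold greaterThanLessThan_iff greaterThan_iff atLeast_iff indicator_def, measurable)
  also have "\<dots> \<le> (\<integral>\<^sup>+x. ennreal (4 * a * (p / (p - 2)) * c powr (2 - p) + 2 powr q * b * (p / (q - p)) * c powr (q - p)) * ennreal (norm (f x) powr p * h x powr (2 - p)) \<partial>lborel)"
  proof (intro nn_integral_mono)
    fix x
    have i1: "(\<integral>\<^sup>+t. ennreal (p * t powr (p - 3)) * indicator {0<..<X x} t \<partial>lborel) = ennreal (p / (p - 2) * X x powr (p - 2))"
    proof -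
      have "(\<integral>\<^sup>+t. ennreal (p * t powr (p - 3)) * indicator {0<..<X x} t \<partial>lborel) = (\<integral>\<^sup>+t. ennreal (p / (p - 2)) * (ennreal ((p - 2) * t powr (p - 2 - 1)) * indicator {0<..<X x} t) \<partial>lborel)"
        using p by (intro nn_integral_cong) (simp add: mult.assoc[symmetric] ennreal_mult[symmetric])
      also have "\<dots> = ennreal (p / (p - 2)) * (\<integral>\<^sup>+t. ennreal ((p - 2) * t powr (p - 2 - 1)) * indicator {0<..<X x} t \<partial>lborel)"
        by (intro nn_integral_cmult) measurable
      also have "\<dots> = ennreal (p / (p - 2)) * ennreal (X x powr (p - 2))"
        using p X0[of x] by (subst has_integral_powr_Ioc) auto
      finally show ?thesis using p by (simp add: ennreal_mult[symmetric])
    qed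
    have i2: "(\<integral>\<^sup>+t. ennreal (p * t powr (p - q - 1)) * (indicator {X x..} t * indicator {0<..} t) \<partial>lborel) = ennreal (p / (q - p) * X x powr (p - q))" if "X x \<noteq> 0"
    proof -
      have X: "0 < X x" using that X0[of x] by simp
      have "(\<integral>\<^sup>+t. ennreal (p * t powr (p - q - 1)) * (indicator {X x..} t * indicator {0<..} t) \<partial>lborel) = (\<integral>\<^sup>+t. ennreal (p / (q - p)) * (ennreal ((q - p) * t powr (- (q - p) - 1)) * indicator {X x..} t) \<partial>lborel)"
        using p X by (intro nn_integral_cong) (auto simp: mult.assoc[symmetric] ennreal_mult[symmetric] indicator_def)
      also have "\<dots> = ennreal (p / (q - p)) * (\<integral>\<^sup>+t. ennreal ((q - p) * t powr (- (q - p) - 1)) * indicator {X x..} t \<partial>lborel)"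
        by (intro nn_integral_cmult) measurable
      also have "\<dots> = ennreal (p / (q - p)) * ennreal (X x powr (- (q - p)))"
        using p X by (subst nn_integral_powr_tail) auto
      finally show ?thesis using p by (simp add: ennreal_mult[symmetric])
    qed
    have "(\<integral>\<^sup>+t. ennreal (4 * a) * (ennreal (p * t powr (p - 3)) * indicator {0<..<X x} t * ennreal ((norm (f x))\<^sup>2))
      + ennreal (2 powr q * b) * (ennreal (p * t powr (p - q - 1)) * (indicator {X x..} t * indicator {0<..} t) * ennreal (norm (f x) powr q * h x powr (2 - q))) \<partial>lborel)
      = ennreal (4 * a) * ((\<integral>\<^sup>+t. ennreal (p * t powr (p - 3)) * indicator {0<..<X x} t \<partial>lborel) * ennreal ((norm (f x))\<^sup>2))
      + ennreal (2 powr q * b) * ((\<integral>\<^sup>+t. ennreal (p * t powr (p - q - 1)) * (indicator {X x..} t * indicator {0<..} t) \<partial>lborel) * ennreal (norm (f x) powr q * h x powr (2 - q)))"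
      by (subst nn_integral_add, measurable, subst nn_integral_cmult, measurable, subst nn_integral_cmult, measurable, subst nn_integral_multc, measurable, subst nn_integral_multc, measurable)
    also have "\<dots> \<le> ennreal (4 * a * (p / (p - 2)) * c powr (2 - p) + 2 powr q * b * (p / (q - p)) * c powr (q - p)) * ennreal (norm (f x) powr p * h x powr (2 - p))"
    proof (cases "X x = 0")
      case True
      then have "f x = 0" using fX[of x] by simp
      then show ?thesis using p by simp
    next
      case False
      then have X: "0 < X x" using X0[of x] by simp
      have e1: "4 * a * (p / (p - 2) * X x powr (p - 2) * (norm (f x))\<^sup>2) = 4 * a * (p / (p - 2)) * c powr (2 - p) * (norm (f x) powr p * h x powr (2 - p))"
      proof -
        have x1: "X x powr p = X x powr (p - 2) * X x powr 2" and x2: "c powr 2 = c powr (2 - p) * c powr p"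
          by (simp_all only: powr_add[symmetric]) simp_all
        have "X x powr (p - 2) * (X x powr 2 * c powr 2 * (h x)\<^sup>2) = c powr (2 - p) * (X x powr p * c powr p * (h x)\<^sup>2)"
          unfolding x1 x2 by (simp only: mult_ac)
        then show ?thesis unfolding pw f2 by (simp only: mult.assoc)
      qed
      have e2: "2 powr q * b * (p / (q - p) * X x powr (p - q) * (norm (f x) powr q * h x powr (2 - q))) = 2 powr q * b * (p / (q - p)) * c powr (q - p) * (norm (f x) powr p * h x powr (2 - p))"
      proof -
        have x1: "X x powr p = X x powr (p - q) * X x powr q" and x2: "c powr q = c powr (q - p) * c powr p"
          by (simp_all only: powr_add[symmetric]) simp_all
        have "X x powr (p - q) * (X x powr q * c powr q * (h x)\<^sup>2) = c powr (q - p) * (X x powr p * c powr p * (h x)\<^sup>2)"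
          unfolding x1 x2 by (simp only: mult_ac)
        then show ?thesis unfolding pw fq by (simp only: mult.assoc)
      qed
      have "ennreal (4 * a) * (ennreal (p / (p - 2) * X x powr (p - 2)) * ennreal ((norm (f x))\<^sup>2)) = ennreal (4 * a * (p / (p - 2)) * c powr (2 - p)) * ennreal (norm (f x) powr p * h x powr (2 - p))"
        using e1 a p by (simp add: ennreal_mult[symmetric])
      moreover have "ennreal (2 powr q * b) * (ennreal (p / (q - p) * X x powr (p - q)) * ennreal (norm (f x) powr q * h x powr (2 - q))) = ennreal (2 powr q * b * (p / (q - p)) * c powr (q - p)) * ennreal (norm (f x) powr p * h x powr (2 - p))"
        using e2 b p by (simp add: ennreal_mult[symmetric])
      ultimately show ?thesis unfolding i1 i2[OF False] using a b p
        by (subst ennreal_plus) (auto simp: distrib_right)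
    qed
    finally show "(\<integral>\<^sup>+t. ennreal (4 * a) * (ennreal (p * t powr (p - 3)) * indicator {0<..<X x} t * ennreal ((norm (f x))\<^sup>2))
      + ennreal (2 powr q * b) * (ennreal (p * t powr (p - q - 1)) * (indicator {X x..} t * indicator {0<..} t) * ennreal (norm (f x) powr q * h x powr (2 - q))) \<partial>lborel)
      \<le> ennreal (4 * a * (p / (p - 2)) * c powr (2 - p) + 2 powr q * b * (p / (q - p)) * c powr (q - p)) * ennreal (norm (f x) powr p * h x powr (2 - p))" .
  qed
  also have "\<dots> = ennreal (4 * a * (p / (p - 2)) * c powr (2 - p) + 2 powr q * b * (p / (q - p)) * c powr (q - p)) * Np"
    unfolding Np_def by (intro nn_integral_cmult) measurable
  also have "4 * a * (p / (p - 2)) * c powr (2 - p) + 2 powr q * b * (p / (q - p)) * c powr (q - p)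
     = (4 * p / (p - 2) + 2 powr q * p / (q - p)) * (a powr ((q - p) / (q - 2)) * b powr ((p - 2) / (q - 2)))"
  proof -
    \<comment> \<open>The interpolation exponents of the two endpoints; that they add up to 1 is
      what merges both terms into the same product of powers.\<close>
    define al be where "al = (q - p) / (q - 2)" and "be = (p - 2) / (q - 2)"
    have ab: "al + be = 1" using p by (simp add: al_def be_def add_divide_distrib[symmetric])
    have x1: "1 / (q - 2) * (2 - p) = - be" "1 / (q - 2) * (q - p) = al" by (simp_all add: al_def be_def minus_divide_left)
    have "c powr (2 - p) = (a / b) powr (- be)" "c powr (q - p) = (a / b) powr al"
      unfolding c_def powr_powr x1 by (rule refl)+
    then have c1: "a * c powr (2 - p) = a powr (1 - be) * b powr be" and c2: "b * c powr (q - p) = a powr al * b powr (1 - al)"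
      using a b by (simp_all add: powr_divide powr_diff powr_minus_divide)
    have e: "1 - be = al" "1 - al = be" using ab by linarith+
    then have c1': "a * c powr (2 - p) = a powr al * b powr be" and c2': "b * c powr (q - p) = a powr al * b powr be"
      using c1 c2 unfolding e by simp_all
    have "4 * a * (p / (p - 2)) * c powr (2 - p) + 2 powr q * b * (p / (q - p)) * c powr (q - p)
      = 4 * (p / (p - 2)) * (a * c powr (2 - p)) + 2 powr q * (p / (q - p)) * (b * c powr (q - p))" by (simp only: mult_ac)
    also have "\<dots> = (4 * p / (p - 2) + 2 powr q * p / (q - p)) * (a powr al * b powr be)"
      unfolding c1' c2' by (simp only: distrib_right times_divide_eq_right)
    finally show ?thesis by (simp only: al_def be_def)
  qed
  finally show ?thesis unfolding Np_def .
qed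

section \<open>Dyadic decomposition of symbols\<close>

lemma Ck_continuous: "Ck k f \<Longrightarrow> continuous_on UNIV f"
  by (cases k) (auto intro: differentiable_imp_continuous_on)

lemma smooth_continuous: "smooth f \<Longrightarrow> continuous_on UNIV f"
  using Ck_continuous[of 0 f] by (auto simp: smooth_def)

lemma smooth_differentiable: "smooth f \<Longrightarrow> f differentiable (at x)"
  unfolding smooth_def by (metis Ck.simps(2) differentiable_on_eq_differentiable_at open_UNIV UNIV_I)

lemma smooth_partial: "smooth f \<Longrightarrow> b \<in> Basis \<Longrightarrow> smooth (partial b f)"
  unfolding smooth_def by (metis Ck.simps(2))

lemma smooth_foldr_partial:
  "smooth f \<Longrightarrow> (\<And>i. e i \<in> Basis) \<Longrightarrow> smooth (foldr (\<lambda>i. partial (e i)) xs f)"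
  by (induction xs) (auto intro: smooth_partial)

lemma has_vector_derivative_partial:
  fixes f :: "'a::euclidean_space \<Rightarrow> complex"
  assumes "smooth f"
  shows "((\<lambda>t. f (x + t *\<^sub>R v)) has_vector_derivative partial v f (x + t *\<^sub>R v)) (at t)"
proof -
  have 1: "(f has_derivative frechet_derivative f (at (x + t *\<^sub>R v))) (at (x + t *\<^sub>R v))"
    using smooth_differentiable[OF assms] by (simp add: frechet_derivative_works)
  have 2: "((\<lambda>t. x + t *\<^sub>R v) has_derivative (\<lambda>s. s *\<^sub>R v)) (at t)"
    by (auto intro!: derivative_eq_intros)
  have "((\<lambda>t. f (x + t *\<^sub>R v)) has_derivative (\<lambda>s. frechet_derivative f (at (x + t *\<^sub>R v)) (s *\<^sub>R v))) (at t)"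
    using has_derivative_compose[OF 2 1] by simp
  moreover have "frechet_derivative f (at (x + t *\<^sub>R v)) (s *\<^sub>R v) = s *\<^sub>R partial v f (x + t *\<^sub>R v)" for s
    unfolding partial_def using linear_scale[OF has_derivative_linear[OF 1]] by simp
  ultimately show ?thesis by (simp add: has_vector_derivative_def)
qed

section \<open>Symmetry of mixed partial derivatives\<close>

lemma vector_derivative_linear_approx:
  fixes \<phi> :: "real \<Rightarrow> complex"
  assumes h: "0 \<le> h" and B: "0 \<le> B" and der: "\<And>s. (\<phi> has_vector_derivative \<phi>' s) (at s)"
    and le: "\<And>s. s \<in> {0..h} \<Longrightarrow> norm (\<phi>' s - L) \<le> B"
  shows "norm (\<phi> h - \<phi> 0 - h *\<^sub>R L) \<le> B * h"
proof -
  have "((\<lambda>s. \<phi> s - s *\<^sub>R L) has_vector_derivative (\<phi>' s - L)) (at s)" for s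
  proof -
    have "((\<lambda>s. s *\<^sub>R L) has_vector_derivative L) (at s)"
      unfolding has_vector_derivative_def by (intro bounded_linear_imp_has_derivative bounded_linear_scaleR_left)
    then show ?thesis by (rule has_vector_derivative_diff[OF der])
  qed
  then have "((\<lambda>s. \<phi>' s - L) has_integral (\<phi> h - h *\<^sub>R L - (\<phi> 0 - 0 *\<^sub>R L))) {0..h}"
    using h by (intro fundamental_theorem_of_calculus) (auto intro: has_vector_derivative_at_within)
  then have "norm (\<phi> h - h *\<^sub>R L - (\<phi> 0 - 0 *\<^sub>R L)) \<le> B * measure lborel (cbox 0 h)"
    using le by (intro has_integral_bound[OF B]) auto
  then show ?thesis using h by (simp add: algebra_simps)
qed

lemma second_difference_approx:
  fixes f :: "'a::euclidean_space \<Rightarrow> complex"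
  assumes f: "smooth f" and u: "u \<in> Basis" and v: "v \<in> Basis" and h: "0 \<le> h" and e: "0 \<le> e"
    and le: "\<And>s t. s \<in> {0..h} \<Longrightarrow> t \<in> {0..h} \<Longrightarrow> norm (partial v (partial u f) (x + s *\<^sub>R u + t *\<^sub>R v) - L) \<le> e"
  shows "norm (f (x + h *\<^sub>R u + h *\<^sub>R v) - f (x + h *\<^sub>R u) - f (x + h *\<^sub>R v) + f x - (h * h) *\<^sub>R L) \<le> e * h * h"
proof -
  define \<phi> where "\<phi> = (\<lambda>s. f (x + h *\<^sub>R v + s *\<^sub>R u) - f (x + s *\<^sub>R u))"
  define \<phi>' where "\<phi>' = (\<lambda>s. partial u f (x + h *\<^sub>R v + s *\<^sub>R u) - partial u f (x + s *\<^sub>R u))"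
  have der: "(\<phi> has_vector_derivative \<phi>' s) (at s)" for s
    unfolding \<phi>_def \<phi>'_def by (intro has_vector_derivative_diff has_vector_derivative_partial f)
  have "norm (\<phi>' s - h *\<^sub>R L) \<le> e * h" if s: "s \<in> {0..h}" for s
  proof -
    have "norm (partial u f (x + s *\<^sub>R u + h *\<^sub>R v) - partial u f (x + s *\<^sub>R u + 0 *\<^sub>R v) - h *\<^sub>R L) \<le> e * h"
      by (rule vector_derivative_linear_approx[OF h e has_vector_derivative_partial[OF smooth_partial[OF f u]]])
        (use le s in auto)
    then show ?thesis by (simp add: \<phi>'_def add_ac)
  qed
  then have "norm (\<phi> h - \<phi> 0 - h *\<^sub>R (h *\<^sub>R L)) \<le> e * h * h"
    using e h by (intro vector_derivative_linear_approx[OF h _ der]) auto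
  then show ?thesis by (simp add: \<phi>_def algebra_simps)
qed

text \<open>The second difference over a square with sides along u and v is symmetric in u and v,
  and divided by h^2 it approximates either mixed derivative by continuity.\<close>

lemma partial_commute:
  fixes f :: "'a::euclidean_space \<Rightarrow> complex"
  assumes f: "smooth f" and u: "u \<in> Basis" and v: "v \<in> Basis"
  shows "partial u (partial v f) = partial v (partial u f)"
proof
  fix x
  define L1 where "L1 = partial v (partial u f) x"
  define L2 where "L2 = partial u (partial v f) x"
  have "norm (L1 - L2) \<le> 0 + e" if e: "0 < e" for e
  proof -
    have c: "isCont (partial v (partial u f)) x" "isCont (partial u (partial v f)) x"
      using smooth_continuous[OF smooth_partial[OF smooth_partial[OF f u] v]] smooth_continuous[OF smooth_partial[OF smooth_partial[OF f v] u]]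
      by (auto simp: continuous_on_eq_continuous_at)
    obtain d1 where d1: "0 < d1" "\<And>y. dist y x < d1 \<Longrightarrow> dist (partial v (partial u f) y) L1 < e / 2"
      using c(1) e unfolding continuous_at_eps_delta L1_def by (meson half_gt_zero)
    obtain d2 where d2: "0 < d2" "\<And>y. dist y x < d2 \<Longrightarrow> dist (partial u (partial v f) y) L2 < e / 2"
      using c(2) e unfolding continuous_at_eps_delta L2_def by (meson half_gt_zero)
    define h where "h = min d1 d2 / 3"
    have h: "0 < h" using d1 d2 by (simp add: h_def)
    have near: "dist (x + s *\<^sub>R u + t *\<^sub>R v) x < min d1 d2" if "s \<in> {0..h}" "t \<in> {0..h}" for s t
    proof -
      have "dist (x + s *\<^sub>R u + t *\<^sub>R v) x = norm (s *\<^sub>R u + t *\<^sub>R v)" by (simp add: dist_norm add.assoc)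
      also have "\<dots> \<le> s + t" using that u v by (intro order_trans[OF norm_triangle_ineq]) simp
      also have "\<dots> < min d1 d2" using that h d1 d2 unfolding h_def by auto
      finally show ?thesis .
    qed
    define \<Delta> where "\<Delta> = f (x + h *\<^sub>R u + h *\<^sub>R v) - f (x + h *\<^sub>R u) - f (x + h *\<^sub>R v) + f x"
    have "norm (\<Delta> - (h * h) *\<^sub>R L1) \<le> e / 2 * h * h"
      unfolding \<Delta>_def using h e near d1
      by (intro second_difference_approx[OF f u v]) (auto simp: dist_norm intro!: less_imp_le)
    moreover have "norm (\<Delta> - (h * h) *\<^sub>R L2) \<le> e / 2 * h * h"
    proof -
      have near': "dist (x + s *\<^sub>R v + t *\<^sub>R u) x < d2" if "s \<in> {0..h}" "t \<in> {0..h}" for s t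
        using near[OF that(2,1)] by (simp add: add_ac)
      have "norm (f (x + h *\<^sub>R v + h *\<^sub>R u) - f (x + h *\<^sub>R v) - f (x + h *\<^sub>R u) + f x - (h * h) *\<^sub>R L2) \<le> e / 2 * h * h"
        using h e near' d2
        by (intro second_difference_approx[OF f v u]) (auto simp: dist_norm intro!: less_imp_le)
      then show ?thesis by (simp add: \<Delta>_def algebra_simps)
    qed
    ultimately have "norm ((\<Delta> - (h * h) *\<^sub>R L2) - (\<Delta> - (h * h) *\<^sub>R L1)) \<le> e / 2 * h * h + e / 2 * h * h"
      by (intro order_trans[OF norm_triangle_ineq4]) simp
    also have "(\<Delta> - (h * h) *\<^sub>R L2) - (\<Delta> - (h * h) *\<^sub>R L1) = (h * h) *\<^sub>R (L1 - L2)" by (simp add: scaleR_diff_right)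
    finally have "(h * h) * norm (L1 - L2) \<le> (h * h) * e" using h by simp
    then show ?thesis using h by simp
  qed
  then have "norm (L1 - L2) \<le> 0" by (rule field_le_epsilon)
  then show "partial u (partial v f) x = partial v (partial u f) x" by (simp add: L1_def L2_def)
qed

lemma foldr_partial_move:
  fixes f :: "'a::euclidean_space \<Rightarrow> complex"
  assumes f: "smooth f" and e: "\<And>i. e i \<in> Basis" and x: "x \<in> set xs"
  shows "foldr (\<lambda>i. partial (e i)) xs f = partial (e x) (foldr (\<lambda>i. partial (e i)) (remove1 x xs) f)"
  using x
proof (induction xs)
  case (Cons y xs)
  show ?case
  proof (cases "x = y")
    case False
    then have "foldr (\<lambda>i. partial (e i)) (y # xs) f = partial (e y) (partial (e x) (foldr (\<lambda>i. partial (e i)) (remove1 x xs) f))"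
      using Cons by simp
    also have "\<dots> = partial (e x) (partial (e y) (foldr (\<lambda>i. partial (e i)) (remove1 x xs) f))"
      by (intro partial_commute smooth_foldr_partial f e)
    finally show ?thesis using False by simp
  qed simp
qed simp

lemma foldr_partial_mset:
  fixes f :: "'a::euclidean_space \<Rightarrow> complex"
  assumes f: "smooth f" and e: "\<And>i. e i \<in> Basis" and "mset xs = mset ys"
  shows "foldr (\<lambda>i. partial (e i)) xs f = foldr (\<lambda>i. partial (e i)) ys f"
  using assms(3)
proof (induction xs arbitrary: ys)
  case (Cons x xs)
  have x: "x \<in> set ys" using Cons.prems by (metis list.set_intros(1) mset_eq_setD)
  have ms: "mset xs = mset (remove1 x ys)" using Cons.prems by (metis mset_remove1 remove1.simps(2))
  then have "foldr (\<lambda>i. partial (e i)) (x # xs) f = partial (e x) (foldr (\<lambda>i. partial (e i)) (remove1 x ys) f)"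
    using Cons.IH[OF ms] by simp
  also have "\<dots> = foldr (\<lambda>i. partial (e i)) ys f" by (rule foldr_partial_move[OF f e x, symmetric])
  finally show ?case .
qed simp

text \<open>The list behind \<open>multi_deriv\<close> is an unspecified choice. Partial derivatives
  commute, so every list with the same multiplicities gives the same derivative.\<close>

lemma multi_deriv_count_list:
  fixes f :: "'a::euclidean_space \<Rightarrow> complex" and xs :: "'n::finite list"
  assumes f: "smooth f" and e: "\<And>i. e i \<in> Basis"
  shows "multi_deriv e (count_list xs) f = foldr (\<lambda>i. partial (e i)) xs f"
proof -
  define ys where "ys = (SOME is. \<forall>i. count_list is i = count_list xs i)"
  have "\<forall>i. count_list ys i = count_list xs i" unfolding ys_def by (rule someI[of _ xs]) simp
  then have "mset ys = mset xs" by (intro multiset_eqI) (simp add: count_mset)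
  then have "foldr (\<lambda>i. partial (e i)) ys f = foldr (\<lambda>i. partial (e i)) xs f" by (rule foldr_partial_mset[OF f e])
  then show ?thesis by (simp add: multi_deriv_def ys_def)
qed

lemma multi_order_count_list: "multi_order (count_list (xs :: 'n::finite list)) = length xs"
  unfolding multi_order_def by (intro sum_count_set) auto

section \<open>Derivatives of the symbol and uniform bounds\<close>

lemma axis_Basis_fst: "(axis i 1, 0) \<in> (Basis :: ((real^'n::finite) \<times> (real^'n)) set)"
  and axis_Basis_snd: "(0, axis i 1) \<in> (Basis :: ((real^'n::finite) \<times> (real^'n)) set)"
  by (auto simp: Basis_prod_def Basis_vec_def)

text \<open>The x-derivatives form a list, since unfreezing adds them one coordinate at a time; in
  \<xi> a single variable and an order suffice, because \<open>growth\<close> contains pure powers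
  only.\<close>

definition symbol_deriv :: "((real^'n::finite) \<times> (real^'n) \<Rightarrow> complex) \<Rightarrow> 'n list \<Rightarrow> 'n \<Rightarrow> nat \<Rightarrow> (real^'n) \<times> (real^'n) \<Rightarrow> complex"
  where "symbol_deriv a L i k = foldr (\<lambda>i. partial (axis i 1, 0)) L (foldr (\<lambda>i. partial (0, axis i 1)) (replicate k i) a)"

lemma smooth_symbol_deriv: "smooth a \<Longrightarrow> smooth (symbol_deriv a L i k)"
  unfolding symbol_deriv_def by (intro smooth_foldr_partial axis_Basis_fst axis_Basis_snd)

lemma symbol_deriv_Nil_0 [simp]: "symbol_deriv a [] i 0 = a"
  by (simp add: symbol_deriv_def)

lemma symbol_deriv_x:
  assumes "smooth a"
  shows "((\<lambda>t. symbol_deriv a L i k (x + t *\<^sub>R axis j 1, \<xi>)) has_vector_derivative symbol_deriv a (j # L) i k (x + t *\<^sub>R axis j 1, \<xi>)) (at t)"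
  using has_vector_derivative_partial[OF smooth_symbol_deriv[OF assms, of L i k], of "(x, \<xi>)" "(axis j 1, 0)" t]
  by (simp add: symbol_deriv_def)

lemma symbol_deriv_\<xi>:
  assumes "smooth a"
  shows "((\<lambda>t. symbol_deriv a [] i k (x, \<xi> + t *\<^sub>R axis i 1)) has_vector_derivative symbol_deriv a [] i (Suc k) (x, \<xi> + t *\<^sub>R axis i 1)) (at t)"
  using has_vector_derivative_partial[OF smooth_symbol_deriv[OF assms, of "[]" i k], of "(x, \<xi>)" "(0, axis i 1)" t]
  by (simp add: symbol_deriv_def)

lemma symbol_deriv_bound:
  assumes a: "a \<in> symbol_class m \<rho> \<delta>"
  shows "\<exists>C. \<forall>x \<xi>. norm (symbol_deriv a L i k (x, \<xi>)) \<le> C * (1 + norm \<xi>) powr (m - \<rho> * real k + \<delta> * real (length L))"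
proof -
  have s: "smooth a" using a by (simp add: symbol_class_def)
  have "D_xi (count_list (replicate k i)) a = foldr (\<lambda>i. partial (0, axis i 1)) (replicate k i) a"
    unfolding D_xi_def by (intro multi_deriv_count_list s axis_Basis_snd)
  moreover have "D_x (count_list L) (foldr (\<lambda>i. partial (0, axis i 1)) (replicate k i) a) = symbol_deriv a L i k"
    unfolding D_x_def symbol_deriv_def by (intro multi_deriv_count_list smooth_foldr_partial s axis_Basis_fst axis_Basis_snd)
  ultimately have "symbol_deriv a L i k = D_x (count_list L) (D_xi (count_list (replicate k i)) a)" by simp
  moreover have "\<forall>\<nu> \<sigma>. \<exists>C. \<forall>x \<xi>. norm (D_x \<nu> (D_xi \<sigma> a) (x, \<xi>)) \<le> C * (1 + norm \<xi>) powr (m - \<rho> * real (multi_order \<sigma>) + \<delta> * real (multi_order \<nu>))"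
    using a by (simp add: symbol_class_def)
  from this[rule_format, of "count_list L" "count_list (replicate k i)"]
  have "\<exists>C. \<forall>x \<xi>. norm (D_x (count_list L) (D_xi (count_list (replicate k i)) a) (x, \<xi>)) \<le> C * (1 + norm \<xi>) powr (m - \<rho> * real k + \<delta> * real (length L))"
    by (simp only: multi_order_count_list length_replicate)
  ultimately show ?thesis by simp
qed

text \<open>Bounded lengths and orders leave finitely many derivatives, so the sum of their
  individual constants serves for all.\<close>

lemma symbol_deriv_bound_uniform:
  fixes a :: "(real^'n::finite) \<times> (real^'n) \<Rightarrow> complex"
  assumes a: "a \<in> symbol_class m \<rho> \<delta>"
  obtains C where "0 < C" "\<And>L i k x \<xi>. length L \<le> M \<Longrightarrow> k \<le> N \<Longrightarrow>
    norm (symbol_deriv a L i k (x, \<xi>)) \<le> C * (1 + norm \<xi>) powr (m - \<rho> * real k + \<delta> * real (length L))"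
proof -
  define I where "I = {L :: 'n list. set L \<subseteq> UNIV \<and> length L \<le> M} \<times> (UNIV :: 'n set) \<times> {..N}"
  have fin: "finite I" unfolding I_def by (intro finite_cartesian_product finite_lists_length_le) auto
  have "\<forall>p. \<exists>C. \<forall>x \<xi>. norm (symbol_deriv a (fst p) (fst (snd p)) (snd (snd p)) (x, \<xi>)) \<le> C * (1 + norm \<xi>) powr (m - \<rho> * real (snd (snd p)) + \<delta> * real (length (fst p)))"
    using symbol_deriv_bound[OF a] by blast
  then obtain C where C: "\<And>p x \<xi>. norm (symbol_deriv a (fst p) (fst (snd p)) (snd (snd p)) (x, \<xi>)) \<le> C p * (1 + norm \<xi>) powr (m - \<rho> * real (snd (snd p)) + \<delta> * real (length (fst p)))"
    by metis
  define B where "B = 1 + (\<Sum>p\<in>I. \<bar>C p\<bar>)"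
  show ?thesis
  proof (rule that[of B])
    show "0 < B" unfolding B_def by (intro add_pos_nonneg sum_nonneg) auto
    fix L :: "'n list" and i k and x \<xi> :: "real^'n" assume "length L \<le> M" "k \<le> N"
    then have p: "(L, i, k) \<in> I" by (simp add: I_def)
    have "C (L, i, k) \<le> B"
      using member_le_sum[OF p, of "\<lambda>p. \<bar>C p\<bar>"] fin by (simp add: B_def)
    then have "C (L, i, k) * (1 + norm \<xi>) powr (m - \<rho> * real k + \<delta> * real (length L)) \<le> B * (1 + norm \<xi>) powr (m - \<rho> * real k + \<delta> * real (length L))"
      by (intro mult_right_mono) auto
    then show "norm (symbol_deriv a L i k (x, \<xi>)) \<le> B * (1 + norm \<xi>) powr (m - \<rho> * real k + \<delta> * real (length L))"
      using C[of "(L, i, k)" x \<xi>] by simp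
  qed
qed

text \<open>\<open>\<phi> k\<close> is the \<open>k\<close>-th derivative of the cut-off \<open>\<phi> 0\<close>; finite smoothness \<open>N\<close> suffices.\<close>

definition cutoff :: "nat \<Rightarrow> real \<Rightarrow> real \<Rightarrow> (nat \<Rightarrow> real \<Rightarrow> real) \<Rightarrow> bool"
  where "cutoff N a b \<phi> \<longleftrightarrow>
    (\<forall>k<N. \<forall>t. (\<phi> k has_real_derivative \<phi> (Suc k) t) (at t)) \<and>
    (\<forall>k. continuous_on UNIV (\<phi> k)) \<and>
    (\<forall>t. \<bar>t\<bar> \<le> a \<longrightarrow> \<phi> 0 t = 1) \<and>
    (\<forall>k t. 0 < k \<longrightarrow> \<bar>t\<bar> \<le> a \<longrightarrow> \<phi> k t = 0) \<and>
    (\<forall>k t. b \<le> \<bar>t\<bar> \<longrightarrow> \<phi> k t = 0)"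

text \<open>Averaging a cut-off over a window gains one derivative, which is a difference quotient
  of the old cut-off. The induction starts from a piecewise linear function.\<close>

lemma cutoff_exists: "0 < a \<Longrightarrow> a < b \<Longrightarrow> \<exists>\<phi>. cutoff N a b \<phi>"
proof (induction N arbitrary: a b)
  case 0
  define \<phi> where "\<phi> = (\<lambda>k::nat. \<lambda>t::real. if k = 0 then max 0 (min 1 ((b - \<bar>t\<bar>) / (b - a))) else 0)"
  have 1: "\<phi> 0 t = 1" if "\<bar>t\<bar> \<le> a" for t
  proof -
    have "1 \<le> (b - \<bar>t\<bar>) / (b - a)" using that 0 by (simp add: pos_le_divide_eq)
    then show ?thesis by (simp add: \<phi>_def)
  qed
  have 2: "\<phi> k t = 0" if "b \<le> \<bar>t\<bar>" for k t
  proof -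
    have "(b - \<bar>t\<bar>) / (b - a) \<le> 0" using that 0 by (intro divide_nonpos_pos) auto
    then show ?thesis by (simp add: \<phi>_def)
  qed
  have 3: "continuous_on UNIV (\<phi> k)" for k
    unfolding \<phi>_def using 0 by (cases "k = 0") (auto intro!: continuous_intros)
  have "cutoff 0 a b \<phi>" unfolding cutoff_def using 1 2 3 by (auto simp: \<phi>_def)
  then show ?case by blast
next
  case (Suc N)
  \<comment> \<open>The window eats h from each side of the transition region; a third of its width
    leaves a nonempty transition for the induction hypothesis.\<close>
  define h where "h = (b - a) / 3"
  have h: "0 < h" "a + h < b - h" "0 < a + h" using Suc.prems by (auto simp: h_def field_simps)
  obtain \<phi> where \<phi>: "cutoff N (a + h) (b - h) \<phi>" using Suc.IH[OF h(3,2)] by blast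
  have cont: "continuous_on UNIV (\<phi> k)" for k using \<phi> by (simp add: cutoff_def)
  obtain G where "\<forall>t::real. -\<infinity> < ereal t \<longrightarrow> ereal t < \<infinity> \<longrightarrow> (G has_vector_derivative \<phi> 0 t) (at t)"
    using einterval_antiderivative[of "-\<infinity>" \<infinity> "\<phi> 0"] cont[of 0] by (auto simp: continuous_on_eq_continuous_at)
  then have G: "(G has_real_derivative \<phi> 0 t) (at t)" for t
    by (simp add: has_real_derivative_iff_has_vector_derivative)
  have Gdiff: "G (t + h) - G (t - h) = 2 * h * c" if "\<And>s. t - h \<le> s \<Longrightarrow> s \<le> t + h \<Longrightarrow> \<phi> 0 s = c" for t c
  proof -
    obtain z where "t - h < z" "z < t + h" "G (t + h) - G (t - h) = (t + h - (t - h)) * \<phi> 0 z"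
      using MVT2[of "t - h" "t + h" G "\<phi> 0"] h G by auto
    then show ?thesis using that[of z] by simp
  qed
  \<comment> \<open>The mean of the old cut-off over [t - h, t + h], written with an antiderivative;
    the derivatives shift by one index.\<close>
  define \<psi> where "\<psi> = (\<lambda>k t. case k of 0 \<Rightarrow> (G (t + h) - G (t - h)) / (2 * h) | Suc j \<Rightarrow> (\<phi> j (t + h) - \<phi> j (t - h)) / (2 * h))"
  have shift: "((\<lambda>t. (F (t + h) - F (t - h)) / (2 * h)) has_real_derivative (F' (t + h) - F' (t - h)) / (2 * h)) (at t)"
    if F: "\<And>t. (F has_real_derivative F' t) (at t)" for F F' :: "real \<Rightarrow> real" and t
  proof -
    have "((\<lambda>t. F (t + h)) has_real_derivative F' (t + h)) (at t)" using F[of "t + h"] by (simp add: DERIV_shift)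
    moreover have "((\<lambda>t. F (t - h)) has_real_derivative F' (t - h)) (at t)" using F[of "t - h"] DERIV_shift[of F "F' (t - h)" t "- h"] by simp
    ultimately show ?thesis by (intro DERIV_cdivide DERIV_diff)
  qed
  have "cutoff (Suc N) a b \<psi>"
    unfolding cutoff_def
  proof (intro conjI allI impI)
    fix k t assume "k < Suc N"
    show "(\<psi> k has_real_derivative \<psi> (Suc k) t) (at t)"
    proof (cases k)
      case 0
      then show ?thesis using shift[OF G, of t] by (simp add: \<psi>_def)
    next
      case (Suc j)
      then have "(\<phi> j has_real_derivative \<phi> (Suc j) t) (at t)" for t using \<phi> \<open>k < Suc N\<close> by (simp add: cutoff_def)
      from shift[OF this, of t] show ?thesis using Suc by (simp add: \<psi>_def)
    qed
  next
    fix k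
    have cG: "continuous_on UNIV G" using G by (meson DERIV_continuous continuous_at_imp_continuous_on)
    have "continuous_on UNIV (\<lambda>t. F (t + h))" "continuous_on UNIV (\<lambda>t. F (t - h))" if "continuous_on UNIV F" for F :: "real \<Rightarrow> real"
      by (rule continuous_on_compose2[OF that], auto intro!: continuous_intros)+
    then show "continuous_on UNIV (\<psi> k)"
      unfolding \<psi>_def using cG cont h by (cases k) (auto intro!: continuous_intros)
  next
    fix t assume t: "\<bar>t\<bar> \<le> a"
    have "\<phi> 0 s = 1" if "t - h \<le> s" "s \<le> t + h" for s
      using \<phi> t that unfolding cutoff_def by (auto simp: abs_le_iff)
    then show "\<psi> 0 t = 1" using Gdiff[of t 1] h by (simp add: \<psi>_def)
  next
    fix k :: nat and t assume k: "0 < k" and t: "\<bar>t\<bar> \<le> a"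
    have t': "\<bar>t + h\<bar> \<le> a + h" "\<bar>t - h\<bar> \<le> a + h" using t h by auto
    obtain j where j: "k = Suc j" using k by (cases k) auto
    have "\<phi> j (t + h) = \<phi> j (t - h)"
      using \<phi> t' by (cases "j = 0") (auto simp: cutoff_def)
    then show "\<psi> k t = 0" by (simp add: \<psi>_def j)
  next
    fix k t assume t: "b \<le> \<bar>t\<bar>"
    show "\<psi> k t = 0"
    proof (cases k)
      case 0
      have "\<phi> 0 s = 0" if "t - h \<le> s" "s \<le> t + h" for s
      proof -
        have "b - h \<le> \<bar>s\<bar>" using that t by linarith
        then show ?thesis using \<phi> by (simp add: cutoff_def)
      qed
      then show ?thesis using Gdiff[of t 0] 0 by (simp add: \<psi>_def)
    next
      case (Suc j)
      have "b - h \<le> \<bar>t + h\<bar>" "b - h \<le> \<bar>t - h\<bar>" using t h by linarith+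
      then show ?thesis using \<phi> Suc by (simp add: \<psi>_def cutoff_def)
    qed
  qed
  then show ?case by blast
qed

text \<open>\<open>leibniz k F G\<close> is the \<open>k\<close>-th derivative of a product, given the derivatives \<open>F l\<close> and \<open>G l\<close> of
  its factors; the recursion avoids binomial coefficients.\<close>

primrec leibniz :: "nat \<Rightarrow> (nat \<Rightarrow> complex) \<Rightarrow> (nat \<Rightarrow> complex) \<Rightarrow> complex" where
  "leibniz 0 F G = F 0 * G 0"
| "leibniz (Suc k) F G = leibniz k (\<lambda>l. F (Suc l)) G + leibniz k F (\<lambda>l. G (Suc l))"

text \<open>The derivatives F' and G' are kept independent of the sequences F and G: differentiation
  in \<xi> shifts the index, whereas differentiation in x changes F and has G' = 0.\<close>

lemma leibniz_derivative:
  assumes "\<And>l. l \<le> k \<Longrightarrow> ((\<lambda>t. F l t) has_vector_derivative F' l t) (at t)"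
    and "\<And>l. l \<le> k \<Longrightarrow> ((\<lambda>t. G l t) has_vector_derivative G' l t) (at t)"
  shows "((\<lambda>t. leibniz k (\<lambda>l. F l t) (\<lambda>l. G l t)) has_vector_derivative
    leibniz k (\<lambda>l. F' l t) (\<lambda>l. G l t) + leibniz k (\<lambda>l. F l t) (\<lambda>l. G' l t)) (at t)"
  using assms
proof (induction k arbitrary: F F' G G')
  case 0
  then show ?case using has_vector_derivative_mult[of "F 0" "F' 0 t" t UNIV "G 0" "G' 0 t"] by (simp add: add.commute)
next
  case (Suc k)
  have "((\<lambda>t. leibniz k (\<lambda>l. F (Suc l) t) (\<lambda>l. G l t)) has_vector_derivative
    leibniz k (\<lambda>l. F' (Suc l) t) (\<lambda>l. G l t) + leibniz k (\<lambda>l. F (Suc l) t) (\<lambda>l. G' l t)) (at t)"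
    using Suc.prems by (intro Suc.IH) auto
  moreover have "((\<lambda>t. leibniz k (\<lambda>l. F l t) (\<lambda>l. G (Suc l) t)) has_vector_derivative
    leibniz k (\<lambda>l. F' l t) (\<lambda>l. G (Suc l) t) + leibniz k (\<lambda>l. F l t) (\<lambda>l. G' (Suc l) t)) (at t)"
    using Suc.prems by (intro Suc.IH) auto
  ultimately show ?case
    using has_vector_derivative_add by (fastforce simp: algebra_simps)
qed

lemma leibniz_zero_right [simp]: "leibniz k F (\<lambda>l. 0) = 0"
  by (induction k arbitrary: F) auto

lemma leibniz_continuous:
  assumes "\<And>l. continuous_on S (F l)" "\<And>l. continuous_on S (G l)"
  shows "continuous_on S (\<lambda>z. leibniz k (\<lambda>l. F l z) (\<lambda>l. G l z))"
  using assms by (induction k arbitrary: F G) (auto intro!: continuous_intros)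

text \<open>Unfolding the recursion gives 2^k products, each with k derivatives distributed over the
  two factors, hence the same power q^k.\<close>

lemma leibniz_bound:
  assumes "\<And>l. l \<le> k \<Longrightarrow> norm (F l) \<le> A * q ^ l" "\<And>l. l \<le> k \<Longrightarrow> norm (G l) \<le> B * q ^ l"
    and "0 \<le> A" "0 \<le> q"
  shows "norm (leibniz k F G) \<le> 2 ^ k * A * B * q ^ k"
  using assms
proof (induction k arbitrary: F G A B)
  case 0
  have "norm (F 0 * G 0) \<le> A * B"
    unfolding norm_mult using 0(1)[of 0] 0(2)[of 0] 0(3) by (intro mult_mono) auto
  then show ?case by simp
next
  case (Suc k)
  have "norm (leibniz k (\<lambda>l. F (Suc l)) G) \<le> 2 ^ k * (A * q) * B * q ^ k"
  proof (rule Suc.IH)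
    show "norm (F (Suc l)) \<le> A * q * q ^ l" if "l \<le> k" for l using Suc.prems(1)[of "Suc l"] that by (simp add: mult.assoc)
  qed (use Suc.prems in auto)
  moreover have "norm (leibniz k F (\<lambda>l. G (Suc l))) \<le> 2 ^ k * A * (B * q) * q ^ k"
  proof (rule Suc.IH)
    show "norm (G (Suc l)) \<le> B * q * q ^ l" if "l \<le> k" for l using Suc.prems(2)[of "Suc l"] that by (simp add: mult.assoc)
  qed (use Suc.prems in auto)
  ultimately have "norm (leibniz (Suc k) F G) \<le> 2 ^ k * (A * q) * B * q ^ k + 2 ^ k * A * (B * q) * q ^ k"
    by (simp only: leibniz.simps) (rule order_trans[OF norm_triangle_ineq add_mono])
  also have "\<dots> = 2 ^ Suc k * A * B * q ^ Suc k" by simp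
  finally show ?case .
qed

text \<open>\<open>freq_cutoff \<phi> j i k\<close> is the derivative of order \<open>k\<close> in \<open>\<xi>\<^sub>i\<close> of the product cut-off to the cube of
  size \<open>2\<^sup>j\<close>, and \<open>freq_piece\<close> that of the cut-off to the \<open>j\<close>-th dyadic shell. For \<open>k = 0\<close> the index
  \<open>i\<close> is irrelevant.\<close>

definition freq_cutoff :: "(nat \<Rightarrow> real \<Rightarrow> real) \<Rightarrow> nat \<Rightarrow> 'n::finite \<Rightarrow> nat \<Rightarrow> real^'n \<Rightarrow> real"
  where "freq_cutoff \<phi> j i k \<xi> = (1 / 2 ^ j) ^ k * \<phi> k (\<xi> $ i / 2 ^ j) * (\<Prod>l\<in>UNIV - {i}. \<phi> 0 (\<xi> $ l / 2 ^ j))"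

definition freq_piece :: "(nat \<Rightarrow> real \<Rightarrow> real) \<Rightarrow> nat \<Rightarrow> 'n::finite \<Rightarrow> nat \<Rightarrow> real^'n \<Rightarrow> real"
  where "freq_piece \<phi> j i k \<xi> = freq_cutoff \<phi> j i k \<xi> - (if j = 0 then 0 else freq_cutoff \<phi> (j - 1) i k \<xi>)"

text \<open>The x-derivatives in L fall on the symbol alone, since the cut-off does not depend on x;
  the k derivatives in one frequency variable are shared by both factors.\<close>

definition symbol_piece ::
    "((real^'n::finite) \<times> (real^'n) \<Rightarrow> complex) \<Rightarrow> (nat \<Rightarrow> real \<Rightarrow> real) \<Rightarrow> nat \<Rightarrow> 'n list \<Rightarrow> 'n \<Rightarrow> nat \<Rightarrow> real^'n \<Rightarrow> real^'n \<Rightarrow> complex"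
  where "symbol_piece a \<phi> j L i k x \<xi> = leibniz k (\<lambda>l. symbol_deriv a L i l (x, \<xi>)) (\<lambda>l. of_real (freq_piece \<phi> j i l \<xi>))"

lemma freq_cutoff_0: "freq_cutoff \<phi> j i 0 \<xi> = (\<Prod>l\<in>UNIV. \<phi> 0 (\<xi> $ l / 2 ^ j))"
  unfolding freq_cutoff_def by (subst prod.remove[of UNIV i]) auto

lemma sum_freq_piece: "(\<Sum>j\<le>J. freq_piece \<phi> j i k \<xi>) = freq_cutoff \<phi> J i k \<xi>"
proof (induction J)
  case 0
  show ?case by (simp add: freq_piece_def)
next
  case (Suc J)
  then show ?case by (simp only: sum.atMost_Suc) (simp add: freq_piece_def[of _ "Suc J"])
qed

lemma continuous_freq_cutoff:
  assumes "cutoff N a b \<phi>" shows "continuous_on UNIV (freq_cutoff \<phi> j i k)"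
proof -
  have c: "continuous_on UNIV (\<phi> k)" for k using assms by (simp add: cutoff_def)
  have "continuous_on UNIV (\<lambda>\<xi> :: real^'a. \<phi> k (\<xi> $ l / 2 ^ j))" for k l
    by (rule continuous_on_compose2[OF c]) (auto intro!: continuous_intros)
  then show ?thesis unfolding freq_cutoff_def by (intro continuous_intros)
qed

lemma freq_cutoff_eq_0:
  assumes \<phi>: "cutoff N 1 2 \<phi>" and "\<xi> \<notin> cube 0 (2 * 2 ^ j)"
  shows "freq_cutoff \<phi> j i k \<xi> = 0"
proof -
  obtain l where l: "2 * 2 ^ j < \<bar>\<xi> $ l\<bar>" using assms(2) by (auto simp: cube_def not_le)
  then have "2 \<le> \<bar>\<xi> $ l / 2 ^ j\<bar>" by (simp add: pos_le_divide_eq)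
  then have z: "\<phi> k (\<xi> $ l / 2 ^ j) = 0" for k using \<phi> by (simp add: cutoff_def)
  show ?thesis
  proof (cases "l = i")
    case False
    then have "(\<Prod>l\<in>UNIV - {i}. \<phi> 0 (\<xi> $ l / 2 ^ j)) = 0" using z by (intro prod_zero) auto
    then show ?thesis by (simp add: freq_cutoff_def)
  qed (use z in \<open>simp add: freq_cutoff_def\<close>)
qed

lemma freq_cutoff_inner:
  assumes \<phi>: "cutoff N 1 2 \<phi>" and "\<xi> \<in> cube 0 (2 ^ j)"
  shows "freq_cutoff \<phi> j i k \<xi> = (if k = 0 then 1 else 0)"
proof -
  have "\<bar>\<xi> $ l / 2 ^ j\<bar> \<le> 1" for l using assms(2) by (simp add: cube_def)
  then show ?thesis using \<phi> by (auto simp: freq_cutoff_def cutoff_def)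
qed

lemma freq_piece_eq_0:
  assumes \<phi>: "cutoff N 1 2 \<phi>" and "\<xi> \<notin> cube 0 (2 * 2 ^ j) \<or> j \<noteq> 0 \<and> \<xi> \<in> cube 0 (2 ^ (j - 1))"
  shows "freq_piece \<phi> j i k \<xi> = 0"
  using assms(2)
proof
  assume *: "\<xi> \<notin> cube 0 (2 * 2 ^ j)"
  have "\<xi> \<notin> cube 0 (2 * 2 ^ (j - 1))"
    using * cube_mono[of "2 * 2 ^ (j - 1)" "2 * 2 ^ j" 0] power_increasing[of "j - 1" j "2::real"] by auto
  then show ?thesis using freq_cutoff_eq_0[OF \<phi> *] freq_cutoff_eq_0[OF \<phi>, of \<xi> "j - 1"] by (simp add: freq_piece_def)
next
  assume *: "j \<noteq> 0 \<and> \<xi> \<in> cube 0 (2 ^ (j - 1))"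
  have "\<xi> \<in> cube 0 (2 ^ j)"
    using * cube_mono[of "2 ^ (j - 1)" "2 ^ j" 0] power_increasing[of "j - 1" j "2::real"] by auto
  then show ?thesis using * freq_cutoff_inner[OF \<phi>, of \<xi> j] freq_cutoff_inner[OF \<phi>, of \<xi> "j - 1"] by (simp add: freq_piece_def)
qed

lemma freq_cutoff_derivative:
  assumes \<phi>: "cutoff N 1 2 \<phi>" and k: "k < N"
  shows "((\<lambda>t. freq_cutoff \<phi> j i k (\<xi> + t *\<^sub>R axis i 1)) has_real_derivative freq_cutoff \<phi> j i (Suc k) (\<xi> + t *\<^sub>R axis i 1)) (at t)"
proof -
  define P where "P = (\<Prod>l\<in>UNIV - {i}. \<phi> 0 (\<xi> $ l / 2 ^ j))"
  have e: "freq_cutoff \<phi> j i k (\<xi> + t *\<^sub>R axis i 1) = (1 / 2 ^ j) ^ k * \<phi> k ((\<xi> $ i + t) / 2 ^ j) * P" for k t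
  proof -
    have "(\<Prod>l\<in>UNIV - {i}. \<phi> 0 ((\<xi> + t *\<^sub>R axis i 1) $ l / 2 ^ j)) = P"
      unfolding P_def by (intro prod.cong refl) (simp add: axis_def)
    then show ?thesis by (simp add: freq_cutoff_def)
  qed
  have "((\<lambda>t. (\<xi> $ i + t) / 2 ^ j) has_real_derivative 1 / 2 ^ j) (at t)" by (auto intro!: derivative_eq_intros)
  moreover have "(\<phi> k has_real_derivative \<phi> (Suc k) ((\<xi> $ i + t) / 2 ^ j)) (at ((\<xi> $ i + t) / 2 ^ j))"
    using \<phi> k by (simp add: cutoff_def)
  ultimately have "((\<lambda>t. \<phi> k ((\<xi> $ i + t) / 2 ^ j)) has_real_derivative \<phi> (Suc k) ((\<xi> $ i + t) / 2 ^ j) * (1 / 2 ^ j)) (at t)"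
    by (intro DERIV_chain2[where f="\<phi> k"])
  then have "((\<lambda>t. (1 / 2 ^ j) ^ k * \<phi> k ((\<xi> $ i + t) / 2 ^ j) * P) has_real_derivative (1 / 2 ^ j) ^ k * (\<phi> (Suc k) ((\<xi> $ i + t) / 2 ^ j) * (1 / 2 ^ j)) * P) (at t)"
    by (intro DERIV_cmult DERIV_cmult_right)
  then show ?thesis unfolding e by (simp add: mult_ac)
qed

lemma freq_piece_derivative:
  assumes \<phi>: "cutoff N 1 2 \<phi>" and k: "k < N"
  shows "((\<lambda>t. freq_piece \<phi> j i k (\<xi> + t *\<^sub>R axis i 1)) has_real_derivative freq_piece \<phi> j i (Suc k) (\<xi> + t *\<^sub>R axis i 1)) (at t)"
  unfolding freq_piece_def
  by (cases "j = 0") (auto intro!: DERIV_diff freq_cutoff_derivative[OF \<phi> k])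

lemma cutoff_bounded:
  assumes \<phi>: "cutoff N 1 2 \<phi>"
  obtains M where "1 \<le> M" "\<And>k t. k \<le> N \<Longrightarrow> \<bar>\<phi> k t\<bar> \<le> M"
proof -
  have "\<exists>B. \<forall>t. \<bar>\<phi> k t\<bar> \<le> B" for k
  proof -
    have "compact (\<phi> k ` {-2..2})"
      using \<phi> by (intro compact_continuous_image) (auto simp: cutoff_def intro: continuous_on_subset)
    then obtain B where B: "\<And>t. t \<in> {-2..2} \<Longrightarrow> \<bar>\<phi> k t\<bar> \<le> B"
      by (force dest!: compact_imp_bounded simp: bounded_iff)
    have "\<bar>\<phi> k t\<bar> \<le> max B 0" for t
    proof (cases "t \<in> {-2..2}")
      case False
      then have "2 \<le> \<bar>t\<bar>" by auto
      then show ?thesis using \<phi> by (simp add: cutoff_def)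
    qed (use B[of t] in auto)
    then show ?thesis by blast
  qed
  then obtain B where B: "\<And>k t. \<bar>\<phi> k t\<bar> \<le> B k" by metis
  show ?thesis
  proof (rule that[of "1 + (\<Sum>k\<le>N. \<bar>B k\<bar>)"])
    show "1 \<le> 1 + (\<Sum>k\<le>N. \<bar>B k\<bar>)" by (simp add: sum_nonneg)
    fix k t assume "k \<le> N"
    then have "\<bar>B k\<bar> \<le> (\<Sum>k\<le>N. \<bar>B k\<bar>)" by (intro member_le_sum) auto
    then show "\<bar>\<phi> k t\<bar> \<le> 1 + (\<Sum>k\<le>N. \<bar>B k\<bar>)" using B[of k t] by linarith
  qed
qed

lemma freq_piece_bound:
  assumes \<phi>: "cutoff N 1 2 \<phi>" and M: "1 \<le> M" "\<And>k t. k \<le> N \<Longrightarrow> \<bar>\<phi> k t\<bar> \<le> M" and k: "k \<le> N"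
  shows "\<bar>freq_piece \<phi> j i k (\<xi> :: real^'n::finite)\<bar> \<le> (1 + 2 ^ N) * M ^ CARD('n) * (1 / 2 ^ j) ^ k"
proof -
  have fc: "\<bar>freq_cutoff \<phi> j i k \<xi>\<bar> \<le> (1 / 2 ^ j) ^ k * M ^ CARD('n)" for j
  proof -
    have "\<bar>\<Prod>l\<in>UNIV - {i}. \<phi> 0 (\<xi> $ l / 2 ^ j)\<bar> \<le> (\<Prod>l\<in>UNIV - {i}. M)"
      unfolding abs_prod using M(2)[of 0] by (intro prod_mono) auto
    then have "\<bar>\<phi> k (\<xi> $ i / 2 ^ j)\<bar> * \<bar>\<Prod>l\<in>UNIV - {i}. \<phi> 0 (\<xi> $ l / 2 ^ j)\<bar> \<le> M * (\<Prod>l\<in>UNIV - {i}. M)"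
      using M k by (intro mult_mono) auto
    also have "\<dots> = (\<Prod>l\<in>(UNIV::'n set). M)" by (rule prod.remove[symmetric]) auto
    also have "\<dots> = M ^ CARD('n)" by simp
    finally show ?thesis unfolding freq_cutoff_def abs_mult by (simp add: mult.assoc divide_right_mono)
  qed
  have B: "0 \<le> M ^ CARD('n)" using M by simp
  show ?thesis
  proof (cases j)
    case 0
    have "\<bar>freq_piece \<phi> j i k \<xi>\<bar> \<le> 1 * M ^ CARD('n) * (1 / 2 ^ j) ^ k" using fc[of 0] 0 by (simp add: freq_piece_def)
    also have "\<dots> \<le> (1 + 2 ^ N) * M ^ CARD('n) * (1 / 2 ^ j) ^ k" using B by (intro mult_right_mono) auto
    finally show ?thesis .
  next
    case (Suc j')
    have "\<bar>freq_piece \<phi> j i k \<xi>\<bar> \<le> \<bar>freq_cutoff \<phi> j i k \<xi>\<bar> + \<bar>freq_cutoff \<phi> j' i k \<xi>\<bar>"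
      by (simp add: freq_piece_def Suc)
    also have "\<dots> \<le> (1 / 2 ^ j) ^ k * M ^ CARD('n) + (1 / 2 ^ j') ^ k * M ^ CARD('n)" by (intro add_mono fc)
    also have "(1 / 2 ^ j') ^ k = (2::real) ^ k * (1 / 2 ^ j) ^ k" by (simp add: Suc power_mult_distrib[symmetric])
    also have "(1 / 2 ^ j) ^ k * M ^ CARD('n) + 2 ^ k * (1 / 2 ^ j) ^ k * M ^ CARD('n) = (1 + 2 ^ k) * M ^ CARD('n) * (1 / 2 ^ j) ^ k"
      by (simp add: algebra_simps)
    also have "\<dots> \<le> (1 + 2 ^ N) * M ^ CARD('n) * (1 / 2 ^ j) ^ k"
      using B k by (intro mult_right_mono add_left_mono power_increasing) auto
    finally show ?thesis .
  qed
qed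

text \<open>For s comparable to 1 a power can be bounded without knowing the sign of the exponent.
  It is used with s = (1 + |\<xi>|) / 2^j.\<close>

lemma powr_between:
  fixes s c e E :: real
  assumes "0 < s" "s \<le> c" "1 / s \<le> c" "\<bar>e\<bar> \<le> E"
  shows "s powr e \<le> c powr E"
proof -
  have c: "1 \<le> c"
    using assms by (cases "1 \<le> s") (auto simp: divide_le_eq intro: order_trans)
  have "s powr e \<le> c powr \<bar>e\<bar>"
  proof (cases "0 \<le> e")
    case True
    then show ?thesis using assms by (simp add: powr_mono2)
  next
    case False
    have "s powr e = (1 / s) powr \<bar>e\<bar>" using False assms by (simp add: powr_divide powr_minus_divide)
    also have "\<dots> \<le> c powr \<bar>e\<bar>" using assms by (intro powr_mono2) auto
    finally show ?thesis .
  qed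
  also have "\<dots> \<le> c powr E" using c assms by (intro powr_mono) auto
  finally show ?thesis .
qed

text \<open>On the support of the j-th piece 1 + |\<xi>| is comparable to R = 2^j. A
  \<xi>-derivative gains R^(-\<rho>) on the symbol and 1 / R on the cut-off, both at most 1 / l
  since \<rho> \<le> 1; an x-derivative costs R^\<delta>, at most l.\<close>

lemma symbol_piece_amplitude:
  fixes a :: "(real^'n::finite) \<times> (real^'n) \<Rightarrow> complex"
  assumes a: "a \<in> symbol_class m \<rho> \<delta>" and \<rho>: "0 \<le> \<delta>" "\<delta> \<le> \<rho>" "\<rho> \<le> 1" and \<phi>: "cutoff (2 * CARD('n)) 1 2 \<phi>"
  obtains C where "0 < C" "\<And>j. amplitude (symbol_piece a \<phi> j) (C * (2 ^ j) powr m) (2 ^ j) ((2 ^ j) powr \<rho>)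
     (\<lambda>x \<xi>. a (x, \<xi>) * of_real (freq_piece \<phi> j undefined 0 \<xi>))"
proof -
  define n where "n = CARD('n)"
  define N where "N = 2 * n"
  have \<phi>N: "cutoff N 1 2 \<phi>" using \<phi> by (simp add: N_def n_def)
  have sm: "smooth a" using a by (simp add: symbol_class_def)
  obtain C1 where C1: "0 < C1" "\<And>L i k x \<xi>. length L \<le> n \<Longrightarrow> k \<le> N \<Longrightarrow>
    norm (symbol_deriv a L i k (x, \<xi>)) \<le> C1 * (1 + norm \<xi>) powr (m - \<rho> * real k + \<delta> * real (length L))"
    using symbol_deriv_bound_uniform[OF a, of n N] by blast
  obtain M where M: "1 \<le> M" "\<And>k t. k \<le> N \<Longrightarrow> \<bar>\<phi> k t\<bar> \<le> M" using cutoff_bounded[OF \<phi>N] by blast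
  define B where "B = (1 + 2 ^ N) * M ^ n"
  have B: "0 < B" using M by (simp add: B_def add_pos_pos)
  define E where "E = \<bar>m\<bar> + real N + real n"
  \<comment> \<open>The base bounds (1 + |\<xi>|) / 2^j and its inverse on the support, and
    \<open>E\<close> bounds every exponent that occurs.\<close>
  define K where "K = (2 * real n + 2) powr E"
  have K: "0 < K" by (simp add: K_def)
  define C where "C = 2 ^ N * C1 * K * B"
  have C: "0 < C" using C1(1) K B by (simp add: C_def)
  show ?thesis
  proof (rule that[OF C])
    fix j :: nat
    define R where "R = (2 ^ j :: real)"
    have R: "1 \<le> R" by (simp add: R_def)
    define l where "l = R powr \<rho>"
    have l: "0 < l" using R by (simp add: l_def)
    have ql: "1 / R \<le> 1 / l"
    proof -
      have "l \<le> R powr 1" unfolding l_def using R \<rho> by (intro powr_mono) auto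
      then show ?thesis using R l by (intro divide_left_mono) auto
    qed
    have cont_a: "continuous_on UNIV (\<lambda>z. symbol_deriv a L i k z)" for L i k
      by (rule smooth_continuous[OF smooth_symbol_deriv[OF sm]])
    have cont_p: "continuous_on UNIV (\<lambda>z :: (real^'n) \<times> (real^'n). complex_of_real (freq_piece \<phi> j i k (snd z)))" for i k
    proof -
      have "continuous_on UNIV (\<lambda>z :: (real^'n) \<times> (real^'n). freq_cutoff \<phi> j i k (snd z))" for j
        by (rule continuous_on_compose2[OF continuous_freq_cutoff[OF \<phi>]]) (auto intro!: continuous_intros)
      then show ?thesis unfolding freq_piece_def by (cases "j = 0") (auto intro!: continuous_intros)
    qed
    show "amplitude (symbol_piece a \<phi> j) (C * (2 ^ j) powr m) (2 ^ j) ((2 ^ j) powr \<rho>)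
     (\<lambda>x \<xi>. a (x, \<xi>) * of_real (freq_piece \<phi> j undefined 0 \<xi>))"
      unfolding R_def[symmetric] l_def[symmetric]
    proof
      show "0 < C * R powr m" using C R by simp
      show "1 \<le> R" "0 < l" using R l by auto
      fix L :: "'n list" and i :: 'n and k :: nat
      show "continuous_on UNIV (\<lambda>(x, \<xi>). symbol_piece a \<phi> j L i k x \<xi>)"
        unfolding symbol_piece_def case_prod_unfold
        using cont_a cont_p by (intro leibniz_continuous) auto
      fix \<xi> x :: "real^'n"
      show "symbol_piece a \<phi> j L i k x \<xi> = 0" if "\<xi> \<notin> cube 0 (2 * R)"
        using that freq_piece_eq_0[OF \<phi>N, of \<xi> j] by (simp add: symbol_piece_def R_def)
      show "((\<lambda>t. symbol_piece a \<phi> j [] i k x (\<xi> + t *\<^sub>R axis i 1)) has_vector_derivative symbol_piece a \<phi> j [] i (Suc k) x (\<xi> + t *\<^sub>R axis i 1)) (at t)"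
        if "k < 2 * CARD('n)" for t
      proof -
        have d: "((\<lambda>t. complex_of_real (freq_piece \<phi> j i q (\<xi> + t *\<^sub>R axis i 1))) has_vector_derivative complex_of_real (freq_piece \<phi> j i (Suc q) (\<xi> + t *\<^sub>R axis i 1))) (at t)"
          if "q \<le> k" for q
        proof (rule has_vector_derivative_of_real)
          have "q < N" using that \<open>k < 2 * CARD('n)\<close> by (simp add: N_def n_def)
          then show "((\<lambda>t. freq_piece \<phi> j i q (\<xi> + t *\<^sub>R axis i 1)) has_real_derivative freq_piece \<phi> j i (Suc q) (\<xi> + t *\<^sub>R axis i 1)) (at t)"
            by (rule freq_piece_derivative[OF \<phi>N])
        qed
        show ?thesis unfolding symbol_piece_def leibniz.simps
          by (rule leibniz_derivative[where F="\<lambda>q t. symbol_deriv a [] i q (x, \<xi> + t *\<^sub>R axis i 1)"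
                and F'="\<lambda>q t. symbol_deriv a [] i (Suc q) (x, \<xi> + t *\<^sub>R axis i 1)"
                and G="\<lambda>q t. complex_of_real (freq_piece \<phi> j i q (\<xi> + t *\<^sub>R axis i 1))"
                and G'="\<lambda>q t. complex_of_real (freq_piece \<phi> j i (Suc q) (\<xi> + t *\<^sub>R axis i 1))"])
            (use symbol_deriv_\<xi>[OF sm] d in auto)
      qed
      show "((\<lambda>t. symbol_piece a \<phi> j L i k (x + t *\<^sub>R axis j' 1) \<xi>) has_vector_derivative symbol_piece a \<phi> j (j' # L) i k (x + t *\<^sub>R axis j' 1) \<xi>) (at t)" for j' t
      proof -
        have "((\<lambda>t. leibniz k (\<lambda>q. symbol_deriv a L i q (x + t *\<^sub>R axis j' 1, \<xi>)) (\<lambda>q. of_real (freq_piece \<phi> j i q \<xi>))) has_vector_derivative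
          leibniz k (\<lambda>q. symbol_deriv a (j' # L) i q (x + t *\<^sub>R axis j' 1, \<xi>)) (\<lambda>q. of_real (freq_piece \<phi> j i q \<xi>))
          + leibniz k (\<lambda>q. symbol_deriv a L i q (x + t *\<^sub>R axis j' 1, \<xi>)) (\<lambda>q. 0)) (at t)"
          by (rule leibniz_derivative[where F="\<lambda>q t. symbol_deriv a L i q (x + t *\<^sub>R axis j' 1, \<xi>)"
                and F'="\<lambda>q t. symbol_deriv a (j' # L) i q (x + t *\<^sub>R axis j' 1, \<xi>)"
                and G="\<lambda>q t. complex_of_real (freq_piece \<phi> j i q \<xi>)" and G'="\<lambda>q t. 0"])
            (use symbol_deriv_x[OF sm] in auto)
        then show ?thesis unfolding symbol_piece_def by (simp only: leibniz_zero_right add_0_right)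
      qed
      show "symbol_piece a \<phi> j [] i 0 = (\<lambda>x \<xi>. a (x, \<xi>) * of_real (freq_piece \<phi> j undefined 0 \<xi>))"
        by (simp add: fun_eq_iff symbol_piece_def freq_piece_def freq_cutoff_0)
      show "norm (symbol_piece a \<phi> j L i k x \<xi>) \<le> C * R powr m * l ^ length L / l ^ k" if L: "length L \<le> CARD('n)" and k: "k \<le> 2 * CARD('n)"
      proof (cases "\<xi> \<notin> cube 0 (2 * 2 ^ j) \<or> j \<noteq> 0 \<and> \<xi> \<in> cube 0 (2 ^ (j - 1))")
        case True
        then have "symbol_piece a \<phi> j L i k x \<xi> = 0" using freq_piece_eq_0[OF \<phi>N, of \<xi> j] by (simp add: symbol_piece_def)
        then show ?thesis using C R l by simp
      next
        case False
        have up: "1 + norm \<xi> \<le> (2 * real n + 2) * R"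
        proof -
          have "norm \<xi> \<le> (\<Sum>i\<in>UNIV. \<bar>\<xi> $ i\<bar>)" by (rule norm_le_l1_cart)
          also have "\<dots> \<le> (\<Sum>i\<in>(UNIV::'n set). 2 * R)" using False by (intro sum_mono) (auto simp: cube_def R_def)
          also have "\<dots> = 2 * real n * R" by (simp add: n_def)
          finally show ?thesis using R by (simp add: algebra_simps)
        qed
        \<comment> \<open>For j = 0 no frequencies are removed near the origin, but there R = 1 and
          the bound is trivial.\<close>
        have low: "R / 2 \<le> 1 + norm \<xi>"
        proof (cases "j = 0")
          case True
          then have "R / 2 \<le> 1" by (simp add: R_def)
          then show ?thesis using norm_ge_zero[of \<xi>] by linarith
        next
          case j: False
          then have "\<xi> \<notin> cube 0 (2 ^ (j - 1))" using False by simp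
          then obtain i where "2 ^ (j - 1) < \<bar>\<xi> $ i\<bar>" by (auto simp: cube_def not_le)
          also have "\<dots> \<le> norm \<xi>" by (rule component_le_norm_cart)
          also have "(2::real) ^ (j - 1) = R / 2" using j by (cases j) (auto simp: R_def)
          finally show ?thesis by simp
        qed
        define s where "s = (1 + norm \<xi>) / R"
        have s: "0 < s" "s \<le> 2 * real n + 2" "1 / s \<le> 2 * real n + 2" "1 + norm \<xi> = s * R"
        proof -
          show "0 < s" using R norm_ge_zero[of \<xi>] by (simp add: s_def add_pos_nonneg)
          show "s \<le> 2 * real n + 2" using up R by (simp add: s_def pos_divide_le_eq)
          show "1 + norm \<xi> = s * R" using R by (simp add: s_def)
          have "1 / 2 \<le> s" using low R by (simp add: s_def pos_le_divide_eq)
          then have "1 / s \<le> 1 / (1 / 2)" using \<open>0 < s\<close> by (intro divide_left_mono) auto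
          then show "1 / s \<le> 2 * real n + 2" by simp
        qed
        have "norm (symbol_piece a \<phi> j L i k x \<xi>) \<le> 2 ^ k * (C1 * K * R powr m * l ^ length L) * B * (1 / l) ^ k"
          unfolding symbol_piece_def
        proof (rule leibniz_bound)
          fix q assume q: "q \<le> k"
          have qN: "q \<le> N" using q k by (simp add: N_def n_def)
          define e where "e = m - \<rho> * real q + \<delta> * real (length L)"
          have b1: "norm (symbol_deriv a L i q (x, \<xi>)) \<le> C1 * (1 + norm \<xi>) powr e"
            unfolding e_def using L qN by (intro C1) (auto simp: n_def)
          have b2: "(1 + norm \<xi>) powr e = s powr e * R powr e" unfolding s(4) by (rule powr_mult)
          have b3: "s powr e \<le> K"
            unfolding K_def
          proof (rule powr_between[OF s(1,2,3)])
            have "\<rho> * real q \<le> 1 * real N" using \<rho> qN by (intro mult_mono) auto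
            moreover have "\<delta> * real (length L) \<le> 1 * real n" using \<rho> L by (intro mult_mono) (auto simp: n_def)
            moreover have "0 \<le> \<rho> * real q" "0 \<le> \<delta> * real (length L)" using \<rho> by auto
            ultimately show "\<bar>e\<bar> \<le> E" unfolding e_def E_def by linarith
          qed
          have b4: "R powr e \<le> R powr m * l ^ length L * (1 / l) ^ q"
          proof -
            \<comment> \<open>The exponent \<delta> of each x-derivative is enlarged to \<rho>,
              which is possible because R is at least 1.\<close>
            have "R powr e \<le> R powr (m + \<rho> * real (length L) + - (\<rho> * real q))"
              unfolding e_def using R \<rho> by (intro powr_mono) (auto simp: mult_right_mono)
            also have "\<dots> = R powr m * R powr (\<rho> * real (length L)) * R powr (- (\<rho> * real q))"
              by (simp only: powr_add)
            also have "R powr (\<rho> * real (length L)) = l ^ length L"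
              using l by (simp only: powr_powr[symmetric] l_def[symmetric] powr_realpow)
            also have "R powr (- (\<rho> * real q)) = (1 / l) ^ q"
              using l by (simp only: powr_minus_divide powr_powr[symmetric] l_def[symmetric] powr_realpow power_one_over)
            finally show ?thesis .
          qed
          have "s powr e * R powr e \<le> K * (R powr m * l ^ length L * (1 / l) ^ q)"
            using b3 b4 K by (intro mult_mono) auto
          then have "C1 * (s powr e * R powr e) \<le> C1 * (K * (R powr m * l ^ length L * (1 / l) ^ q))"
            using C1(1) by (intro mult_left_mono) auto
          with b1 b2 show "norm (symbol_deriv a L i q (x, \<xi>)) \<le> C1 * K * R powr m * l ^ length L * (1 / l) ^ q"
            by (simp only: mult.assoc)
        next
          fix q assume q: "q \<le> k"
          have qN: "q \<le> N" using q k by (simp add: N_def n_def)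
          have "norm (complex_of_real (freq_piece \<phi> j i q \<xi>)) \<le> B * (1 / R) ^ q"
            using freq_piece_bound[OF \<phi>N M qN, of j i \<xi>] by (simp add: B_def n_def R_def)
          also have "\<dots> \<le> B * (1 / l) ^ q" using B R ql by (intro mult_left_mono power_mono) auto
          finally show "norm (complex_of_real (freq_piece \<phi> j i q \<xi>)) \<le> B * (1 / l) ^ q" .
        qed (use C1(1) K R l in auto)
        also have "\<dots> \<le> 2 ^ N * (C1 * K * R powr m * l ^ length L) * B * (1 / l) ^ k"
          using C1(1) K R l B k by (intro mult_right_mono power_increasing) (auto simp: N_def n_def)
        also have "\<dots> = C * R powr m * l ^ length L / l ^ k" by (simp only: C_def power_one_over power_inverse mult_ac divide_inverse mult_1_left)
        finally show ?thesis .
      qed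
    qed
  qed
qed

section \<open>Schwartz functions\<close>

lemma axis_Basis: "(axis i 1 :: real^'n::finite) \<in> Basis"
  by (auto simp: Basis_vec_def)

lemma schwartz_derivative_bound:
  fixes f :: "real^'n::finite \<Rightarrow> complex"
  assumes f: "f \<in> schwartz"
  shows "\<exists>C. \<forall>x. norm (foldr (\<lambda>i. partial (axis i 1)) xs f x) \<le> C / growth x"
proof -
  define F where "F = multi_deriv (\<lambda>i. axis i 1) (count_list xs) f"
  have F: "F = foldr (\<lambda>i. partial (axis i 1)) xs f"
    unfolding F_def by (rule multi_deriv_count_list[OF _ axis_Basis]) (use f in \<open>simp add: schwartz_def\<close>)
  have b: "bounded (range (\<lambda>x. (\<Prod>i\<in>UNIV. (x $ i) ^ \<alpha> i) *\<^sub>R F x))" for \<alpha> :: "'n \<Rightarrow> nat"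
    using f by (simp add: schwartz_def F_def)
  have "\<exists>C. \<forall>x. norm (F x) \<le> C" using b[of "\<lambda>_. 0"] by (auto simp: bounded_iff)
  then obtain C0 where C0: "\<And>x. norm (F x) \<le> C0" by blast
  have "\<exists>C. \<forall>x. (x $ i) ^ (2 * CARD('n)) * norm (F x) \<le> C" for i
  proof -
    obtain C where C: "\<And>x. norm ((\<Prod>l\<in>UNIV. (x $ l) ^ (if l = i then 2 * CARD('n) else 0)) *\<^sub>R F x) \<le> C"
      using b[of "\<lambda>l. if l = i then 2 * CARD('n) else 0"] by (auto simp: bounded_iff)
    have "(\<Prod>l\<in>UNIV. (x $ l) ^ (if l = i then 2 * CARD('n) else 0)) = (x $ i) ^ (2 * CARD('n))" for x :: "real^'n"
    proof -
      have "(\<Prod>l\<in>UNIV. (x $ l) ^ (if l = i then 2 * CARD('n) else 0)) = (\<Prod>l\<in>UNIV. if l = i then (x $ l) ^ (2 * CARD('n)) else 1)"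
        by (intro prod.cong) auto
      then show ?thesis by simp
    qed
    then show ?thesis using C by (auto simp: abs_mult power_even_abs intro!: exI[of _ C])
  qed
  then obtain C where C: "\<And>i x. (x $ i) ^ (2 * CARD('n)) * norm (F x) \<le> C i" by metis
  have "norm (F x) \<le> (C0 + (\<Sum>i\<in>UNIV. C i)) / growth x" for x
  proof -
    have "norm (F x) * growth x = norm (F x) + (\<Sum>i\<in>UNIV. (x $ i) ^ (2 * CARD('n)) * norm (F x))"
      by (simp add: growth_def distrib_left sum_distrib_left mult.commute)
    also have "\<dots> \<le> C0 + (\<Sum>i\<in>UNIV. C i)" by (intro add_mono sum_mono C C0)
    finally show ?thesis by (simp add: pos_le_divide_eq growth_pos)
  qed
  then show ?thesis unfolding F by blast
qed

lemma fourier_eq_FT: "fourier f \<xi> = of_real (1 / (2 * pi) ^ CARD('n)) * FT f (- \<xi> :: real^'n::finite)"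
  by (simp add: fourier_def FT_def inner_commute)

lemma integrable_schwartz: "f \<in> schwartz \<Longrightarrow> integrable lborel (f :: real^'n::finite \<Rightarrow> complex)"
  using schwartz_derivative_bound[of f "[]"] smooth_continuous[of f]
  by (auto simp: schwartz_def intro!: integrable_growth_bound borel_measurable_continuous_onI)

text \<open>Integrating by parts 2 n times in each variable bounds every summand of
  \<open>growth\<close> times the transform.\<close>

lemma FT_schwartz_bound:
  fixes f :: "real^'n::finite \<Rightarrow> complex"
  assumes f: "f \<in> schwartz"
  shows "\<exists>C. \<forall>u. norm (FT f u) \<le> C / growth u"
proof -
  have sm: "smooth f" using f by (simp add: schwartz_def)
  have "\<exists>C. \<forall>u. (u $ i) ^ (2 * CARD('n)) * norm (FT f u) \<le> C" for i
  proof -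
    define F where "F k = foldr (\<lambda>i. partial (axis i 1)) (replicate k i) f" for k
    have smF: "smooth (F k)" for k unfolding F_def by (rule smooth_foldr_partial[OF sm axis_Basis])
    have FS: "F (Suc k) = partial (axis i 1) (F k)" for k unfolding F_def by (simp only: replicate_Suc foldr.simps o_apply)
    have "FT (F (2 * CARD('n))) u = (- \<i> * of_real (u $ i)) ^ (2 * CARD('n)) * FT (F 0) u" for u
    proof (rule FT_derivative_chain[where F=F and N="2 * CARD('n)" and k="2 * CARD('n)"])
      show "((\<lambda>t. F k (x + t *\<^sub>R axis i 1)) has_vector_derivative F (Suc k) (x + t *\<^sub>R axis i 1)) (at t)" for k x t
        unfolding FS by (rule has_vector_derivative_partial[OF smF])
      show "\<exists>C. \<forall>x. norm (F k x) \<le> C / growth x" for k unfolding F_def by (rule schwartz_derivative_bound[OF f])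
    qed (simp_all add: smooth_continuous[OF smF])
    then have "(u $ i) ^ (2 * CARD('n)) * norm (FT f u) = norm (FT (F (2 * CARD('n))) u)" for u
      by (simp add: norm_mult norm_power power_even_abs F_def)
    then show ?thesis using norm_FT_le[of "F (2 * CARD('n))"] by auto
  qed
  then obtain C where C: "\<And>i u. (u $ i) ^ (2 * CARD('n)) * norm (FT f u) \<le> C i" by metis
  have "norm (FT f u) \<le> ((LINT \<xi>|lborel. norm (f \<xi>)) + (\<Sum>i\<in>UNIV. C i)) / growth u" for u
  proof -
    have "norm (FT f u) * growth u = norm (FT f u) + (\<Sum>i\<in>UNIV. (u $ i) ^ (2 * CARD('n)) * norm (FT f u))"
      by (simp add: growth_def distrib_left sum_distrib_left mult.commute)
    also have "\<dots> \<le> (LINT \<xi>|lborel. norm (f \<xi>)) + (\<Sum>i\<in>UNIV. C i)" by (intro add_mono sum_mono C norm_FT_le)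
    finally show ?thesis by (simp add: pos_le_divide_eq growth_pos)
  qed
  then show ?thesis by blast
qed

lemma integrable_fourier:
  fixes f :: "real^'n::finite \<Rightarrow> complex"
  assumes f: "f \<in> schwartz"
  shows "integrable lborel (fourier f)"
proof -
  have [measurable]: "f \<in> borel_measurable borel"
    using f smooth_continuous[of f] by (auto simp: schwartz_def intro: borel_measurable_continuous_onI)
  obtain C where C: "\<And>u. norm (FT f u) \<le> C / growth u" using FT_schwartz_bound[OF f] by blast
  have "(\<lambda>u. FT f (- u)) \<in> borel_measurable borel" by measurable
  then have "integrable lborel (\<lambda>u. FT f (- u))"
    using C[of "- _"] by (intro integrable_growth_bound) (auto simp del: growth_def)
  then show ?thesis unfolding fourier_eq_FT by (rule integrable_mult_right)
qed

context amplitude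
begin

text \<open>Fubini's theorem relates the kernel form to the symbol form; the factor (2 pi)^n undoes
  the normalisation of \<open>fourier\<close>.\<close>

lemma T_schwartz:
  assumes f: "f \<in> schwartz"
  shows "T f x = (2 * pi) ^ CARD('n) * (LINT \<xi>|lborel. iexp (x \<bullet> \<xi>) * b x \<xi> * fourier f \<xi>)"
proof -
  have [measurable]: "f \<in> borel_measurable borel"
    using f smooth_continuous[of f] by (auto simp: schwartz_def intro: borel_measurable_continuous_onI)
  have ib: "integrable lborel (b x)" using integrable_D[of 0 undefined x] by (simp add: base)
  then have [measurable]: "b x \<in> borel_measurable borel" by auto
  define G where "G = (\<lambda>y \<xi>. iexp ((x - y) \<bullet> \<xi>) * b x \<xi> * f y)"
  have "T f x = (LINT y|lborel. LINT \<xi>|lborel. G y \<xi>)"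
    by (simp only: T_def FT_def G_def integral_mult_left_zero)
  also have "\<dots> = (LINT \<xi>|lborel. LINT y|lborel. G y \<xi>)"
  proof (rule Fubini_swap_bound)
    show "(\<lambda>(y, \<xi>). G y \<xi>) \<in> borel_measurable (lborel \<Otimes>\<^sub>M lborel)" unfolding G_def by measurable
    show "integrable lborel (\<lambda>y. norm (f y))" using integrable_schwartz[OF f] by simp
    show "integrable lborel (\<lambda>\<xi>. norm (b x \<xi>))" using ib by simp
    show "norm (G y \<xi>) \<le> norm (f y) * norm (b x \<xi>)" for y \<xi> by (simp add: G_def norm_mult)
  qed
  also have "\<dots> = (LINT \<xi>|lborel. (2 * pi) ^ CARD('n) * (iexp (x \<bullet> \<xi>) * b x \<xi> * fourier f \<xi>))"
  proof (rule Bochner_Integration.integral_cong[OF refl])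
    fix \<xi> :: "real^'n"
    have "G y \<xi> = (iexp (x \<bullet> \<xi>) * b x \<xi>) * (exp (- \<i> * of_real (y \<bullet> \<xi>)) * f y)" for y
      by (simp add: G_def inner_diff_left exp_diff exp_minus divide_inverse ring_distribs algebra_simps)
    then have "(LINT y|lborel. G y \<xi>) = (iexp (x \<bullet> \<xi>) * b x \<xi>) * (LINT y|lborel. exp (- \<i> * of_real (y \<bullet> \<xi>)) * f y)"
      by (simp only: integral_mult_right_zero)
    then show "(LINT y|lborel. G y \<xi>) = (2 * pi) ^ CARD('n) * (iexp (x \<bullet> \<xi>) * b x \<xi> * fourier f \<xi>)"
      by (simp add: fourier_def)
  qed
  also have "\<dots> = (2 * pi) ^ CARD('n) * (LINT \<xi>|lborel. iexp (x \<bullet> \<xi>) * b x \<xi> * fourier f \<xi>)"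
    by (simp only: integral_mult_right_zero)
  finally show ?thesis .
qed

lemma integrable_b_fourier:
  assumes f: "f \<in> schwartz"
  shows "integrable lborel (\<lambda>\<xi>. iexp (x \<bullet> \<xi>) * b x \<xi> * fourier f \<xi>)"
proof (rule Bochner_Integration.integrable_bound)
  have ib: "integrable lborel (b x)" using integrable_D[of 0 undefined x] by (simp add: base)
  then have [measurable]: "b x \<in> borel_measurable borel" by auto
  have [measurable]: "fourier f \<in> borel_measurable borel" using borel_measurable_integrable[OF integrable_fourier[OF f]] by simp
  show "integrable lborel (\<lambda>\<xi>. A * fourier f \<xi>)" using integrable_fourier[OF f] by simp
  show "(\<lambda>\<xi>. iexp (x \<bullet> \<xi>) * b x \<xi> * fourier f \<xi>) \<in> borel_measurable lborel" by measurable
  have "norm (b x \<xi>) \<le> A" for \<xi> using bound[of "[]" 0 undefined x \<xi>] by (simp add: base)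
  then show "AE \<xi> in lborel. norm (iexp (x \<bullet> \<xi>) * b x \<xi> * fourier f \<xi>) \<le> norm (A * fourier f \<xi>)"
    using A by (auto simp: norm_mult intro!: mult_right_mono)
qed

end

definition freq_symbol ::
    "((real^'n::finite) \<times> (real^'n) \<Rightarrow> complex) \<Rightarrow> (nat \<Rightarrow> real \<Rightarrow> real) \<Rightarrow> nat \<Rightarrow> real^'n \<Rightarrow> real^'n \<Rightarrow> complex"
  where "freq_symbol a \<phi> j = (\<lambda>x \<xi>. a (x, \<xi>) * of_real (freq_piece \<phi> j undefined 0 \<xi>))"

text \<open>The partial sums telescope to the symbol times a cut-off that equals 1 near any fixed
  \<xi> from some index on. As m \<le> 0 the symbol is bounded, so the integrable
  \<open>fourier f\<close> dominates.\<close>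

lemma sum_pieces_tendsto_pseudo_diff:
  fixes a :: "(real^'n::finite) \<times> (real^'n) \<Rightarrow> complex"
  assumes a: "a \<in> symbol_class m \<rho> \<delta>" and m: "m \<le> 0" and \<phi>: "cutoff N 1 2 \<phi>" and N: "0 < N"
    and am: "\<And>j. \<exists>D A R l. amplitude D A R l (freq_symbol a \<phi> j)" and f: "f \<in> schwartz"
  shows "(\<lambda>J. \<Sum>j\<le>J. of_real (1 / (2 * pi) ^ CARD('n)) * amplitude.T (freq_symbol a \<phi> j) f x) \<longlonglongrightarrow> pseudo_diff a f x"
proof -
  obtain C where C0: "0 < C" and C: "\<And>L i k x \<xi>. length L \<le> 0 \<Longrightarrow> k \<le> 0 \<Longrightarrow>
      norm (symbol_deriv a L i k (x, \<xi>)) \<le> C * (1 + norm \<xi>) powr (m - \<rho> * real k + \<delta> * real (length L))"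
    using symbol_deriv_bound_uniform[OF a, of 0 0] by blast
  have aC: "norm (a (x, \<xi>)) \<le> C" for \<xi>
  proof -
    have "norm (a (x, \<xi>)) \<le> C * (1 + norm \<xi>) powr m" using C[of "[]" 0 undefined x \<xi>] by simp
    also have "(1 + norm \<xi>) powr m \<le> (1 + norm \<xi>) powr 0" using m by (intro powr_mono) auto
    finally show ?thesis using C0 by (simp split: if_splits)
  qed
  have sm: "smooth a" using a by (simp add: symbol_class_def)
  obtain M where M: "1 \<le> M" "\<And>k t. k \<le> N \<Longrightarrow> \<bar>\<phi> k t\<bar> \<le> M" using cutoff_bounded[OF \<phi>] by blast
  have [measurable]: "fourier f \<in> borel_measurable borel" using borel_measurable_integrable[OF integrable_fourier[OF f]] by simp
  define g where "g = (\<lambda>J \<xi>. iexp (x \<bullet> \<xi>) * (a (x, \<xi>) * of_real (freq_cutoff \<phi> J undefined 0 \<xi>)) * fourier f \<xi>)"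
  have cont_a: "continuous_on UNIV (\<lambda>\<xi>. a (x, \<xi>))"
    by (rule continuous_on_compose2[OF smooth_continuous[OF sm]]) (auto intro!: continuous_intros)
  have [measurable]: "(\<lambda>\<xi>. a (x, \<xi>)) \<in> borel_measurable borel" by (rule borel_measurable_continuous_onI[OF cont_a])
  have [measurable]: "freq_cutoff \<phi> J i k \<in> borel_measurable borel" for J and i :: 'n and k
    by (rule borel_measurable_continuous_onI[OF continuous_freq_cutoff[OF \<phi>]])
  have "(\<lambda>J. LINT \<xi>|lborel. g J \<xi>) \<longlonglongrightarrow> (LINT \<xi>|lborel. iexp (x \<bullet> \<xi>) * a (x, \<xi>) * fourier f \<xi>)"
  proof (rule integral_dominated_convergence)
    show "integrable lborel (\<lambda>\<xi>. C * M ^ CARD('n) * norm (fourier f \<xi>))" using integrable_fourier[OF f] by simp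
    show "(\<lambda>\<xi>. iexp (x \<bullet> \<xi>) * a (x, \<xi>) * fourier f \<xi>) \<in> borel_measurable lborel" by measurable
    show "g J \<in> borel_measurable lborel" for J unfolding g_def by measurable
    show "AE \<xi> in lborel. (\<lambda>J. g J \<xi>) \<longlonglongrightarrow> iexp (x \<bullet> \<xi>) * a (x, \<xi>) * fourier f \<xi>"
    proof (rule AE_I2)
      fix \<xi> :: "real^'n"
      obtain J0 where J0: "norm \<xi> < 2 ^ J0" using real_arch_pow[of 2 "norm \<xi>"] by auto
      have "g J \<xi> = iexp (x \<bullet> \<xi>) * a (x, \<xi>) * fourier f \<xi>" if "J0 \<le> J" for J
      proof -
        have "\<bar>\<xi> $ i\<bar> \<le> 2 ^ J" for i
          using component_le_norm_cart[of \<xi> i] J0 power_increasing[OF that, of "2::real"] by linarith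
        then have "\<xi> \<in> cube 0 (2 ^ J)" by (simp add: cube_def)
        then show ?thesis using freq_cutoff_inner[OF \<phi>, of \<xi> J undefined 0] by (simp add: g_def)
      qed
      then show "(\<lambda>J. g J \<xi>) \<longlonglongrightarrow> iexp (x \<bullet> \<xi>) * a (x, \<xi>) * fourier f \<xi>"
        by (intro tendsto_eventually eventually_sequentiallyI[of J0])
    qed
    show "AE \<xi> in lborel. norm (g J \<xi>) \<le> C * M ^ CARD('n) * norm (fourier f \<xi>)" for J
    proof (rule AE_I2)
      fix \<xi> :: "real^'n"
      have "\<bar>freq_cutoff \<phi> J undefined 0 \<xi>\<bar> \<le> (\<Prod>l\<in>(UNIV::'n set). M)"
        unfolding freq_cutoff_0 abs_prod using M(2)[of 0] by (intro prod_mono) auto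
      then have "norm (a (x, \<xi>)) * \<bar>freq_cutoff \<phi> J undefined 0 \<xi>\<bar> \<le> C * M ^ CARD('n)"
        using aC C0 by (intro mult_mono) auto
      then show "norm (g J \<xi>) \<le> C * M ^ CARD('n) * norm (fourier f \<xi>)"
        by (simp add: g_def norm_mult mult_right_mono)
    qed
  qed
  moreover have "(\<Sum>j\<le>J. of_real (1 / (2 * pi) ^ CARD('n)) * amplitude.T (freq_symbol a \<phi> j) f x) = (LINT \<xi>|lborel. g J \<xi>)" for J
  proof -
    have i: "integrable lborel (\<lambda>\<xi>. iexp (x \<bullet> \<xi>) * freq_symbol a \<phi> j x \<xi> * fourier f \<xi>)"
      and T: "amplitude.T (freq_symbol a \<phi> j) f x = (2 * pi) ^ CARD('n) * (LINT \<xi>|lborel. iexp (x \<bullet> \<xi>) * freq_symbol a \<phi> j x \<xi> * fourier f \<xi>)" for j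
      using am[of j] amplitude.T_schwartz[OF _ f] amplitude.integrable_b_fourier[OF _ f] by blast+
    have "(\<Sum>j\<le>J. of_real (1 / (2 * pi) ^ CARD('n)) * amplitude.T (freq_symbol a \<phi> j) f x)
        = (\<Sum>j\<le>J. LINT \<xi>|lborel. iexp (x \<bullet> \<xi>) * freq_symbol a \<phi> j x \<xi> * fourier f \<xi>)"
      unfolding T by (intro sum.cong refl) simp
    also have "\<dots> = (LINT \<xi>|lborel. (\<Sum>j\<le>J. iexp (x \<bullet> \<xi>) * freq_symbol a \<phi> j x \<xi> * fourier f \<xi>))"
      by (rule Bochner_Integration.integral_sum[symmetric]) (rule i)
    also have "\<dots> = (LINT \<xi>|lborel. g J \<xi>)"
      by (simp add: g_def freq_symbol_def sum_freq_piece[symmetric] sum_distrib_left sum_distrib_right)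
    finally show ?thesis .
  qed
  ultimately show ?thesis by (simp add: pseudo_diff_def)
qed

section \<open>Summation of the pieces\<close>

text \<open>Extracting the geometric factor \<open>\<theta> powr (1 / p)\<close> to the power k from
  the k-th term leaves functions bounded uniformly in L^p; Jensen's inequality with the geometric
  weights sums them.\<close>

lemma series_Lp_bound:
  fixes y :: "nat \<Rightarrow> 'a \<Rightarrow> ennreal" and \<theta> K p :: real
  assumes p: "1 < p" and \<theta>: "0 < \<theta>" "\<theta> < 1" and K: "0 \<le> K"
    and [measurable]: "\<And>k. y k \<in> borel_measurable M"
    and bd: "\<And>k. (\<integral>\<^sup>+x. epowr (y k x) p \<partial>M) \<le> ennreal (K * \<theta> ^ k) * B"
  defines "S \<equiv> (\<Sum>k. (\<theta> powr (1 / p)) ^ k)"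
  shows "(\<integral>\<^sup>+x. epowr (\<Sum>k. y k x) p \<partial>M) \<le> ennreal (S powr (p - 1) * (K * S)) * B"
proof -
  define \<eta> where "\<eta> = \<theta> powr (1 / p)"
  have \<eta>: "0 < \<eta>" "\<eta> < 1"
    using \<theta> p powr_less_mono2[of "1 / p" \<theta> 1] by (auto simp: \<eta>_def)
  have sm: "summable (\<lambda>k. \<eta> ^ k)" using \<eta> by (simp add: summable_geometric)
  have S: "S = (\<Sum>k. \<eta> ^ k)" by (simp add: S_def \<eta>_def)
  have \<eta>p: "(1 / \<eta> ^ k) powr p = 1 / \<theta> ^ k" for k
  proof -
    have "(\<eta> ^ k) powr p = (\<eta> powr p) ^ k" using \<eta> by (simp add: powr_realpow[symmetric] powr_powr mult.commute)
    also have "\<eta> powr p = \<theta>" using \<theta> p by (simp add: \<eta>_def powr_powr)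
    finally show ?thesis using \<eta> by (simp add: powr_divide)
  qed
  define z where "z k x = ennreal (1 / \<eta> ^ k) * y k x" for k x
  have [measurable]: "z k \<in> borel_measurable M" for k unfolding z_def by measurable
  have yz: "y k x = ennreal (\<eta> ^ k) * z k x" for k x
    unfolding z_def mult.assoc[symmetric] using \<eta> by (subst ennreal_mult[symmetric]) auto
  have bz: "(\<integral>\<^sup>+x. epowr (z k x) p \<partial>M) \<le> ennreal K * B" for k
  proof -
    have "(\<integral>\<^sup>+x. epowr (z k x) p \<partial>M) = (\<integral>\<^sup>+x. ennreal (1 / \<theta> ^ k) * epowr (y k x) p \<partial>M)"
      using p \<eta> by (simp add: z_def epowr_mult epowr_ennreal \<eta>p)
    also have "\<dots> = ennreal (1 / \<theta> ^ k) * (\<integral>\<^sup>+x. epowr (y k x) p \<partial>M)" by (rule nn_integral_cmult) measurable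
    also have "\<dots> \<le> ennreal (1 / \<theta> ^ k) * (ennreal (K * \<theta> ^ k) * B)" by (rule mult_left_mono[OF bd]) simp
    also have "\<dots> = ennreal (1 / \<theta> ^ k * (K * \<theta> ^ k)) * B"
      using \<theta> K by (subst ennreal_mult) (auto simp: mult.assoc)
    also have "1 / \<theta> ^ k * (K * \<theta> ^ k) = K" using \<theta> by simp
    finally show ?thesis .
  qed
  have "(\<integral>\<^sup>+x. epowr (\<Sum>k. y k x) p \<partial>M) \<le> (\<integral>\<^sup>+x. ennreal (S powr (p - 1)) * (\<Sum>k. ennreal (\<eta> ^ k) * epowr (z k x) p) \<partial>M)"
    unfolding yz S using \<eta> by (intro nn_integral_mono epowr_suminf_le p sm) auto
  also have "\<dots> = ennreal (S powr (p - 1)) * (\<integral>\<^sup>+x. (\<Sum>k. ennreal (\<eta> ^ k) * epowr (z k x) p) \<partial>M)"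
    by (rule nn_integral_cmult) measurable
  also have "(\<integral>\<^sup>+x. (\<Sum>k. ennreal (\<eta> ^ k) * epowr (z k x) p) \<partial>M) = (\<Sum>k. \<integral>\<^sup>+x. ennreal (\<eta> ^ k) * epowr (z k x) p \<partial>M)"
    by (rule nn_integral_suminf) measurable
  also have "\<dots> = (\<Sum>k. ennreal (\<eta> ^ k) * (\<integral>\<^sup>+x. epowr (z k x) p \<partial>M))"
    by (intro suminf_cong nn_integral_cmult) measurable
  also have "\<dots> \<le> (\<Sum>k. ennreal (\<eta> ^ k) * (ennreal K * B))"
    by (intro suminf_le summableI mult_left_mono bz) auto
  also have "\<dots> = (\<Sum>k. ennreal (\<eta> ^ k)) * (ennreal K * B)" by simp
  also have "(\<Sum>k. ennreal (\<eta> ^ k)) = ennreal S" unfolding S using \<eta> sm by (intro suminf_ennreal2) auto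
  finally have le: "(\<integral>\<^sup>+x. epowr (\<Sum>k. y k x) p \<partial>M) \<le> ennreal (S powr (p - 1)) * (ennreal S * (ennreal K * B))"
    by (simp add: mult_left_mono)
  have S0: "0 \<le> S" unfolding S using \<eta> by (intro suminf_nonneg sm) auto
  have "ennreal (S powr (p - 1) * (K * S)) = ennreal (S powr (p - 1)) * (ennreal K * ennreal S)"
    using S0 K by (simp add: ennreal_mult)
  with le show ?thesis by (simp only: mult_ac)
qed

lemma borel_version_complex:
  fixes f :: "real^'n::finite \<Rightarrow> complex"
  assumes f: "f \<in> borel_measurable lebesgue"
  obtains g where "g \<in> borel_measurable borel" "AE x in lborel. f x = g x"
proof -
  have "(\<lambda>x. Re (f x)) \<in> borel_measurable lebesgue" "(\<lambda>x. Im (f x)) \<in> borel_measurable lebesgue"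
    using f by measurable
  then obtain u v where uv [measurable]: "u \<in> borel_measurable lborel" "v \<in> borel_measurable lborel"
    and eq: "AE x in lborel. Re (f x) = u x" "AE x in lborel. Im (f x) = v x"
    using completion_ex_borel_measurable_real by blast
  from eq have "AE x in lborel. f x = Complex (u x) (v x)" by eventually_elim (simp add: complex_eq_iff)
  moreover have "(\<lambda>x. Complex (u x) (v x)) \<in> borel_measurable borel"
    using uv by (simp add: Complex_eq)
  ultimately show ?thesis by (rule that[rotated])
qed

lemma AE_lebesgue_iff: "(AE x in lebesgue. P x) \<longleftrightarrow> (AE x in lborel. P x)"
  by (rule AE_completion_iff)

text \<open>The extension is the series of the T j applied to a Borel version. The sum of the norms
  lies in L^p, so the series converges absolutely almost everywhere, which transfers bound and
  linearity. For Schwartz functions the pointwise limit \<open>Ts\<close> identifies the sum with P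
  f.\<close>

lemma bounded_on_Lp_series:
  fixes w w' :: "real^'n::finite \<Rightarrow> real" and T :: "nat \<Rightarrow> (real^'n \<Rightarrow> complex) \<Rightarrow> real^'n \<Rightarrow> complex"
    and P :: "(real^'n \<Rightarrow> complex) \<Rightarrow> real^'n \<Rightarrow> complex"
  defines "N p g \<equiv> Lp_int p w' g"
  assumes p: "1 < p" and wm: "w \<in> borel_measurable lebesgue" and w'm [measurable]: "w' \<in> borel_measurable borel" and w': "\<And>x. 0 < w' x" and ww': "AE x in lebesgue. w x = w' x"
    and \<theta>: "0 < \<theta>" "\<theta> < 1" and K: "0 \<le> K"
    and Tm [measurable]: "\<And>j f. f \<in> borel_measurable borel \<Longrightarrow> T j f \<in> borel_measurable borel"
    and Tb: "\<And>j f. f \<in> borel_measurable borel \<Longrightarrow> N p f < \<infinity> \<Longrightarrow> N p (T j f) \<le> ennreal (K * \<theta> ^ j) * N p f"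
    and Tl: "\<And>j f g c d. f \<in> borel_measurable borel \<Longrightarrow> g \<in> borel_measurable borel \<Longrightarrow> N p f < \<infinity> \<Longrightarrow> N p g < \<infinity> \<Longrightarrow>
      AE x in lborel. T j (\<lambda>y. c * f y + d * g y) x = c * T j f x + d * T j g x"
    and Tc: "\<And>j f g. f \<in> borel_measurable borel \<Longrightarrow> g \<in> borel_measurable borel \<Longrightarrow> (AE x in lborel. f x = g x) \<Longrightarrow> T j f = T j g"
    and Ts: "\<And>f x. f \<in> schwartz \<Longrightarrow> (\<lambda>J. \<Sum>j\<le>J. T j f x) \<longlonglongrightarrow> P f x"
  shows "bounded_on_Lp p w P"
proof -
  have wd: "(\<lambda>x. ennreal (w' x)) \<in> borel_measurable lborel" by measurable
  define \<mu> where "\<mu> = density lborel (\<lambda>x. ennreal (w' x))"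
  define C where "C = (let S = (\<Sum>k. (\<theta> powr (1 / p)) ^ k) in S powr (p - 1) * (K * S))"
  have N\<mu>: "N p g = (\<integral>\<^sup>+x. epowr (ennreal (norm (g x))) p \<partial>\<mu>)" if [measurable]: "g \<in> borel_measurable borel" for g
  proof -
    have "(\<integral>\<^sup>+x. epowr (ennreal (norm (g x))) p \<partial>\<mu>) = (\<integral>\<^sup>+x. ennreal (w' x) * epowr (ennreal (norm (g x))) p \<partial>lborel)"
      unfolding \<mu>_def by (rule nn_integral_density) measurable
    also have "\<dots> = N p g" unfolding N_def
      using p w' by (intro nn_integral_cong) (simp add: epowr_ennreal ennreal_mult'' less_imp_le mult.commute)
    finally show ?thesis by simp
  qed
  have sum_bound: "(\<integral>\<^sup>+x. epowr (\<Sum>k. ennreal (norm (T k g x))) p \<partial>\<mu>) \<le> ennreal C * N p g"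
    if g [measurable]: "g \<in> borel_measurable borel" and fin: "N p g < \<infinity>" for g
    unfolding C_def Let_def
  proof (rule series_Lp_bound[OF p \<theta> K])
    show "(\<lambda>x. ennreal (norm (T k g x))) \<in> borel_measurable \<mu>" for k unfolding \<mu>_def by measurable
    show "(\<integral>\<^sup>+x. epowr (ennreal (norm (T k g x))) p \<partial>\<mu>) \<le> ennreal (K * \<theta> ^ k) * N p g" for k
      using N\<mu>[OF Tm[OF g]] Tb[OF g fin] by simp
  qed
  have summ: "AE x in lborel. summable (\<lambda>k. norm (T k g x))"
    if g [measurable]: "g \<in> borel_measurable borel" and fin: "N p g < \<infinity>" for g
  proof -
    have "(\<integral>\<^sup>+x. epowr (\<Sum>k. ennreal (norm (T k g x))) p \<partial>\<mu>) < \<infinity>"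
      by (rule le_less_trans[OF sum_bound[OF g fin]]) (use fin in \<open>simp add: ennreal_mult_less_top\<close>)
    moreover have "(\<lambda>x. epowr (\<Sum>k. ennreal (norm (T k g x))) p) \<in> borel_measurable \<mu>" unfolding \<mu>_def by measurable
    ultimately have "AE x in \<mu>. epowr (\<Sum>k. ennreal (norm (T k g x))) p \<noteq> \<infinity>"
      by (intro nn_integral_PInf_AE) auto
    then have "AE x in lborel. 0 < ennreal (w' x) \<longrightarrow> epowr (\<Sum>k. ennreal (norm (T k g x))) p \<noteq> \<infinity>"
      unfolding \<mu>_def AE_density[OF wd] .
    then show ?thesis
    proof eventually_elim
      case (elim x)
      have "0 < ennreal (w' x)" using w'[of x] by simp
      with elim have ne: "epowr (\<Sum>k. ennreal (norm (T k g x))) p \<noteq> \<infinity>" by (rule mp)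
      have "(\<Sum>k. ennreal (norm (T k g x))) \<noteq> top"
      proof
        assume top: "(\<Sum>k. ennreal (norm (T k g x))) = top"
        have "epowr (\<Sum>k. ennreal (norm (T k g x))) p = top" unfolding top using p by (intro epowr_top) linarith
        with ne show False unfolding infinity_ennreal_def by (rule notE)
      qed
      then show ?case by (rule summable_suminf_not_top[OF norm_ge_zero])
    qed
  qed
  \<comment> \<open>Elements of L^p(w) are Lebesgue measurable only, while the T j are controlled on
    Borel functions; by \<open>Tc\<close> the choice of version is immaterial.\<close>
  define ver where "ver f = (SOME g. g \<in> borel_measurable borel \<and> (AE x in lborel. f x = g x))" for f :: "real^'n \<Rightarrow> complex"
  have ver: "ver f \<in> borel_measurable borel" "AE x in lborel. f x = ver f x" if "f \<in> borel_measurable lebesgue" for f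
  proof -
    have "\<exists>g. g \<in> borel_measurable borel \<and> (AE x in lborel. f x = g x)"
      using borel_version_complex[OF that] by blast
    from someI_ex[OF this] show "ver f \<in> borel_measurable borel" "AE x in lborel. f x = ver f x" by (simp_all add: ver_def)
  qed
  have norm_eq: "Lp_norm p w f = epowr (N p g) (1 / p)"
    if g [measurable]: "g \<in> borel_measurable borel" and fg: "AE x in lborel. f x = g x" for f g
  proof -
    have "AE x in lebesgue. f x = g x" using fg by (simp add: AE_lebesgue_iff)
    with ww' have "AE x in lebesgue. ennreal (norm (f x) powr p * w x) = ennreal (norm (g x) powr p * w' x)"
      by eventually_elim simp
    then show ?thesis unfolding Lp_norm_def N_def by (subst nn_integral_lebesgue_version) auto
  qed
  define S where "S f x = (\<Sum>j. T j (ver f) x)" for f x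
  have verN: "N p (ver f) < \<infinity>" if "f \<in> Lp_space p w" for f
  proof -
    have fm: "f \<in> borel_measurable lebesgue" and "Lp_norm p w f < \<infinity>" using that by (auto simp: Lp_space_def)
    then have "epowr (N p (ver f)) (1 / p) < \<infinity>" using norm_eq[OF ver[OF fm]] by simp
    then show ?thesis using epowr_less_top_iff[of "1 / p" "N p (ver f)"] p by simp
  qed
  have bd: "S f \<in> Lp_space p w \<and> Lp_norm p w (S f) \<le> ennreal (C powr (1 / p)) * Lp_norm p w f" if f: "f \<in> Lp_space p w" for f
  proof -
    have fm: "f \<in> borel_measurable lebesgue" using f by (simp add: Lp_space_def)
    note vm [measurable] = ver(1)[OF fm]
    have [measurable]: "S f \<in> borel_measurable borel" unfolding S_def by measurable
    have C0: "0 \<le> C" unfolding C_def Let_def using K \<theta> p powr_less_mono2[of "1 / p" \<theta> 1]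
      by (intro mult_nonneg_nonneg suminf_nonneg summable_geometric) auto
    have "N p (S f) = (\<integral>\<^sup>+x. epowr (ennreal (norm (S f x))) p \<partial>\<mu>)" by (rule N\<mu>) measurable
    also have "\<dots> \<le> (\<integral>\<^sup>+x. epowr (\<Sum>k. ennreal (norm (T k (ver f) x))) p \<partial>\<mu>)"
    proof (intro nn_integral_mono epowr_mono)
      fix x
      show "ennreal (norm (S f x)) \<le> (\<Sum>k. ennreal (norm (T k (ver f) x)))"
      proof (cases "(\<Sum>k. ennreal (norm (T k (ver f) x))) = top")
        case False
        then have "summable (\<lambda>k. norm (T k (ver f) x))" by (rule summable_suminf_not_top[OF norm_ge_zero])
        then show ?thesis unfolding S_def by (subst suminf_ennreal2) (auto intro!: ennreal_leI summable_norm)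
      qed simp
    qed (use p in auto)
    also have "\<dots> \<le> ennreal C * N p (ver f)" by (rule sum_bound[OF vm verN[OF f]])
    finally have le: "N p (S f) \<le> ennreal C * N p (ver f)" .
    have "Lp_norm p w (S f) = epowr (N p (S f)) (1 / p)" by (rule norm_eq) auto
    also have "\<dots> \<le> epowr (ennreal C * N p (ver f)) (1 / p)" using le p by (intro epowr_mono) auto
    also have "\<dots> = ennreal (C powr (1 / p)) * Lp_norm p w f"
      using p C0 norm_eq[OF vm ver(2)[OF fm]] by (simp add: epowr_mult epowr_ennreal)
    finally have le': "Lp_norm p w (S f) \<le> ennreal (C powr (1 / p)) * Lp_norm p w f" .
    moreover have "Lp_norm p w f < \<infinity>" using f by (simp add: Lp_space_def)
    ultimately have "Lp_norm p w (S f) < \<infinity>" by (auto intro: le_less_trans simp: ennreal_mult_less_top)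
    moreover have "S f \<in> borel_measurable lebesgue" by (rule measurable_completion) simp
    ultimately show ?thesis using le' by (simp add: Lp_space_def)
  qed
  have dens: "AE x in density lebesgue (\<lambda>x. ennreal (w x)). Q x" if "AE x in lborel. Q x" for Q
  proof -
    have "(\<lambda>x. ennreal (w x)) \<in> borel_measurable lebesgue" using wm by measurable
    moreover have "AE x in lebesgue. Q x" using that by (simp add: AE_lebesgue_iff)
    ultimately show ?thesis by (auto simp: AE_density elim: eventually_mono)
  qed
  show ?thesis
    unfolding bounded_on_Lp_def
  proof (intro exI[of _ S] conjI ballI allI)
    show "\<exists>C::real. \<forall>f\<in>Lp_space p w. S f \<in> Lp_space p w \<and> Lp_norm p w (S f) \<le> ennreal C * Lp_norm p w f"
      using bd by blast
  next
    fix f g :: "real^'n \<Rightarrow> complex" and c d :: complex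
    assume fg: "f \<in> Lp_space p w" "g \<in> Lp_space p w"
    then have m: "f \<in> borel_measurable lebesgue" "g \<in> borel_measurable lebesgue" by (auto simp: Lp_space_def)
    then have hm: "(\<lambda>y. c * f y + d * g y) \<in> borel_measurable lebesgue" by measurable
    note v = ver[OF m(1)] ver[OF m(2)] ver[OF hm]
    have "AE x in lborel. ver (\<lambda>y. c * f y + d * g y) x = c * ver f x + d * ver g x"
      using v(2,4,6) by eventually_elim simp
    then have Tv: "T j (ver (\<lambda>y. c * f y + d * g y)) = T j (\<lambda>y. c * ver f y + d * ver g y)" for j
      using v by (intro Tc) auto
    have "AE x in lborel. \<forall>j. T j (\<lambda>y. c * ver f y + d * ver g y) x = c * T j (ver f) x + d * T j (ver g) x"
      using v verN[OF fg(1)] verN[OF fg(2)] by (subst AE_all_countable) (intro allI Tl)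
    moreover have "AE x in lborel. summable (\<lambda>k. norm (T k (ver f) x))" "AE x in lborel. summable (\<lambda>k. norm (T k (ver g) x))"
      using summ v verN fg by auto
    ultimately have "AE x in lborel. S (\<lambda>y. c * f y + d * g y) x = c * S f x + d * S g x"
    proof (eventually_elim)
      case (elim x)
      have "summable (\<lambda>k. T k (ver f) x)" "summable (\<lambda>k. T k (ver g) x)" using elim by (auto intro: summable_norm_cancel)
      then show ?case using elim Tv by (simp add: S_def suminf_add[symmetric] suminf_mult summable_mult)
    qed
    then show "AE x in density lebesgue (\<lambda>x. ennreal (w x)). S (\<lambda>y. c * f y + d * g y) x = c * S f x + d * S g x" by (rule dens)
  next
    fix f :: "real^'n \<Rightarrow> complex" assume f: "f \<in> schwartz \<inter> Lp_space p w"
    then have fm: "f \<in> borel_measurable lebesgue" by (simp add: Lp_space_def)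
    have "f \<in> borel_measurable borel"
      using f smooth_continuous[of f] by (auto simp: schwartz_def intro: borel_measurable_continuous_onI)
    moreover have "AE x in lborel. ver f x = f x" using ver(2)[OF fm] by eventually_elim simp
    ultimately have "T j (ver f) = T j f" for j using ver(1)[OF fm] by (intro Tc)
    then have "S f x = P f x" for x
      using Ts[of f x] f by (auto simp: S_def intro!: sums_unique[symmetric] simp: sums_def_le)
    then show "AE x in density lebesgue (\<lambda>x. ennreal (w x)). S f x = P f x" by simp
  qed
qed

lemma norm_integral_le_nn_integral: "ennreal (norm (LINT y|M. g y)) \<le> (\<integral>\<^sup>+y. ennreal (norm (g y :: complex)) \<partial>M)"
  by (cases "integrable M g") (auto intro: integral_norm_bound_ennreal simp: not_integrable_integral_eq)

text \<open>A finite weighted norm of the absolute kernel integral makes that integral finite almost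
  everywhere, as w is positive. Integrability is needed because the Bochner integral is additive
  only on integrable functions.\<close>

lemma AE_integrable_of_weighted:
  fixes k :: "real^'n::finite \<Rightarrow> real^'n \<Rightarrow> complex" and f :: "real^'n \<Rightarrow> complex" and w :: "real^'n \<Rightarrow> real"
  assumes p: "0 < p" and k: "(\<lambda>z. k (fst z) (snd z)) \<in> borel_measurable (lborel \<Otimes>\<^sub>M lborel)"
    and f [measurable]: "f \<in> borel_measurable borel" and [measurable]: "w \<in> borel_measurable borel" and w: "\<And>x. 0 < w x"
    and fin: "eLp_int p w (\<lambda>x. \<integral>\<^sup>+y. ennreal (norm (k x y)) * ennreal (norm (f y)) \<partial>lborel) < \<infinity>"
  shows "AE x in lborel. integrable lborel (\<lambda>y. k x y * f y)"
proof -
  have k' [measurable]: "(\<lambda>z. ennreal (norm (k (fst z) (snd z))) * ennreal (norm (f (snd z)))) \<in> borel_measurable (lborel \<Otimes>\<^sub>M lborel)"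
    using k by measurable
  have [measurable]: "(\<lambda>x. \<integral>\<^sup>+y. ennreal (norm (k x y)) * ennreal (norm (f y)) \<partial>lborel) \<in> borel_measurable lborel"
    using lborel.borel_measurable_nn_integral_fst[OF k'] by simp
  have "AE x in lborel. epowr (\<integral>\<^sup>+y. ennreal (norm (k x y)) * ennreal (norm (f y)) \<partial>lborel) p * ennreal (w x) \<noteq> \<infinity>"
    by (rule nn_integral_PInf_AE) (use fin in \<open>auto simp: less_top\<close>)
  then show ?thesis
  proof eventually_elim
    case (elim x)
    have "(\<integral>\<^sup>+y. ennreal (norm (k x y)) * ennreal (norm (f y)) \<partial>lborel) \<noteq> top"
    proof
      assume top: "(\<integral>\<^sup>+y. ennreal (norm (k x y)) * ennreal (norm (f y)) \<partial>lborel) = top"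
      show False using elim w[of x] unfolding top epowr_top[OF p] by (simp add: ennreal_top_mult)
    qed
    then have "(\<integral>\<^sup>+y. ennreal (norm (k x y * f y)) \<partial>lborel) < \<infinity>"
      by (simp add: norm_mult ennreal_mult less_top)
    moreover have "(\<lambda>y. k x y) \<in> borel_measurable lborel"
      using measurable_compose[OF measurable_Pair1'[of x lborel lborel] k] by simp
    then have "(\<lambda>y. k x y * f y) \<in> borel_measurable lborel" by measurable
    ultimately show ?case by (intro integrableI_bounded)
  qed
qed

lemma two_power_powr: "(2 ^ j) powr e = (2 powr e :: real) ^ j"
  by (simp add: powr_realpow[symmetric] powr_powr mult.commute)

text \<open>Exponents for A = C R^m and l = R^\<rho>: the order m r + n (1 - \<rho>) is negative
  exactly when averages of exponent r give decay.\<close>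

lemma amplitude_power:
  fixes C R m \<rho> r q :: real
  assumes "0 < C" "0 < R"
  shows "((C * R powr m) powr r * (R / R powr \<rho>) ^ n) powr q = C powr (r * q) * R powr (q * (m * r + real n * (1 - \<rho>)))"
proof -
  have "R / R powr \<rho> = R powr (1 - \<rho>)" using assms by (simp add: powr_diff)
  then have "(R / R powr \<rho>) ^ n = R powr (real n * (1 - \<rho>))"
    using assms by (simp add: powr_realpow[symmetric] powr_powr mult.commute)
  then have "(C * R powr m) powr r * (R / R powr \<rho>) ^ n = C powr r * (R powr (m * r) * R powr (real n * (1 - \<rho>)))"
    by (simp add: powr_mult powr_powr)
  also have "\<dots> = C powr r * R powr (m * r + real n * (1 - \<rho>))" by (simp only: powr_add)
  finally have e: "(C * R powr m) powr r * (R / R powr \<rho>) ^ n = C powr r * R powr (m * r + real n * (1 - \<rho>))" .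
  show ?thesis unfolding e by (simp add: powr_mult powr_powr mult.commute)
qed

section \<open>Boundedness from decay of the dyadic pieces\<close>

locale frequency_decomposition =
  fixes a :: "(real^'n::finite) \<times> (real^'n) \<Rightarrow> complex" and m \<rho> \<delta> :: real and \<phi> :: "nat \<Rightarrow> real \<Rightarrow> real" and C :: real
  assumes sym: "a \<in> symbol_class m \<rho> \<delta>" and m: "m \<le> 0" and \<rho>: "\<rho> < 1" and \<phi>: "cutoff (2 * CARD('n)) 1 2 \<phi>" and C: "0 < C"
    and amp: "amplitude (symbol_piece a \<phi> j) (C * (2 ^ j) powr m) (2 ^ j) ((2 ^ j) powr \<rho>) (freq_symbol a \<phi> j)"
begin

abbreviation P :: "nat \<Rightarrow> (real^'n \<Rightarrow> complex) \<Rightarrow> real^'n \<Rightarrow> complex"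
  where "P j \<equiv> amplitude.T (freq_symbol a \<phi> j)"

abbreviation k :: "nat \<Rightarrow> real^'n \<Rightarrow> real^'n \<Rightarrow> complex"
  where "k j x y \<equiv> FT (freq_symbol a \<phi> j x) (x - y)"

lemma P_eq: "P j f x = (LINT y|lborel. k j x y * f y)"
  by (rule amplitude.T_def[OF amp])

lemma k_measurable [measurable]: "(\<lambda>z. k j (fst z) (snd z)) \<in> borel_measurable (lborel \<Otimes>\<^sub>M lborel)"
  by (rule amplitude.FT_b_measurable[OF amp]) measurable

lemma k_measurable2 [measurable]: "(\<lambda>y. k j x y) \<in> borel_measurable borel"
  by (rule amplitude.FT_b_measurable[OF amp]) measurable

lemma P_measurable [measurable]: "f \<in> borel_measurable borel \<Longrightarrow> P j f \<in> borel_measurable borel"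
  by (rule amplitude.T_measurable[OF amp])

text \<open>Restores the factor (2 pi)^(-n), which changes the constant only. Integrability almost
  everywhere is demanded separately, as it is what makes the pieces linear.\<close>

lemma bounded_of_decay:
  fixes w w' :: "real^'n \<Rightarrow> real"
  defines "N p g \<equiv> Lp_int p w' g"
  assumes p: "1 < p" and wm: "w \<in> borel_measurable lebesgue" and w'm [measurable]: "w' \<in> borel_measurable borel"
    and w': "\<And>x. 0 < w' x" and ww': "AE x in lebesgue. w x = w' x"
    and \<theta>: "0 < \<theta>" "\<theta> < 1" and K: "0 \<le> K"
    and bd: "\<And>j f. f \<in> borel_measurable borel \<Longrightarrow> N p f < \<infinity> \<Longrightarrow> N p (P j f) \<le> ennreal (K * \<theta> ^ j) * N p f"
    and int: "\<And>j f. f \<in> borel_measurable borel \<Longrightarrow> N p f < \<infinity> \<Longrightarrow> AE x in lborel. integrable lborel (\<lambda>y. k j x y * f y)"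
  shows "bounded_on_Lp p w (pseudo_diff a)"
proof -
  define c where "c = 1 / (2 * pi) ^ CARD('n)"
  have c: "0 < c" by (simp add: c_def)
  define T where "T j f x = of_real c * P j f x" for j f x
  show ?thesis
  proof (rule bounded_on_Lp_series[where T=T and w'=w', OF p wm w'm w' ww' \<theta>])
    show "0 \<le> c powr p * K" using K by simp
    show "T j f \<in> borel_measurable borel" if [measurable]: "f \<in> borel_measurable borel" for j f
      unfolding T_def by measurable
    show "Lp_int p w' (T j f)
        \<le> ennreal (c powr p * K * \<theta> ^ j) * Lp_int p w' f"
      if f [measurable]: "f \<in> borel_measurable borel" and fin: "Lp_int p w' f < \<infinity>" for j f
    proof -
      have "Lp_int p w' (T j f) = (\<integral>\<^sup>+x. ennreal (c powr p) * ennreal (norm (P j f x) powr p * w' x) \<partial>lborel)"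
        unfolding T_def using c by (simp add: norm_mult powr_mult ennreal_mult'[symmetric] mult.assoc)
      also have "\<dots> = ennreal (c powr p) * N p (P j f)" unfolding N_def by (rule nn_integral_cmult) measurable
      also have "\<dots> \<le> ennreal (c powr p) * (ennreal (K * \<theta> ^ j) * N p f)"
        using fin by (intro mult_left_mono bd f) (simp_all add: N_def)
      also have "\<dots> = ennreal (c powr p * K * \<theta> ^ j) * N p f"
        unfolding mult.assoc[symmetric] by (subst ennreal_mult'[symmetric]) (auto simp: mult.assoc)
      finally show ?thesis by (simp add: N_def)
    qed
    show "AE x in lborel. T j (\<lambda>y. e * f y + d * g y) x = e * T j f x + d * T j g x"
      if fg: "f \<in> borel_measurable borel" "g \<in> borel_measurable borel"
        "Lp_int p w' f < \<infinity>" "Lp_int p w' g < \<infinity>" for j f g e d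
    proof -
      have "AE x in lborel. integrable lborel (\<lambda>y. k j x y * f y)" "AE x in lborel. integrable lborel (\<lambda>y. k j x y * g y)"
        using fg by (auto intro!: int simp: N_def)
      then show ?thesis
      proof eventually_elim
        case (elim x)
        have "(\<lambda>y. k j x y * (e * f y + d * g y)) = (\<lambda>y. e * (k j x y * f y) + d * (k j x y * g y))"
          by (simp add: fun_eq_iff algebra_simps)
        then have "P j (\<lambda>y. e * f y + d * g y) x = (LINT y|lborel. e * (k j x y * f y) + d * (k j x y * g y))"
          by (simp only: P_eq)
        also have "\<dots> = e * P j f x + d * P j g x" using elim by (simp add: P_eq)
        finally show ?case by (simp add: T_def algebra_simps)
      qed
    qed
    show "T j f = T j g" if [measurable]: "f \<in> borel_measurable borel" "g \<in> borel_measurable borel" and fg: "AE x in lborel. f x = g x" for j f g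
    proof
      fix x
      have "(LINT y|lborel. k j x y * f y) = (LINT y|lborel. k j x y * g y)"
      proof (rule integral_cong_AE)
        show "(\<lambda>y. k j x y * f y) \<in> borel_measurable lborel" "(\<lambda>y. k j x y * g y) \<in> borel_measurable lborel"
          using k_measurable2[of j x] that(1,2) by simp_all
        show "AE y in lborel. k j x y * f y = k j x y * g y" using fg by eventually_elim simp
      qed
      then show "T j f x = T j g x" by (simp add: T_def P_eq)
    qed
    show "(\<lambda>J. \<Sum>j\<le>J. T j f x) \<longlonglongrightarrow> pseudo_diff a f x" if "f \<in> schwartz" for f x
      unfolding T_def c_def
      by (rule sum_pieces_tendsto_pseudo_diff[OF sym m \<phi> _ _ that]) (simp, use amp in blast)
  qed
qed

lemma bounded_averages:
  fixes w w' :: "real^'n \<Rightarrow> real"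
  assumes r: "1 < r" "r \<le> 2" "r < p" and wm: "w \<in> borel_measurable lebesgue" and ww': "AE x in lebesgue. w x = w' x"
    and Ap: "cube_Ap (p / r) w'" and dec: "m + real CARD('n) * (1 - \<rho>) / r < 0"
  shows "bounded_on_Lp p w (pseudo_diff a)"
proof -
  have w'm [measurable]: "w' \<in> borel_measurable borel" and w': "\<And>x. 0 < w' x" using Ap by (auto simp: cube_Ap_def)
  obtain C' where C': "0 < C'" and kb: "\<And>D A R l b f. amplitude D A R l b \<Longrightarrow> f \<in> borel_measurable borel \<Longrightarrow>
    eLp_int p w' (\<lambda>x. \<integral>\<^sup>+y. ennreal (norm (FT (b x) (x - y))) * f y \<partial>lborel)
       \<le> ennreal (C' * (A powr r * (R / l) ^ CARD('n)) powr (p / r)) * eLp_int p w' f"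
    using weighted_kernel_bound[OF r(1,2,3) Ap] by blast
  \<comment> \<open>Equals p times m + n (1 - \<rho>) / r, the order of the p-th power of the
    operator norm of the j-th piece.\<close>
  define E where "E = p / r * (m * r + real CARD('n) * (1 - \<rho>))"
  have E: "E < 0"
  proof -
    have "m * r + real CARD('n) * (1 - \<rho>) = r * (m + real CARD('n) * (1 - \<rho>) / r)" using r by (simp add: field_simps)
    also have "\<dots> < 0" using r dec by (intro mult_pos_neg) auto
    finally show ?thesis unfolding E_def using r by (intro mult_pos_neg) auto
  qed
  define K where "K = C' * C powr p"
  have eN: "eLp_int p w' (\<lambda>y. ennreal (norm (f y))) = Lp_int p w' f" for f :: "real^'n \<Rightarrow> complex"
    using r w' by (intro nn_integral_cong) (simp add: epowr_ennreal ennreal_mult'' less_imp_le)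
  have main: "eLp_int p w' (\<lambda>x. \<integral>\<^sup>+y. ennreal (norm (k j x y)) * ennreal (norm (f y)) \<partial>lborel)
       \<le> ennreal (K * (2 powr E) ^ j) * Lp_int p w' f"
    if [measurable]: "f \<in> borel_measurable borel" for j and f :: "real^'n \<Rightarrow> complex"
  proof -
    have "C' * ((C * (2 ^ j) powr m) powr r * (2 ^ j / (2 ^ j) powr \<rho>) ^ CARD('n)) powr (p / r) = K * (2 powr E) ^ j"
      using amplitude_power[OF C, of "2 ^ j" m r \<rho> "CARD('n)" "p / r"] r by (simp add: K_def E_def two_power_powr)
    then show ?thesis using kb[OF amp, of "\<lambda>y. ennreal (norm (f y))" j] unfolding eN by simp
  qed
  show ?thesis
  proof (rule bounded_of_decay[OF _ wm w'm w' ww'])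
    show "0 < 2 powr E" "2 powr E < 1" "1 < p" using E r by (auto simp: powr_less_one)
    show "0 \<le> K" using C' by (simp add: K_def)
    fix j and f :: "real^'n \<Rightarrow> complex" assume f [measurable]: "f \<in> borel_measurable borel"
      and fin: "Lp_int p w' f < \<infinity>"
    have "Lp_int p w' (P j f)
        \<le> eLp_int p w' (\<lambda>x. \<integral>\<^sup>+y. ennreal (norm (k j x y)) * ennreal (norm (f y)) \<partial>lborel)"
      unfolding eN[symmetric]
    proof (intro nn_integral_mono mult_right_mono epowr_mono)
      show "ennreal (norm (P j f x)) \<le> (\<integral>\<^sup>+y. ennreal (norm (k j x y)) * ennreal (norm (f y)) \<partial>lborel)" for x
        using norm_integral_le_nn_integral[of lborel "\<lambda>y. k j x y * f y"] by (simp add: P_eq norm_mult ennreal_mult)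
    qed (use r in auto)
    also note main[OF f]
    finally show "Lp_int p w' (P j f)
        \<le> ennreal (K * (2 powr E) ^ j) * Lp_int p w' f" .
    show "AE x in lborel. integrable lborel (\<lambda>y. k j x y * f y)"
    proof (rule AE_integrable_of_weighted[OF _ k_measurable f w'm w'])
      show "0 < p" using r by simp
      show "eLp_int p w' (\<lambda>x. \<integral>\<^sup>+y. ennreal (norm (k j x y)) * ennreal (norm (f y)) \<partial>lborel) < \<infinity>"
        by (rule le_less_trans[OF main[OF f]]) (use fin in \<open>simp add: ennreal_mult_less_top\<close>)
    qed
  qed
qed

text \<open>The bounds on \<open>L\<^sup>2\<close> and \<open>L\<^sup>q(w\<^sup>s)\<close> are interpolated. The exponents are chosen such that the order
  \<open>E\<close> of the \<open>j\<close>-th piece vanishes for \<open>s = \<sigma>\<close> in the borderline case of \<open>dec\<close>; openness of the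
  weight class permits \<open>s > \<sigma>\<close>, which makes \<open>E\<close> negative.\<close>

lemma bounded_interpolation:
  fixes w w' :: "real^'n \<Rightarrow> real"
  assumes p: "2 < p" and \<sigma>: "1 \<le> \<sigma>" and wm: "w \<in> borel_measurable lebesgue" and ww': "AE x in lebesgue. w x = w' x"
    and w'm [measurable]: "w' \<in> borel_measurable borel" and w': "\<And>x. 0 < w' x"
    and Ap: "cube_Ap (\<sigma> * (p / 2 - 1) + 1) (\<lambda>x. w' x powr \<sigma>)"
    and dec: "m + (1 - 2 / p * (1 - 1 / \<sigma>)) * (real CARD('n) * (1 - \<rho>) / 2) \<le> 0"
  shows "bounded_on_Lp p w (pseudo_diff a)"
proof -
  have P: "1 < \<sigma> * (p / 2 - 1) + 1" using p \<sigma> by simp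
  obtain e where e: "0 < e" and Ape: "\<And>e'. 0 < e' \<Longrightarrow> e' \<le> e \<Longrightarrow> cube_Ap ((\<sigma> * (p / 2 - 1) + 1 - 1) * (1 + e') + 1) (\<lambda>x. (w' x powr \<sigma>) powr (1 + e'))"
    using cube_Ap_powr[OF P Ap] by blast
  define s where "s = \<sigma> * (1 + e)"
  have s: "1 < s" "\<sigma> < s"
  proof -
    show "\<sigma> < s" using \<sigma> e by (simp add: s_def)
    with \<sigma> show "1 < s" by simp
  qed
  \<comment> \<open>Two demands meet in this exponent: q / 2 is the index at which the class of w^s
    is known, and a single h can satisfy h^(2 - p) = w and h^(2 - q) = w^s.\<close>
  define q where "q = 2 + s * (p - 2)"
  have q2: "q - 2 = s * (p - 2)" by (simp add: q_def)
  have pq: "p < q"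
  proof -
    have "1 * (p - 2) < s * (p - 2)" using p s by (intro mult_strict_right_mono) auto
    then have "p - 2 < q - 2" by (simp only: q2 mult_1)
    then show ?thesis by simp
  qed
  have Aps: "cube_Ap (q / 2) (\<lambda>x. w' x powr s)"
  proof -
    have 1: "(\<sigma> * (p / 2 - 1) + 1 - 1) * (1 + e) + 1 = q / 2" by (simp add: q_def s_def field_simps)
    have 2: "(w' x powr \<sigma>) powr (1 + e) = w' x powr s" for x by (simp add: powr_powr s_def)
    show ?thesis using Ape[OF e order_refl] unfolding 1 2 .
  qed
  define h where "h x = w' x powr (- 1 / (p - 2))" for x
  have [measurable]: "h \<in> borel_measurable borel" unfolding h_def by measurable
  have h: "0 < h x" for x using w'[of x] by (simp add: h_def)
  have hp: "h x powr (2 - p) = w' x" for x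
  proof -
    have "- 1 / (p - 2) * (2 - p) = 1" using p by (simp add: field_simps)
    then show ?thesis using w'[of x] by (simp add: h_def powr_powr)
  qed
  have hq: "h x powr (2 - q) = w' x powr s" for x
  proof -
    have "- 1 / (p - 2) * (2 - q) = s" using p q2 by (simp add: field_simps)
    then show ?thesis by (simp add: h_def powr_powr)
  qed
  define \<beta> where "\<beta> = 1 / s"
  have \<beta>: "(p - 2) / (q - 2) = \<beta>" "(q - p) / (q - 2) = 1 - \<beta>" and \<beta>q: "\<beta> * q = 2 * \<beta> + p - 2"
  proof -
    show 1: "(p - 2) / (q - 2) = \<beta>" using p s by (simp add: q2 \<beta>_def)
    have "(q - p) / (q - 2) = (q - 2) / (q - 2) - (p - 2) / (q - 2)" by (simp only: diff_divide_distrib[symmetric]) simp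
    moreover have "(q - 2) / (q - 2) = 1" using p pq by simp
    ultimately show "(q - p) / (q - 2) = 1 - \<beta>" by (simp only: 1)
    show "\<beta> * q = 2 * \<beta> + p - 2" using s by (simp add: q_def \<beta>_def field_simps)
  qed
  have r2: "1 < (2::real)" "(2::real) \<le> 2" "2 < q" using p pq by auto
  obtain C' where C': "0 < C'" and kb: "\<And>D A R l b f. amplitude D A R l b \<Longrightarrow> f \<in> borel_measurable borel \<Longrightarrow>
    (\<integral>\<^sup>+x. epowr (\<integral>\<^sup>+y. ennreal (norm (FT (b x) (x - y))) * f y \<partial>lborel) q * ennreal (w' x powr s) \<partial>lborel)
       \<le> ennreal (C' * (A powr 2 * (R / l) ^ CARD('n)) powr (q / 2)) * (\<integral>\<^sup>+y. epowr (f y) q * ennreal (w' y powr s) \<partial>lborel)"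
    using weighted_kernel_bound[OF r2 Aps] by blast
  define \<Delta> where "\<Delta> = real CARD('n) * (1 - \<rho>)"
  have \<Delta>: "0 < \<Delta>" using \<rho> by (simp add: \<Delta>_def)
  define G where "G = CV_const TYPE('n) * growth_mass TYPE('n)"
  have G: "0 < G" unfolding G_def CV_const_def using growth_mass_pos[where 'n='n] by (auto intro!: mult_pos_pos add_pos_nonneg)
  define aj where "aj j = G * (C * (2 ^ j) powr m)\<^sup>2" for j :: nat
  define bj where "bj j = C' * ((C * (2 ^ j) powr m) powr 2 * (2 ^ j / (2 ^ j) powr \<rho>) ^ CARD('n)) powr (q / 2)" for j :: nat
  have aj: "0 < aj j" for j using G C by (simp add: aj_def)
  have bj: "0 < bj j" for j using C' C by (simp add: bj_def)
  \<comment> \<open>The L^2 bound for squares has order 2 m, the weighted bound for q-th powers has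
    order q (m + \<Delta> / 2); they enter with the interpolation weights 1 - \<beta> and \<beta> =
    1 / s.\<close>
  define E where "E = 2 * m * (1 - \<beta>) + q / 2 * (m * 2 + \<Delta>) * \<beta>"
  define K where "K = (G * C\<^sup>2) powr (1 - \<beta>) * (C' * C powr q) powr \<beta>"
  have abj: "aj j powr (1 - \<beta>) * bj j powr \<beta> = K * (2 powr E) ^ j" for j
  proof -
    have "aj j = (G * C\<^sup>2) * (2 ^ j) powr (2 * m)"
      unfolding aj_def mult_2 powr_add by (simp only: power2_eq_square mult_ac)
    then have 1: "aj j powr (1 - \<beta>) = (G * C\<^sup>2) powr (1 - \<beta>) * (2 ^ j) powr (2 * m * (1 - \<beta>))"
      by (simp only: powr_mult powr_powr)
    have "bj j = (C' * C powr q) * (2 ^ j) powr (q / 2 * (m * 2 + \<Delta>))"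
      using amplitude_power[OF C, of "2 ^ j" m 2 \<rho> "CARD('n)" "q / 2"] by (simp add: bj_def \<Delta>_def)
    then have 2: "bj j powr \<beta> = (C' * C powr q) powr \<beta> * (2 ^ j) powr (q / 2 * (m * 2 + \<Delta>) * \<beta>)"
      by (simp only: powr_mult powr_powr)
    have "aj j powr (1 - \<beta>) * bj j powr \<beta> = K * ((2 ^ j) powr (2 * m * (1 - \<beta>)) * (2 ^ j) powr (q / 2 * (m * 2 + \<Delta>) * \<beta>))"
      unfolding 1 2 K_def by (simp only: mult_ac)
    also have "\<dots> = K * (2 ^ j) powr E" unfolding E_def by (simp only: powr_add)
    finally show ?thesis by (simp only: two_power_powr)
  qed
  have E: "E < 0"
  proof -
    have "E = 2 * m * (1 - \<beta>) + (\<beta> * q) / 2 * (m * 2 + \<Delta>)" by (simp add: E_def)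
    \<comment> \<open>Up to the factor p this is the left side of \<open>dec\<close> with s in place
      of \<sigma>. It decreases strictly as \<sigma> grows to s, hence a vanishing bound becomes
      negative.\<close>
    also have "\<dots> = p * (m + (1 - 2 / p * (1 - \<beta>)) * (\<Delta> / 2))" unfolding \<beta>q using p by (simp add: field_simps)
    also have "\<dots> < 0"
    proof (rule mult_pos_neg)
      have "1 - 1 / \<sigma> < 1 - \<beta>" using \<sigma> s by (simp add: \<beta>_def frac_less2)
      then have "2 / p * (1 - 1 / \<sigma>) < 2 / p * (1 - \<beta>)" using p by (intro mult_strict_left_mono) auto
      then have "(1 - 2 / p * (1 - \<beta>)) * (\<Delta> / 2) < (1 - 2 / p * (1 - 1 / \<sigma>)) * (\<Delta> / 2)"
        using \<Delta> by (intro mult_strict_right_mono) auto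
      then show "m + (1 - 2 / p * (1 - \<beta>)) * (\<Delta> / 2) < 0" using dec unfolding \<Delta>_def[symmetric] by linarith
    qed (use p in simp)
    finally show ?thesis .
  qed
  have eN: "(\<integral>\<^sup>+y. epowr (ennreal (norm (f y))) q * ennreal (w' y powr s) \<partial>lborel) = (\<integral>\<^sup>+y. ennreal (norm (f y) powr q * w' y powr s) \<partial>lborel)" for f :: "real^'n \<Rightarrow> complex"
    using p pq by (intro nn_integral_cong) (simp add: epowr_ennreal ennreal_mult'')
  have main: "(\<integral>\<^sup>+x. epowr (\<integral>\<^sup>+y. ennreal (norm (k j x y)) * ennreal (norm (f y)) \<partial>lborel) q * ennreal (w' x powr s) \<partial>lborel)
       \<le> ennreal (bj j) * (\<integral>\<^sup>+y. ennreal (norm (f y) powr q * w' y powr s) \<partial>lborel)"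
    if [measurable]: "f \<in> borel_measurable borel" for j and f :: "real^'n \<Rightarrow> complex"
    using kb[OF amp, of "\<lambda>y. ennreal (norm (f y))" j] unfolding eN bj_def by simp
  have int_q: "AE x in lborel. integrable lborel (\<lambda>y. k j x y * f y)"
    if f [measurable]: "f \<in> borel_measurable borel" and fin: "SW_int h q f < \<infinity>" for j f
  proof (rule AE_integrable_of_weighted[OF _ k_measurable f, where w="\<lambda>x. w' x powr s"])
    show "0 < q" using p pq by simp
    show "(\<lambda>x. w' x powr s) \<in> borel_measurable borel" by measurable
    show "0 < w' x powr s" for x using w'[of x] by simp
    show "(\<integral>\<^sup>+x. epowr (\<integral>\<^sup>+y. ennreal (norm (k j x y)) * ennreal (norm (f y)) \<partial>lborel) q * ennreal (w' x powr s) \<partial>lborel) < \<infinity>"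
      by (rule le_less_trans[OF main[OF f]]) (use fin in \<open>simp add: ennreal_mult_less_top hq\<close>)
  qed
  have int_2: "integrable lborel (\<lambda>y. k j x y * f y)"
    if "f \<in> borel_measurable borel" "L2sq f < \<infinity>" for j f x
    by (rule amplitude.T_integrable[OF amp that])
  define c where "c = 4 * p / (p - 2) + 2 powr q * p / (q - p)"
  show ?thesis
  proof (rule bounded_of_decay[OF _ wm w'm w' ww'])
    show "0 < 2 powr E" "2 powr E < 1" "1 < p" using E p by (auto simp: powr_less_one)
    show "0 \<le> c * K" using p pq by (simp add: c_def K_def)
    fix j and f :: "real^'n \<Rightarrow> complex" assume f [measurable]: "f \<in> borel_measurable borel"
      and fin: "Lp_int p w' f < \<infinity>"
    have "SW_int h p (\<lambda>x. P j f x)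
      \<le> ennreal (c * (aj j powr ((q - p) / (q - 2)) * bj j powr ((p - 2) / (q - 2)))) *
        SW_int h p f"
      unfolding c_def
    proof (rule interpolation[OF p pq _ h aj bj])
      show "h \<in> borel_measurable borel" "f \<in> borel_measurable borel" by measurable
      show "P j f \<in> borel_measurable borel" if "f \<in> borel_measurable borel" for f using that by (rule P_measurable)
      show "L2sq (P j f) \<le> ennreal (aj j) * L2sq f"
        if "f \<in> borel_measurable borel" "L2sq f < \<infinity>" for f
        using amplitude.T_L2[OF amp that] by (simp only: aj_def G_def)
      show "SW_int h q (\<lambda>x. P j f x) \<le> ennreal (bj j) * SW_int h q f"
        if f [measurable]: "f \<in> borel_measurable borel" for f
      proof -
        have "(\<integral>\<^sup>+x. ennreal (norm (P j f x) powr q * w' x powr s) \<partial>lborel)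
            \<le> (\<integral>\<^sup>+x. epowr (\<integral>\<^sup>+y. ennreal (norm (k j x y)) * ennreal (norm (f y)) \<partial>lborel) q * ennreal (w' x powr s) \<partial>lborel)"
          unfolding eN[symmetric]
        proof (intro nn_integral_mono mult_right_mono epowr_mono)
          show "ennreal (norm (P j f x)) \<le> (\<integral>\<^sup>+y. ennreal (norm (k j x y)) * ennreal (norm (f y)) \<partial>lborel)" for x
            using norm_integral_le_nn_integral[of lborel "\<lambda>y. k j x y * f y"] by (simp add: P_eq norm_mult ennreal_mult)
        qed (use p pq in auto)
        also note main[OF f]
        finally show ?thesis unfolding hq .
      qed
      show "AE x in lborel. P j (\<lambda>y. f y + g y) x = P j f x + P j g x"
        if fg: "f \<in> borel_measurable borel" "g \<in> borel_measurable borel" "L2sq f < \<infinity>"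
          "SW_int h q g < \<infinity>" for f g
        using int_q[OF fg(2,4), of j]
      proof eventually_elim
        case (elim x)
        then show ?case using int_2[OF fg(1,3), of j x] by (simp add: P_eq distrib_left)
      qed
      show "SW_int h p f < \<infinity>" using fin by (simp only: hp)
    qed
    then show "Lp_int p w' (P j f)
        \<le> ennreal (c * K * (2 powr E) ^ j) * Lp_int p w' f"
      unfolding \<beta> abj hp by (simp only: mult.assoc)
    show "AE x in lborel. integrable lborel (\<lambda>y. k j x y * f y)"
    proof -
      \<comment> \<open>Truncation at the level h: one part is square integrable, the other lies in
        the weighted L^q space, and each has an integrable product with the kernel.\<close>
      define f1 where "f1 x = (if h x < norm (f x) then f x else 0)" for x
      define f2 where "f2 x = (if h x < norm (f x) then 0 else f x)" for x
      have [measurable]: "f1 \<in> borel_measurable borel" "f2 \<in> borel_measurable borel"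
        unfolding f1_def f2_def by measurable
      have "(norm (f1 x))\<^sup>2 \<le> norm (f x) powr p * h x powr (2 - p)" for x
      proof (cases "h x < norm (f x)")
        case True
        have "norm (f x) powr (2 - p) \<le> h x powr (2 - p)"
          using True h[of x] p by (intro powr_mono2') auto
        then have "norm (f x) powr p * norm (f x) powr (2 - p) \<le> norm (f x) powr p * h x powr (2 - p)"
          by (intro mult_left_mono) auto
        moreover have "norm (f x) powr p * norm (f x) powr (2 - p) = (norm (f x))\<^sup>2"
          using True h[of x] by (simp add: powr_add[symmetric])
        ultimately show ?thesis using True by (simp add: f1_def)
      qed (simp add: f1_def)
      then have "L2sq f1 \<le> Lp_int p w' f"
        unfolding hp[symmetric] by (intro nn_integral_mono ennreal_leI)
      then have i1: "integrable lborel (\<lambda>y. k j x y * f1 y)" for x using fin by (intro int_2) auto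
      have "norm (f2 x) powr q * h x powr (2 - q) \<le> norm (f x) powr p * h x powr (2 - p)" for x
      proof (cases "h x < norm (f x) \<or> f x = 0")
        case False
        have "norm (f x) powr (q - p) \<le> h x powr (q - p)" using False pq by (intro powr_mono2) auto
        then have "norm (f x) powr p * norm (f x) powr (q - p) * h x powr (2 - q) \<le> norm (f x) powr p * h x powr (q - p) * h x powr (2 - q)"
          by (intro mult_right_mono mult_left_mono) auto
        then show ?thesis using False by (simp add: f2_def mult.assoc powr_add[symmetric])
      qed (auto simp: f2_def)
      then have "SW_int h q f2 \<le> Lp_int p w' f"
        unfolding hp[symmetric] by (intro nn_integral_mono ennreal_leI)
      then have "AE x in lborel. integrable lborel (\<lambda>y. k j x y * f2 y)" using fin by (intro int_q) auto
      then show ?thesis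
      proof eventually_elim
        case (elim x)
        have "(\<lambda>y. k j x y * f y) = (\<lambda>y. k j x y * f1 y + k j x y * f2 y)" by (auto simp: f1_def f2_def)
        then show ?case using Bochner_Integration.integrable_add[OF i1 elim] by simp
      qed
    qed
  qed
qed

end

text \<open>The convention that 0 times infinity is 0 admits weights vanishing almost everywhere
  into the classes. All functions then have norm 0, and the zero operator agrees with T almost
  everywhere for the zero measure.\<close>

lemma bounded_on_Lp_null_weight:
  fixes w :: "real^'n::finite \<Rightarrow> real"
  assumes w: "weight w" and null: "AE x in lebesgue. w x = 0"
  shows "bounded_on_Lp p w T"
  unfolding bounded_on_Lp_def
proof (intro exI[of _ "\<lambda>f x. 0"] conjI ballI)
  have "(\<lambda>x. ennreal (w x)) \<in> borel_measurable lebesgue" using weight_measurable[OF w] by measurable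
  then have dens: "AE x in density lebesgue (\<lambda>x. ennreal (w x)). Q x" for Q
    using null by (auto simp: AE_density elim: eventually_mono)
  have eq: "Lp_norm p w f = Lp_norm p w g" for f g
  proof -
    have "(\<integral>\<^sup>+x. ennreal (norm (f x) powr p * w x) \<partial>lebesgue) = (\<integral>\<^sup>+x. ennreal (norm (g x) powr p * w x) \<partial>lebesgue)"
      by (rule nn_integral_cong_AE) (use null in \<open>eventually_elim, simp\<close>)
    then show ?thesis by (simp add: Lp_norm_def)
  qed
  show "\<exists>C::real. \<forall>f\<in>Lp_space p w. (\<lambda>x. 0) \<in> Lp_space p w \<and> Lp_norm p w (\<lambda>x. 0) \<le> ennreal C * Lp_norm p w f"
  proof (intro exI[of _ 1] ballI conjI)
    fix f assume "f \<in> Lp_space p w"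
    then show "(\<lambda>x. 0) \<in> Lp_space p w" using eq[of "\<lambda>x. 0" f] by (simp add: Lp_space_def)
    show "Lp_norm p w (\<lambda>x. 0) \<le> ennreal 1 * Lp_norm p w f" using eq[of "\<lambda>x. 0" f] by simp
  qed
  show "\<forall>c d. AE x in density lebesgue (\<lambda>x. ennreal (w x)). (0::complex) = c * 0 + d * 0" by simp
  show "AE x in density lebesgue (\<lambda>x. ennreal (w x)). 0 = T f x" for f by (rule dens)
qed

section \<open>The weight classes of the three cases\<close>

context frequency_decomposition
begin

text \<open>The decay condition may be an equality at r. Openness of the weight class in its index
  allows a larger averaging exponent t, at which the inequality is strict.\<close>

lemma bounded_Ap:
  assumes r: "1 \<le> r" "r < 2" "r < p" and w: "w \<in> Ap (p / r)" and dec: "m + real CARD('n) * (1 - \<rho>) / r \<le> 0"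
  shows "bounded_on_Lp p w (pseudo_diff a)"
proof (cases "AE x in lebesgue. w x = 0")
  case True
  then show ?thesis using w by (intro bounded_on_Lp_null_weight) (auto simp: Ap_def)
next
  case False
  have P: "1 < p / r" using r by simp
  obtain w' where ww': "AE x in lebesgue. w x = w' x" and Ap: "cube_Ap (p / r) w'"
    by (rule Ap_imp_cube_Ap[OF P w False])
  obtain P0 where P0: "1 < P0" "P0 < p / r" and op: "\<And>Q. P0 \<le> Q \<Longrightarrow> Q < p / r \<Longrightarrow> cube_Ap Q w'"
    by (rule cube_Ap_open[OF P Ap]) blast
  \<comment> \<open>The maximum with p / 2 keeps the averaging exponent t = p / Q at most 2, where
    the kernel bound is available; r < 2 ensures that Q still stays below p / r.\<close>
  define Q where "Q = max P0 (p / 2)"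
  have "p / 2 < p / r" using r by (intro divide_strict_left_mono) auto
  then have Q: "1 < Q" "P0 \<le> Q" "p / 2 \<le> Q" "Q < p / r"
    using P0 by (auto simp: Q_def)
  have p: "0 < p" using r by simp
  define t where "t = p / Q"
  have t: "r < t" "t \<le> 2" "t < p" "p / t = Q"
  proof -
    show "r < t" using Q r by (simp add: t_def field_simps)
    show "t \<le> 2" using Q by (simp add: t_def field_simps)
    show "t < p" using Q p by (simp add: t_def pos_divide_less_eq)
    show "p / t = Q" using Q p by (simp add: t_def)
  qed
  have w_m: "w \<in> borel_measurable lebesgue" using w by (intro weight_measurable) (auto simp: Ap_def)
  show ?thesis
  proof (rule bounded_averages[OF _ t(2,3) w_m ww'])
    show "1 < t" using t r by simp
    show "cube_Ap (p / t) w'" unfolding t(4) by (rule op[OF Q(2,4)])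
    have "real CARD('n) * (1 - \<rho>) / t < real CARD('n) * (1 - \<rho>) / r"
      using t r \<rho> by (intro divide_strict_left_mono) auto
    then show "m + real CARD('n) * (1 - \<rho>) / t < 0" using dec by linarith
  qed
qed

text \<open>At r = 2 the averaging exponent cannot be raised, so the gain comes from interpolation
  with the unweighted bound, starting from the power 1 of the weight.\<close>

lemma bounded_Ap_2:
  assumes p: "2 < p" and w: "w \<in> Ap (p / 2)" and dec: "m + real CARD('n) * (1 - \<rho>) / 2 \<le> 0"
  shows "bounded_on_Lp p w (pseudo_diff a)"
proof (cases "AE x in lebesgue. w x = 0")
  case True
  then show ?thesis using w by (intro bounded_on_Lp_null_weight) (auto simp: Ap_def)
next
  case False
  have P: "1 < p / 2" using p by simp
  obtain w' where ww': "AE x in lebesgue. w x = w' x" and Ap: "cube_Ap (p / 2) w'"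
    by (rule Ap_imp_cube_Ap[OF P w False])
  have w'm: "w' \<in> borel_measurable borel" and w': "\<And>x. 0 < w' x" using Ap by (auto simp: cube_Ap_def)
  have w_m: "w \<in> borel_measurable lebesgue" using w by (intro weight_measurable) (auto simp: Ap_def)
  show ?thesis
  proof (rule bounded_interpolation[OF p order_refl w_m ww' w'm w'])
    have "(\<lambda>x. w' x powr 1) = w'" using w' by (simp add: fun_eq_iff less_imp_le)
    then show "cube_Ap (1 * (p / 2 - 1) + 1) (\<lambda>x. w' x powr 1)" using Ap by simp
    show "m + (1 - 2 / p * (1 - 1 / 1)) * (real CARD('n) * (1 - \<rho>) / 2) \<le> 0" using dec by simp
  qed
qed

lemma bounded_Ap_RHp:
  assumes p: "2 < p" and \<sigma>: "1 < \<sigma>" and w: "w \<in> Ap (p / 2)" "w \<in> RHp \<sigma>"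
    and dec: "m + (1 - 2 / p * (1 - 1 / \<sigma>)) * (real CARD('n) * (1 - \<rho>) / 2) \<le> 0"
  shows "bounded_on_Lp p w (pseudo_diff a)"
proof (cases "AE x in lebesgue. w x = 0")
  case True
  then show ?thesis using w by (intro bounded_on_Lp_null_weight) (auto simp: Ap_def)
next
  case False
  have P: "1 < p / 2" using p by simp
  obtain w' where ww': "AE x in lebesgue. w x = w' x" and w': "\<And>x. 0 < w' x" and w'm: "w' \<in> borel_measurable borel"
    and Ap: "cube_Ap (\<sigma> * (p / 2 - 1) + 1) (\<lambda>x. w' x powr \<sigma>)"
    using Ap_RHp_imp_cube_Ap[OF P \<sigma> w False] by blast
  have w_m: "w \<in> borel_measurable lebesgue" using w by (intro weight_measurable) (auto simp: Ap_def)
  show ?thesis by (rule bounded_interpolation[OF p less_imp_le[OF \<sigma>] w_m ww' w'm w' Ap dec])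
qed

end

theorem corollary4p2:
  fixes a :: "(real^'n::finite) \<times> (real^'n) \<Rightarrow> complex" and m \<rho> \<delta> :: real
  assumes "m < 0" and "0 < \<delta>" and "\<delta> \<le> \<rho>" and "\<rho> < 1"
    and "a \<in> symbol_class m \<rho> \<delta>"
  shows
    "(m = - real CARD('n) * (1 - \<rho>) \<longrightarrow>
        (\<forall>p w. 1 < p \<and> w \<in> Ap p \<longrightarrow> bounded_on_Lp p w (pseudo_diff a)))
     \<and>
     (- real CARD('n) * (1 - \<rho>) < m \<and> m \<le> - real CARD('n) * (1 - \<rho>) / 2 \<longrightarrow>
        (let r = - real CARD('n) * (1 - \<rho>) / m in
         \<forall>p w. r < p \<and> w \<in> Ap (p / r) \<longrightarrow> bounded_on_Lp p w (pseudo_diff a)))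
     \<and>
     (- real CARD('n) * (1 - \<rho>) / 2 < m \<longrightarrow>
        (let s = 2 * real CARD('n) * (1 - \<rho>) / (real CARD('n) * (1 - \<rho>) + 2 * m) in
         \<forall>p w. 2 < p \<and> p < s \<and> w \<in> Ap (p / 2) \<inter> RHp (conj_exp (s / p)) \<longrightarrow>
           bounded_on_Lp p w (pseudo_diff a)))"
proof -
  obtain \<phi> where \<phi>: "cutoff (2 * CARD('n)) 1 2 \<phi>" using cutoff_exists[of 1 2 "2 * CARD('n)"] by auto
  obtain C where "0 < C" and amp: "\<And>j. amplitude (symbol_piece a \<phi> j) (C * (2 ^ j) powr m) (2 ^ j) ((2 ^ j) powr \<rho>)
     (\<lambda>x \<xi>. a (x, \<xi>) * of_real (freq_piece \<phi> j undefined 0 \<xi>))"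
    using symbol_piece_amplitude[OF assms(5) _ assms(3) _ \<phi>] assms(2,4) by auto
  interpret frequency_decomposition a m \<rho> \<delta> \<phi> C
  proof (rule frequency_decomposition.intro)
    show "amplitude (symbol_piece a \<phi> j) (C * (2 ^ j) powr m) (2 ^ j) ((2 ^ j) powr \<rho>) (freq_symbol a \<phi> j)" for j
      using amp by (simp add: freq_symbol_def)
  qed (use assms \<phi> \<open>0 < C\<close> in auto)
  define D where "D = real CARD('n) * (1 - \<rho>)"
  have D: "0 < D" using assms by (simp add: D_def)
  have e: "- real CARD('n) * (1 - \<rho>) = - D" "2 * real CARD('n) * (1 - \<rho>) = 2 * D" by (simp_all add: D_def)
  have "bounded_on_Lp p w (pseudo_diff a)" if "m = - D" "1 < p" "w \<in> Ap p" for p w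
    using that by (intro bounded_Ap[of 1]) (auto simp: D_def[symmetric])
  moreover have "bounded_on_Lp p w (pseudo_diff a)"
    if m: "- D < m" "m \<le> - D / 2" and p: "- D / m < p" and w: "w \<in> Ap (p / (- D / m))" for p w
  proof -
    have r: "1 < - D / m" "- D / m \<le> 2" using m D assms(1) by (simp_all only: neg_less_divide_eq neg_divide_le_eq)
    \<comment> \<open>In fact an equality: r_e is the exponent at which the loss n (1 - \<rho>) / r
      exactly offsets m.\<close>
    have dec: "m + D / (- D / m) \<le> 0" using D assms(1) by simp
    show ?thesis
    proof (cases "- D / m = 2")
      case True
      show ?thesis
        by (rule bounded_Ap_2) (use p w dec in \<open>simp_all only: True D_def[symmetric]\<close>)
    next
      case False
      then show ?thesis
        by (intro bounded_Ap[OF _ _ p w]) (use r dec in \<open>simp_all add: D_def[symmetric]\<close>)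
    qed
  qed
  moreover have "bounded_on_Lp p w (pseudo_diff a)"
    if m: "- D / 2 < m" and p: "2 < p" and ps': "p < 2 * D / (D + 2 * m)"
      and w': "w \<in> Ap (p / 2)" "w \<in> RHp (conj_exp (2 * D / (D + 2 * m) / p))" for p w
  proof -
    define s where "s = 2 * D / (D + 2 * m)"
    have ps: "p < s" and w: "w \<in> Ap (p / 2)" "w \<in> RHp (conj_exp (s / p))" using ps' w' by (auto simp: s_def)
    have sp: "1 < s / p" using p ps by simp
    have s: "2 / s = 1 + 2 * m / D" using D m by (simp add: s_def field_simps)
    have c: "1 / conj_exp (s / p) = 1 - p / s" using sp p ps by (simp add: conj_exp_def field_simps)
    show ?thesis
    proof (rule bounded_Ap_RHp[OF p _ w])
      have "1 < conj_exp x" if "1 < x" for x using that by (simp add: conj_exp_def pos_less_divide_eq)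
      then show "1 < conj_exp (s / p)" using sp .
      \<comment> \<open>With \<sigma> = (s / p)' one has 1 - 1 / \<sigma> = p / s, so p drops out.
        Since 2 / s = 1 + 2 m / D, the required inequality holds with equality: this is the
        borderline case, and it determines the value of s_e.\<close>
      have "2 / p * (1 - 1 / conj_exp (s / p)) = 2 / s" unfolding c using p by simp
      then show "m + (1 - 2 / p * (1 - 1 / conj_exp (s / p))) * (real CARD('n) * (1 - \<rho>) / 2) \<le> 0"
        unfolding D_def[symmetric] using D by (simp add: s)
    qed
  qed
  ultimately show ?thesis
    unfolding e unfolding D_def[symmetric] Let_def by blast
qed

end
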